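(* Let $(W,S)$ be a Coxeter system of type $A_n$, let $c$ be any standard Coxeter element of $(W,S)$, and let $\{Z_x\}_{x\in\mathrm{Div}(c)}$ be the corresponding basis of the Temperley–Lieb algebra $\mathrm{TL}_n$, i.e. $Z_x:=\omega(\mathbf{x})$ for $x\in\mathrm{Div}(c)$, where $\mathbf{x}\in\mathbf{D}_c\subset B(W)$ is the simple dual braid corresponding to $x$. Then for any $x\in\mathrm{Div}(c)$, one has $$Z_x\in\sum_{w\in W_f}\mathbb{N}[v,v^{-1}]\,(-1)^{\ell_S(w)}\,b_w.$$
   Context: $W=\mathfrak{S}_{n+1}$, $S=\{s_1,\ldots,s_n\}$, $s_i=(i,i+1)$, $\ell_S$ the length function with respect to $S$. A standard Coxeter element is a product of the elements of $S$, each appearing once, in some order. $T=\bigcup_{w\in W}wSw^{-1}$, $\ell_T$ is the length function on $W$ with respect to $T$; $x\preccurlyeq_T y$ means $\ell_T(x)+\ell_T(x^{-1}y)=\ell_T(y)$, and $\mathrm{Div}(c)=\{x\in W\mid x\preccurlyeq_T c\}$. Artin–Tits group: $B(W)=\mathcal{B}_{n+1}$ is generated by a copy $\mathbf{S}=\{\mathbf{s}\mid s\in S\}$ of $S$ with the braid relations. Dual braid monoid: $B_c^*(W)$ is the monoid generated by a copy $\mathbf{D}_c=\{\mathbf{x}\mid x\in\mathrm{Div}(c)\}$ of $\mathrm{Div}(c)$ with relations $\mathbf{x}\mathbf{y}=\mathbf{z}$ whenever $x,y,z\in\mathrm{Div}(c)$, $xy=z$ and $\ell_T(z)=\ell_T(x)+\ell_T(y)$.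 By a theorem of Bessis, it embeds in its group of fractions, and sending each $\mathbf{s}\in\mathbf{S}$ to the element of $\mathbf{D}_c$ corresponding to $s$ extends to an isomorphism from $B(W)$ to this group of fractions; via it $\mathbf{D}_c\subset B_c^*(W)$ is viewed inside $B(W)$. Temperley–Lieb algebra: $\mathrm{TL}_n$ is the associative unital $\mathbb{Z}[v,v^{-1}]$-algebra with generators $b_{s_1},\ldots,b_{s_n}$ and relations $b_{s_i}b_{s_{i\pm1}}b_{s_i}=b_{s_i}$, $b_{s_i}b_{s_j}=b_{s_j}b_{s_i}$ if $|i-j|>1$, $b_{s_i}^2=(v+v^{-1})b_{s_i}$. An element $w\in W$ is fully commutative if one can pass from any reduced $S$-expression of $w$ to any other by applying only relations $s_is_j=s_js_i$ with $|i-j|>1$; $W_f$ is the set of fully commutative elements. For $w\in W_f$ with reduced expression $st\cdots u$, $b_w:=b_sb_t\cdots b_u$ is well defined, and $\{b_w\}_{w\in W_f}$ is a basis of $\mathrm{TL}_n$. The map $\omega:B(W)\to\mathrm{TL}_n^\times$ is the group morphism with $\omega(\mathbf{s}_i)=v^{-1}-b_{s_i}$ for $1\le i\le n$. It is known that $\omega(\mathbf{D}_c)$ is a basis of $\mathrm{TL}_n$ for every standard Coxeter element $c$. $\mathbb{N}[v,v^{-1}]$ denotes Laurent polynomials with non-negative integer coefficients. *)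

theory Defs
  imports
    "HOL-Library.Poly_Mapping"
    "HOL-Algebra.Sym_Groups"
    "HOL-Algebra.QuotRing"
begin

section \<open>Monoids and groups given by generators and relations\<close>

definition word_prod :: "('b, 'm) monoid_scheme \<Rightarrow> ('a \<Rightarrow> 'b) \<Rightarrow> 'a list \<Rightarrow> 'b"
  where "word_prod G f u = foldr (\<lambda>x y. f x \<otimes>\<^bsub>G\<^esub> y) u \<one>\<^bsub>G\<^esub>"

inductive_set pres_cong :: "'a set \<Rightarrow> ('a list \<times> 'a list) set \<Rightarrow> ('a list \<times> 'a list) set"
  for X :: "'a set" and R :: "('a list \<times> 'a list) set"
  where
    refl: "u \<in> lists X \<Longrightarrow> (u, u) \<in> pres_cong X R"
  | rel: "\<lbrakk>(u, v) \<in> R; u \<in> lists X; v \<in> lists X; p \<in> lists X; q \<in> lists X\<rbrakk>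
      \<Longrightarrow> (p @ u @ q, p @ v @ q) \<in> pres_cong X R"
  | sym: "(u, v) \<in> pres_cong X R \<Longrightarrow> (v, u) \<in> pres_cong X R"
  | trans: "\<lbrakk>(u, v) \<in> pres_cong X R; (v, w) \<in> pres_cong X R\<rbrakk> \<Longrightarrow> (u, w) \<in> pres_cong X R"

definition presented_monoid :: "'a set \<Rightarrow> ('a list \<times> 'a list) set \<Rightarrow> 'a list set monoid"
  where "presented_monoid X R =
    \<lparr>carrier = lists X // pres_cong X R,
     mult = (\<lambda>A B. pres_cong X R `` {u @ v |u v. u \<in> A \<and> v \<in> B}),
     one = pres_cong X R `` {[]}\<rparr>"

text \<open>In a presented group a letter is a pair \<open>(x, e)\<close>, standing for \<open>x\<close> if \<open>e\<close> is true and for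
  the inverse of \<open>x\<close> otherwise. The defining relations \<open>R\<close> are between positive words.\<close>

definition group_rels :: "'a set \<Rightarrow> ('a list \<times> 'a list) set
    \<Rightarrow> (('a \<times> bool) list \<times> ('a \<times> bool) list) set"
  where "group_rels X R =
    {(map (\<lambda>x. (x, True)) u, map (\<lambda>x. (x, True)) v) |u v. (u, v) \<in> R}
    \<union> {([(x, e), (x, \<not> e)], []) |x e. x \<in> X}"

definition presented_group :: "'a set \<Rightarrow> ('a list \<times> 'a list) set \<Rightarrow> ('a \<times> bool) list set monoid"
  where "presented_group X R = presented_monoid (X \<times> UNIV) (group_rels X R)"

definition monoid_gen :: "'a set \<Rightarrow> ('a list \<times> 'a list) set \<Rightarrow> 'a \<Rightarrow> 'a list set"
  where "monoid_gen X R x = pres_cong X R `` {[x]}"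

definition group_gen :: "'a set \<Rightarrow> ('a list \<times> 'a list) set \<Rightarrow> 'a \<Rightarrow> ('a \<times> bool) list set"
  where "group_gen X R x = pres_cong (X \<times> UNIV) (group_rels X R) `` {[(x, True)]}"

text \<open>The group morphism from a presented group to \<open>H\<close> which sends each generator \<open>x\<close> to \<open>f x\<close>:
  an element, i.e. a class of signed words, is sent to the common value in \<open>H\<close> of these words.\<close>

definition group_lift :: "('b, 'm) monoid_scheme \<Rightarrow> ('a \<Rightarrow> 'b) \<Rightarrow> ('a \<times> bool) list set \<Rightarrow> 'b"
  where "group_lift H f A =
    the_elem (word_prod H (\<lambda>(x, e). if e then f x else inv\<^bsub>H\<^esub> (f x)) ` A)"

text \<open>The group of fractions of a monoid \<open>M\<close> is its enveloping group, that is the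
  group generated by the elements of \<open>M\<close> subject to the relations that hold in \<open>M\<close>;
  \<open>frac_incl M\<close> is the canonical morphism from \<open>M\<close> to it.\<close>

definition mult_rels :: "('a, 'm) monoid_scheme \<Rightarrow> ('a list \<times> 'a list) set"
  where "mult_rels M =
    {([a, b], [a \<otimes>\<^bsub>M\<^esub> b]) |a b. a \<in> carrier M \<and> b \<in> carrier M} \<union> {([\<one>\<^bsub>M\<^esub>], [])}"

definition fraction_group :: "('a, 'm) monoid_scheme \<Rightarrow> ('a \<times> bool) list set monoid"
  where "fraction_group M = presented_group (carrier M) (mult_rels M)"

definition frac_incl :: "('a, 'm) monoid_scheme \<Rightarrow> 'a \<Rightarrow> ('a \<times> bool) list set"
  where "frac_incl M = group_gen (carrier M) (mult_rels M)"


section \<open>The Coxeter group of type \<open>A\<^sub>n\<close>\<close>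

abbreviation Sym :: "nat \<Rightarrow> (nat \<Rightarrow> nat) monoid"
  where "Sym n \<equiv> sym_group (n + 1)"

definition s_perm :: "nat \<Rightarrow> nat \<Rightarrow> nat"
  where "s_perm i = transpose i (i + 1)"

definition simple_refls :: "nat \<Rightarrow> (nat \<Rightarrow> nat) set"
  where "simple_refls n = s_perm ` {1..n}"

definition refls :: "nat \<Rightarrow> (nat \<Rightarrow> nat) set"
  where "refls n = {w \<otimes>\<^bsub>Sym n\<^esub> r \<otimes>\<^bsub>Sym n\<^esub> inv\<^bsub>Sym n\<^esub> w |w r. w \<in> carrier (Sym n) \<and> r \<in> simple_refls n}"

definition word_length :: "('a, 'm) monoid_scheme \<Rightarrow> 'a set \<Rightarrow> 'a \<Rightarrow> nat"
  where "word_length G A w =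
    (LEAST k. \<exists>u. set u \<subseteq> A \<and> length u = k \<and> word_prod G (\<lambda>x. x) u = w)"

definition length_S :: "nat \<Rightarrow> (nat \<Rightarrow> nat) \<Rightarrow> nat"
  where "length_S n = word_length (Sym n) (simple_refls n)"

definition length_T :: "nat \<Rightarrow> (nat \<Rightarrow> nat) \<Rightarrow> nat"
  where "length_T n = word_length (Sym n) (refls n)"

definition abs_le :: "nat \<Rightarrow> (nat \<Rightarrow> nat) \<Rightarrow> (nat \<Rightarrow> nat) \<Rightarrow> bool"
  where "abs_le n x y \<longleftrightarrow> length_T n x + length_T n (inv\<^bsub>Sym n\<^esub> x \<otimes>\<^bsub>Sym n\<^esub> y) = length_T n y"

definition Div :: "nat \<Rightarrow> (nat \<Rightarrow> nat) \<Rightarrow> (nat \<Rightarrow> nat) set"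
  where "Div n c = {x \<in> carrier (Sym n). abs_le n x c}"

definition standard_coxeter_element :: "nat \<Rightarrow> (nat \<Rightarrow> nat) \<Rightarrow> bool"
  where "standard_coxeter_element n c \<longleftrightarrow>
    (\<exists>u. distinct u \<and> set u = {1..n} \<and> c = word_prod (Sym n) s_perm u)"

text \<open>Reduced \<open>S\<close>-expressions are represented by the lists of the indices of their letters.\<close>

definition reduced_exprs :: "nat \<Rightarrow> (nat \<Rightarrow> nat) \<Rightarrow> nat list set"
  where "reduced_exprs n w =
    {u \<in> lists {1..n}. word_prod (Sym n) s_perm u = w \<and> length u = length_S n w}"

definition far :: "nat \<Rightarrow> nat \<Rightarrow> bool"
  where "far i j \<longleftrightarrow> \<bar>int i - int j\<bar> > 1"

definition commutation_steps :: "(nat list \<times> nat list) set"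
  where "commutation_steps = {(p @ [i, j] @ q, p @ [j, i] @ q) |p q i j. far i j}"

definition fully_commutative :: "nat \<Rightarrow> (nat \<Rightarrow> nat) \<Rightarrow> bool"
  where "fully_commutative n w \<longleftrightarrow>
    (\<forall>u \<in> reduced_exprs n w. \<forall>u' \<in> reduced_exprs n w. (u, u') \<in> commutation_steps\<^sup>*)"

definition W_f :: "nat \<Rightarrow> (nat \<Rightarrow> nat) set"
  where "W_f n = {w \<in> carrier (Sym n). fully_commutative n w}"


section \<open>The Artin--Tits group, the dual braid monoid, and simple dual braids\<close>

definition adjacent :: "nat \<Rightarrow> nat \<Rightarrow> bool"
  where "adjacent i j \<longleftrightarrow> \<bar>int i - int j\<bar> = 1"

definition braid_rels :: "nat \<Rightarrow> (nat list \<times> nat list) set"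
  where "braid_rels n =
    {([i, j, i], [j, i, j]) |i j. i \<in> {1..n} \<and> j \<in> {1..n} \<and> adjacent i j}
    \<union> {([i, j], [j, i]) |i j. i \<in> {1..n} \<and> j \<in> {1..n} \<and> far i j}"

definition braid_group :: "nat \<Rightarrow> (nat \<times> bool) list set monoid"
  where "braid_group n = presented_group {1..n} (braid_rels n)"

text \<open>The relations of the second set identify the generator attached to the identity of \<open>Sym n\<close>
  with the unit of the dual braid monoid. The first set alone would only make it an idempotent
  acting trivially on all generators, and the monoid would not embed in its group of fractions.\<close>

definition dual_braid_rels :: "nat \<Rightarrow> (nat \<Rightarrow> nat) \<Rightarrow> ((nat \<Rightarrow> nat) list \<times> (nat \<Rightarrow> nat) list) set"
  where "dual_braid_rels n c =
    {([x, y], [z]) |x y z. x \<in> Div n c \<and> y \<in> Div n c \<and> z \<in> Div n c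
       \<and> x \<otimes>\<^bsub>Sym n\<^esub> y = z \<and> length_T n z = length_T n x + length_T n y}
    \<union> {([\<one>\<^bsub>Sym n\<^esub>], [])}"

definition dual_braid_monoid :: "nat \<Rightarrow> (nat \<Rightarrow> nat) \<Rightarrow> (nat \<Rightarrow> nat) list set monoid"
  where "dual_braid_monoid n c = presented_monoid (Div n c) (dual_braid_rels n c)"

definition dual_braid_gen :: "nat \<Rightarrow> (nat \<Rightarrow> nat) \<Rightarrow> (nat \<Rightarrow> nat) \<Rightarrow> (nat \<Rightarrow> nat) list set"
  where "dual_braid_gen n c = monoid_gen (Div n c) (dual_braid_rels n c)"

definition dual_braid_in_frac ::
    "nat \<Rightarrow> (nat \<Rightarrow> nat) \<Rightarrow> (nat \<Rightarrow> nat) \<Rightarrow> ((nat \<Rightarrow> nat) list set \<times> bool) list set"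
  where "dual_braid_in_frac n c x = frac_incl (dual_braid_monoid n c) (dual_braid_gen n c x)"

text \<open>Bessis' isomorphism from the Artin--Tits group to the group of fractions of the dual braid
  monoid; the simple dual braid attached to \<open>x\<close> is the braid it maps to the generator given by
  \<open>x\<close>.\<close>

definition bessis_iso ::
    "nat \<Rightarrow> (nat \<Rightarrow> nat) \<Rightarrow> (nat \<times> bool) list set \<Rightarrow> ((nat \<Rightarrow> nat) list set \<times> bool) list set"
  where "bessis_iso n c =
    group_lift (fraction_group (dual_braid_monoid n c)) (\<lambda>i. dual_braid_in_frac n c (s_perm i))"

definition simple_dual_braid ::
    "nat \<Rightarrow> (nat \<Rightarrow> nat) \<Rightarrow> (nat \<Rightarrow> nat) \<Rightarrow> (nat \<times> bool) list set"
  where "simple_dual_braid n c x =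
    inv_into (carrier (braid_group n)) (bessis_iso n c) (dual_braid_in_frac n c x)"


section \<open>The Temperley--Lieb algebra\<close>

text \<open>The convolution product makes \<^typ>\<open>int \<Rightarrow>\<^sub>0 int\<close> the group ring of the integers over the
  integers, which is the ring of Laurent polynomials in the
  variable \<open>v_laurent\<close>.\<close>

type_synonym laurent = "int \<Rightarrow>\<^sub>0 int"

definition v_laurent :: laurent
  where "v_laurent = Poly_Mapping.single 1 1"

definition v_inv_laurent :: laurent
  where "v_inv_laurent = Poly_Mapping.single (- 1) 1"

definition nonneg_laurent :: "laurent set"
  where "nonneg_laurent = {p. \<forall>k. Poly_Mapping.lookup p k \<ge> 0}"

text \<open>With concatenation as addition on words, the convolution product on
  finitely supported functions on words is that of the free associative algebra.\<close>

instantiation list :: (type) monoid_add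
begin
definition zero_list :: "'a list" where "zero_list = []"
definition plus_list :: "'a list \<Rightarrow> 'a list \<Rightarrow> 'a list" where "plus_list = (@)"
instance by standard (simp_all add: zero_list_def plus_list_def)
end

definition free_algebra :: "'a set \<Rightarrow> ('a list \<Rightarrow>\<^sub>0 'r::comm_ring_1) ring"
  where "free_algebra X =
    \<lparr>carrier = {p. Poly_Mapping.keys p \<subseteq> lists X}, mult = (*), one = 1, zero = 0, add = (+)\<rparr>"

definition scalar_poly :: "'r::comm_ring_1 \<Rightarrow> 'a list \<Rightarrow>\<^sub>0 'r"
  where "scalar_poly r = Poly_Mapping.single [] r"

definition indet :: "'a \<Rightarrow> 'a list \<Rightarrow>\<^sub>0 'r::comm_ring_1"
  where "indet i = Poly_Mapping.single [i] 1"

definition TL_free :: "nat \<Rightarrow> (nat list \<Rightarrow>\<^sub>0 laurent) ring"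
  where "TL_free n = free_algebra {1..n}"

definition TL_rels :: "nat \<Rightarrow> (nat list \<Rightarrow>\<^sub>0 laurent) set"
  where "TL_rels n =
    {indet i * indet j * indet i - indet i |i j. i \<in> {1..n} \<and> j \<in> {1..n} \<and> adjacent i j}
    \<union> {indet i * indet j - indet j * indet i |i j. i \<in> {1..n} \<and> j \<in> {1..n} \<and> far i j}
    \<union> {indet i * indet i - scalar_poly (v_laurent + v_inv_laurent) * indet i |i. i \<in> {1..n}}"

definition TL_ideal :: "nat \<Rightarrow> (nat list \<Rightarrow>\<^sub>0 laurent) set"
  where "TL_ideal n = Idl\<^bsub>TL_free n\<^esub> (TL_rels n)"

definition TL :: "nat \<Rightarrow> (nat list \<Rightarrow>\<^sub>0 laurent) set ring"
  where "TL n = TL_free n Quot TL_ideal n"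

definition TL_class :: "nat \<Rightarrow> (nat list \<Rightarrow>\<^sub>0 laurent) \<Rightarrow> (nat list \<Rightarrow>\<^sub>0 laurent) set"
  where "TL_class n p = TL_ideal n +>\<^bsub>TL_free n\<^esub> p"

definition TL_scalar :: "nat \<Rightarrow> laurent \<Rightarrow> (nat list \<Rightarrow>\<^sub>0 laurent) set"
  where "TL_scalar n r = TL_class n (scalar_poly r)"

definition TL_smult ::
    "nat \<Rightarrow> laurent \<Rightarrow> (nat list \<Rightarrow>\<^sub>0 laurent) set \<Rightarrow> (nat list \<Rightarrow>\<^sub>0 laurent) set"
  where "TL_smult n r a = TL_scalar n r \<otimes>\<^bsub>TL n\<^esub> a"

definition b_gen :: "nat \<Rightarrow> nat \<Rightarrow> (nat list \<Rightarrow>\<^sub>0 laurent) set"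
  where "b_gen n i = TL_class n (indet i)"

text \<open>For fully commutative \<open>w\<close> this does not depend on the chosen reduced expression of \<open>w\<close>.\<close>

definition b_elt :: "nat \<Rightarrow> (nat \<Rightarrow> nat) \<Rightarrow> (nat list \<Rightarrow>\<^sub>0 laurent) set"
  where "b_elt n w = word_prod (TL n) (b_gen n) (SOME u. u \<in> reduced_exprs n w)"

definition omega :: "nat \<Rightarrow> (nat \<times> bool) list set \<Rightarrow> (nat list \<Rightarrow>\<^sub>0 laurent) set"
  where "omega n = group_lift (units_of (TL n)) (\<lambda>i. TL_scalar n v_inv_laurent \<ominus>\<^bsub>TL n\<^esub> b_gen n i)"

definition Z_elt :: "nat \<Rightarrow> (nat \<Rightarrow> nat) \<Rightarrow> (nat \<Rightarrow> nat) \<Rightarrow> (nat list \<Rightarrow>\<^sub>0 laurent) set"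
  where "Z_elt n c x = omega n (simple_dual_braid n c x)"

end

theory Submission
  imports Defs
begin

text \<open>A standard Coxeter element \<open>c\<close> is a cycle that runs around \<open>n + 1\<close> points placed on the two
  sides of an ellipse, and a divisor \<open>x\<close> of \<open>c\<close> is a noncrossing partition of these points into
  polygons. Stacking the polygons in a suitable order shows that the simple dual braid of \<open>x\<close> is a
  Mikado braid, that is, a product \<open>\<Sigma>\<^sub>u \<Sigma>\<^sub>w\<^sup>-\<^sup>1\<close> of the canonical positive lift of one permutation
  and the inverse of that of another.

  A Mikado braid on \<open>n + 1\<close> strands is obtained from one on \<open>n\<close> strands by laying one more strand in
  front of all the others. With the generators \<open>- b\<^sub>i\<close>, resolving the crossings of this strand with a
  planar diagram produces non-negative Laurent coefficients only, because no closed loop ever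
  arises. By induction the image of a Mikado braid is a non-negative combination of products of
  the \<open>- b\<^sub>i\<close> along normal words. These words are reduced and their products avoid the pattern 321,
  so they represent fully commutative elements.

  The images of the simple dual braids satisfy the relations of the dual braid monoid; hence they
  determine a morphism on its group of fractions, which agrees with \<open>\<omega>\<close> through Bessis'
  isomorphism.\<close>

text \<open>Planar geometry enters only through lengths. \<open>pair_below\<close> says that two
  reflections multiply, in the given order, to a divisor of the Coxeter element, and the crossing
  lemmas translate this into the signs of the points involved. The Mikado form arises by
  conjugation. The layering of the polygons yields an arrangement w of the points in which the ends
  of every edge are neighbours. The canonical lift of w then conjugates simple generators to the
  atoms of the edges, so the dual braid times the lift of w is the lift of w times a product of
  distinct simple generators. Each of these increases the length, hence the result is again a
  canonical lift. Everything recurses on the largest point: the reflection length, the Coxeter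
  element, the lifts and the planar diagrams. A Coxeter element is determined by the side on which
  each new generator is multiplied, that is, by one sign per step. A simple dual braid is defined as
  some preimage under Bessis' morphism. Since \<open>omega\<close> factors through that morphism,
  its image can be computed without knowing which preimage was taken.\<close>

abbreviation tr :: "nat \<Rightarrow> nat \<Rightarrow> nat \<Rightarrow> nat"
  where "tr \<equiv> Transposition.transpose"

section \<open>Transpositions, cosets and the reflection length\<close>

lemma permutes_mono: "p permutes {1..m} \<Longrightarrow> m \<le> n \<Longrightarrow> p permutes {1..n::nat}"
  by (rule permutes_subset) auto

lemma tr_permutes: "a \<in> {1..M} \<Longrightarrow> b \<in> {1..M} \<Longrightarrow> tr a b permutes {1..M}"
  by (rule permutes_swap_id)

lemma tr_conj: "bij f \<Longrightarrow> f \<circ> tr a b = tr (f a) (f b) \<circ> f"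
  by (simp add: transpose_comp_eq bij_is_inj)

lemma tr_tr: "tr a b \<circ> tr c d = tr (tr a b c) (tr a b d) \<circ> tr a b"
  by (rule tr_conj) simp

lemma tr_tr': "tr a b \<circ> tr c d = tr c d \<circ> tr (tr c d a) (tr c d b)"
  by (subst tr_tr[of c d]) simp

lemma tr_cancel: "f \<circ> tr a b \<circ> tr a b = f"
  by (simp add: comp_assoc)

lemma permutes_SucD:
  "w permutes {1..Suc M} \<Longrightarrow> w (Suc M) = Suc M \<Longrightarrow> w permutes {1..M}"
  by (rule permutes_superset[of w "{1..Suc M}"]) (auto simp: le_Suc_eq)

text \<open>The identity and the transpositions \<open>tr k (Suc M)\<close> represent the cosets of
  the permutations of {1..M}; \<open>k\<close> is the preimage of the top point. This is the case
  split behind the inductions on the largest point.\<close>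

lemma perm_Suc_cases:
  assumes "w permutes {1..Suc M}"
  obtains (fixed) "w permutes {1..M}"
  | (move) y k where "y permutes {1..M}" "k \<in> {1..M}" "w = y \<circ> tr k (Suc M)"
proof (cases "w (Suc M) = Suc M")
  case True
  then show ?thesis using fixed permutes_SucD[OF assms] by simp
next
  case False
  define k where "k = inv' w (Suc M)"
  have wk: "w k = Suc M" unfolding k_def by (simp add: permutes_inverses[OF assms])
  then have k: "k \<in> {1..M}" using False assms
    by (metis atLeastAtMost_iff le_SucE le_numeral_extra(4) not_less_eq_eq permutes_in_image
        permutes_not_in le_Suc_eq)
  have "w \<circ> tr k (Suc M) permutes {1..Suc M}"
    by (rule permutes_compose[OF tr_permutes assms]) (use k in auto)
  then have "w \<circ> tr k (Suc M) permutes {1..M}"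
    by (rule permutes_SucD) (simp add: wk)
  then show ?thesis using move[of "w \<circ> tr k (Suc M)" k] k tr_cancel[of w k "Suc M"] by simp
qed

text \<open>The reflection length of a permutation of \<open>{1..M}\<close>, in a form that lends itself to induction
  on the largest point.\<close>

fun abs_len :: "nat \<Rightarrow> (nat \<Rightarrow> nat) \<Rightarrow> nat" where
  "abs_len 0 w = 0"
| "abs_len (Suc M) w = (if w (Suc M) = Suc M then abs_len M w
     else Suc (abs_len M (w \<circ> tr (inv' w (Suc M)) (Suc M))))"

lemma abs_len_fix: "y permutes {1..M} \<Longrightarrow> abs_len (Suc M) y = abs_len M y"
  by (simp add: permutes_not_in)

lemma abs_len_move:
  assumes y: "y permutes {1..M}" and k: "k \<in> {1..M}"
  shows "abs_len (Suc M) (y \<circ> tr k (Suc M)) = Suc (abs_len M y)"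
proof -
  let ?w = "y \<circ> tr k (Suc M)"
  have bij: "bij ?w" using permutes_bij[OF y] by (simp add: bij_comp)
  have "?w k = Suc M" using y by (simp add: permutes_not_in)
  then have inv: "inv' ?w (Suc M) = k" using bij by (metis bij_inv_eq_iff)
  have "y k \<in> {1..M}" using k y by (metis permutes_in_image)
  then have "?w (Suc M) \<noteq> Suc M" by auto
  then show ?thesis using inv by (simp only: abs_len.simps if_False inv tr_cancel)
qed

declare abs_len.simps(2) [simp del]

text \<open>Right multiplication by a transposition has to be brought back to coset form, with the
  letter that moves the top point in last place. A letter below the top passes to the left and
  relabels \<open>k\<close>.\<close>

lemma tr_move_low: "a \<noteq> N \<Longrightarrow> b \<noteq> N \<Longrightarrow> y \<circ> tr k N \<circ> tr a b = y \<circ> tr a b \<circ> tr (tr a b k) N"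
  by (simp add: comp_assoc) (subst tr_tr', simp)

text \<open>Of two letters that move the top point, one is traded for a letter below it.\<close>

lemma tr_move_top: "k \<noteq> m \<Longrightarrow> k \<noteq> N \<Longrightarrow> m \<noteq> N \<Longrightarrow> y \<circ> tr k N \<circ> tr m N = y \<circ> tr m k \<circ> tr k N"
  by (simp add: comp_assoc) (subst tr_tr, simp)

lemma tr_in: "a \<in> S \<Longrightarrow> b \<in> S \<Longrightarrow> k \<in> S \<Longrightarrow> tr a b k \<in> S"
  by (simp add: Transposition.transpose_def)

text \<open>\<open>abs_len\<close> is defined by one particular way of stripping the top point. That
  every transposition changes it by exactly one makes it intrinsic: comparison with word length and
  conjugation invariance rest on this.\<close>

lemma abs_len_tr:
  "\<lbrakk>w permutes {1..M}; a \<in> {1..M}; b \<in> {1..M}; a \<noteq> b\<rbrakk> \<Longrightarrow>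
   abs_len M (w \<circ> tr a b) = Suc (abs_len M w) \<or> Suc (abs_len M (w \<circ> tr a b)) = abs_len M w"
proof (induction (no_simp) M arbitrary: w a b)
  case 0
  then show ?case by simp
next
  case (Suc M)
  \<comment> \<open>The ends of a transposition are interchangeable, so only the second one is
    allowed to be the top point.\<close>
  have main: "abs_len (Suc M) (w \<circ> tr a b) = Suc (abs_len (Suc M) w) \<or>
      Suc (abs_len (Suc M) (w \<circ> tr a b)) = abs_len (Suc M) w"
    if ab: "a \<in> {1..M}" "b \<in> {1..Suc M}" "a \<noteq> b" for a b
    using Suc.prems(1)
  proof (cases rule: perm_Suc_cases)
    case fixed
    show ?thesis
    proof (cases "b = Suc M")
      case True
      then show ?thesis using abs_len_move[OF fixed ab(1)] abs_len_fix[OF fixed] by simp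
    next
      case False
      then have b: "b \<in> {1..M}" using ab by auto
      have p: "w \<circ> tr a b permutes {1..M}"
        using fixed ab b by (intro permutes_compose tr_permutes)
      show ?thesis unfolding abs_len_fix[OF fixed] abs_len_fix[OF p] by (rule Suc.IH[OF fixed ab(1) b ab(3)])
    qed
  next
    case (move y k)
    show ?thesis
    proof (cases "b = Suc M")
      case True
      show ?thesis
      proof (cases "k = a")
        case True
        then have "w \<circ> tr a b = y" using move \<open>b = Suc M\<close> tr_cancel by simp
        then show ?thesis using abs_len_move[OF move(1,2)] abs_len_fix[OF move(1)] move(3) by simp
      next
        case False
        have eq: "w \<circ> tr a b = y \<circ> tr a k \<circ> tr k (Suc M)"
          using move ab False \<open>b = Suc M\<close> by (simp only: move(3)) (intro tr_move_top, auto)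
        have p: "y \<circ> tr a k permutes {1..M}"
          using move ab by (intro permutes_compose tr_permutes)
        have "abs_len (Suc M) w = Suc (abs_len M y)"
          unfolding move(3) by (rule abs_len_move[OF move(1,2)])
        moreover have "abs_len (Suc M) (w \<circ> tr a b) = Suc (abs_len M (y \<circ> tr a k))"
          unfolding eq by (rule abs_len_move[OF p move(2)])
        ultimately show ?thesis using Suc.IH[OF move(1) ab(1) move(2)] False by metis
      qed
    next
      case False
      then have b: "b \<in> {1..M}" using ab by auto
      have eq: "w \<circ> tr a b = y \<circ> tr a b \<circ> tr (tr a b k) (Suc M)"
        unfolding move(3) using ab False by (intro tr_move_low) auto
      have p: "y \<circ> tr a b permutes {1..M}"
        using move ab b by (intro permutes_compose tr_permutes)
      have k': "tr a b k \<in> {1..M}" using move ab b by (intro tr_in)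
      have "abs_len (Suc M) w = Suc (abs_len M y)"
        unfolding move(3) by (rule abs_len_move[OF move(1,2)])
      moreover have "abs_len (Suc M) (w \<circ> tr a b) = Suc (abs_len M (y \<circ> tr a b))"
        unfolding eq by (rule abs_len_move[OF p k'])
      ultimately show ?thesis using Suc.IH[OF move(1) ab(1) b ab(3)] by metis
    qed
  qed
  show ?case
  proof (cases "a = Suc M")
    case True
    then have "b \<in> {1..M}" using Suc.prems by auto
    then show ?thesis using main[of b a] Suc.prems(2,4) by (metis transpose_commute)
  next
    case False
    then have "a \<in> {1..M}" using Suc.prems by auto
    then show ?thesis using main[of a b] Suc.prems(3,4) by blast
  qed
qed

definition tpairs :: "nat \<Rightarrow> (nat \<times> nat) set"
  where "tpairs M = {(a, b). a \<in> {1..M} \<and> b \<in> {1..M} \<and> a \<noteq> b}"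

definition tprod :: "(nat \<times> nat) list \<Rightarrow> nat \<Rightarrow> nat"
  where "tprod ws = foldr (\<lambda>(a, b) f. tr a b \<circ> f) ws id"

lemma tpairs_Suc: "tpairs M \<subseteq> tpairs (Suc M)"
  by (auto simp: tpairs_def)

lemma tpairs_mono: "m \<le> n \<Longrightarrow> tpairs m \<subseteq> tpairs n"
  by (auto simp: tpairs_def)

lemma tprod_simps [simp]: "tprod [] = id" "tprod ((a, b) # ws) = tr a b \<circ> tprod ws"
  by (auto simp: tprod_def)

lemma tprod_append [simp]: "tprod (us @ vs) = tprod us \<circ> tprod vs"
  by (induction us) (auto simp: o_assoc)

lemma tprod_permutes: "set ws \<subseteq> tpairs M \<Longrightarrow> tprod ws permutes {1..M}"
  by (induction ws) (auto simp: tpairs_def permutes_id simp del: One_nat_def intro!: permutes_compose tr_permutes)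

lemma abs_len_id [simp]: "abs_len M id = 0"
proof (induction (no_simp) M)
  case (Suc M)
  have "abs_len (Suc M) id = abs_len M id" by (rule abs_len_fix[OF permutes_id])
  then show ?case using Suc by (simp only:)
qed (simp only: abs_len.simps)

lemma abs_len_le_length: "set ws \<subseteq> tpairs M \<Longrightarrow> abs_len M (tprod ws) \<le> length ws"
proof (induction (no_simp) ws rule: rev_induct)
  case Nil
  show ?case by (simp only: tprod_simps abs_len_id)
next
  case (snoc p ws)
  obtain a b where p: "p = (a, b)" by force
  have ab: "a \<in> {1..M}" "b \<in> {1..M}" "a \<noteq> b" using snoc.prems p by (auto simp: tpairs_def)
  have ws: "set ws \<subseteq> tpairs M" using snoc.prems by simp
  have "abs_len M (tprod (ws @ [p])) = abs_len M (tprod ws \<circ> tr a b)"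
    by (simp only: p tprod_append tprod_simps comp_id)
  then show ?case using abs_len_tr[OF tprod_permutes[OF ws] ab] snoc.IH[OF ws]
    by (simp only: length_append list.size) linarith
qed

lemma ex_tword:
  "w permutes {1..M} \<Longrightarrow> \<exists>ws. set ws \<subseteq> tpairs M \<and> tprod ws = w \<and> length ws = abs_len M w"
proof (induction (no_simp) M arbitrary: w)
  case 0
  then have "w = id" by simp
  then show ?case by (intro exI[of _ "[]"]) simp
next
  case (Suc M)
  from Suc.prems show ?case
  proof (cases rule: perm_Suc_cases)
    case fixed
    from Suc.IH[OF fixed] show ?thesis using tpairs_Suc abs_len_fix[OF fixed] by fastforce
  next
    case (move y k)
    from Suc.IH[OF move(1)] obtain ws where
      "set ws \<subseteq> tpairs M" "tprod ws = y" "length ws = abs_len M y" by auto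
    moreover have "(k, Suc M) \<in> tpairs (Suc M)" using move(2) by (auto simp: tpairs_def)
    moreover have "abs_len (Suc M) w = Suc (abs_len M y)"
      unfolding move(3) by (rule abs_len_move[OF move(1,2)])
    ultimately show ?thesis using tpairs_Suc[of M] 
      by (intro exI[of _ "ws @ [(k, Suc M)]"] conjI) (auto simp only: move(3) set_append tprod_append tprod_simps comp_id length_append list.size, auto)
  qed
qed

text \<open>Each letter changes the recursive length by one, so no word is shorter; unwinding the
  recursion spells out a word that attains it.\<close>

lemma abs_len_Min:
  assumes "w permutes {1..M}"
  shows "abs_len M w = (LEAST k. \<exists>ws. set ws \<subseteq> tpairs M \<and> length ws = k \<and> tprod ws = w)"
  by (rule Least_equality[symmetric])
     (use ex_tword[OF assms] abs_len_le_length[of _ M] in blast, use abs_len_le_length[of _ M] in blast)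

lemma abs_len_comp: 
  assumes "x permutes {1..M}" "y permutes {1..M}"
  shows "abs_len M (x \<circ> y) \<le> abs_len M x + abs_len M y"
proof -
  from ex_tword[OF assms(1)] obtain us where "set us \<subseteq> tpairs M" "tprod us = x" "length us = abs_len M x"
    by auto
  moreover from ex_tword[OF assms(2)] obtain vs where
    "set vs \<subseteq> tpairs M" "tprod vs = y" "length vs = abs_len M y" by auto
  ultimately show ?thesis using abs_len_le_length[of "us @ vs" M] by auto
qed

lemma tprod_conj:
  assumes "bij g" shows "g \<circ> tprod ws = tprod (map (\<lambda>(a, b). (g a, g b)) ws) \<circ> g"
proof (induction (no_simp) ws)
  case (Cons p ws)
  obtain a b where p: "p = (a, b)" by force
  have "g \<circ> tprod (p # ws) = (g \<circ> tr a b) \<circ> tprod ws" by (simp add: p o_assoc)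
  also have "\<dots> = tr (g a) (g b) \<circ> (g \<circ> tprod ws)" by (simp only: tr_conj[OF assms] comp_assoc)
  also have "\<dots> = tprod (map (\<lambda>(a, b). (g a, g b)) (p # ws)) \<circ> g"
    by (simp only: Cons p list.map prod.case tprod_simps comp_assoc)
  finally show ?case .
qed simp

text \<open>Conjugating a shortest word letter by letter gives a word of the same length;
  conjugating back gives the other inequality.\<close>

lemma abs_len_conj: 
  assumes w: "w permutes {1..M}" and g: "g permutes {1..M}"
  shows "abs_len M (g \<circ> w \<circ> inv' g) = abs_len M w"
proof -
  have *: "abs_len M (g \<circ> w \<circ> inv' g) \<le> abs_len M w"
    if w: "w permutes {1..M}" and g: "g permutes {1..M}" for w g
  proof -
    from ex_tword[OF w] obtain ws where ws: "set ws \<subseteq> tpairs M" "tprod ws = w" "length ws = abs_len M w"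
      by auto
    have "g \<circ> w \<circ> inv' g = tprod (map (\<lambda>(a, b). (g a, g b)) ws)"
      by (simp add: ws(2)[symmetric] tprod_conj[OF permutes_bij[OF g]] comp_assoc permutes_inv_o[OF g])
    moreover have "set (map (\<lambda>(a, b). (g a, g b)) ws) \<subseteq> tpairs M"
      using ws(1) permutes_in_image[OF g] inj_eq[OF permutes_inj[OF g]]
      by (auto simp: tpairs_def simp del: One_nat_def atLeastAtMost_iff dest!: subsetD)
    ultimately show ?thesis using abs_len_le_length ws(3) by (metis length_map)
  qed
  have "inv' g \<circ> (g \<circ> w \<circ> inv' g) \<circ> inv' (inv' g) = w"
    by (simp add: permutes_inv_inv[OF g] comp_assoc permutes_inv_o[OF g])
       (simp add: o_assoc permutes_inv_o[OF g])
  then show ?thesis using *[OF w g] *[OF _ permutes_inv[OF g], of "g \<circ> w \<circ> inv' g"]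
    permutes_compose[OF permutes_compose[OF permutes_inv[OF g] w] g] by (simp add: comp_assoc)
qed

text \<open>One product is the conjugate of the other by x. This cyclic rotation carries a letter
  that moves the top point from the left end to the right end, where \<open>abs_len_move\<close>
  reads it off.\<close>

lemma abs_len_swap:
  assumes "x permutes {1..M}" "y permutes {1..M}"
  shows "abs_len M (x \<circ> y) = abs_len M (y \<circ> x)"
  using abs_len_conj[OF permutes_compose[OF assms] assms(1)] 
  by (simp add: comp_assoc permutes_inv_o[OF assms(1)])

lemma abs_len_tr_left:
  "\<lbrakk>w permutes {1..M}; a \<in> {1..M}; b \<in> {1..M}; a \<noteq> b\<rbrakk> \<Longrightarrow>
   abs_len M (tr a b \<circ> w) = Suc (abs_len M w) \<or> Suc (abs_len M (tr a b \<circ> w)) = abs_len M w"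
  using abs_len_tr[of w M a b] abs_len_swap[of "tr a b" M w] tr_permutes[of a M b] by simp

lemma abs_len_mono:
  "w permutes {1..m} \<Longrightarrow> m \<le> M \<Longrightarrow> abs_len M w = abs_len m w"
proof (induction (no_simp) M)
  case (Suc M)
  then show ?case
    using abs_len_fix[of w M] permutes_mono[of w m M] by (cases "m = Suc M") auto
qed simp

lemma abs_len_single:
  assumes "a \<in> {1..M}" "b \<in> {1..M}" "a \<noteq> b" shows "abs_len M (tr a b) = 1"
  using abs_len_tr[OF permutes_id assms] by simp

lemma abs_len_less: "w permutes {1..M} \<Longrightarrow> abs_len M w \<le> M - 1"
proof (induction (no_simp) M arbitrary: w)
  case (Suc M)
  from Suc.prems show ?case
  proof (cases rule: perm_Suc_cases)
    case fixed
    then show ?thesis using Suc.IH[OF fixed] abs_len_fix[OF fixed] by auto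
  next
    case (move y k)
    have "abs_len (Suc M) w = Suc (abs_len M y)"
      unfolding move(3) by (rule abs_len_move[OF move(1,2)])
    moreover have "M \<ge> 1" using move(2) by auto
    ultimately show ?thesis using Suc.IH[OF move(1)] by linarith
  qed
qed simp

subsection \<open>Divisibility\<close>

text \<open>The absolute order, with a cofactor v in place of the quotient by x, so that inverses
  are avoided. \<open>Div_eq\<close> shows the agreement with \<open>Div\<close>.\<close>

definition below :: "nat \<Rightarrow> (nat \<Rightarrow> nat) \<Rightarrow> (nat \<Rightarrow> nat) \<Rightarrow> bool"
  where "below M x c \<longleftrightarrow> x permutes {1..M} \<and>
    (\<exists>v. v permutes {1..M} \<and> c = x \<circ> v \<and> abs_len M c = abs_len M x + abs_len M v)"

lemma below_permutes: "below M x c \<Longrightarrow> x permutes {1..M}"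
  by (simp add: below_def)

text \<open>A conjugate of \<open>a\<close> can be moved to the right of \<open>x\<close> at no cost
  in length, so a middle factor of a length-additive product is also a left factor.\<close>

lemma below_mid:
  assumes p: "a permutes {1..M}" "x permutes {1..M}" "b permutes {1..M}"
    and c: "c = a \<circ> x \<circ> b" and l: "abs_len M a + abs_len M x + abs_len M b \<le> abs_len M c"
  shows "below M x c"
proof -
  define v where "v = (inv' x \<circ> a \<circ> inv' (inv' x)) \<circ> b"
  have 1: "inv' x \<circ> a \<circ> inv' (inv' x) permutes {1..M}"
    using p by (intro permutes_compose permutes_inv) auto
  have v: "v permutes {1..M}" unfolding v_def by (rule permutes_compose[OF p(3) 1])
  have cv: "c = x \<circ> v" unfolding v_def c
    by (simp add: permutes_inv_inv[OF p(2)] o_assoc permutes_inv_o[OF p(2)])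
  have "abs_len M v \<le> abs_len M a + abs_len M b"
    unfolding v_def using abs_len_comp[OF 1 p(3)] abs_len_conj[OF p(1) permutes_inv[OF p(2)]] by simp
  moreover have "abs_len M c \<le> abs_len M x + abs_len M v"
    unfolding cv by (rule abs_len_comp[OF p(2) v])
  ultimately show ?thesis using l v cv p(2) unfolding below_def by (intro conjI exI[of _ v]) auto
qed

lemma below_trans_mid:
  assumes "below M x c" and p: "a permutes {1..M}" "y permutes {1..M}" "b permutes {1..M}"
    and x: "x = a \<circ> y \<circ> b" and l: "abs_len M a + abs_len M y + abs_len M b \<le> abs_len M x"
  shows "below M y c"
proof -
  obtain v where v: "v permutes {1..M}" "c = x \<circ> v" "abs_len M c = abs_len M x + abs_len M v"
    using assms(1) by (auto simp: below_def)
  show ?thesis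
  proof (rule below_mid[OF p(1,2)])
    show bv: "b \<circ> v permutes {1..M}" by (rule permutes_compose[OF v(1) p(3)])
    show "c = a \<circ> y \<circ> (b \<circ> v)" by (simp add: v(2) x o_assoc)
    show "abs_len M a + abs_len M y + abs_len M (b \<circ> v) \<le> abs_len M c"
      using abs_len_comp[OF p(3) v(1)] v(3) l by simp
  qed
qed

text \<open>The product of \<open>tr a b\<close> and \<open>tr d e\<close>, in this order, is a
  divisor of length two. The condition is put on the quotient, which starts with the inverse of the
  product; hence the reversed order of the letters.\<close>

definition pair_below :: "nat \<Rightarrow> (nat \<Rightarrow> nat) \<Rightarrow> nat \<Rightarrow> nat \<Rightarrow> nat \<Rightarrow> nat \<Rightarrow> bool"
  where "pair_below M c a b d e \<longleftrightarrow> abs_len M (tr d e \<circ> tr a b \<circ> c) + 2 = abs_len M c"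

lemma pair_below_of_below:
  assumes "below M (tr a b \<circ> tr d e) c" "abs_len M (tr a b \<circ> tr d e) = 2"
  shows "pair_below M c a b d e"
proof -
  obtain v where v: "v permutes {1..M}" "c = (tr a b \<circ> tr d e) \<circ> v"
    "abs_len M c = abs_len M (tr a b \<circ> tr d e) + abs_len M v"
    using assms(1) by (auto simp: below_def)
  have "tr d e \<circ> tr a b \<circ> c = v"
  proof -
    have "tr d e \<circ> tr a b \<circ> c = tr d e \<circ> (tr a b \<circ> tr a b) \<circ> tr d e \<circ> v"
      by (simp only: v(2) o_assoc)
    also have "\<dots> = (tr d e \<circ> tr d e) \<circ> v" by (simp only: transpose_comp_involutory comp_id)
    finally show ?thesis by simp
  qed
  then show ?thesis using v(3) assms(2) by (simp add: pair_below_def)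
qed

subsection \<open>Cycle classes\<close>

text \<open>For a permutation \<open>x\<close> this says that \<open>a\<close> and \<open>b\<close> lie in the same cycle.\<close>

definition same :: "nat \<Rightarrow> (nat \<Rightarrow> nat) \<Rightarrow> nat \<Rightarrow> nat \<Rightarrow> bool"
  where "same M x a b \<longleftrightarrow> a = b \<or> abs_len M (x \<circ> tr a b) < abs_len M x"

lemma same_refl [simp]: "same M x a a" by (simp add: same_def)

lemma same_sym: "same M x a b = same M x b a"
  by (auto simp: same_def transpose_commute)

lemma same_fix_low:
  assumes "x permutes {1..M}" "a \<in> {1..M}" "b \<in> {1..M}"
  shows "same (Suc M) x a b = same M x a b"
  using assms abs_len_fix[of "x \<circ> tr a b" M] abs_len_fix[of x M]
    permutes_compose[OF tr_permutes[of a M b], of x]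
  by (simp only: same_def)

lemma same_fix_top:
  assumes "x permutes {1..M}" "a \<in> {1..M}"
  shows "\<not> same (Suc M) x a (Suc M)"
  using assms abs_len_move[of x M a] abs_len_fix[of x M] by (auto simp: same_def)

text \<open>Multiplication by \<open>tr k (Suc M)\<close> inserts the top point into the cycle of
  \<open>k\<close> and changes no other membership. With \<open>same_move_top\<close> this gives an
  inductive description of cycles in terms of lengths alone.\<close>

lemma same_move_low:
  assumes "y permutes {1..M}" "k \<in> {1..M}" "a \<in> {1..M}" "b \<in> {1..M}"
  shows "same (Suc M) (y \<circ> tr k (Suc M)) a b = same M y a b"
proof -
  have "y \<circ> tr k (Suc M) \<circ> tr a b = y \<circ> tr a b \<circ> tr (tr a b k) (Suc M)"
    using assms by (intro tr_move_low) auto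
  then show ?thesis
    using assms abs_len_move[of y M k] abs_len_move[of "y \<circ> tr a b" M "tr a b k"]
      permutes_compose[OF tr_permutes[of a M b], of y] tr_in[of a "{1..M}" b k]
    by (simp add: same_def)
qed

lemma same_move_top:
  assumes "y permutes {1..M}" "k \<in> {1..M}" "a \<in> {1..M}"
  shows "same (Suc M) (y \<circ> tr k (Suc M)) a (Suc M) = same M y a k"
proof (cases "a = k")
  case True
  then show ?thesis using assms abs_len_move[of y M k] abs_len_fix[of y M]
    by (simp add: same_def tr_cancel)
next
  case False
  have "y \<circ> tr k (Suc M) \<circ> tr a (Suc M) = y \<circ> tr a k \<circ> tr k (Suc M)"
    using assms False by (intro tr_move_top) auto
  then show ?thesis
    using assms False abs_len_move[of y M k] abs_len_move[of "y \<circ> tr a k" M k]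
      permutes_compose[OF tr_permutes[of a M k], of y]
    by (auto simp: same_def)
qed

text \<open>Transitivity cannot be seen from the lengths directly. In the induction the top point is
  replaced by \<open>k\<close>, whose cycle it has joined.\<close>

lemma same_trans:
  "\<lbrakk>x permutes {1..M}; a \<in> {1..M}; b \<in> {1..M}; d \<in> {1..M}; same M x a b; same M x b d\<rbrakk> \<Longrightarrow> same M x a d"
proof (induction M arbitrary: x a b d)
  case 0
  then show ?case by simp
next
  case (Suc M)
  have low: "z \<in> {1..Suc M} \<longleftrightarrow> z \<in> {1..M} \<or> z = Suc M" for z by auto
  from Suc.prems(1) show ?case
  proof (cases rule: perm_Suc_cases)
    case fixed
    have top: "\<not> same (Suc M) x (Suc M) z" if "z \<in> {1..M}" for z
      using same_fix_top[OF fixed that] same_sym by metis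
    consider "a \<in> {1..M}" "b \<in> {1..M}" "d \<in> {1..M}" | "a = d" | "a = b" | "b = d"
      using Suc.prems(2-6) same_fix_top[OF fixed] top unfolding low by metis
    then show ?thesis
    proof cases
      case 1
      then show ?thesis using Suc.IH[OF fixed 1] Suc.prems(5,6) same_fix_low[OF fixed] by metis
    qed (use Suc.prems in simp_all)
  next
    case (move y k)
    note IH = Suc.IH[OF move(1)]
    note L = same_move_low[OF move(1,2)] and T = same_move_top[OF move(1,2)]
    have T': "same (Suc M) x (Suc M) z = same M y k z" if "z \<in> {1..M}" for z
      using T[OF that] same_sym unfolding move(3) by metis
    consider "a = Suc M" "d = Suc M" | "a = b" | "b = d" | "a = Suc M" "b \<in> {1..M}" "d \<in> {1..M}"
      | "a \<in> {1..M}" "b = Suc M" "d \<in> {1..M}" | "a \<in> {1..M}" "b \<in> {1..M}" "d = Suc M"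
      | "a \<in> {1..M}" "b \<in> {1..M}" "d \<in> {1..M}"
      using Suc.prems(2-4) unfolding low by metis
    then show ?thesis
    proof cases
      case 4
      then show ?thesis using IH[OF move(2) 4(2,3)] Suc.prems(5,6) T' L unfolding move(3) by metis
    next
      case 5
      then show ?thesis using IH[OF 5(1) move(2) 5(3)] Suc.prems(5,6) T T' L unfolding move(3) by metis
    next
      case 6
      then show ?thesis using IH[OF 6(1,2) move(2)] Suc.prems(5,6) T L unfolding move(3) by metis
    next
      case 7
      then show ?thesis using IH[OF 7] Suc.prems(5,6) L unfolding move(3) by metis
    qed (use Suc.prems in simp_all)
  qed
qed

text \<open>Multiplying by \<open>tr a b\<close> can split only the cycle that contains
  \<open>a\<close> and \<open>b\<close>. Thus chords of two different cycles can be removed one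
  after the other.\<close>

lemma same_disjoint:
  "\<lbrakk>x permutes {1..M}; a \<in> {1..M}; b \<in> {1..M}; d \<in> {1..M}; e \<in> {1..M};
    same M x a b; same M x d e; \<not> same M x a d\<rbrakk> \<Longrightarrow> same M (x \<circ> tr a b) d e"
proof (induction (no_simp) M arbitrary: x a b d e)
  case 0
  then show ?case by simp
next
  case (Suc M)
  consider "a = b" | "d = e" | "a \<noteq> b" "d \<noteq> e" by blast
  then show ?case
  proof cases
    case 1
    then show ?thesis using Suc.prems by simp
  next
    case 2
    then show ?thesis by simp
  next
    case 3
    have low: "z \<in> {1..Suc M} \<longleftrightarrow> z \<in> {1..M} \<or> z = Suc M" for z by auto
    from Suc.prems(1) show ?thesis
    proof (cases rule: perm_Suc_cases)
      case fixed
      have ab: "a \<in> {1..M}" "b \<in> {1..M}" "d \<in> {1..M}" "e \<in> {1..M}"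
        using Suc.prems 3 fixed unfolding low by (metis same_fix_top same_sym)+
      then have "same M (x \<circ> tr a b) d e"
        using Suc.IH[OF fixed ab] Suc.prems fixed same_fix_low[OF fixed] by metis
      moreover have "x \<circ> tr a b permutes {1..M}"
        using fixed ab by (intro permutes_compose tr_permutes)
      ultimately show ?thesis using ab same_fix_low by metis
    next
      case (move y k)
      have main: "same (Suc M) (x \<circ> tr a b) d e"
        if ab: "a \<in> {1..M}" "b \<in> {1..Suc M}" "a \<noteq> b" and de: "d \<in> {1..M}" "e \<in> {1..Suc M}" "d \<noteq> e"
          and s: "same (Suc M) x a b" "same (Suc M) x d e" "\<not> same (Suc M) x a d" for a b d e
      proof -
        have nad: "\<not> same M y a d" using s(3) move ab de by (simp add: same_move_low)
        show ?thesis
        proof (cases "b = Suc M")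
          case True
          have ak: "same M y a k" using s(1) True move ab by (simp add: same_move_top)
          have e: "e \<in> {1..M}"
          proof (rule ccontr)
            assume "e \<notin> {1..M}"
            then have "e = Suc M" using de by auto
            then have "same M y d k" using s(2) move de by (simp add: same_move_top)
            then show False using nad ak same_trans[OF move(1)] move(2) ab(1) de(1) same_sym by metis
          qed
          have sde: "same M y d e" using s(2) move de e by (simp add: same_move_low)
          show ?thesis
          proof (cases "a = k")
            case k: True
            then have "x \<circ> tr a b = y" using True move by (simp add: tr_cancel)
            then show ?thesis using sde move de e by (simp add: same_fix_low)
          next
            case False
            then have "x \<circ> tr a b = y \<circ> tr a k \<circ> tr k (Suc M)"
              unfolding move(3) True using move ab by (intro tr_move_top) auto
            moreover have "same M (y \<circ> tr a k) d e"
              by (rule Suc.IH[OF move(1) ab(1) move(2) de(1) e ak sde nad])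
            moreover have "y \<circ> tr a k permutes {1..M}"
              using move ab by (intro permutes_compose tr_permutes)
            ultimately show ?thesis using move de e by (simp add: same_move_low)
          qed
        next
          case False
          then have b: "b \<in> {1..M}" using ab by auto
          have sab: "same M y a b" using s(1) move ab b by (simp add: same_move_low)
          have eq: "x \<circ> tr a b = y \<circ> tr a b \<circ> tr (tr a b k) (Suc M)"
            unfolding move(3) using ab b by (intro tr_move_low) auto
          have p: "y \<circ> tr a b permutes {1..M}" using move ab b by (intro permutes_compose tr_permutes)
          have k': "tr a b k \<in> {1..M}" using ab b move by (intro tr_in)
          show ?thesis
          proof (cases "e = Suc M")
            case True
            have dk: "same M y d k" using s(2) True move de by (simp add: same_move_top)
            have "k \<noteq> a" "k \<noteq> b" 
              using dk nad sab same_trans[OF move(1)] ab b de move(2) same_sym by metis+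
            then have "tr a b k = k" by simp
            moreover have "same M (y \<circ> tr a b) d k"
              by (rule Suc.IH[OF move(1) ab(1) b de(1) move(2) sab dk nad])
            ultimately show ?thesis using p k' de True move(2) by (simp add: eq same_move_top)
          next
            case False
            then have e: "e \<in> {1..M}" using de by auto
            have "same M y d e" using s(2) move de e by (simp add: same_move_low)
            then have "same M (y \<circ> tr a b) d e"
              by (rule Suc.IH[OF move(1) ab(1) b de(1) e sab _ nad])
            then show ?thesis using p k' de e by (simp add: eq same_move_low)
          qed
        qed
      qed
      \<comment> \<open>At most one of two distinct points is the top point; it is listed
        second.\<close>
      have swap: "\<exists>a' b'. a' \<in> {1..M} \<and> b' \<in> {1..Suc M} \<and> a' \<noteq> b' \<and> ((a' = a \<and> b' = b) \<or> (a' = b \<and> b' = a))"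
        if "a \<in> {1..Suc M}" "b \<in> {1..Suc M}" "a \<noteq> b" for a b
      proof (cases "a = Suc M")
        case True
        then show ?thesis using that by (intro exI[of _ b] exI[of _ a]) auto
      next
        case False
        then show ?thesis using that by (intro exI[of _ a] exI[of _ b]) auto
      qed
      from swap[OF Suc.prems(2,3) 3(1)] obtain a' b' where A: "a' \<in> {1..M}" "b' \<in> {1..Suc M}" "a' \<noteq> b'" 
        and A': "(a' = a \<and> b' = b) \<or> (a' = b \<and> b' = a)" by blast
      from swap[OF Suc.prems(4,5) 3(2)] obtain d' e' where D: "d' \<in> {1..M}" "e' \<in> {1..Suc M}" "d' \<noteq> e'" 
        and D': "(d' = d \<and> e' = e) \<or> (d' = e \<and> e' = d)" by blast
      note T = same_trans[OF Suc.prems(1)]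
      have ab: "same (Suc M) x a' b'" "same (Suc M) x a a'" "a' \<in> {1..Suc M}"
        using A' Suc.prems(2,3,6) same_sym same_refl by metis+
      have de: "same (Suc M) x d' e'" "same (Suc M) x d' d" "d' \<in> {1..Suc M}"
        using D' Suc.prems(4,5,7) same_sym same_refl by metis+
      have "\<not> same (Suc M) x a' d'"
      proof
        assume "same (Suc M) x a' d'"
        from T[OF Suc.prems(2) ab(3) de(3) ab(2) this] have "same (Suc M) x a d'" .
        from T[OF Suc.prems(2) de(3) Suc.prems(4) this de(2)] show False using Suc.prems(8) by simp
      qed
      from main[OF A D ab(1) de(1) this] have *: "same (Suc M) (x \<circ> tr a' b') d' e'" .
      have "tr a' b' = tr a b" using A' transpose_commute by metis
      with * have "same (Suc M) (x \<circ> tr a b) d' e'" by (simp only:)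
      then show ?thesis using D' same_sym by metis
    qed
  qed
qed

section \<open>Standard Coxeter elements\<close>

text \<open>The sign \<open>\<epsilon> i\<close> tells whether \<open>s\<^sub>i\<close> comes before or after \<open>s\<^sub>i\<^sub>-\<^sub>1\<close>. It places the point \<open>i\<close> on
  one of the two sides of an ellipse, the points of which \<open>cox \<epsilon> n\<close> permutes cyclically.\<close>

fun cox :: "(nat \<Rightarrow> bool) \<Rightarrow> nat \<Rightarrow> nat \<Rightarrow> nat" where
  "cox \<epsilon> 0 = id"
| "cox \<epsilon> (Suc m) = (if \<epsilon> (Suc m) then tr (Suc m) (Suc (Suc m)) \<circ> cox \<epsilon> m
     else cox \<epsilon> m \<circ> tr (Suc m) (Suc (Suc m)))"

lemma cox_permutes: "cox \<epsilon> m permutes {1..Suc m}"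
proof (induction m)
  case 0
  show ?case by (simp only: cox.simps permutes_id)
next
  case (Suc m)
  have "tr (Suc m) (Suc (Suc m)) permutes {1..Suc (Suc m)}" by (rule tr_permutes) auto
  with permutes_mono[OF Suc, of "Suc (Suc m)"] show ?case
    unfolding cox.simps by (auto split: if_splits intro!: permutes_compose simp del: One_nat_def)
qed

lemma top_tr_permutes: "tr (Suc m) (Suc (Suc m)) permutes {1..Suc (Suc m)}"
  by (rule tr_permutes) auto

lemma abs_len_top: "y permutes {1..Suc m} \<Longrightarrow> 
  abs_len (Suc (Suc m)) (y \<circ> tr (Suc m) (Suc (Suc m))) = Suc (abs_len (Suc m) y)"
  by (rule abs_len_move) auto

text \<open>Cyclic rotation carries the new factor of the Coxeter element to the right end, where it
  adds one to the length. Questions about points up to \<open>Suc m\<close> are thereby reduced to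
  \<open>cox \<epsilon> m\<close>.\<close>

lemma abs_len_cox_Suc:
  assumes y: "y permutes {1..Suc m}"
  shows "abs_len (Suc (Suc m)) (y \<circ> cox \<epsilon> (Suc m)) = Suc (abs_len (Suc m) (y \<circ> cox \<epsilon> m))"
proof -
  let ?s = "tr (Suc m) (Suc (Suc m))"
  have y2: "y permutes {1..Suc (Suc m)}" and c2: "cox \<epsilon> m permutes {1..Suc (Suc m)}"
    using permutes_mono[OF y] permutes_mono[OF cox_permutes[of \<epsilon> m]] by simp_all
  show ?thesis
  proof (cases "\<epsilon> (Suc m)")
    case True
    have "abs_len (Suc (Suc m)) (y \<circ> cox \<epsilon> (Suc m)) = abs_len (Suc (Suc m)) ((y \<circ> ?s) \<circ> cox \<epsilon> m)"
      using True by (simp only: cox.simps if_True o_assoc)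
    also have "\<dots> = abs_len (Suc (Suc m)) ((cox \<epsilon> m \<circ> y) \<circ> ?s)"
      using abs_len_swap[OF permutes_compose[OF top_tr_permutes y2] c2] by (simp only: comp_assoc)
    also have "\<dots> = Suc (abs_len (Suc m) (cox \<epsilon> m \<circ> y))"
      by (intro abs_len_top permutes_compose y cox_permutes)
    finally show ?thesis by (simp only: abs_len_swap[OF cox_permutes y])
  next
    case False
    then have "y \<circ> cox \<epsilon> (Suc m) = (y \<circ> cox \<epsilon> m) \<circ> ?s"
      by (simp only: cox.simps if_False o_assoc)
    then show ?thesis using abs_len_top permutes_compose[OF cox_permutes y] by metis
  qed
qed

text \<open>The companion for permutations that fix \<open>Suc m\<close> instead of the top point:
  conjugation by \<open>s\<close> carries the points 1..Suc m to 1..m and Suc (Suc m).\<close>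

lemma abs_len_cox_conj:
  assumes y: "y permutes {1..Suc m}"
  defines "s \<equiv> tr (Suc m) (Suc (Suc m))"
  shows "abs_len (Suc (Suc m)) (s \<circ> y \<circ> s \<circ> cox \<epsilon> (Suc m)) = Suc (abs_len (Suc m) (y \<circ> cox \<epsilon> m))"
proof -
  have s: "s permutes {1..Suc (Suc m)}" and ss: "s \<circ> s = id"
    unfolding s_def by (rule top_tr_permutes) simp
  have y2: "y permutes {1..Suc (Suc m)}" and c2: "cox \<epsilon> m permutes {1..Suc (Suc m)}"
    using permutes_mono[OF y] permutes_mono[OF cox_permutes[of \<epsilon> m]] by simp_all
  have ss': "s \<circ> (s \<circ> f) = f" for f by (simp only: o_assoc ss id_comp)
  show ?thesis
  proof (cases "\<epsilon> (Suc m)")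
    case True
    have "s \<circ> y \<circ> s \<circ> cox \<epsilon> (Suc m) = s \<circ> (y \<circ> cox \<epsilon> m)"
      using True by (simp only: cox.simps if_True s_def[symmetric] comp_assoc ss')
    then show ?thesis
      using abs_len_swap[OF s permutes_compose[OF c2 y2]] abs_len_top[OF permutes_compose[OF cox_permutes y]]
      by (simp only: s_def)
  next
    case False
    have "s \<circ> y \<circ> s \<circ> cox \<epsilon> (Suc m) = s \<circ> (y \<circ> s \<circ> cox \<epsilon> m \<circ> s)"
      using False by (simp only: cox.simps if_False s_def[symmetric] comp_assoc)
    then have "abs_len (Suc (Suc m)) (s \<circ> y \<circ> s \<circ> cox \<epsilon> (Suc m)) = abs_len (Suc (Suc m)) ((y \<circ> s \<circ> cox \<epsilon> m \<circ> s) \<circ> s)"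
      by (simp only:) (intro abs_len_swap permutes_compose s y2 c2)
    also have "(y \<circ> s \<circ> cox \<epsilon> m \<circ> s) \<circ> s = y \<circ> s \<circ> cox \<epsilon> m"
      by (simp only: comp_assoc ss comp_id)
    also have "abs_len (Suc (Suc m)) (y \<circ> s \<circ> cox \<epsilon> m) = abs_len (Suc (Suc m)) ((cox \<epsilon> m \<circ> y) \<circ> s)"
      using abs_len_swap[OF permutes_compose[OF s y2] c2] by (simp only: comp_assoc)
    also have "\<dots> = Suc (abs_len (Suc m) (cox \<epsilon> m \<circ> y))"
      unfolding s_def by (intro abs_len_top permutes_compose y cox_permutes)
    finally show ?thesis by (simp only: abs_len_swap[OF cox_permutes y])
  qed
qed

lemma abs_len_cox: "abs_len (Suc m) (cox \<epsilon> m) = m"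
proof (induction m)
  case 0
  show ?case by (simp only: cox.simps abs_len_id)
next
  case (Suc m)
  then show ?case using abs_len_cox_Suc[OF permutes_id, of m \<epsilon>] by (simp only: id_comp)
qed

declare cox.simps(2) [simp del]

subsection \<open>Crossing transpositions\<close>

abbreviation pb :: "(nat \<Rightarrow> bool) \<Rightarrow> nat \<Rightarrow> nat \<Rightarrow> nat \<Rightarrow> nat \<Rightarrow> nat \<Rightarrow> bool"
  where "pb \<epsilon> m \<equiv> pair_below (Suc m) (cox \<epsilon> m)"

lemma pb_cong: "tr d e \<circ> tr a b = tr d' e' \<circ> tr a' b' \<Longrightarrow> pb \<epsilon> m a b d e = pb \<epsilon> m a' b' d' e'"
  by (simp only: pair_below_def)

lemma pb_commute:
  "pb \<epsilon> m b a d e = pb \<epsilon> m a b d e" "pb \<epsilon> m a b e d = pb \<epsilon> m a b d e"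
  by (simp_all only: pair_below_def transpose_commute)

lemma pb_Suc:
  assumes "a \<in> {1..Suc m}" "b \<in> {1..Suc m}" "d \<in> {1..Suc m}" "e \<in> {1..Suc m}"
  shows "pb \<epsilon> (Suc m) a b d e = pb \<epsilon> m a b d e"
  unfolding pair_below_def abs_len_cox
  using abs_len_cox_Suc[OF permutes_compose[OF tr_permutes[OF assms(1,2)] tr_permutes[OF assms(3,4)]], of \<epsilon>] by simp

text \<open>With \<open>pb_Suc\<close> this removes one of the two largest points. A configuration
  that misses the top point restricts as it is; one that misses \<open>Suc m\<close> restricts after
  the top point is renamed to \<open>Suc m\<close>.\<close>

lemma pb_conj:
  assumes "a \<in> {1..Suc m}" "b \<in> {1..Suc m}" "d \<in> {1..Suc m}" "e \<in> {1..Suc m}"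
  defines "s \<equiv> tr (Suc m) (Suc (Suc m))"
  shows "pb \<epsilon> (Suc m) (s a) (s b) (s d) (s e) = pb \<epsilon> m a b d e"
proof -
  have c: "tr (s a) (s b) = s \<circ> tr a b \<circ> s" for a b
    unfolding s_def by (subst tr_conj) (simp_all add: comp_assoc)
  have ss: "s \<circ> s = id" by (simp add: s_def)
  have "tr (s d) (s e) \<circ> tr (s a) (s b) = (s \<circ> tr d e) \<circ> (s \<circ> s) \<circ> (tr a b \<circ> s)"
    by (simp only: c comp_assoc)
  also have "\<dots> = s \<circ> (tr d e \<circ> tr a b) \<circ> s" by (simp only: ss comp_id comp_assoc)
  finally have eq: "tr (s d) (s e) \<circ> tr (s a) (s b) = s \<circ> (tr d e \<circ> tr a b) \<circ> s" .
  have "tr d e \<circ> tr a b permutes {1..Suc m}" using assms by (intro permutes_compose tr_permutes)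
  from abs_len_cox_conj[OF this, of \<epsilon>] show ?thesis
    unfolding pair_below_def abs_len_cox eq unfolding s_def by simp
qed

context
  fixes \<epsilon> :: "nat \<Rightarrow> bool" and m n N :: nat
  defines "n \<equiv> Suc m" and "N \<equiv> Suc (Suc m)"
begin

private lemma N: "n \<noteq> N" "n \<in> {1..N}" "N \<in> {1..N}" "k < n \<Longrightarrow> k \<noteq> n" "k < n \<Longrightarrow> k \<noteq> N"
  by (auto simp: n_def N_def)

private lemma top: "tr n N permutes {1..N}" "cox \<epsilon> m permutes {1..N}"
  by (intro tr_permutes N) (use permutes_mono[OF cox_permutes] in \<open>simp add: N_def\<close>)

private lemma abs_len_tr_cox: 
  assumes "k \<in> {1..m}" shows "abs_len N (tr k N \<circ> cox \<epsilon> m) = Suc m"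
proof -
  have "tr k N permutes {1..N}" using assms by (intro tr_permutes) (auto simp: N_def)
  from abs_len_swap[OF this top(2)] show ?thesis
    using abs_len_move[OF cox_permutes[of \<epsilon> m], of k] assms by (simp add: N_def abs_len_cox)
qed

text \<open>The reflections of three points k < n < N give a divisor in only one of the two cyclic
  orders, and the sign of n decides which. In the excluded order the last generator of the Coxeter
  element cancels, and the quotient is too long.\<close>

lemma not_pb_top:
  assumes "k \<in> {1..m}"
  shows "\<epsilon> n \<Longrightarrow> \<not> pb \<epsilon> n n N k N" "\<not> \<epsilon> n \<Longrightarrow> \<not> pb \<epsilon> n k N n N"
proof -
  have *: "tr n N \<circ> (tr n N \<circ> f) = f" for f by (simp add: o_assoc)
  assume e: "\<epsilon> n"
  have "tr k N \<circ> tr n N \<circ> cox \<epsilon> n = tr k N \<circ> cox \<epsilon> m"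
    using e by (simp only: n_def cox.simps if_True comp_assoc N_def[symmetric]) (simp only: * n_def[symmetric])
  then show "\<not> pb \<epsilon> n n N k N"
    using abs_len_tr_cox[OF assms] abs_len_cox[of n \<epsilon>] by (simp add: pair_below_def n_def N_def)
next
  assume e: "\<not> \<epsilon> n"
  have "abs_len N (tr n N \<circ> tr k N \<circ> cox \<epsilon> n) = abs_len N (tr n N \<circ> (tr k N \<circ> cox \<epsilon> m \<circ> tr n N))"
    using e by (simp only: n_def N_def cox.simps if_False comp_assoc)
  also have "\<dots> = abs_len N ((tr k N \<circ> cox \<epsilon> m \<circ> tr n N) \<circ> tr n N)"
    by (intro abs_len_swap top permutes_compose tr_permutes) (use assms in \<open>auto simp: N_def\<close>)
  also have "\<dots> = Suc m" by (simp only: tr_cancel abs_len_tr_cox[OF assms])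
  finally show "\<not> pb \<epsilon> n k N n N"
    using abs_len_cox[of n \<epsilon>] by (simp add: pair_below_def n_def N_def)
qed

text \<open>Two disjoint chords that end at the two largest points. Moving the last generator of the
  Coxeter element past \<open>tr k N\<close> turns \<open>N\<close> into \<open>n\<close>, and the
  question becomes one about two chords that meet in \<open>n\<close>.\<close>

lemma pb_top:
  assumes i: "i \<in> {1..m}" and k: "k \<in> {1..m}" and ik: "i \<noteq> k" and pb: "pb \<epsilon> n i n k N \<or> pb \<epsilon> n k N i n"
  shows "\<epsilon> n \<Longrightarrow> pb \<epsilon> m k n i n" "\<not> \<epsilon> n \<Longrightarrow> pb \<epsilon> m i n k n"
proof -
  have comm: "tr k N \<circ> tr i n = tr i n \<circ> tr k N"
    using i k ik by (subst tr_tr) (auto simp: n_def N_def)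
  have pbk: "pb \<epsilon> n i n k N" using pb by (simp add: pair_below_def comm)
  have p: "tr k N permutes {1..N}" "tr i n permutes {1..N}" "tr k n permutes {1..n}" "tr i n permutes {1..n}"
    using i k by (auto intro!: tr_permutes simp: n_def N_def simp del: One_nat_def)
  have p2: "tr k n permutes {1..N}" using permutes_mono[OF p(3)] by (simp add: n_def N_def)
  have c: "cox \<epsilon> m permutes {1..n}" using cox_permutes by (simp add: n_def)
  {
    assume e: "\<epsilon> n"
    have "tr k N \<circ> tr i n \<circ> cox \<epsilon> n = tr i n \<circ> (tr k N \<circ> tr n N) \<circ> cox \<epsilon> m"
    proof -
      have "cox \<epsilon> n = tr n N \<circ> cox \<epsilon> m" using e by (simp only: n_def N_def cox.simps if_True)
      then show ?thesis by (simp only: comm) (simp only: comp_assoc)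
    qed
    also have "tr k N \<circ> tr n N = tr n N \<circ> tr k n"
      using k by (subst tr_tr') (auto simp: n_def N_def)
    finally have "abs_len N (tr k N \<circ> tr i n \<circ> cox \<epsilon> n) = abs_len N ((tr i n \<circ> tr n N) \<circ> (tr k n \<circ> cox \<epsilon> m))"
      by (simp only: comp_assoc)
    also have "\<dots> = abs_len N ((tr k n \<circ> cox \<epsilon> m) \<circ> (tr i n \<circ> tr n N))"
      by (intro abs_len_swap permutes_compose top p p2)
    also have "\<dots> = abs_len N ((tr k n \<circ> cox \<epsilon> m \<circ> tr i n) \<circ> tr n N)" by (simp only: comp_assoc)
    also have "\<dots> = Suc (abs_len n (tr k n \<circ> cox \<epsilon> m \<circ> tr i n))"
      unfolding n_def N_def by (intro abs_len_top) (use c p in \<open>auto intro!: permutes_compose simp: n_def simp del: One_nat_def\<close>)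
    also have "abs_len n (tr k n \<circ> cox \<epsilon> m \<circ> tr i n) = abs_len n (tr i n \<circ> (tr k n \<circ> cox \<epsilon> m))"
      by (intro abs_len_swap permutes_compose c p)
    finally show "pb \<epsilon> m k n i n" using pbk abs_len_cox[of n \<epsilon>] abs_len_cox[of m \<epsilon>]
      by (simp add: pair_below_def n_def N_def comp_assoc del: comp_apply)
  next
    assume e: "\<not> \<epsilon> n"
    have "abs_len N (tr k N \<circ> tr i n \<circ> cox \<epsilon> n) = abs_len N (tr k N \<circ> (tr i n \<circ> cox \<epsilon> m \<circ> tr n N))"
      using e by (simp only: n_def N_def cox.simps if_False comp_assoc)
    also have "\<dots> = abs_len N ((tr i n \<circ> cox \<epsilon> m \<circ> tr n N) \<circ> tr k N)"
      by (intro abs_len_swap permutes_compose top p)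
    also have "(tr i n \<circ> cox \<epsilon> m \<circ> tr n N) \<circ> tr k N = tr i n \<circ> cox \<epsilon> m \<circ> (tr n N \<circ> tr k N)"
      by (simp only: comp_assoc)
    also have "tr n N \<circ> tr k N = tr k n \<circ> tr n N"
      using k by (subst tr_tr) (auto simp: n_def N_def)
    also have "abs_len N (tr i n \<circ> cox \<epsilon> m \<circ> (tr k n \<circ> tr n N)) = abs_len N ((tr i n \<circ> cox \<epsilon> m \<circ> tr k n) \<circ> tr n N)"
      by (simp only: comp_assoc)
    also have "\<dots> = Suc (abs_len n (tr i n \<circ> cox \<epsilon> m \<circ> tr k n))"
      unfolding n_def N_def by (intro abs_len_top) (use c p in \<open>auto intro!: permutes_compose simp: n_def simp del: One_nat_def\<close>)
    also have "abs_len n (tr i n \<circ> cox \<epsilon> m \<circ> tr k n) = abs_len n (tr k n \<circ> (tr i n \<circ> cox \<epsilon> m))"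
      by (intro abs_len_swap permutes_compose c p)
    finally show "pb \<epsilon> m i n k n" using pbk abs_len_cox[of n \<epsilon>] abs_len_cox[of m \<epsilon>]
      by (simp add: pair_below_def n_def N_def comp_assoc del: comp_apply)
  }
qed

end

text \<open>The orientation of a triangle inscribed in the ellipse depends on the side of its middle
  vertex. \<open>pb_conj\<close> lowers the rightmost vertex until it is the successor of
  \<open>b\<close>, the case settled by \<open>not_pb_top\<close>.\<close>

lemma pb_triangle:
  assumes "a \<in> {1..<b}" "b < Suc m"
  shows "pb \<epsilon> m a (Suc m) b (Suc m) \<Longrightarrow> \<epsilon> b" "pb \<epsilon> m b (Suc m) a (Suc m) \<Longrightarrow> \<not> \<epsilon> b"
  using assms
proof (induction m)
  case (Suc m)
  let ?s = "tr (Suc m) (Suc (Suc m))"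
  {
    case 1
    show ?case
    proof (cases "b = Suc m")
      case True
      then show ?thesis using not_pb_top[of a m \<epsilon>] 1 by auto
    next
      case False
      then have "?s a = a" "?s b = b" "?s (Suc m) = Suc (Suc m)" using 1 by auto
      then show ?thesis using pb_conj[of a m "Suc m" b "Suc m" \<epsilon>] 1 Suc.IH(1) False by simp
    qed
  next
    case 2
    show ?case
    proof (cases "b = Suc m")
      case True
      then show ?thesis using not_pb_top[of a m \<epsilon>] 2 by auto
    next
      case False
      then have "?s a = a" "?s b = b" "?s (Suc m) = Suc (Suc m)" using 2 by auto
      then show ?thesis using pb_conj[of b m "Suc m" a "Suc m" \<epsilon>] 2 Suc.IH(2) False by simp
    qed
  }
qed simp_all

text \<open>Four points of the ellipse from left to right: the chords a d and b e avoid each other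
  only if b and d are on different sides, a e and b d only if they are on the same side. Lowering e
  to the successor of d and applying \<open>pb_top\<close> leaves two chords that meet in d, that
  is, \<open>pb_triangle\<close>.\<close>

lemma pb_crossing:
  assumes "a \<in> {1..<b}" "b < d" "d < e" "e \<le> Suc m"
  shows "pb \<epsilon> m a d b e \<Longrightarrow> \<epsilon> b \<noteq> \<epsilon> d" "pb \<epsilon> m a e b d \<Longrightarrow> \<epsilon> b = \<epsilon> d"
  using assms
proof (induction m arbitrary: e)
  case 0 {
    case 1
    then show ?case by simp
  next
    case 2
    then show ?case by simp
  }
next
  case (Suc m)
  let ?s = "tr (Suc m) (Suc (Suc m))"
  {
    case 1
    consider "e \<le> Suc m" | "e = Suc (Suc m)" "d < Suc m" | "e = Suc (Suc m)" "d = Suc m"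
      using 1 by linarith
    then show ?case
    proof cases
      case a: 1
      then show ?thesis using 1 Suc.IH(1)[of e] pb_Suc[of a m d b e \<epsilon>] by simp
    next
      case 2
      then have "?s a = a" "?s b = b" "?s d = d" "?s (Suc m) = Suc (Suc m)" using 1 by auto
      then show ?thesis using pb_conj[of a m d b "Suc m" \<epsilon>] 1 2 Suc.IH(1)[of "Suc m"] by simp
    next
      case 3
      then have e: "e = Suc (Suc m)" "d = Suc m" using 1 by linarith+
      have "pb \<epsilon> (Suc m) a (Suc m) b (Suc (Suc m))" "a \<in> {1..m}" "b \<in> {1..m}" "a \<noteq> b"
        using 1 unfolding e by simp_all
      from pb_top[OF this(2-4), of \<epsilon>] this(1) show ?thesis
        using pb_triangle[of a b m \<epsilon>] 1 e by (cases "\<epsilon> (Suc m)") simp_all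
    qed
  next
    case 2
    consider "e \<le> Suc m" | "e = Suc (Suc m)" "d < Suc m" | "e = Suc (Suc m)" "d = Suc m"
      using 2 by linarith
    then show ?case
    proof cases
      case a: 1
      then show ?thesis using 2 Suc.IH(2)[of e] pb_Suc[of a m e b d \<epsilon>] by simp
    next
      case b: 2
      then have "?s a = a" "?s b = b" "?s d = d" "?s (Suc m) = Suc (Suc m)" using 2 by auto
      then show ?thesis using pb_conj[of a m "Suc m" b d \<epsilon>] 2 b Suc.IH(2)[of "Suc m"] by simp
    next
      case 3
      then have e: "e = Suc (Suc m)" "d = Suc m" using 2 by linarith+
      have "pb \<epsilon> (Suc m) a (Suc (Suc m)) b (Suc m)" "a \<in> {1..m}" "b \<in> {1..m}" "b \<noteq> a"
        using 2 unfolding e by simp_all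
      from pb_top[OF this(3,2,4), of \<epsilon>] this(1) show ?thesis
        using pb_triangle[of a b m \<epsilon>] 2 e by (cases "\<epsilon> (Suc m)") simp_all
    qed
  }
qed

subsection \<open>Comparison with the definitions\<close>

lemma inv_Sym: "w permutes {1..n+1} \<Longrightarrow> inv\<^bsub>Sym n\<^esub> w = inv' w"
  by (intro group.inv_equality[OF sym_group_is_group])
    (auto simp: sym_group_def permutes_inv permutes_inv_o simp del: One_nat_def)

lemma refls_eq: "refls n = {tr a b |a b. (a, b) \<in> tpairs (n + 1)}"
proof (intro equalityI subsetI)
  fix t assume "t \<in> refls n"
  then obtain w i where w: "w permutes {1..n+1}" and i: "i \<in> {1..n}" and 
    t: "t = w \<circ> tr i (i + 1) \<circ> inv\<^bsub>Sym n\<^esub> w"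
    by (auto simp: refls_def simple_refls_def s_perm_def sym_group_carrier sym_group_mult)
  have "inv\<^bsub>Sym n\<^esub> w = inv' w" by (rule inv_Sym[OF w])
  then have "t = tr (w i) (w (i+1)) \<circ> (w \<circ> inv' w)"
    unfolding t by (simp only: tr_conj[OF permutes_bij[OF w]] comp_assoc)
  then have "t = tr (w i) (w (i+1))" by (simp add: permutes_inv_o[OF w])
  moreover have "(w i, w (i + 1)) \<in> tpairs (n + 1)"
    using i permutes_in_image[OF w] inj_eq[OF permutes_inj[OF w]] by (auto simp: tpairs_def)
  ultimately show "t \<in> {tr a b |a b. (a, b) \<in> tpairs (n + 1)}" by blast
next
  fix t assume "t \<in> {tr a b |a b. (a, b) \<in> tpairs (n + 1)}"
  then obtain a b where ab: "a \<in> {1..n+1}" "b \<in> {1..n+1}" "a \<noteq> b" and t: "t = tr a b"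
    by (auto simp: tpairs_def)
  then have n: "1 \<le> n" by (cases "n = 0") auto
  \<comment> \<open>Chosen so that \<open>w\<close> sends 1 to \<open>a\<close> and 2 to
    \<open>b\<close>, hence conjugates the first simple transposition to
    \<open>tr a b\<close>.\<close>
  define b' where "b' = tr 1 a b"
  define w where "w = tr 1 a \<circ> tr (1 + 1) b'"
  have b': "b' \<in> {1..n+1}" unfolding b'_def using ab by (intro tr_in) auto
  have w: "w permutes {1..n+1}" unfolding w_def
    using ab b' n by (intro permutes_compose tr_permutes) auto
  have "b' \<noteq> 1" using ab by (auto simp: b'_def Transposition.transpose_def split: if_splits)
  then have "w 1 = a" "w (1 + 1) = b" by (simp_all add: w_def b'_def)
  then have "t = w \<circ> tr 1 (1 + 1) \<circ> inv' w"
    using tr_conj[OF permutes_bij[OF w], of 1 "1 + 1"] by (simp add: t comp_assoc permutes_inv_o[OF w])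
  moreover have "inv\<^bsub>Sym n\<^esub> w = inv' w" by (rule inv_Sym[OF w])
  moreover have "tr 1 (1 + 1) \<in> simple_refls n"
    unfolding simple_refls_def s_perm_def using n by (intro image_eqI[of _ _ 1]) simp_all
  ultimately have "t = w \<otimes>\<^bsub>Sym n\<^esub> tr 1 (1 + 1) \<otimes>\<^bsub>Sym n\<^esub> inv\<^bsub>Sym n\<^esub> w" "tr 1 (1 + 1) \<in> simple_refls n"
    by (simp_all only: sym_group_mult)
  with w show "t \<in> refls n" unfolding refls_def sym_group_carrier by blast
qed

lemma word_prod_Sym: "word_prod (Sym n) f u = foldr (\<lambda>x y. f x \<circ> y) u id"
  by (simp add: word_prod_def sym_group_mult sym_group_one)

lemma foldr_Cons: "foldr (\<lambda>x y. f x \<circ> y) (i # u) id = f i \<circ> foldr (\<lambda>x y. f x \<circ> y) u id"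
  by simp

lemma length_T_eq:
  assumes "w permutes {1..n+1}" shows "length_T n w = abs_len (n + 1) w"
proof -
  have "(\<exists>u. set u \<subseteq> refls n \<and> length u = k \<and> word_prod (Sym n) (\<lambda>x. x) u = w) \<longleftrightarrow>
    (\<exists>ws. set ws \<subseteq> tpairs (n + 1) \<and> length ws = k \<and> tprod ws = w)" for k w
  proof
    assume "\<exists>u. set u \<subseteq> refls n \<and> length u = k \<and> word_prod (Sym n) (\<lambda>x. x) u = w"
    then obtain u where u: "set u \<subseteq> refls n" "length u = k" "word_prod (Sym n) (\<lambda>x. x) u = w" by blast
    have "\<exists>ws. set ws \<subseteq> tpairs (n + 1) \<and> length ws = length u \<and> tprod ws = word_prod (Sym n) (\<lambda>x. x) u"
      using u(1)
    proof (induction u)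
      case Nil
      show ?case by (intro exI[of _ "[]"]) (simp only: word_prod_Sym foldr.simps tprod_simps id_apply list.set list.size, simp)
    next
      case (Cons t u)
      then obtain ws where ws: "set ws \<subseteq> tpairs (n + 1)" "length ws = length u" 
        "tprod ws = word_prod (Sym n) (\<lambda>x. x) u" by auto
      from Cons.prems obtain a b where "t = tr a b" "(a, b) \<in> tpairs (n + 1)" by (auto simp: refls_eq)
      moreover have "word_prod (Sym n) (\<lambda>x. x) (t # u) = t \<circ> word_prod (Sym n) (\<lambda>x. x) u"
        by (simp only: word_prod_Sym foldr_Cons)
      ultimately show ?case using ws by (intro exI[of _ "(a, b) # ws"]) (simp del: comp_apply)
    qed
    then show "\<exists>ws. set ws \<subseteq> tpairs (n + 1) \<and> length ws = k \<and> tprod ws = w" using u by auto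
  next
    assume "\<exists>ws. set ws \<subseteq> tpairs (n + 1) \<and> length ws = k \<and> tprod ws = w"
    then obtain ws where ws: "set ws \<subseteq> tpairs (n + 1)" "length ws = k" "tprod ws = w" by blast
    have "word_prod (Sym n) (\<lambda>x. x) (map (\<lambda>(a, b). tr a b) ws) = tprod ws"
    proof (induction ws)
      case Nil
      show ?case by (simp only: word_prod_Sym list.map foldr.simps id_apply tprod_simps)
    next
      case (Cons p ws)
      have "word_prod (Sym n) (\<lambda>x. x) (t # u) = t \<circ> word_prod (Sym n) (\<lambda>x. x) u" for t u
        by (simp only: word_prod_Sym foldr_Cons)
      with Cons show ?case by (cases p) (simp only: list.map prod.case tprod_simps)
    qed
    then show "\<exists>u. set u \<subseteq> refls n \<and> length u = k \<and> word_prod (Sym n) (\<lambda>x. x) u = w"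
      using ws by (intro exI[of _ "map (\<lambda>(a, b). tr a b) ws"]) (auto simp: refls_eq)
  qed
  then show ?thesis using abs_len_Min[OF assms] by (simp only: length_T_def word_length_def)
qed

lemma Div_eq:
  assumes c: "c permutes {1..n+1}" shows "Div n c = {x. below (n + 1) x c}"
proof -
  have "abs_le n x c \<longleftrightarrow> below (n + 1) x c" if x: "x permutes {1..n+1}" for x
  proof -
    have v: "inv' x \<circ> c permutes {1..n+1}" using c x by (intro permutes_compose permutes_inv)
    have "abs_le n x c \<longleftrightarrow> abs_len (n+1) x + abs_len (n+1) (inv' x \<circ> c) = abs_len (n+1) c"
      by (simp only: abs_le_def sym_group_mult inv_Sym[OF x] length_T_eq[OF x] length_T_eq[OF c] length_T_eq[OF v])
    also have "\<dots> \<longleftrightarrow> below (n + 1) x c"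
    proof
      assume "abs_len (n+1) x + abs_len (n+1) (inv' x \<circ> c) = abs_len (n+1) c"
      then show "below (n + 1) x c" unfolding below_def using x v
        by (intro conjI exI[of _ "inv' x \<circ> c"]) (simp_all add: o_assoc permutes_inv_o[OF x])
    next
      assume "below (n + 1) x c"
      then obtain v where v: "v permutes {1..n+1}" "c = x \<circ> v" 
        "abs_len (n+1) c = abs_len (n+1) x + abs_len (n+1) v" by (auto simp: below_def)
      then have "inv' x \<circ> c = v" by (simp add: o_assoc permutes_inv_o[OF x])
      then show "abs_len (n+1) x + abs_len (n+1) (inv' x \<circ> c) = abs_len (n+1) c" using v(3) by simp
    qed
    finally show ?thesis .
  qed
  then show ?thesis by (auto simp: Div_def sym_group_carrier below_permutes simp del: One_nat_def dest: below_permutes)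
qed

lemma s_perm_eq: "s_perm i = tr i (Suc i)"
  by (simp add: s_perm_def)

lemma prod_commute_far:
  assumes "set u \<subseteq> {1..<m}"
  shows "foldr (\<lambda>x y. s_perm x \<circ> y) u id \<circ> s_perm (Suc m) = s_perm (Suc m) \<circ> foldr (\<lambda>x y. s_perm x \<circ> y) u id"
  using assms
proof (induction u)
  case (Cons i u)
  have "s_perm i \<circ> s_perm (Suc m) = s_perm (Suc m) \<circ> s_perm i"
    unfolding s_perm_eq using Cons.prems by (subst tr_tr) auto
  moreover have "foldr (\<lambda>x y. s_perm x \<circ> y) u id \<circ> s_perm (Suc m) = s_perm (Suc m) \<circ> foldr (\<lambda>x y. s_perm x \<circ> y) u id"
    by (rule Cons.IH) (use Cons.prems in simp)
  ultimately show ?case by (simp only: foldr_Cons comp_assoc) (simp only: o_assoc)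
qed simp

lemma foldr_comp_append: "foldr (\<lambda>x y. f x \<circ> y) (u @ v) id = foldr (\<lambda>x y. f x \<circ> y) u id \<circ> foldr (\<lambda>x y. f x \<circ> y) v id"
  by (induction u) (auto simp: comp_assoc)

text \<open>The largest letter commutes with all others except \<open>n\<close>, so it can be moved
  to the end of the word from which \<open>n\<close> does not separate it. Its sign records which
  end this is.\<close>

lemma coxeter_signs:
  assumes "distinct u" "set u = {1..n}"
  shows "\<exists>\<epsilon>. foldr (\<lambda>x y. s_perm x \<circ> y) u id = cox \<epsilon> n"
  using assms
proof (induction n arbitrary: u)
  case 0
  then show ?case by simp
next
  case (Suc n)
  have "Suc n \<in> set u" using Suc.prems by simp
  then obtain u1 u2 where u: "u = u1 @ Suc n # u2" by (meson split_list)
  define P where "P = (\<lambda>u. foldr (\<lambda>x y. s_perm x \<circ> y) u id)"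
  have app: "P (u @ v) = P u \<circ> P v" for u v unfolding P_def by (rule foldr_comp_append)
  have dist: "distinct (u1 @ u2)" and "set (u1 @ u2) = set u - {Suc n}" using Suc.prems u by auto
  then have set: "set (u1 @ u2) = {1..n}" using Suc.prems by auto
  from Suc.IH[OF dist set] obtain \<epsilon> where \<epsilon>: "P (u1 @ u2) = cox \<epsilon> n" unfolding P_def by blast
  have cong: "cox (\<epsilon>(Suc n := b)) m = cox \<epsilon> m" if "m \<le> n" for b m
    using that by (induction m) (auto simp: cox.simps(2))
  have Pu: "P u = P u1 \<circ> s_perm (Suc n) \<circ> P u2" unfolding u app by (simp add: P_def o_assoc)
  show ?case
  proof (cases "n \<in> set u1")
    case True
    then have "set u2 \<subseteq> {1..<n}" using dist set by fastforce
    then have "P u = cox \<epsilon> n \<circ> s_perm (Suc n)"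
      unfolding Pu \<epsilon>[symmetric] app using prod_commute_far by (simp only: P_def comp_assoc)
    also have "\<dots> = cox (\<epsilon>(Suc n := False)) (Suc n)"
      by (simp only: cox.simps fun_upd_same if_False cong[OF order.refl] s_perm_eq)
    finally show ?thesis unfolding P_def by blast
  next
    case False
    then have "set u1 \<subseteq> {1..<n}" using set by (fastforce simp: order.order_iff_strict)
    then have "P u = s_perm (Suc n) \<circ> cox \<epsilon> n"
      unfolding Pu \<epsilon>[symmetric] app using prod_commute_far by (simp only: P_def o_assoc)
    also have "\<dots> = cox (\<epsilon>(Suc n := True)) (Suc n)"
      by (simp only: cox.simps fun_upd_same if_True cong[OF order.refl] s_perm_eq)
    finally show ?thesis unfolding P_def by blast
  qed
qed

section \<open>Atoms of the dual braid monoid in a group with braid relations\<close>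

text \<open>Braids are written additively, since \<^class>\<open>group_add\<close> is the type class of
  not necessarily commutative groups.\<close>

lemma conj_eq_iff: "g + x = y + g \<longleftrightarrow> g + x - g = (y::'g::group_add)"
  by (metis add_diff_cancel diff_add_cancel)

lemma commute_minus: "(x::'g::group_add) + y = y + x \<Longrightarrow> - x + y = y + - x"
  by (metis add.assoc add_minus_cancel minus_add_cancel add.right_inverse add_0_right)

text \<open>Formulated for any group with elements that satisfy the braid relations. It is read in
  the units of the Temperley-Lieb algebras for the braids themselves, and in the integers for the
  Coxeter length and for purely combinatorial facts.\<close>

locale braid_rep =
  fixes n :: nat and s :: "nat \<Rightarrow> 'g::group_add"
  assumes braid: "\<lbrakk>1 \<le> i; Suc i \<le> n\<rbrakk> \<Longrightarrow> s i + s (Suc i) + s i = s (Suc i) + s i + s (Suc i)"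
    and far_comm: "\<lbrakk>1 \<le> i; Suc i < j; j \<le> n\<rbrakk> \<Longrightarrow> s i + s j = s j + s i"
begin

text \<open>The atom of the dual braid monoid attached to the transposition of \<open>k < l\<close> is \<open>A \<epsilon> k l\<close>: a half
  twist along the chord of the ellipse.\<close>

primrec A :: "(nat \<Rightarrow> bool) \<Rightarrow> nat \<Rightarrow> nat \<Rightarrow> 'g" where
  "A \<epsilon> k 0 = 0"
| "A \<epsilon> k (Suc l) = (if l \<le> k then s k else if \<epsilon> l then s l + A \<epsilon> k l - s l else - s l + A \<epsilon> k l + s l)"

lemma A_base [simp]: "A \<epsilon> k (Suc k) = s k"
  by simp

lemma A_step: "k < l \<Longrightarrow> A \<epsilon> k (Suc l) = (if \<epsilon> l then s l + A \<epsilon> k l - s l else - s l + A \<epsilon> k l + s l)"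
  by simp

declare A.simps [simp del]

lemma A_comm:
  assumes "1 \<le> k" "k < l" "l < i" "i \<le> n"
  shows "A \<epsilon> k l + s i = s i + A \<epsilon> k l"
  using assms(2,3)
proof (induction l)
  case (Suc l)
  show ?case
  proof (cases "l = k")
    case True
    then show ?thesis using far_comm[of k i] Suc.prems assms by simp
  next
    case False
    then have l: "k < l" "l < i" using Suc.prems by auto
    have IH: "A \<epsilon> k l + s i = s i + A \<epsilon> k l" using Suc.IH l by simp
    have c: "s l + s i = s i + s l" using far_comm[of l i] Suc.prems assms l by simp
    have c': "- s l + s i = s i + - s l" by (rule commute_minus[OF c])
    show ?thesis unfolding A_step[OF l(1)]
      by (simp add: diff_conv_add_uminus add.assoc del: add_uminus_conv_diff)
        (metis c c' IH add.assoc)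
  qed
qed simp

text \<open>If \<open>B\<close> and \<open>x\<close> satisfy the braid relation, conjugating
  \<open>B\<close> by \<open>x\<close> is the same as conjugating \<open>x\<close> by the inverse of
  \<open>B\<close>. This lets the roles of the conjugating and the conjugated element be
  exchanged.\<close>

lemma braid_step:
  fixes B x y :: 'g
  assumes "B + x + B = x + B + x"
  shows "x + B - x = - B + x + B" "- x + B + x = B + x - B" "B + (x + B - x) = x + B"
proof -
  have "B + (x + B - x) = B + x + B - x" by (simp only: diff_conv_add_uminus add.assoc)
  also have "\<dots> = x + B" unfolding assms by simp
  finally show "B + (x + B - x) = x + B" .
  then show "x + B - x = - B + x + B" by (metis add.assoc minus_add_cancel)
  have "x + (B + x - B) = x + B + x - B" by (simp only: diff_conv_add_uminus add.assoc)
  also have "\<dots> = B + x" unfolding assms[symmetric] by simp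
  finally have "x + (B + x - B) = B + x" .
  then show "- x + B + x = B + x - B" by (metis add.assoc minus_add_cancel)
qed

text \<open>By \<open>braid_step\<close> the longer atom is a conjugate of \<open>s l\<close> by the
  shorter atom \<open>B\<close> or its inverse. Since \<open>B\<close> commutes with the next
  generator, the braid relation of the two generators is carried along.\<close>

lemma A_braid:
  assumes "1 \<le> k" "k < l" "l \<le> n"
  shows "A \<epsilon> k l + s l + A \<epsilon> k l = s l + A \<epsilon> k l + s l"
  using assms(2,3)
proof (induction l)
  case (Suc l)
  show ?case
  proof (cases "l = k")
    case True
    then show ?thesis using braid[of k] Suc.prems assms by simp
  next
    case False
    then have l: "k < l" using Suc.prems by auto
    define B where "B = A \<epsilon> k l"
    define x where "x = s l"
    define y where "y = s (Suc l)"
    have IH: "B + x + B = x + B + x" using Suc l by (simp add: B_def x_def)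
    have By: "B + y = y + B" unfolding B_def y_def by (rule A_comm) (use assms l Suc in auto)
    have By': "y + - B = - B + y" using commute_minus[OF By] by simp
    have xy: "x + y + x = y + x + y" unfolding x_def y_def by (rule braid) (use l Suc assms in auto)
    have *: "(- B + x + B) + y + (- B + x + B) = y + (- B + x + B) + y"
    proof -
      have "(- B + x + B) + y + (- B + x + B) = - B + x + (B + y) + - B + x + B" by (simp only: add.assoc)
      also have "\<dots> = - B + (x + y + x) + B"
        unfolding By by (simp add: add.assoc diff_conv_add_uminus del: add_uminus_conv_diff)
      also have "\<dots> = (- B + y) + x + (y + B)" unfolding xy by (simp only: add.assoc)
      also have "\<dots> = y + (- B + x + B) + y" unfolding By'[symmetric] By[symmetric] by (simp only: add.assoc)
      finally show ?thesis .
    qed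
    have **: "(B + x - B) + y + (B + x - B) = y + (B + x - B) + y"
    proof -
      have "(B + x - B) + y + (B + x - B) = B + x + (- B + y) + B + x - B" by (simp add: add.assoc diff_conv_add_uminus del: add_uminus_conv_diff)
      also have "\<dots> = B + (x + y + x) - B" unfolding By'[symmetric] by (simp add: add.assoc)
      also have "\<dots> = (B + y) + x + (y + - B)" unfolding xy by (simp add: add.assoc diff_conv_add_uminus del: add_uminus_conv_diff)
      also have "\<dots> = y + (B + x - B) + y"
        unfolding By' By by (simp add: add.assoc diff_conv_add_uminus del: add_uminus_conv_diff)
      finally show ?thesis .
    qed
    show ?thesis unfolding A_step[OF l] B_def[symmetric] x_def[symmetric] y_def[symmetric]
      using * ** braid_step[OF IH] by simp
  qed
qed simp

definition A2 :: "(nat \<Rightarrow> bool) \<Rightarrow> nat \<Rightarrow> nat \<Rightarrow> 'g"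
  where "A2 \<epsilon> a b = A \<epsilon> (min a b) (max a b)"

lemma A2_sym: "A2 \<epsilon> a b = A2 \<epsilon> b a"
  by (simp add: A2_def min.commute max.commute)

lemma A2_less: "a < b \<Longrightarrow> A2 \<epsilon> a b = A \<epsilon> a b"
  by (simp add: A2_def)

lemma A2_top: "A2 \<epsilon> m (Suc m) = s m"
  by (simp add: A2_less)

lemma A2_comm:
  assumes "a \<in> {1..<i}" "b \<in> {1..<i}" "a \<noteq> b" "i \<le> n"
  shows "A2 \<epsilon> a b + s i = s i + A2 \<epsilon> a b"
  unfolding A2_def by (rule A_comm) (use assms in \<open>auto simp: min_def max_def\<close>)

text \<open>The braid version of renaming \<open>Suc m\<close> to the top point: conjugation by the
  generator or by its inverse, according to the sign.\<close>

lemma A2_conj: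
  assumes m: "Suc m \<le> n" and ab: "a \<in> {1..Suc m}" "b \<in> {1..Suc m}" "a \<noteq> b"
    and S: "S = tr (Suc m) (Suc (Suc m))" and g: "g = (if \<epsilon> (Suc m) then s (Suc m) else - s (Suc m))"
  shows "A2 \<epsilon> (S a) (S b) = g + A2 \<epsilon> a b - g"
proof -
  have top: "A2 \<epsilon> (S a) (S b) = g + A2 \<epsilon> a b - g" if "b = Suc m" "a \<in> {1..m}" for a b
  proof -
    have "S a = a" "S b = Suc (Suc m)" using that by (auto simp: S)
    then show ?thesis using that by (simp add: A2_less A_step g)
  qed
  consider "b = Suc m" "a \<in> {1..m}" | "a = Suc m" "b \<in> {1..m}" | "a \<in> {1..m}" "b \<in> {1..m}"
    using ab by (cases "a = Suc m"; cases "b = Suc m") auto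
  then show ?thesis
  proof cases
    case 1
    then show ?thesis by (rule top)
  next
    case 2
    then show ?thesis using top[of a b] A2_sym by metis
  next
    case 3
    then have "S a = a" "S b = b" by (auto simp: S)
    moreover have "A2 \<epsilon> a b + s (Suc m) = s (Suc m) + A2 \<epsilon> a b"
      by (rule A2_comm) (use 3 ab m in auto)
    then have "g + A2 \<epsilon> a b = A2 \<epsilon> a b + g"
      using commute_minus[of "s (Suc m)" "A2 \<epsilon> a b"] by (auto simp: g)
    ultimately show ?thesis by (simp add: conj_eq_iff)
  qed
qed

text \<open>The Hurwitz relation between atoms, for reflections whose product divides the Coxeter
  element. Pairs that miss one of the two largest points come from the induction hypothesis
  (\<open>low\<close>, \<open>conj\<close>). Those that involve both are computed from braid
  relations, and there the divisibility fixes the sign or supplies a divisor on fewer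
  points.\<close>

theorem dual_relation:
  assumes "m \<le> n" "(a, b) \<in> tpairs (Suc m)" "(d, e) \<in> tpairs (Suc m)" "{a, b} \<noteq> {d, e}" "pb \<epsilon> m a b d e"
  shows "A2 \<epsilon> a b + A2 \<epsilon> d e = A2 \<epsilon> (tr a b d) (tr a b e) + A2 \<epsilon> a b"
  using assms
proof (induction m arbitrary: a b d e)
  case 0
  then show ?case by (auto simp: tpairs_def)
next
  case (Suc m)
  define P where "P a b d e \<longleftrightarrow> A2 \<epsilon> a b + A2 \<epsilon> d e = A2 \<epsilon> (tr a b d) (tr a b e) + A2 \<epsilon> a b" for a b d e
  have P_swap1: "P b a d e = P a b d e" and P_swap2: "P a b e d = P a b d e" for a b d e
    by (simp_all add: P_def A2_sym[of \<epsilon> b a] A2_sym[of \<epsilon> e d] A2_sym[of \<epsilon> "tr a b e"] transpose_commute[of b a])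
  let ?n = "Suc m" and ?N = "Suc (Suc m)"
  define x where "x = s ?n"
  define g where "g = (if \<epsilon> ?n then x else - x)"
  have mn: "?n \<le> n" using Suc.prems by simp
  have IH: "A2 \<epsilon> a b + A2 \<epsilon> d e = A2 \<epsilon> (tr a b d) (tr a b e) + A2 \<epsilon> a b"
    if "(a, b) \<in> tpairs (Suc m)" "(d, e) \<in> tpairs (Suc m)" "{a, b} \<noteq> {d, e}" "pb \<epsilon> m a b d e" for a b d e
    using Suc.IH that mn by simp
  have top: "A2 \<epsilon> ?n ?N = x" by (simp add: A2_top x_def)
  have X: "A2 \<epsilon> k ?N = g + A2 \<epsilon> k ?n - g" if "k \<in> {1..m}" for k
  proof -
    have "tr ?n ?N k = k" "tr ?n ?N ?n = ?N" using that by auto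
    then show ?thesis using A2_conj[OF mn, of k ?n "tr ?n ?N" g \<epsilon>] that by (simp add: g_def x_def)
  qed
  have br: "A2 \<epsilon> k ?n + x + A2 \<epsilon> k ?n = x + A2 \<epsilon> k ?n + x" if "k \<in> {1..m}" for k
    using that mn by (simp add: x_def A2_less A_braid)
  have comm: "A2 \<epsilon> i k + x = x + A2 \<epsilon> i k" if "i \<in> {1..m}" "k \<in> {1..m}" "i \<noteq> k" for i k
    unfolding x_def by (rule A2_comm) (use that mn in auto)

  have low: "P a b d e" if "a \<in> {1..?n}" "b \<in> {1..?n}" "d \<in> {1..?n}" "e \<in> {1..?n}" "a \<noteq> b" "d \<noteq> e" 
    "{a, b} \<noteq> {d, e}" "pb \<epsilon> ?n a b d e" for a b d e
    unfolding P_def by (rule IH) (use that pb_Suc[OF that(1-4), of \<epsilon>] in \<open>auto simp: tpairs_def\<close>)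
  have conj: "P a b d e" if in': "a \<in> {1..m} \<union> {?N}" "b \<in> {1..m} \<union> {?N}" "d \<in> {1..m} \<union> {?N}" "e \<in> {1..m} \<union> {?N}"
    and "a \<noteq> b" "d \<noteq> e" "{a, b} \<noteq> {d, e}" "pb \<epsilon> ?n a b d e" for a b d e
  proof -
    define S where "S = tr ?n ?N"
    have SS: "S (S z) = z" for z by (simp add: S_def)
    have Sin: "S z \<in> {1..?n}" if "z \<in> {1..m} \<union> {?N}" for z using that by (auto simp: S_def)
    have inj: "S y = S z \<longleftrightarrow> y = z" for y z by (metis SS)
    have cj: "A2 \<epsilon> y z = g + A2 \<epsilon> (S y) (S z) - g"
      if "y \<in> {1..m} \<union> {?N}" "z \<in> {1..m} \<union> {?N}" "y \<noteq> z" for y z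
      using A2_conj[OF mn Sin[OF that(1)] Sin[OF that(2)], of S g \<epsilon>] that(3) inj SS
      by (simp add: g_def x_def S_def)
    have "pb \<epsilon> m (S a) (S b) (S d) (S e)"
      using pb_conj[OF in'[THEN Sin], of \<epsilon>] that(8) SS by (simp add: S_def)
    moreover have "{S a, S b} \<noteq> {S d, S e}"
      using that(7) by (auto simp: doubleton_eq_iff inj)
    ultimately have *: "A2 \<epsilon> (S a) (S b) + A2 \<epsilon> (S d) (S e) = A2 \<epsilon> (tr (S a) (S b) (S d)) (tr (S a) (S b) (S e)) + A2 \<epsilon> (S a) (S b)"
      by (intro IH) (use in'[THEN Sin] that inj in \<open>auto simp: tpairs_def\<close>)
    have t: "tr (S a) (S b) (S z) = S (tr a b z)" for z
      by (auto simp: Transposition.transpose_def inj)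
    have tin: "tr a b z \<in> {1..m} \<union> {?N}" if "z \<in> {1..m} \<union> {?N}" for z
      using in' that by (intro tr_in)
    have tne: "tr a b d \<noteq> tr a b e" using \<open>d \<noteq> e\<close> by (simp add: inj_eq[OF inj_transpose])
    show ?thesis unfolding P_def cj[OF in'(1,2) \<open>a \<noteq> b\<close>] cj[OF in'(3,4) \<open>d \<noteq> e\<close>] cj[OF tin[OF in'(3)] tin[OF in'(4)] tne]
    proof -
      have g: "(g + y - g) + (g + z - g) = g + (y + z) - g" for y z
        by (simp add: add.assoc diff_conv_add_uminus del: add_uminus_conv_diff)
      show "g + A2 \<epsilon> (S a) (S b) - g + (g + A2 \<epsilon> (S d) (S e) - g) =
        g + A2 \<epsilon> (S (tr a b d)) (S (tr a b e)) - g + (g + A2 \<epsilon> (S a) (S b) - g)"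
        unfolding g * t ..
    qed
  qed

  \<comment> \<open>Pairs that contain the new simple generator. If the other chord ends at one of
    its two points, \<open>not_pb_top\<close> fixes the sign, and the claim is the definition of an
    atom at the top point or a braid relation.\<close>
  have top1: "P ?n ?N d e" if de: "d \<in> {1..m}" "e \<in> {1..?N}" "d \<noteq> e" and pb: "pb \<epsilon> ?n ?n ?N d e" for d e
  proof -
    consider "e \<in> {1..m}" | "e = ?N" | "e = ?n" using de by force
    then show ?thesis
    proof cases
      case 1
      then have "tr ?n ?N d = d" "tr ?n ?N e = e" using de by auto
      then show ?thesis using comm[OF de(1) 1 de(3)] by (simp add: P_def top)
    next
      case 2
      then have "\<not> \<epsilon> ?n" using not_pb_top(1)[OF de(1), of \<epsilon>] pb by blast
      moreover have "tr ?n ?N d = d" "tr ?n ?N e = ?n" using de 2 by auto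
      ultimately show ?thesis using X[OF de(1)] 2 by (simp add: P_def top g_def add.assoc)
    next
      case 3
      have "tr d ?n \<circ> tr ?n ?N = tr ?n ?N \<circ> tr d ?N"
        using de 3 by (subst tr_tr') simp
      then have "\<epsilon> ?n" using not_pb_top(2)[OF de(1), of \<epsilon>] pb 3 pb_cong by blast
      moreover have "tr ?n ?N d = d" "tr ?n ?N e = ?N" using de 3 by auto
      ultimately show ?thesis using X[OF de(1)] 3 by (simp add: P_def top g_def)
    qed
  qed
  have top2: "P d e ?n ?N" if de: "d \<in> {1..m}" "e \<in> {1..?N}" "d \<noteq> e" and pb: "pb \<epsilon> ?n d e ?n ?N" for d e
  proof -
    consider "e \<in> {1..m}" | "e = ?N" | "e = ?n" using de by force
    then show ?thesis
    proof cases
      case 1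
      then have "tr d e ?n = ?n" "tr d e ?N = ?N" using de by auto
      then show ?thesis using comm[OF de(1) 1 de(3)] by (simp add: P_def top)
    next
      case 2
      then have "\<epsilon> ?n" using not_pb_top(2)[OF de(1), of \<epsilon>] pb by blast
      moreover have "tr d e ?n = ?n" "tr d e ?N = d" using de 2 by auto
      moreover have "A2 \<epsilon> d ?n + (x + A2 \<epsilon> d ?n - x) = x + A2 \<epsilon> d ?n"
        by (rule braid_step(3)[OF br[OF de(1)]])
      ultimately show ?thesis using X[OF de(1)] 2 A2_sym[of \<epsilon> ?n d] A2_sym[of \<epsilon> ?N d] A2_sym[of \<epsilon> ?N ?n] by (simp add: P_def top g_def add.assoc)
    next
      case 3
      have "tr ?n ?N \<circ> tr d ?n = tr d ?N \<circ> tr ?n ?N"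
        using de 3 by (subst tr_tr) simp
      then have "\<not> \<epsilon> ?n" using not_pb_top(1)[OF de(1), of \<epsilon>] pb 3 pb_cong by blast
      moreover have "tr d e ?n = d" "tr d e ?N = ?N" using de 3 by auto
      moreover have "- x + A2 \<epsilon> d ?n + x + A2 \<epsilon> d ?n = A2 \<epsilon> d ?n + x"
        using br[OF de(1)] by (simp add: add.assoc)
      ultimately show ?thesis using X[OF de(1)] 3 by (simp add: P_def top g_def)
    qed
  qed
  have mixed: "P k ?N i ?n \<and> P i ?n k ?N" if ik: "i \<in> {1..m}" "k \<in> {1..m}" "i \<noteq> k" 
    and pb: "pb \<epsilon> ?n i ?n k ?N \<or> pb \<epsilon> ?n k ?N i ?n" for i k
  proof -
    let ?A = "A2 \<epsilon> i ?n" and ?B = "A2 \<epsilon> k ?n" and ?C = "A2 \<epsilon> i k"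
    \<comment> \<open>The two reflections are disjoint, so both claims say that their atoms commute.
      The induction hypothesis is used twice in the triangle i, k, n: it makes the three products of
      cyclically consecutive atoms \<open>?A\<close>, \<open>?B\<close>, \<open>?C\<close>
      equal.\<close>
    have "?A + (g + ?B - g) = (g + ?B - g) + ?A"
    proof (cases "\<epsilon> ?n")
      case True
      have pb1: "pb \<epsilon> m k ?n i ?n" by (rule pb_top(1)[OF ik pb True])
      have "tr i ?n k = k" "tr k ?n i = i" "tr k ?n ?n = k" using ik by auto
      have "tr i ?n \<circ> tr k ?n = tr i k \<circ> tr i ?n" using ik by (subst tr_tr) (simp add: transpose_commute)
      then have pb2: "pb \<epsilon> m i ?n i k" using pb1 pb_cong by blast
      have 1: "?B + ?A = ?C + ?B"
        using IH[OF _ _ _ pb1] ik by (auto simp: tpairs_def doubleton_eq_iff)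
      have 2: "?A + ?C = ?B + ?A"
        using IH[OF _ _ _ pb2] ik A2_sym[of \<epsilon> ?n k] by (auto simp: tpairs_def doubleton_eq_iff)
      have 3: "?A - ?B = - ?B + ?C" using 1 by (metis add.assoc add_diff_cancel minus_add_cancel diff_conv_add_uminus)
      have "?A + (x + ?B - x) = (?A - ?B) + x + ?B"
        unfolding braid_step(1)[OF br[OF ik(2)]] by (simp only: add.assoc diff_conv_add_uminus)
      also have "\<dots> = - ?B + (?C + x) + ?B" unfolding 3 by (simp only: add.assoc diff_conv_add_uminus)
      also have "\<dots> = - ?B + x + (?C + ?B)" unfolding comm[OF ik] by (simp only: add.assoc diff_conv_add_uminus)
      also have "\<dots> = (x + ?B - x) + ?A"
        unfolding braid_step(1)[OF br[OF ik(2)]] 1[symmetric] by (simp only: add.assoc diff_conv_add_uminus)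
      finally show ?thesis using True by (simp add: g_def)
    next
      case False
      have pb1: "pb \<epsilon> m i ?n k ?n" by (rule pb_top(2)[OF ik pb False])
      have "tr k ?n \<circ> tr i ?n = tr i k \<circ> tr k ?n" using ik by (subst tr_tr) simp
      then have "tr k ?n \<circ> tr i ?n = tr k i \<circ> tr k ?n" by (simp only: transpose_commute)
      then have pb2: "pb \<epsilon> m k ?n k i" using pb1 pb_cong by blast
      have 1: "?A + ?B = ?C + ?A"
        using IH[OF _ _ _ pb1] ik A2_sym[of \<epsilon> k i] by (auto simp: tpairs_def doubleton_eq_iff)
      have 2: "?B + ?C = ?A + ?B"
        using IH[OF _ _ _ pb2] ik A2_sym[of \<epsilon> ?n i] A2_sym[of \<epsilon> k i] by (auto simp: tpairs_def doubleton_eq_iff)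
      have 3: "?C - ?B = - ?B + ?A" using 2 by (metis add.assoc add_diff_cancel minus_add_cancel diff_conv_add_uminus)
      have "?A + (- x + ?B + x) = (?A + ?B) + x - ?B"
        unfolding braid_step(2)[OF br[OF ik(2)]] by (simp only: add.assoc diff_conv_add_uminus)
      also have "\<dots> = ?B + (?C + x) - ?B" unfolding 2[symmetric] by (simp only: add.assoc diff_conv_add_uminus)
      also have "\<dots> = ?B + x + (?C - ?B)" unfolding comm[OF ik] by (simp only: add.assoc diff_conv_add_uminus)
      also have "\<dots> = (- x + ?B + x) + ?A"
        unfolding braid_step(2)[OF br[OF ik(2)]] 3 by (simp only: add.assoc diff_conv_add_uminus)
      finally show ?thesis using False by (simp add: g_def)
    qed
    then show ?thesis using ik X[OF ik(2)] by (simp add: P_def)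
  qed
  have mixed': "P k ?N k ?n" if k: "k \<in> {1..m}" and pb: "pb \<epsilon> ?n k ?N k ?n" for k
  proof -
    have "tr k ?n \<circ> tr k ?N = tr ?n ?N \<circ> tr k ?n" using k by (subst tr_tr) simp
    also have "\<dots> = tr k ?N \<circ> tr ?n ?N" using k by (subst tr_tr) simp
    finally have "\<not> \<epsilon> ?n" using not_pb_top(1)[OF k, of \<epsilon>] pb pb_cong by blast
    moreover have "tr k ?N k = ?N" "tr k ?N ?n = ?n" using k by auto
    moreover have "- x + A2 \<epsilon> k ?n + x + A2 \<epsilon> k ?n = A2 \<epsilon> k ?n + x"
      using br[OF k] by (simp add: add.assoc)
    ultimately show ?thesis using X[OF k] A2_sym[of \<epsilon> ?N ?n] by (simp add: P_def top g_def add.assoc)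
  qed
  have mixed'': "P k ?n k ?N" if k: "k \<in> {1..m}" and pb: "pb \<epsilon> ?n k ?n k ?N" for k
  proof -
    have "tr k ?N \<circ> tr k ?n = tr ?N ?n \<circ> tr k ?N" using k by (subst tr_tr) simp
    then have "tr k ?N \<circ> tr k ?n = tr ?n ?N \<circ> tr k ?N" by (simp only: transpose_commute)
    then have "\<epsilon> ?n" using not_pb_top(2)[OF k, of \<epsilon>] pb pb_cong by blast
    moreover have "tr k ?n k = ?n" "tr k ?n ?N = ?N" using k by auto
    moreover have "A2 \<epsilon> k ?n + (x + A2 \<epsilon> k ?n - x) = x + A2 \<epsilon> k ?n"
      by (rule braid_step(3)[OF br[OF k]])
    ultimately show ?thesis using X[OF k] by (simp add: P_def top g_def)
  qed

  have sorted: "P a b d e" if ab: "a < b" "d < e" "1 \<le> a" "1 \<le> d" "b \<le> ?N" "e \<le> ?N" 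
    and ne: "{a, b} \<noteq> {d, e}" and pb: "pb \<epsilon> ?n a b d e" for a b d e
  proof -
    consider "b \<le> ?n" "e \<le> ?n" | "a = ?n" "b = ?N" | "d = ?n" "e = ?N" 
      | "b = ?N" "a \<le> m" "e = ?n" | "b = ?n" "e = ?N" "d \<le> m"
      | "a \<noteq> ?n" "b \<noteq> ?n" "d \<noteq> ?n" "e \<noteq> ?n"
      using ab by linarith
    then show ?thesis
    proof cases
      case 1
      then show ?thesis using low[of a b d e] ab ne pb by simp
    next
      case 2
      then have "d \<le> m" using ab ne by (cases "d = ?n") auto
      then show ?thesis using top1[of d e] ab(2,4,6) pb unfolding 2 by simp
    next
      case 3
      then have "a \<le> m" using ab ne by (cases "a = ?n") auto
      then show ?thesis using top2[of a b] ab(1,3,5) pb unfolding 3 by simp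
    next
      case 4
      then show ?thesis using mixed[of d a] mixed'[of a] ab pb by (cases "d = a") auto
    next
      case 5
      then show ?thesis using mixed[of a d] mixed''[of a] ab pb by (cases "d = a") auto
    next
      case 6
      then have "a \<in> {1..m} \<union> {?N}" "b \<in> {1..m} \<union> {?N}" "d \<in> {1..m} \<union> {?N}" "e \<in> {1..m} \<union> {?N}"
        using ab by (simp_all, linarith+)
      then show ?thesis using conj[of a b d e] ab(1,2) pb ne by blast
    qed
  qed
  have "P (min a b) (max a b) (min d e) (max d e)"
  proof (rule sorted)
    show "{min a b, max a b} \<noteq> {min d e, max d e}" using Suc.prems(4) by (auto simp: min_def max_def doubleton_eq_iff)
    show "pb \<epsilon> ?n (min a b) (max a b) (min d e) (max d e)"
      using Suc.prems(5) by (simp add: min_def max_def pb_commute)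
  qed (use Suc.prems in \<open>auto simp: tpairs_def min_def max_def\<close>)
  then have "P a b d e" by (auto simp: min_def max_def P_swap1 P_swap2 split: if_splits)
  then show ?case by (simp add: P_def)
qed

subsection \<open>Reduced words of transpositions\<close>

definition ev :: "(nat \<Rightarrow> bool) \<Rightarrow> (nat \<times> nat) list \<Rightarrow> 'g"
  where "ev \<epsilon> ws = sum_list (map (\<lambda>(a, b). A2 \<epsilon> a b) ws)"

lemma ev_simps [simp]: "ev \<epsilon> [] = 0" "ev \<epsilon> (us @ vs) = ev \<epsilon> us + ev \<epsilon> vs" 
  "ev \<epsilon> ((a, b) # us) = A2 \<epsilon> a b + ev \<epsilon> us"
  by (simp_all add: ev_def)

definition treduced :: "(nat \<times> nat) list \<Rightarrow> bool"
  where "treduced ws \<longleftrightarrow> length ws = abs_len (Suc n) (tprod ws)"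

lemma treduced_append:
  assumes "treduced (us @ vs)" "set (us @ vs) \<subseteq> tpairs (Suc n)"
  shows "treduced us" "treduced vs"
  using assms abs_len_comp[of "tprod us" "Suc n" "tprod vs"]
    abs_len_le_length[of us "Suc n"] abs_len_le_length[of vs "Suc n"] tprod_permutes[of us "Suc n"] tprod_permutes[of vs "Suc n"]
  by (simp_all add: treduced_def)

lemma below_infix:
  assumes "treduced (us @ vs @ ws)" "set (us @ vs @ ws) \<subseteq> tpairs (Suc n)" "below (Suc n) (tprod (us @ vs @ ws)) c"
  shows "below (Suc n) (tprod vs) c"
proof (rule below_trans_mid[OF assms(3)])
  show "tprod (us @ vs @ ws) = tprod us \<circ> tprod vs \<circ> tprod ws" by (simp only: tprod_append comp_assoc)
  have "treduced us" "treduced vs" "treduced ws" "treduced (vs @ ws)"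
    using treduced_append[OF assms(1,2)] treduced_append[of vs ws] assms(2) by simp_all
  then show "abs_len (Suc n) (tprod us) + abs_len (Suc n) (tprod vs) + abs_len (Suc n) (tprod ws) \<le> abs_len (Suc n) (tprod (us @ vs @ ws))"
    using assms(1) unfolding treduced_def by (simp only: length_append)
qed (use assms(2) in \<open>auto intro!: tprod_permutes simp del: One_nat_def\<close>)

text \<open>The relation is applied to the pair itself and to the pair obtained from it by a Hurwitz
  move, which has the same product. This gives the move in both directions.\<close>

lemma pair_relation:
  assumes "treduced (us @ [(a, b), (d, e)])" "set (us @ [(a, b), (d, e)]) \<subseteq> tpairs (Suc n)" 
    "below (Suc n) (tprod (us @ [(a, b), (d, e)])) (cox \<epsilon> n)"
  shows "A2 \<epsilon> a b + A2 \<epsilon> d e = A2 \<epsilon> (tr a b d) (tr a b e) + A2 \<epsilon> a b"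
    and "A2 \<epsilon> a b + A2 \<epsilon> d e = A2 \<epsilon> d e + A2 \<epsilon> (tr d e a) (tr d e b)"
    and "{a, b} \<noteq> {d, e}"
proof -
  have red: "treduced [(a, b), (d, e)]" by (rule treduced_append(2)[OF assms(1,2)])
  then have len: "abs_len (Suc n) (tr a b \<circ> tr d e) = 2"
    unfolding treduced_def by (simp only: tprod_simps comp_id list.size)
  have "below (Suc n) (tprod [(a, b), (d, e)]) (cox \<epsilon> n)"
    using below_infix[of us "[(a, b), (d, e)]" "[]"] assms by simp
  then have "below (Suc n) (tr a b \<circ> tr d e) (cox \<epsilon> n)" by (simp only: tprod_simps comp_id)
  then have pb: "pb \<epsilon> n a b d e" using len by (rule pair_below_of_below)
  show ne: "{a, b} \<noteq> {d, e}"
  proof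
    assume "{a, b} = {d, e}"
    then have "tr a b = tr d e" by (auto simp: doubleton_eq_iff transpose_commute)
    then show False using len by simp
  qed
  have in': "(a, b) \<in> tpairs (Suc n)" "(d, e) \<in> tpairs (Suc n)" using assms(2) by auto
  show "A2 \<epsilon> a b + A2 \<epsilon> d e = A2 \<epsilon> (tr a b d) (tr a b e) + A2 \<epsilon> a b"
    by (rule dual_relation[OF order.refl in' ne pb])
  let ?f = "tr d e"
  have "tr (?f a) (?f b) \<circ> tr d e = tr d e \<circ> tr a b" by (simp only: tr_tr[of d e a b])
  then have pb': "pb \<epsilon> n d e (?f a) (?f b)" using pb pb_cong by blast
  have "(?f a, ?f b) \<in> tpairs (Suc n)"
    using in' tr_in[of d "{1..Suc n}" e] inj_eq[OF inj_transpose[of d e]] unfolding tpairs_def by blast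
  moreover have "{d, e} \<noteq> {?f a, ?f b}"
  proof
    assume "{d, e} = {?f a, ?f b}"
    then have "?f ` {d, e} = ?f ` {?f a, ?f b}" by simp
    then have "{e, d} = {a, b}" by simp
    then show False using ne by auto
  qed
  ultimately have "A2 \<epsilon> d e + A2 \<epsilon> (?f a) (?f b) = A2 \<epsilon> (?f (?f a)) (?f (?f b)) + A2 \<epsilon> d e"
    using dual_relation[OF order.refl in'(2) _ _ pb'] by simp
  then show "A2 \<epsilon> a b + A2 \<epsilon> d e = A2 \<epsilon> d e + A2 \<epsilon> (?f a) (?f b)" by simp
qed

text \<open>The letters that move the largest point are pushed to the right by Hurwitz moves, and two of
  them are merged into one; a reduced word ends up with at most one of them.\<close>

lemma hurwitz:
  assumes "m \<le> n" "set ws \<subseteq> tpairs (Suc m)" "treduced ws" "below (Suc n) (tprod ws) (cox \<epsilon> n)"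
  shows "(\<exists>v. set v \<subseteq> tpairs m \<and> tprod v = tprod ws \<and> length v = length ws \<and> ev \<epsilon> v = ev \<epsilon> ws) \<or>
    (\<exists>v k. set v \<subseteq> tpairs m \<and> k \<in> {1..m} \<and> tprod (v @ [(k, Suc m)]) = tprod ws \<and>
      length (v @ [(k, Suc m)]) = length ws \<and> ev \<epsilon> (v @ [(k, Suc m)]) = ev \<epsilon> ws)"
  using assms(2-4)
proof (induction ws rule: rev_induct)
  case Nil
  show ?case by (intro disjI1 exI[of _ "[]"]) simp
next
  case (snoc t ws)
  have tp: "tpairs (Suc m) \<subseteq> tpairs (Suc n)" using assms(1) by (intro tpairs_mono) simp
  have tp': "tpairs m \<subseteq> tpairs (Suc m)" by (rule tpairs_Suc)
  obtain d e where t: "t = (d, e)" by force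
  have all: "set (ws @ [t]) \<subseteq> tpairs (Suc n)" using snoc.prems(1) tp by blast
  have ws: "set ws \<subseteq> tpairs (Suc m)" "treduced ws" "below (Suc n) (tprod ws) (cox \<epsilon> n)"
    using snoc.prems treduced_append(1)[OF snoc.prems(2) all] below_infix[of "[]" ws "[t]"] all 
    by (simp_all only: append_Nil set_append le_sup_iff)
  have de: "d \<in> {1..Suc m}" "e \<in> {1..Suc m}" "d \<noteq> e" using snoc.prems(1) by (auto simp: t tpairs_def)
  have main: "?case" if t: "t = (d, e) \<or> t = (e, d)" and e: "d \<in> {1..m}" "e \<in> {1..Suc m}" "d \<noteq> e" for d e
  proof -
    have tt: "tprod [t] = tr d e" "ev \<epsilon> [t] = A2 \<epsilon> d e" 
      using t by (auto simp: transpose_commute A2_sym[of \<epsilon> d])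
    from snoc.IH[OF ws] show ?thesis
    proof (elim disjE exE conjE)
      fix v assume v: "set v \<subseteq> tpairs m" "tprod v = tprod ws" "length v = length ws" "ev \<epsilon> v = ev \<epsilon> ws"
      have eq: "tprod (v @ [(d, e)]) = tprod (ws @ [t])" "ev \<epsilon> (v @ [(d, e)]) = ev \<epsilon> (ws @ [t])"
        "length (v @ [(d, e)]) = length (ws @ [t])"
        using v tt by (simp_all del: comp_apply)
      show ?thesis
      proof (cases "e = Suc m")
        case True
        show ?thesis
          by (rule disjI2, rule exI[of _ v], rule exI[of _ d]) (use v e eq True in auto)
      next
        case False
        then have "(d, e) \<in> tpairs m" using e by (auto simp: tpairs_def)
        then show ?thesis
          by (intro disjI1 exI[of _ "v @ [(d, e)]"]) (use v eq in simp)
      qed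
    next
      fix v k assume v: "set v \<subseteq> tpairs m" "k \<in> {1..m}" "tprod (v @ [(k, Suc m)]) = tprod ws" 
        "length (v @ [(k, Suc m)]) = length ws" "ev \<epsilon> (v @ [(k, Suc m)]) = ev \<epsilon> ws"
      have eq: "tprod (v @ [(k, Suc m), (d, e)]) = tprod (ws @ [t])" 
        "ev \<epsilon> (v @ [(k, Suc m), (d, e)]) = ev \<epsilon> (ws @ [t])"
        "length (v @ [(k, Suc m), (d, e)]) = length (ws @ [t])"
      proof -
        have *: "v @ [(k, Suc m), (d, e)] = (v @ [(k, Suc m)]) @ [(d, e)]" by simp
        have **: "tprod [(d, e)] = tprod [t]" "ev \<epsilon> [(d, e)] = ev \<epsilon> [t]"
          using tt by (simp_all del: comp_apply)
        show "tprod (v @ [(k, Suc m), (d, e)]) = tprod (ws @ [t])"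
          unfolding * tprod_append v(3)[unfolded tprod_append] ** ..
        show "ev \<epsilon> (v @ [(k, Suc m), (d, e)]) = ev \<epsilon> (ws @ [t])"
          unfolding * ev_simps(2) v(5)[unfolded ev_simps(2)] ** ..
        show "length (v @ [(k, Suc m), (d, e)]) = length (ws @ [t])" using v(4) by simp
      qed
      have in': "set (v @ [(k, Suc m), (d, e)]) \<subseteq> tpairs (Suc n)"
        using v(1,2) e tp tp' by (auto simp: tpairs_def)
      have red: "treduced (v @ [(k, Suc m), (d, e)])" 
        using snoc.prems(2) unfolding treduced_def eq .
      have bel: "below (Suc n) (tprod (v @ [(k, Suc m), (d, e)])) (cox \<epsilon> n)"
        using snoc.prems(3) unfolding eq .
      note R = pair_relation[OF red in' bel]
      show ?thesis
      \<comment> \<open>If both letters move the top point they merge: (k N)(d N) = (d k)(k N) with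
        N = Suc m. They differ because the word is reduced.\<close>
      proof (cases "e = Suc m")
        case True
        have km: "k \<noteq> d" using R(3) True by auto
        then have t': "tr k (Suc m) d = d" "tr k (Suc m) e = k" using True e by auto
        let ?v = "v @ [(d, k)]"
        show ?thesis
        proof (rule disjI2, rule exI[of _ ?v], rule exI[of _ k], intro conjI)
          show "set ?v \<subseteq> tpairs m" using v e km by (auto simp: tpairs_def)
          have "tprod (v @ [(k, Suc m), (d, e)]) = tprod v \<circ> (tr k (Suc m) \<circ> tr d e)"
            by (simp only: tprod_append tprod_simps comp_id)
          also have "\<dots> = tprod (?v @ [(k, Suc m)])"
            by (subst tr_tr) (simp only: t' tprod_append tprod_simps comp_id comp_assoc)
          finally show "tprod (?v @ [(k, Suc m)]) = tprod (ws @ [t])" using eq by simp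
          show "ev \<epsilon> (?v @ [(k, Suc m)]) = ev \<epsilon> (ws @ [t])"
            unfolding eq(2)[symmetric] using R(1) t' by (simp add: add.assoc)
        qed (use v eq in auto)
      next
        case False
        then have e': "e \<in> {1..m}" using e by auto
        \<comment> \<open>\<open>?k\<close> is the lower end of the top letter after it has passed
          \<open>tr d e\<close>.\<close>
        let ?v = "v @ [(d, e)]" and ?k = "tr d e k"
        have t': "tr d e (Suc m) = Suc m" using e False by auto
        show ?thesis
        proof (rule disjI2, rule exI[of _ ?v], rule exI[of _ ?k], intro conjI)
          show "set ?v \<subseteq> tpairs m" using v e e' by (auto simp: tpairs_def)
          show "?k \<in> {1..m}" using e e' v(2) by (intro tr_in)
          have "tprod (v @ [(k, Suc m), (d, e)]) = tprod v \<circ> (tr k (Suc m) \<circ> tr d e)"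
            by (simp only: tprod_append tprod_simps comp_id)
          also have "\<dots> = tprod (?v @ [(?k, Suc m)])"
            by (subst tr_tr') (simp only: t' tprod_append tprod_simps comp_id comp_assoc)
          finally show "tprod (?v @ [(?k, Suc m)]) = tprod (ws @ [t])" using eq by simp
          show "ev \<epsilon> (?v @ [(?k, Suc m)]) = ev \<epsilon> (ws @ [t])"
            unfolding eq(2)[symmetric] using R(2) t' by (simp add: add.assoc)
        qed (use v eq in auto)
      qed
    qed
  qed
  show ?case
  proof (cases "d = Suc m")
    case True
    then show ?thesis using main[of e d] de t by auto
  next
    case False
    then show ?thesis using main[of d e] de t by auto
  qed
qed

text \<open>The analogue of Matsumoto's theorem for dual braids. In the form reached by
  \<open>hurwitz\<close> the last letter is determined by the permutation, as \<open>k\<close> is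
  the preimage of the top point; stripping it leaves words on fewer points.\<close>

theorem ev_unique:
  assumes "m \<le> Suc n" "set us \<subseteq> tpairs m" "set vs \<subseteq> tpairs m" "tprod us = tprod vs"
    "treduced us" "treduced vs" "below (Suc n) (tprod us) (cox \<epsilon> n)"
  shows "ev \<epsilon> us = ev \<epsilon> vs"
  using assms
proof (induction m arbitrary: us vs)
  case 0
  then show ?case by (simp add: tpairs_def)
next
  case (Suc m)
  have mn: "m \<le> n" using Suc.prems by simp
  have tp: "tpairs m \<subseteq> tpairs (Suc n)" using mn by (intro tpairs_mono) simp
  have fix_top: "tprod v (Suc m) = Suc m" if "set v \<subseteq> tpairs m" for v
    using tprod_permutes[OF that] by (simp add: permutes_not_in)
  have top: "inv' (tprod (v @ [(k, Suc m)])) (Suc m) = k" "tprod (v @ [(k, Suc m)]) (Suc m) \<noteq> Suc m" 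
    if v: "set v \<subseteq> tpairs m" and k: "k \<in> {1..m}" for v k
  proof -
    have bij: "bij (tprod (v @ [(k, Suc m)]))"
      using permutes_bij[OF tprod_permutes[OF v]] by (simp add: bij_comp)
    have 1: "tprod (v @ [(k, Suc m)]) k = Suc m" using fix_top[OF v] by simp
    show "inv' (tprod (v @ [(k, Suc m)])) (Suc m) = k" using bij 1 by (metis bij_inv_eq_iff)
    have "k \<noteq> Suc m" using k by simp
    then show "tprod (v @ [(k, Suc m)]) (Suc m) \<noteq> Suc m" using bij 1 by (metis bij_pointE)
  qed
  have below_us: "below (Suc n) (tprod vs) (cox \<epsilon> n)" using Suc.prems by simp
  from hurwitz[OF mn Suc.prems(2,5,7)] show ?case
  proof (elim disjE exE conjE)
    fix u assume u: "set u \<subseteq> tpairs m" "tprod u = tprod us" "length u = length us" "ev \<epsilon> u = ev \<epsilon> us"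
    from hurwitz[OF mn Suc.prems(3,6) below_us] show ?thesis
    proof (elim disjE exE conjE)
      fix v assume v: "set v \<subseteq> tpairs m" "tprod v = tprod vs" "length v = length vs" "ev \<epsilon> v = ev \<epsilon> vs"
      have "ev \<epsilon> u = ev \<epsilon> v"
        by (rule Suc.IH) (use u v mn Suc.prems in \<open>simp_all add: treduced_def\<close>)
      then show ?thesis using u v by simp
    next
      fix v k assume v: "set v \<subseteq> tpairs m" "k \<in> {1..m}" "tprod (v @ [(k, Suc m)]) = tprod vs"
      then show ?thesis using top(2)[OF v(1,2)] fix_top[OF u(1)] u(2) Suc.prems(4) by simp
    qed
  next
    fix u l assume u: "set u \<subseteq> tpairs m" "l \<in> {1..m}" "tprod (u @ [(l, Suc m)]) = tprod us" 
      "length (u @ [(l, Suc m)]) = length us" "ev \<epsilon> (u @ [(l, Suc m)]) = ev \<epsilon> us"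
    from hurwitz[OF mn Suc.prems(3,6) below_us] show ?thesis
    proof (elim disjE exE conjE)
      fix v assume v: "set v \<subseteq> tpairs m" "tprod v = tprod vs"
      then show ?thesis using top(2)[OF u(1,2)] fix_top[OF v(1)] unfolding u(3) v(2) Suc.prems(4) by blast
    next
      fix v k assume v: "set v \<subseteq> tpairs m" "k \<in> {1..m}" "tprod (v @ [(k, Suc m)]) = tprod vs" 
        "length (v @ [(k, Suc m)]) = length vs" "ev \<epsilon> (v @ [(k, Suc m)]) = ev \<epsilon> vs"
      have lk: "l = k" using top(1)[OF u(1,2)] top(1)[OF v(1,2)] u(3) v(3) Suc.prems(4) by simp
      have "tprod u \<circ> tr k (Suc m) \<circ> tr k (Suc m) = tprod v \<circ> tr k (Suc m) \<circ> tr k (Suc m)"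
        using u(3) v(3) Suc.prems(4) lk by (simp del: comp_apply)
      then have uv: "tprod u = tprod v" by (simp only: tr_cancel)
      have red: "treduced (u @ [(l, Suc m)])" "treduced (v @ [(k, Suc m)])"
        using Suc.prems(5,6) u v unfolding treduced_def by simp_all
      have in': "set (u @ [(l, Suc m)]) \<subseteq> tpairs (Suc n)" "set (v @ [(k, Suc m)]) \<subseteq> tpairs (Suc n)"
        using u(1,2) v(1,2) tp mn by (auto simp: tpairs_def)
      have "below (Suc n) (tprod u) (cox \<epsilon> n)"
        using below_infix[of "[]" u "[(l, Suc m)]"] red in' u(3) Suc.prems(7) by simp
      then have "ev \<epsilon> u = ev \<epsilon> v"
        using Suc.IH[OF _ u(1) v(1) uv] mn treduced_append(1)[OF red(1) in'(1)] treduced_append(1)[OF red(2) in'(2)] by simp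
      then show ?thesis using u(5) v(5) lk by simp
    qed
  qed
qed

text \<open>For divisors of the Coxeter element the chosen reduced word is immaterial, by
  \<open>ev_unique\<close>. Only there is the value meaningful.\<close>

definition dual_elt :: "(nat \<Rightarrow> bool) \<Rightarrow> (nat \<Rightarrow> nat) \<Rightarrow> 'g"
  where "dual_elt \<epsilon> x = ev \<epsilon> (SOME ws. set ws \<subseteq> tpairs (Suc n) \<and> tprod ws = x \<and> treduced ws)"

lemma dual_elt_eq:
  assumes "set ws \<subseteq> tpairs (Suc n)" "treduced ws" "below (Suc n) (tprod ws) (cox \<epsilon> n)"
  shows "dual_elt \<epsilon> (tprod ws) = ev \<epsilon> ws"
proof -
  define us where "us = (SOME us. set us \<subseteq> tpairs (Suc n) \<and> tprod us = tprod ws \<and> treduced us)"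
  have us: "set us \<subseteq> tpairs (Suc n) \<and> tprod us = tprod ws \<and> treduced us"
    unfolding us_def by (rule someI[of _ ws]) (use assms in simp)
  have "ev \<epsilon> us = ev \<epsilon> ws"
    by (rule ev_unique[of "Suc n"]) (use us assms in simp_all)
  then show ?thesis by (simp add: dual_elt_def us_def)
qed

lemma ex_treduced:
  assumes "x permutes {1..Suc n}"
  obtains ws where "set ws \<subseteq> tpairs (Suc n)" "tprod ws = x" "treduced ws"
  using ex_tword[OF assms] by (auto simp: treduced_def)

lemma dual_elt_mult:
  assumes "x permutes {1..Suc n}" "y permutes {1..Suc n}" "below (Suc n) (x \<circ> y) (cox \<epsilon> n)"
    "abs_len (Suc n) (x \<circ> y) = abs_len (Suc n) x + abs_len (Suc n) y"
  shows "dual_elt \<epsilon> (x \<circ> y) = dual_elt \<epsilon> x + dual_elt \<epsilon> y"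
proof -
  obtain us where us: "set us \<subseteq> tpairs (Suc n)" "tprod us = x" "treduced us" by (rule ex_treduced[OF assms(1)])
  obtain vs where vs: "set vs \<subseteq> tpairs (Suc n)" "tprod vs = y" "treduced vs" by (rule ex_treduced[OF assms(2)])
  have in': "set (us @ vs) \<subseteq> tpairs (Suc n)" using us vs by simp
  have p: "tprod (us @ vs) = x \<circ> y" using us vs by (simp only: tprod_append)
  have red: "treduced (us @ vs)" using us vs assms(4) unfolding treduced_def p by simp
  have bel: "below (Suc n) (tprod (us @ vs)) (cox \<epsilon> n)" using assms(3) p by simp
  have "below (Suc n) (tprod us) (cox \<epsilon> n)" "below (Suc n) (tprod vs) (cox \<epsilon> n)"
    using below_infix[of "[]" us vs] below_infix[of us vs "[]"] red in' bel by simp_all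
  then show ?thesis
    using dual_elt_eq[OF in' red bel] dual_elt_eq[OF us(1,3)] dual_elt_eq[OF vs(1,3)] us(2) vs(2) p by simp
qed

lemma dual_elt_id: "dual_elt \<epsilon> id = 0"
proof -
  have "below (Suc n) id (cox \<epsilon> n)"
    unfolding below_def by (intro conjI exI[of _ "cox \<epsilon> n"]) (use cox_permutes permutes_id in \<open>simp_all only: abs_len_id id_comp add_0\<close>)
  then show ?thesis using dual_elt_eq[of "[]"] by (simp add: treduced_def)
qed

text \<open>The Coxeter element has the largest possible length \<open>n\<close>, so a transposition
  can only shorten it.\<close>

lemma below_tr:
  assumes "(a, b) \<in> tpairs (Suc n)" shows "below (Suc n) (tr a b) (cox \<epsilon> n)"
proof -
  have ab: "a \<in> {1..Suc n}" "b \<in> {1..Suc n}" "a \<noteq> b" using assms by (auto simp: tpairs_def)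
  have p: "tr a b permutes {1..Suc n}" using ab by (intro tr_permutes)
  have v: "tr a b \<circ> cox \<epsilon> n permutes {1..Suc n}" by (rule permutes_compose[OF cox_permutes p])
  have "abs_len (Suc n) (tr a b \<circ> cox \<epsilon> n) \<le> n" using abs_len_less[OF v] by simp
  then have "Suc (abs_len (Suc n) (tr a b \<circ> cox \<epsilon> n)) = abs_len (Suc n) (cox \<epsilon> n)"
    using abs_len_tr_left[OF cox_permutes ab, of \<epsilon>] abs_len_cox[of n \<epsilon>] by linarith
  then show ?thesis unfolding below_def
    by (intro conjI exI[of _ "tr a b \<circ> cox \<epsilon> n"] p v) (simp_all only: o_assoc transpose_comp_involutory id_comp abs_len_single[OF ab])
qed

lemma dual_elt_tr:
  assumes "(a, b) \<in> tpairs (Suc n)" shows "dual_elt \<epsilon> (tr a b) = A2 \<epsilon> a b"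
proof -
  have "abs_len (Suc n) (tr a b) = 1" using assms by (intro abs_len_single) (auto simp: tpairs_def)
  then have "treduced [(a, b)]" unfolding treduced_def by (simp only: tprod_simps comp_id) simp
  then show ?thesis using dual_elt_eq[of "[(a, b)]" \<epsilon>] below_tr[OF assms, of \<epsilon>] assms by simp
qed

end

subsection \<open>Canonical lifts of permutations\<close>

text \<open>A permutation of {1..M} with arbitrary values elsewhere. Removing the last point by
  \<open>dl\<close> controls the values on the smaller range only, so \<open>permutes\<close> would
  not be preserved.\<close>

definition pinj :: "nat \<Rightarrow> (nat \<Rightarrow> nat) \<Rightarrow> bool"
  where "pinj M a \<longleftrightarrow> inj_on a {1..M} \<and> a ` {1..M} \<subseteq> {1..M}"

lemma pinj_onto: "pinj M a \<Longrightarrow> a ` {1..M} = {1..M}"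
  unfolding pinj_def by (intro endo_inj_surj) auto

lemma pinj_in: "pinj M a \<Longrightarrow> 1 \<le> i \<Longrightarrow> i \<le> M \<Longrightarrow> 1 \<le> a i \<and> a i \<le> M"
  unfolding pinj_def by (auto simp: image_subset_iff)

lemma pinj_neq: "pinj M a \<Longrightarrow> 1 \<le> i \<Longrightarrow> i \<le> M \<Longrightarrow> 1 \<le> j \<Longrightarrow> j \<le> M \<Longrightarrow> i \<noteq> j \<Longrightarrow> a i \<noteq> a j"
  unfolding pinj_def by (meson atLeastAtMost_iff inj_onD)

definition dl :: "nat \<Rightarrow> (nat \<Rightarrow> nat) \<Rightarrow> nat \<Rightarrow> nat"
  where "dl j a i = (if a i > j then a i - 1 else a i)"

text \<open>Reopens at \<open>j\<close> the gap that \<open>dl\<close> closes.\<close>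

definition up :: "nat \<Rightarrow> nat \<Rightarrow> nat"
  where "up j i = (if i < j then i else Suc i)"

lemma up_dl: "a i \<noteq> j \<Longrightarrow> up j (dl j a i) = a i"
  by (auto simp: up_def dl_def)

lemma up_less_iff: "up j x < up j y \<longleftrightarrow> x < y"
  by (auto simp: up_def)

lemma pinj_dl:
  assumes a: "pinj (Suc M) a" shows "pinj M (dl (a (Suc M)) a)"
proof -
  let ?j = "a (Suc M)"
  have ne: "a i \<noteq> ?j" if "i \<in> {1..M}" for i
    using pinj_neq[OF a, of i "Suc M"] that by auto
  have "inj_on (dl ?j a) {1..M}"
  proof (rule inj_onI)
    fix x y assume x: "x \<in> {1..M}" and y: "y \<in> {1..M}" and "dl ?j a x = dl ?j a y"
    then have "a x = a y" using up_dl[of a x ?j] up_dl[of a y ?j] ne by metis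
    then show "x = y" using pinj_neq[OF a, of x y] x y by force
  qed
  moreover have "dl ?j a i \<in> {1..M}" if i: "i \<in> {1..M}" for i
  proof -
    have "1 \<le> a i" "a i \<le> Suc M" "1 \<le> ?j" "?j \<le> Suc M"
      using pinj_in[OF a, of i] pinj_in[OF a, of "Suc M"] i by auto
    then show ?thesis using ne[OF i] by (auto simp: dl_def)
  qed
  ultimately show ?thesis by (auto simp: pinj_def)
qed

lemma dl_dl: 
  "p < q \<Longrightarrow> a i \<noteq> p \<Longrightarrow> a i \<noteq> q \<Longrightarrow> dl (q - 1) (dl p a) i = dl p (dl q a) i"
  by (auto simp: dl_def)

context braid_rep
begin

text \<open>The run s_j ... s_(k-1), in which one strand passes all the others between the positions
  j and k.\<close>

definition seg :: "nat \<Rightarrow> nat \<Rightarrow> 'g"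
  where "seg j k = sum_list (map s [j..<k])"

lemma seg_empty [simp]: "k \<le> j \<Longrightarrow> seg j k = 0"
  by (simp add: seg_def)

lemma seg_rec: "j < k \<Longrightarrow> seg j k = s j + seg (Suc j) k"
  by (simp add: seg_def upt_rec)

lemma seg_Suc: "j \<le> k \<Longrightarrow> seg j (Suc k) = seg j k + s k"
  by (simp add: seg_def)

lemma seg_comm:
  assumes "\<And>i. j \<le> i \<Longrightarrow> i < k \<Longrightarrow> s i + x = x + s i"
  shows "seg j k + x = x + seg j k"
  using assms
proof (induction k)
  case (Suc k)
  show ?case
  proof (cases "j \<le> k")
    case True
    have 1: "seg j k + x = x + seg j k" by (rule Suc.IH) (use Suc.prems in auto)
    have 2: "s k + x = x + s k" using Suc.prems True by simp
    show ?thesis by (simp only: seg_Suc[OF True] add.assoc 2) (simp only: add.assoc[symmetric] 1)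
  qed simp
qed simp

lemma seg_comm_s:
  assumes "(1 \<le> i \<and> Suc i < j \<and> k \<le> Suc n) \<or> (1 \<le> j \<and> k < i \<and> i \<le> n)"
  shows "seg j k + s i = s i + seg j k"
proof (rule seg_comm)
  fix t assume t: "j \<le> t" "t < k"
  show "s t + s i = s i + s t"
    using assms far_comm[of i t] far_comm[of t i] t by (auto simp: not_less)
qed

text \<open>The letter commutes with the run except where it meets \<open>s i\<close> and
  \<open>s (Suc i)\<close>; there the braid relation raises its index by one.\<close>

lemma seg_shift:
  assumes "1 \<le> j" "j \<le> i" "Suc i < k" "k \<le> Suc n"
  shows "seg j k + s i = s (Suc i) + seg j k"
proof -
  have split: "seg j k = seg j i + (s i + (s (Suc i) + seg (Suc (Suc i)) k))"
  proof -
    have "[j..<k] = [j..<i] @ [i..<k]" using upt_add_eq_append[of j i "k - i"] assms by simp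
    then have "seg j k = seg j i + seg i k" by (simp add: seg_def)
    then show ?thesis using assms by (simp add: seg_rec[of i] seg_rec[of "Suc i"])
  qed
  have 1: "seg (Suc (Suc i)) k + s i = s i + seg (Suc (Suc i)) k"
    by (rule seg_comm_s) (use assms in auto)
  have 2: "seg j i + s (Suc i) = s (Suc i) + seg j i"
    by (rule seg_comm_s) (use assms in auto)
  have b: "s i + s (Suc i) + s i = s (Suc i) + s i + s (Suc i)" by (rule braid) (use assms in auto)
  have "seg j k + s i = seg j i + (s i + s (Suc i) + s i) + seg (Suc (Suc i)) k"
    unfolding split by (simp only: add.assoc 1)
  also have "\<dots> = (seg j i + s (Suc i)) + s i + s (Suc i) + seg (Suc (Suc i)) k"
    unfolding b by (simp only: add.assoc)
  also have "\<dots> = s (Suc i) + seg j k" unfolding split 2 by (simp only: add.assoc)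
  finally show ?thesis .
qed

lemma seg_shift_seg:
  assumes "1 \<le> p" "p \<le> a" "b < k" "k \<le> Suc n"
  shows "seg p k + seg a b = seg (Suc a) (Suc b) + seg p k"
  using assms(3)
proof (induction b)
  case (Suc b)
  show ?case
  proof (cases "a \<le> b")
    case True
    have 1: "seg p k + s b = s (Suc b) + seg p k" by (rule seg_shift) (use assms Suc.prems True in auto)
    have "seg p k + seg a (Suc b) = (seg p k + seg a b) + s b" by (simp only: seg_Suc[OF True] add.assoc)
    also have "\<dots> = seg (Suc a) (Suc b) + (seg p k + s b)" using Suc by (simp add: add.assoc)
    also have "\<dots> = (seg (Suc a) (Suc b) + s (Suc b)) + seg p k" unfolding 1 by (simp only: add.assoc)
    also have "seg (Suc a) (Suc b) + s (Suc b) = seg (Suc a) (Suc (Suc b))" using True by (simp only: seg_Suc Suc_le_mono)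
    finally show ?thesis .
  qed simp
qed simp

text \<open>Only the relative order of the values of \<open>a\<close> on \<open>{1..Suc m}\<close> matters: \<open>dl\<close> closes the gap left by
  the value of the last point.\<close>

primrec Sig :: "nat \<Rightarrow> (nat \<Rightarrow> nat) \<Rightarrow> 'g" where
  "Sig 0 a = 0"
| "Sig (Suc m) a = seg (a (Suc (Suc m))) (Suc (Suc m)) + Sig m (dl (a (Suc (Suc m))) a)"

lemma Sig_cong: "(\<And>i. 1 \<le> i \<Longrightarrow> i \<le> Suc m \<Longrightarrow> a i = b i) \<Longrightarrow> Sig m a = Sig m b"
proof (induction m arbitrary: a b)
  case (Suc m)
  have "Sig m (dl (a (Suc (Suc m))) a) = Sig m (dl (b (Suc (Suc m))) b)"
    by (rule Suc.IH) (use Suc.prems in \<open>simp add: dl_def\<close>)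
  then show ?case using Suc.prems[of "Suc (Suc m)"] by simp
qed simp

lemma Sig_comm:
  assumes "pinj (Suc m) a" "Suc m < i" "i \<le> n"
  shows "Sig m a + s i = s i + Sig m a"
  using assms
proof (induction m arbitrary: a)
  case (Suc m)
  let ?j = "a (Suc (Suc m))"
  have 1: "Sig m (dl ?j a) + s i = s i + Sig m (dl ?j a)"
    by (rule Suc.IH[OF pinj_dl]) (use Suc.prems in auto)
  have 2: "seg ?j (Suc (Suc m)) + s i = s i + seg ?j (Suc (Suc m))"
    by (rule seg_comm_s) (use pinj_in[OF Suc.prems(1), of "Suc (Suc m)"] Suc.prems in auto)
  show ?case by (simp only: Sig.simps add.assoc 1) (simp only: add.assoc[symmetric] 2)
qed simp

text \<open>Canonical lifts are multiplicative when a simple factor increases the length. Away from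
  the last position this passes to the recursive call; at the last position the two last runs have
  to be exchanged, which is \<open>seg_shift_seg\<close>.\<close>

lemma Sig_lift:
  assumes "pinj (Suc m) a" "m \<le> n" "1 \<le> i" "i \<le> m" "a i < a (Suc i)"
  shows "Sig m (a \<circ> tr i (Suc i)) = Sig m a + s i"
  using assms
proof (induction m arbitrary: a)
  case (Suc m)
  let ?N = "Suc (Suc m)"
  have pN: "pinj (Suc m) (dl (a ?N) a)" by (rule pinj_dl[OF Suc.prems(1)])
  show ?case
  proof (cases "i = Suc m")
    case False
    let ?j = "a ?N"
    have top: "(a \<circ> tr i (Suc i)) ?N = ?j" using False Suc.prems by simp
    have "dl ?j (a \<circ> tr i (Suc i)) = dl ?j a \<circ> tr i (Suc i)" by (rule ext) (simp add: dl_def)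
    moreover have "dl ?j a i < dl ?j a (Suc i)"
      using up_less_iff[of ?j "dl ?j a i" "dl ?j a (Suc i)"] up_dl[of a i ?j] up_dl[of a "Suc i" ?j]
        pinj_neq[OF Suc.prems(1), of i ?N] pinj_neq[OF Suc.prems(1), of "Suc i" ?N] Suc.prems False by simp
    ultimately show ?thesis using Suc.IH[OF pN] Suc.prems False top by (simp only: Sig.simps) (simp add: add.assoc)
  next
    case True
    let ?p = "a (Suc m)" and ?q = "a ?N"
    have pq: "?p < ?q" using Suc.prems True by simp
    have r: "1 \<le> ?p" "?q \<le> ?N" using pinj_in[OF Suc.prems(1), of "Suc m"] pinj_in[OF Suc.prems(1), of ?N] by auto
    let ?b = "a \<circ> tr i (Suc i)"
    have b: "?b ?N = ?p" "?b (Suc m) = ?q" using True by simp_all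
    show ?thesis
    proof (cases m)
      case 0
      then have "?p = 1" "?q = 2" using pq r by auto
      then show ?thesis using True 0 b by (simp add: seg_rec numeral_2_eq_2)
    next
      case (Suc m')
      let ?a2 = "dl ?p (dl ?q a)"
      have d: "dl ?q a (Suc m) = ?p" using pq by (simp add: dl_def)
      have db: "dl ?p ?b (Suc m) = ?q - 1" using pq b by (simp add: dl_def)
      have "Sig (Suc m) ?b = seg ?p ?N + (seg (?q - 1) (Suc m) + Sig m' (dl (?q - 1) (dl ?p ?b)))"
        using Suc b db by simp
      also have "Sig m' (dl (?q - 1) (dl ?p ?b)) = Sig m' ?a2"
      proof (rule Sig_cong)
        fix t assume t: "1 \<le> t" "t \<le> Suc m'"
        then have "?b t = a t" using True Suc by (simp add: Transposition.transpose_def)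
        moreover have "a t \<noteq> ?p" "a t \<noteq> ?q"
          using pinj_neq[OF Suc.prems(1), of t "Suc m"] pinj_neq[OF Suc.prems(1), of t ?N] t Suc by auto
        ultimately show "dl (?q - 1) (dl ?p ?b) t = ?a2 t"
          using dl_dl[OF pq, of ?b t] by (simp add: dl_def)
      qed
      also have "seg ?p ?N + (seg (?q - 1) (Suc m) + Sig m' ?a2) = (seg ?p ?N + seg (?q - 1) (Suc m)) + Sig m' ?a2"
        by (simp only: add.assoc)
      also have "seg ?p ?N + seg (?q - 1) (Suc m) = seg ?q ?N + seg ?p ?N"
        using seg_shift_seg[of ?p "?q - 1" "Suc m" ?N] pq r Suc.prems by simp
      also have "seg ?p ?N = seg ?p (Suc m) + s i" using pq r True by (simp add: seg_Suc)
      also have "seg ?q ?N + (seg ?p (Suc m) + s i) + Sig m' ?a2 = seg ?q ?N + (seg ?p (Suc m) + (s i + Sig m' ?a2))"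
        by (simp only: add.assoc)
      also have "s i + Sig m' ?a2 = Sig m' ?a2 + s i"
      proof (rule Sig_comm[symmetric])
        show "pinj (Suc m') ?a2" using pinj_dl[of "Suc m'" "dl ?q a"] pN d Suc by simp
      qed (use True Suc Suc.prems in auto)
      also have "seg ?q ?N + (seg ?p (Suc m) + (Sig m' ?a2 + s i)) = Sig (Suc m) a + s i"
        using Suc d by (simp add: add.assoc)
      finally show ?thesis .
    qed
  qed
qed simp

subsection \<open>Conjugating simple generators by lifts\<close>

lemma A_cong: "(\<And>i. k < i \<Longrightarrow> i < l \<Longrightarrow> \<epsilon> i = \<epsilon>' i) \<Longrightarrow> A \<epsilon> k l = A \<epsilon>' k l"
proof (induction l)
  case (Suc l)
  show ?case
  proof (cases "k < l")
    case True
    then have "A \<epsilon> k l = A \<epsilon>' k l" "\<epsilon> l = \<epsilon>' l" using Suc by auto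
    then show ?thesis using True by (simp add: A_step)
  qed (simp add: A.simps)
qed (simp add: A.simps)

lemma seg_A_comm:
  assumes "1 \<le> k" "k < l" "l < j" "K \<le> Suc n"
  shows "seg j K + A \<epsilon> k l = A \<epsilon> k l + seg j K"
  by (rule seg_comm) (use A_comm[of k l _ \<epsilon>] assms in auto)

text \<open>A strand inserted at height \<open>j\<close> renames the ends of an atom by
  \<open>up j\<close>. If \<open>j\<close> falls strictly between the new ends, the atom has to pass
  on one prescribed side of the strand, hence the condition on the sign at \<open>j\<close>.\<close>

lemma seg_A:
  assumes k: "1 \<le> k" "k < l" and K: "l < K" "K \<le> Suc n" and j: "1 \<le> j" "j \<le> K" and \<epsilon>: "up j k < j \<Longrightarrow> j < up j l \<Longrightarrow> \<epsilon> j"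
  shows "seg j K + A (\<epsilon> \<circ> up j) k l = A \<epsilon> (up j k) (up j l) + seg j K"
  using k(2) K(1) \<epsilon>
proof (induction l)
  case (Suc l)
  consider "Suc l < j" | "Suc l = j" | "j \<le> l" "k = l" | "j \<le> l" "k < l" using Suc.prems by linarith
  then show ?case
  proof cases
    case 1
    have "A (\<epsilon> \<circ> up j) k (Suc l) = A \<epsilon> k (Suc l)"
      by (rule A_cong) (use 1 in \<open>simp add: up_def\<close>)
    moreover have "up j k = k" "up j (Suc l) = Suc l" using 1 Suc.prems by (auto simp: up_def)
    ultimately show ?thesis using seg_A_comm[of k "Suc l" j K \<epsilon>] k Suc.prems 1 assms by (simp del: comp_apply)
  next
    case 2
    have "A (\<epsilon> \<circ> up j) k (Suc l) = A \<epsilon> k (Suc l)"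
      by (rule A_cong) (use 2 in \<open>simp add: up_def\<close>)
    moreover have u: "up j k = k" "up j (Suc l) = Suc (Suc l)" using 2 Suc.prems by (auto simp: up_def)
    moreover have "\<epsilon> j" using Suc.prems 2 u by simp
    moreover have "seg (Suc j) K + A \<epsilon> k j = A \<epsilon> k j + seg (Suc j) K"
      by (rule seg_A_comm) (use k 2 assms Suc.prems in auto)
    moreover have "seg j K = s j + seg (Suc j) K" using 2 Suc.prems by (intro seg_rec) simp
    ultimately show ?thesis using 2 A_step[of k j \<epsilon>] Suc.prems 
      by (simp add: add.assoc diff_conv_add_uminus del: add_uminus_conv_diff comp_apply)
  next
    case 3
    then have "up j k = Suc k" "up j (Suc l) = Suc (Suc k)" by (auto simp: up_def)
    then show ?thesis using 3 seg_shift[of j k K] Suc.prems assms by simp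
  next
    case 4
    have u: "up j l = Suc l" "up j (Suc l) = Suc (Suc l)" using 4 by (auto simp: up_def)
    have IH: "seg j K + A (\<epsilon> \<circ> up j) k l = A \<epsilon> (up j k) (Suc l) + seg j K"
      using Suc.IH 4 Suc.prems u by (auto simp: less_Suc_eq_le simp del: comp_apply)
    have sh: "seg j K + s l = s (Suc l) + seg j K" by (rule seg_shift) (use 4 Suc.prems assms in auto)
    have "s (Suc l) + (seg j K + - s l) = (seg j K + s l) + - s l" by (simp only: sh add.assoc)
    also have "\<dots> = seg j K" by (simp only: add.assoc right_minus add_0_right)
    finally have sh': "seg j K + - s l = - s (Suc l) + seg j K" by (metis minus_add_cancel)
    have ku: "up j k < Suc l" using u(1) up_less_iff[of j k l] 4 by simp
    have "seg j K + (g' + A (\<epsilon> \<circ> up j) k l - g') = (g + A \<epsilon> (up j k) (Suc l) - g) + seg j K"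
      if g: "seg j K + g' = g + seg j K" "seg j K + - g' = - g + seg j K" for g g'
    proof -
      have "seg j K + (g' + A (\<epsilon> \<circ> up j) k l - g') = (seg j K + g') + A (\<epsilon> \<circ> up j) k l + - g'"
        by (simp only: diff_conv_add_uminus add.assoc)
      also have "\<dots> = g + (seg j K + A (\<epsilon> \<circ> up j) k l) + - g'" unfolding g by (simp only: add.assoc)
      also have "\<dots> = g + A \<epsilon> (up j k) (Suc l) + (seg j K + - g')" unfolding IH by (simp only: add.assoc)
      also have "\<dots> = (g + A \<epsilon> (up j k) (Suc l) - g) + seg j K" unfolding g by (simp only: diff_conv_add_uminus add.assoc)
      finally show ?thesis .
    qed
    note C = this[of "s l" "s (Suc l)"] this[of "- s l" "- s (Suc l)"]
    have e: "(\<epsilon> \<circ> up j) l = \<epsilon> (Suc l)" by (simp add: u)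
    show ?thesis unfolding A_step[OF 4(2)] u A_step[OF ku] e using C sh sh' by (simp del: comp_apply)
  qed
qed simp

text \<open>The atom of the last two strands is absorbed by the runs, where it supplies the missing
  last letter of the shorter one. For neighbouring ends this is \<open>seg_shift_seg\<close>; a
  negative sign extends the atom by a letter that cancels against the run.\<close>

lemma A_seg_back:
  assumes k: "1 \<le> k" "k < l" and l: "l \<le> K" "K \<le> Suc n" and \<epsilon>: "\<And>i. k < i \<Longrightarrow> i < l \<Longrightarrow> \<not> \<epsilon> i"
  shows "A \<epsilon> k l + (seg l K + seg k (K - 1)) = seg l K + seg k K"
  using k(2) l(1) \<epsilon>
proof (induction l)
  case (Suc l)
  show ?case
  proof (cases "l = k")
    case True
    have "seg k K + seg k (K - 1) = seg (Suc k) (Suc (K - 1)) + seg k K"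
      by (rule seg_shift_seg) (use k l Suc.prems in auto)
    then show ?thesis using True Suc.prems seg_rec[of k K] by (simp add: add.assoc)
  next
    case False
    then have kl: "k < l" and e: "\<not> \<epsilon> l" using Suc.prems by auto
    have sg: "seg l K = s l + seg (Suc l) K" using Suc.prems by (intro seg_rec) simp
    have "A \<epsilon> k l + (seg l K + seg k (K - 1)) = seg l K + seg k K" using Suc kl by simp
    then show ?thesis using e by (simp add: A_step[OF kl] sg add.assoc)
  qed
qed simp

text \<open>Here \<open>w\<close> is read as a stack of strands, position by position. A half twist
  of the strands at the positions \<open>p\<close> and \<open>Suc p\<close> becomes a half twist
  along the chord of their points. The chord passes a point in between on the side that depends on
  whether that strand is later or earlier in the stack.\<close>

lemma Sig_conj:
  assumes "pinj (Suc m) w" "m \<le> n" "1 \<le> p" "p \<le> m" "w p < w (Suc p)"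
    "\<And>i. 1 \<le> i \<Longrightarrow> i \<le> Suc m \<Longrightarrow> w p < w i \<Longrightarrow> w i < w (Suc p) \<Longrightarrow> \<epsilon> (w i) \<longleftrightarrow> p < i"
  shows "Sig m w + s p = A \<epsilon> (w p) (w (Suc p)) + Sig m w"
  using assms
proof (induction m arbitrary: w \<epsilon>)
  case (Suc m)
  let ?N = "Suc (Suc m)"
  let ?j = "w ?N" 
  let ?w = "dl ?j w"
  have pw: "pinj (Suc m) ?w" by (rule pinj_dl[OF Suc.prems(1)])
  have ne: "w i \<noteq> ?j" if "1 \<le> i" "i \<le> Suc m" for i
    using pinj_neq[OF Suc.prems(1), of i ?N] that by auto
  have u: "up ?j (?w i) = w i" if "1 \<le> i" "i \<le> Suc m" for i
    using up_dl[of w i "?j"] ne[OF that] by simp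
  have j: "1 \<le> ?j" "?j \<le> ?N" using pinj_in[OF Suc.prems(1), of ?N] by auto
  show ?case
  proof (cases "p = Suc m")
    case False
    then have p: "p \<le> m" using Suc.prems by simp
    have lt: "?w p < ?w (Suc p)"
      using up_less_iff[of ?j "?w p" "?w (Suc p)"] u[of p] u[of "Suc p"] p Suc.prems by simp
    have IH: "Sig m ?w + s p = A (\<epsilon> \<circ> up ?j) (?w p) (?w (Suc p)) + Sig m ?w"
    proof (rule Suc.IH[OF pw _ Suc.prems(3) p lt])
      fix i assume i: "1 \<le> i" "i \<le> Suc m" "?w p < ?w i" "?w i < ?w (Suc p)"
      then have "w p < w i" "w i < w (Suc p)"
        using up_less_iff[of ?j] u[of p] u[of "Suc p"] u[of i] p Suc.prems by (metis Suc_le_mono le_SucI)+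
      then show "(\<epsilon> \<circ> up ?j) (?w i) \<longleftrightarrow> p < i" using Suc.prems(6)[of i] i u[of i] by simp
    qed (use Suc.prems in simp)
    have r: "1 \<le> ?w p" "?w (Suc p) \<le> Suc m"
      using pinj_in[OF pw, of p] pinj_in[OF pw, of "Suc p"] p Suc.prems by auto
    have "seg ?j ?N + A (\<epsilon> \<circ> up ?j) (?w p) (?w (Suc p)) = A \<epsilon> (up ?j (?w p)) (up ?j (?w (Suc p))) + seg ?j ?N"
    proof (rule seg_A)
      assume "up ?j (?w p) < ?j" "?j < up ?j (?w (Suc p))"
      then show "\<epsilon> ?j" using Suc.prems(6)[of ?N] u[of p] u[of "Suc p"] p Suc.prems by simp
    qed (use r lt j Suc.prems in auto)
    then have *: "seg ?j ?N + A (\<epsilon> \<circ> up ?j) (?w p) (?w (Suc p)) = A \<epsilon> (w p) (w (Suc p)) + seg ?j ?N"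
      using u[of p] u[of "Suc p"] p Suc.prems by simp
    have "Sig (Suc m) w + s p = seg ?j ?N + (Sig m ?w + s p)" by (simp only: Sig.simps add.assoc)
    also have "\<dots> = (seg ?j ?N + A (\<epsilon> \<circ> up ?j) (?w p) (?w (Suc p))) + Sig m ?w" unfolding IH by (simp only: add.assoc)
    also have "\<dots> = A \<epsilon> (w p) (w (Suc p)) + Sig (Suc m) w" unfolding * by (simp only: Sig.simps add.assoc)
    finally show ?thesis .
  next
    case True
    let ?k = "w (Suc m)"
    have kj: "?k < ?j" using Suc.prems True by simp
    have k1: "1 \<le> ?k" using pinj_in[OF Suc.prems(1), of "Suc m"] by simp
    \<comment> \<open>Since \<open>p\<close> is the last position but one, every point between the
      two ends occurs earlier in the arrangement than \<open>p\<close>.\<close>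
    have bk: "\<not> \<epsilon> i" if i: "?k < i" "i < ?j" for i
    proof -
      have "i \<in> w ` {1..?N}" using pinj_onto[OF Suc.prems(1)] i j k1 by auto
      then obtain t where t: "i = w t" "1 \<le> t" "t \<le> ?N" by auto
      then have "t \<noteq> ?N" using i by auto
      then show ?thesis using Suc.prems(6)[of t] t i True by auto
    qed
    have *: "A \<epsilon> ?k ?j + (seg ?j ?N + seg ?k (?N - 1)) = seg ?j ?N + seg ?k ?N"
      by (rule A_seg_back) (use kj k1 j Suc.prems bk in auto)
    have d: "?w (Suc m) = ?k" using kj by (simp add: dl_def)
    obtain T where T: "Sig (Suc m) w = seg ?j ?N + (seg ?k (Suc m) + T)" "T + s p = s p + T"
    proof (cases m)
      case 0
      then have "?k = 1" using kj k1 j by simp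
      then show ?thesis using that[of 0] 0 by simp
    next
      case (Suc m')
      have "pinj (Suc m') (dl ?k ?w)" using pinj_dl[of "Suc m'" ?w] pw d Suc by simp
      then have "Sig m' (dl ?k ?w) + s p = s p + Sig m' (dl ?k ?w)"
        by (rule Sig_comm) (use True Suc Suc.prems in auto)
      then show ?thesis using that[of "Sig m' (dl ?k ?w)"] d Suc by simp
    qed
    have "Sig (Suc m) w + s p = seg ?j ?N + (seg ?k (Suc m) + s p) + T" unfolding T(1) by (simp only: add.assoc T(2))
    also have "seg ?k (Suc m) + s p = seg ?k ?N" using kj j True by (simp add: seg_Suc)
    also have "seg ?j ?N + seg ?k ?N + T = A \<epsilon> ?k ?j + Sig (Suc m) w"
      unfolding *[symmetric] T(1) by (simp add: add.assoc)
    finally show ?thesis using True by simp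
  qed
qed simp

lemma run_mono:
  fixes w :: "nat \<Rightarrow> nat"
  assumes "\<And>p. p \<in> P \<Longrightarrow> w p < w (Suc p)" "{i..<j} \<subseteq> P" "i \<le> j"
  shows "w i \<le> w j"
  using assms(2,3)
proof (induction j)
  case (Suc j)
  show ?case
  proof (cases "i = Suc j")
    case False
    then have "{i..<j} \<subseteq> P" "j \<in> P" "i \<le> j" using Suc.prems by auto
    then have "w i \<le> w j" "j \<in> P" using Suc.IH by auto
    then show ?thesis using assms(1)[of j] by simp
  qed simp
qed simp

text \<open>A product of distinct simple transpositions moves a position only along a run of the
  positions used, so multiplying an increasing arrangement by it always increases the length.\<close>

lemma Sig_mult_distinct:
  assumes w: "pinj (Suc n) w" and inc: "\<And>p. p \<in> set qs \<Longrightarrow> 1 \<le> p \<and> p \<le> n \<and> w p < w (Suc p)" and d: "distinct qs"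
  shows "\<exists>u. pinj (Suc n) u \<and> Sig n w + sum_list (map s qs) = Sig n u"
proof -
  have "\<exists>g. g permutes {1..Suc n} \<and> (\<forall>i. {min i (g i)..<max i (g i)} \<subseteq> set qs) \<and>
    Sig n w + sum_list (map s qs) = Sig n (w \<circ> g)"
    using inc d
  proof (induction qs rule: rev_induct)
    case Nil
    have "w \<circ> id = w" by (rule comp_id)
    show ?case
    proof (intro exI conjI)
      show "id permutes {1..Suc n}" by (rule permutes_id)
    qed (simp_all add: \<open>w \<circ> id = w\<close> del: comp_id)
  next
    case (snoc p qs)
    have "\<exists>g. g permutes {1..Suc n} \<and> (\<forall>i. {min i (g i)..<max i (g i)} \<subseteq> set qs) \<and>
      Sig n w + sum_list (map s qs) = Sig n (w \<circ> g)"
      by (rule snoc.IH) (use snoc.prems in auto)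
    then obtain g where g: "g permutes {1..Suc n}" "\<And>i. {min i (g i)..<max i (g i)} \<subseteq> set qs" 
      "Sig n w + sum_list (map s qs) = Sig n (w \<circ> g)" by blast
    have p: "1 \<le> p" "p \<le> n" "p \<notin> set qs" using snoc.prems by auto
    \<comment> \<open>The position \<open>p\<close> has not been used yet, so \<open>g\<close> can
      move neither \<open>p\<close> upwards nor \<open>Suc p\<close> downwards across it.\<close>
    have gp: "g p \<le> p" using g(2)[of p] p(3) by (cases "p < g p") (auto simp: subset_iff)
    have gp': "Suc p \<le> g (Suc p)" using g(2)[of "Suc p"] p(3) by (cases "g (Suc p) < Suc p") (auto simp: subset_iff)
    have pinc: "w q < w (Suc q)" if "q \<in> set (qs @ [p])" for q using snoc.prems that by auto
    have i1: "{g p..<p} \<subseteq> set qs" "{Suc p..<g (Suc p)} \<subseteq> set qs" using g(2)[of p] g(2)[of "Suc p"] gp gp' by simp_all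
    have "w (g p) \<le> w p" "w (Suc p) \<le> w (g (Suc p))"
      using run_mono[of "set qs" w, OF _ i1(1) gp] run_mono[of "set qs" w, OF _ i1(2) gp'] pinc by auto
    moreover have "w p < w (Suc p)" using pinc by simp
    ultimately have lt: "(w \<circ> g) p < (w \<circ> g) (Suc p)" by simp
    have "pinj (Suc n) (w \<circ> g)"
      using w permutes_inj_on[OF g(1)] permutes_image[OF g(1)] unfolding pinj_def
      by (metis comp_inj_on image_comp)
    from Sig_lift[OF this order.refl p(1,2) lt]
    have "Sig n w + sum_list (map s (qs @ [p])) = Sig n (w \<circ> (g \<circ> tr p (Suc p)))"
      using g(3) by (simp add: add.assoc[symmetric] comp_assoc del: comp_apply)
    moreover have "g \<circ> tr p (Suc p) permutes {1..Suc n}"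
      by (rule permutes_compose[OF tr_permutes g(1)]) (use p in auto)
    moreover have "{min i ((g \<circ> tr p (Suc p)) i)..<max i ((g \<circ> tr p (Suc p)) i)} \<subseteq> set (qs @ [p])" for i
    proof -
      consider "i = p" | "i = Suc p" | "i \<noteq> p" "i \<noteq> Suc p" by blast
      then show ?thesis
      proof cases
        case 1
        then have "{min i ((g \<circ> tr p (Suc p)) i)..<max i ((g \<circ> tr p (Suc p)) i)} = {p..<g (Suc p)}" using gp' by simp
        also have "\<dots> \<subseteq> insert p {Suc p..<g (Suc p)}" by auto
        finally show ?thesis using i1 by auto
      next
        case 2
        then have "{min i ((g \<circ> tr p (Suc p)) i)..<max i ((g \<circ> tr p (Suc p)) i)} = {g p..<Suc p}" using gp by simp
        also have "\<dots> \<subseteq> insert p {g p..<p}" by auto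
        finally show ?thesis using i1 by auto
      next
        case 3
        then show ?thesis using g(2)[of i] by auto
      qed
    qed
    ultimately show ?case by blast
  qed
  then obtain g where g: "g permutes {1..Suc n}" "Sig n w + sum_list (map s qs) = Sig n (w \<circ> g)" by blast
  have "pinj (Suc n) (w \<circ> g)"
    using w permutes_inj_on[OF g(1)] permutes_image[OF g(1)] unfolding pinj_def
    by (metis comp_inj_on image_comp)
  then show ?thesis using g(2) by blast
qed

end

subsection \<open>Edges of noncrossing partitions\<close>

lemma same_eq_abs_len:
  assumes "x permutes {1..M}" "a \<in> {1..M}" "b \<in> {1..M}" "a \<noteq> b"
  shows "same M x a b \<longleftrightarrow> Suc (abs_len M (x \<circ> tr a b)) = abs_len M x"
  using abs_len_tr[OF assms] assms(4) unfolding same_def by linarith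

lemma pb_down:
  assumes "m \<le> n" "a \<in> {1..Suc m}" "b \<in> {1..Suc m}" "d \<in> {1..Suc m}" "e \<in> {1..Suc m}"
  shows "pb \<epsilon> n a b d e = pb \<epsilon> m a b d e"
  using assms(1)
proof (induction n)
  case (Suc n)
  show ?case
  proof (cases "m = Suc n")
    case False
    then show ?thesis using Suc assms pb_Suc[of a n b d e \<epsilon>] by auto
  qed simp
qed simp

text \<open>Neighbours in numerical order, not along the cycle: a polygon is represented by the
  chords between horizontally consecutive vertices.\<close>

definition edge :: "nat \<Rightarrow> (nat \<Rightarrow> nat) \<Rightarrow> nat \<Rightarrow> nat \<Rightarrow> bool"
  where "edge M x k l \<longleftrightarrow> 1 \<le> k \<and> k < l \<and> l \<le> M \<and> same M x k l \<and> (\<forall>m. k < m \<and> m < l \<longrightarrow> \<not> same M x k m)"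

lemma below_right:
  assumes "below M (a \<circ> p) c" "a permutes {1..M}" "p permutes {1..M}" 
    "abs_len M a + abs_len M p \<le> abs_len M (a \<circ> p)"
  shows "below M a c" "below M p c"
  using below_trans_mid[OF assms(1) permutes_id assms(2,3)] below_trans_mid[OF assms(1) assms(2,3) permutes_id] assms(4)
  by (simp_all del: comp_apply)

lemma abs_len_pair:
  assumes "k \<in> {1..M}" "l \<in> {1..M}" "k \<noteq> l"
  shows "abs_len (Suc M) (tr k (Suc M) \<circ> tr l (Suc M)) = 2"
proof -
  have "tr k (Suc M) \<circ> tr l (Suc M) = tr l k \<circ> tr k (Suc M)"
    using assms tr_move_top[of k l "Suc M" id] by (simp only: id_comp) simp
  moreover have "abs_len (Suc M) (tr l k \<circ> tr k (Suc M)) = Suc (abs_len M (tr l k))"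
    using assms by (intro abs_len_move tr_permutes)
  ultimately show ?thesis using abs_len_single[of l M k] assms by simp
qed

text \<open>On an ellipse the two neighbours of the rightmost vertex of a polygon lie on different sides;
  the second vertex from the right is one of them.\<close>

lemma second_largest:
  assumes y: "y permutes {1..M}" and k: "k \<in> {1..M}" and x: "x = y \<circ> tr k (Suc M)" 
    and M: "M \<le> n" and below: "below (Suc n) x (cox \<epsilon> n)"
    and K: "K \<in> {1..M}" "same (Suc M) x K (Suc M)" "\<And>b. b \<in> {1..M} \<Longrightarrow> same (Suc M) x b (Suc M) \<Longrightarrow> b \<le> K"
  shows "k = K \<or> x (Suc M) = K"
proof (rule ccontr)
  let ?N = "Suc M"
  assume neg: "\<not> (k = K \<or> x ?N = K)"
  have xp: "x permutes {1..?N}" unfolding x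
    by (rule permutes_compose[OF tr_permutes permutes_mono[OF y]]) (use k in auto)
  have al: "abs_len (Suc n) z = abs_len ?N z" if "z permutes {1..?N}" for z
    using abs_len_mono[OF that, of "Suc n"] M by simp
  have bel: "pb \<epsilon> M a ?N b ?N" if P: "below (Suc n) (tr a ?N \<circ> tr b ?N) (cox \<epsilon> n)" 
    and ab: "a \<in> {1..M}" "b \<in> {1..M}" "a \<noteq> b" for a b
  proof -
    have "tr a ?N \<circ> tr b ?N permutes {1..?N}" using ab by (intro permutes_compose tr_permutes) auto
    then have "abs_len (Suc n) (tr a ?N \<circ> tr b ?N) = 2" using abs_len_pair[OF ab] al by simp
    then have "pb \<epsilon> n a ?N b ?N" using pair_below_of_below[OF P] by simp
    then show ?thesis using pb_down[OF M, of a ?N b ?N \<epsilon>] ab by auto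
  qed
  have kK: "k < K"
  proof -
    have "same ?N x k ?N" unfolding x using same_move_top[OF y k k] by simp
    then show ?thesis using K(3)[OF k] neg by simp
  qed
  \<comment> \<open>The chords from \<open>k\<close> and \<open>K\<close> to the top point split off
    on the right of \<open>x\<close>. Their product is a divisor, and \<open>pb_triangle\<close>
    reads off the sign of the middle point \<open>K\<close>.\<close>
  have "\<epsilon> K"
  proof (rule pb_triangle(1))
    have sKk: "same M y K k" using K(2) unfolding x same_move_top[OF y k K(1)] .
    define P where "P = tr k ?N \<circ> tr K ?N"
    define a where "a = y \<circ> tr K k"
    have a: "a permutes {1..M}" unfolding a_def using y k K by (intro permutes_compose tr_permutes)
    have P: "P permutes {1..?N}" unfolding P_def using k K by (intro permutes_compose tr_permutes) auto
    have "P = tr K k \<circ> tr k ?N"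
      unfolding P_def using kK k K tr_move_top[of k K ?N id] by (simp only: id_comp) simp
    then have xa: "x = a \<circ> P" unfolding x a_def by (simp only: o_assoc tr_cancel)
    have "Suc (abs_len M a) = abs_len M y"
      unfolding a_def using same_eq_abs_len[OF y K(1) k] kK sKk by simp
    moreover have "abs_len ?N x = Suc (abs_len M y)" unfolding x by (rule abs_len_move[OF y k])
    moreover have "abs_len ?N P = 2" unfolding P_def using kK by (intro abs_len_pair k K) simp
    ultimately have "abs_len (Suc n) a + abs_len (Suc n) P \<le> abs_len (Suc n) (a \<circ> P)"
      using al[OF P] al[OF xp] al[OF permutes_mono[OF a, of ?N]] abs_len_fix[OF a] xa by simp
    then have "below (Suc n) P (cox \<epsilon> n)"
      using below_right(2)[of "Suc n" a P] below xa permutes_mono[OF a, of "Suc n"] permutes_mono[OF P, of "Suc n"] M by simp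
    then show "pb \<epsilon> M k ?N K ?N" using bel k K kK by (simp add: P_def)
  qed (use kK K k in auto)
  \<comment> \<open>The mirror image: \<open>k\<close> is the preimage of the top point and
    \<open>k'\<close> its image, so now two chords split off on the left, in the other order, and
    the sign comes out opposite.\<close>
  moreover have "\<not> \<epsilon> K"
  proof -
    define k' where "k' = x ?N"
    have k': "k' \<in> {1..M}"
    proof -
      have "y k \<in> {1..M}" using y k by (metis permutes_in_image)
      then show ?thesis by (simp add: k'_def x)
    qed
    define y' where "y' = tr k' ?N \<circ> x"
    have y'1: "y' permutes {1..?N}" unfolding y'_def using k' by (intro permutes_compose tr_permutes xp) auto
    then have y': "y' permutes {1..M}" by (rule permutes_SucD) (simp add: y'_def k'_def)
    have xy': "x = tr k' ?N \<circ> y'" unfolding y'_def by (simp only: o_assoc transpose_comp_involutory id_comp)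
    have t: "tr a ?N permutes {1..?N}" if "a \<in> {1..M}" for a using that by (intro tr_permutes) auto
    have lx: "abs_len ?N x = Suc (abs_len M y')"
      unfolding xy' abs_len_swap[OF t[OF k'] y'1] by (rule abs_len_move[OF y' k'])
    have "same ?N x k' ?N"
    proof -
      have "abs_len ?N (x \<circ> tr k' ?N) = abs_len ?N (tr k' ?N \<circ> x)" by (rule abs_len_swap[OF xp t[OF k']])
      also have "\<dots> = abs_len M y'" unfolding y'_def[symmetric] by (rule abs_len_fix[OF y'])
      finally show ?thesis using lx by (simp add: same_def)
    qed
    then have k'K: "k' < K" using K(3)[OF k'] neg by (simp add: k'_def)
    show ?thesis
    proof (rule pb_triangle(2))
      define P where "P = tr K ?N \<circ> tr k' ?N"
      define b where "b = tr K k' \<circ> y'"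
      have b: "b permutes {1..M}" unfolding b_def using y' k' K by (intro permutes_compose tr_permutes)
      have P: "P permutes {1..?N}" unfolding P_def using k' K by (intro permutes_compose tr_permutes) auto
      have "P = tr k' K \<circ> tr K ?N"
        unfolding P_def using k'K k' K tr_move_top[of K k' ?N id] by (simp only: id_comp) simp
      also have "\<dots> = tr k' ?N \<circ> tr k' K" using k'K k' K by (subst tr_tr) simp
      finally have xb: "x = P \<circ> b" unfolding xy' b_def by (simp only: comp_assoc transpose_commute[of K k'])
        (simp only: o_assoc tr_cancel)
      have tt: "tr K ?N \<circ> tr k' ?N = tr k' K \<circ> tr K ?N"
        using k'K k' K by (subst tr_tr) simp
      have tp: "tr k' K permutes {1..M}" using k' K by (intro tr_permutes)
      have "abs_len ?N (x \<circ> tr K ?N) = abs_len ?N (tr K ?N \<circ> x)" by (rule abs_len_swap[OF xp t[OF K(1)]])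
      also have "tr K ?N \<circ> x = tr k' K \<circ> tr K ?N \<circ> y'" unfolding xy' by (simp only: o_assoc tt)
      also have "abs_len ?N (tr k' K \<circ> tr K ?N \<circ> y') = abs_len ?N (y' \<circ> (tr k' K \<circ> tr K ?N))"
        by (intro abs_len_swap permutes_compose t K y'1 permutes_mono[OF tp]) simp
      also have "\<dots> = abs_len ?N ((y' \<circ> tr k' K) \<circ> tr K ?N)" by (simp only: o_assoc)
      also have "\<dots> = Suc (abs_len M (y' \<circ> tr k' K))" by (intro abs_len_move permutes_compose tp y' K)
      also have "abs_len M (y' \<circ> tr k' K) = abs_len M b" 
        unfolding b_def transpose_commute[of K k'] by (rule abs_len_swap[OF y' tp])
      finally have "abs_len ?N (x \<circ> tr K ?N) = Suc (abs_len M b)" .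
      moreover have "abs_len ?N (x \<circ> tr K ?N) < abs_len ?N x" using K(1,2) unfolding same_def by fastforce
      ultimately have "Suc (abs_len M b) < abs_len ?N x" by (simp only:)
      moreover have "abs_len ?N P = 2" unfolding P_def using k'K by (intro abs_len_pair k' K) simp
      moreover have "abs_len M y' \<le> Suc (abs_len M b)"
        unfolding b_def using abs_len_tr_left[OF y' K(1) k'] k'K by auto
      ultimately have "abs_len (Suc n) P + abs_len (Suc n) b \<le> abs_len (Suc n) (P \<circ> b)"
        using al[OF P] al[OF xp] al[OF permutes_mono[OF b, of ?N]] abs_len_fix[OF b] xb lx by simp
      then have "below (Suc n) P (cox \<epsilon> n)"
        using below_right(1)[of "Suc n" P b] below xb permutes_mono[OF b, of "Suc n"] permutes_mono[OF P, of "Suc n"] M by simp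
      then show "pb \<epsilon> M K ?N k' ?N" using bel k' K k'K by (simp add: P_def)
    qed (use k'K K k' in auto)
  qed
  ultimately show False by simp
qed

text \<open>If the top point is not fixed, \<open>second_largest\<close> makes the edge that ends
  there a first or a last letter of \<open>x\<close>. Removing it frees the top point from its cycle
  and leaves all other cycle memberships unchanged, so every edge is used once.\<close>

lemma edge_word:
  assumes "x permutes {1..M}" "M \<le> Suc n" "below (Suc n) x (cox \<epsilon> n)"
  shows "\<exists>ws. (\<forall>(k, l) \<in> set ws. edge M x k l) \<and> distinct ws \<and> tprod ws = x \<and> length ws = abs_len M x"
  using assms
proof (induction M arbitrary: x)
  case 0
  then have "x = id" by simp
  then show ?case by (intro exI[of _ "[]"]) simp
next
  case (Suc M)
  let ?N = "Suc M"
  have al: "abs_len (Suc n) z = abs_len ?N z" if "z permutes {1..?N}" for z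
    using abs_len_mono[OF that, of "Suc n"] Suc.prems by simp
  have lift: "edge ?N x k l" if e: "edge M y k l" 
    and s: "\<And>a b. a \<in> {1..M} \<Longrightarrow> b \<in> {1..M} \<Longrightarrow> same ?N x a b = same M y a b" for y k l
    using e s unfolding edge_def by auto
  from Suc.prems(1) show ?case
  proof (cases rule: perm_Suc_cases)
    case fixed
    from Suc.IH[OF fixed _ Suc.prems(3)] Suc.prems(2) obtain ws where
      "\<forall>(k, l) \<in> set ws. edge M x k l" "distinct ws" "tprod ws = x" "length ws = abs_len M x" by auto
    then show ?thesis using lift same_fix_low[OF fixed] abs_len_fix[OF fixed] by (intro exI[of _ ws]) auto
  next
    case (move y k)
    define S where "S = {b \<in> {1..M}. same ?N x b ?N}"
    have kS: "k \<in> S" unfolding S_def move(3) using move(2) same_move_top[OF move(1,2,2)] by simp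
    have fS: "finite S" unfolding S_def by simp
    define K where "K = Max S"
    have KS: "K \<in> S" unfolding K_def using fS kS by (intro Max_in) auto
    then have K: "K \<in> {1..M}" "same ?N x K ?N" by (auto simp: S_def)
    have Kmax: "b \<le> K" if "b \<in> {1..M}" "same ?N x b ?N" for b
      unfolding K_def using fS that by (intro Max_ge) (auto simp: S_def)
    have edgeK: "edge ?N x K ?N" unfolding edge_def
    proof (intro conjI allI impI)
      fix m assume m: "K < m \<and> m < ?N"
      show "\<not> same ?N x K m"
      proof
        assume "same ?N x K m"
        then have "same ?N x m ?N"
          using same_trans[OF Suc.prems(1), of m K ?N] K m same_sym by auto
        then show False using Kmax[of m] m by auto
      qed
    qed (use K in auto)
    have Kp: "tr K ?N permutes {1..?N}" using K by (intro tr_permutes) auto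
    from second_largest[OF move _ Suc.prems(3) K Kmax] Suc.prems(2)
    have "k = K \<or> x ?N = K" by simp
    then obtain y where y: "y permutes {1..M}" "abs_len ?N x = Suc (abs_len M y)" "below (Suc n) y (cox \<epsilon> n)"
      and s: "\<And>a b. a \<in> {1..M} \<Longrightarrow> b \<in> {1..M} \<Longrightarrow> same ?N x a b = same M y a b"
      and or: "x = y \<circ> tr K ?N \<or> x = tr K ?N \<circ> y"
    proof (elim disjE)
      assume kK: "k = K"
      have len: "abs_len ?N x = Suc (abs_len M y)" unfolding move(3) by (rule abs_len_move[OF move(1,2)])
      have "below (Suc n) y (cox \<epsilon> n)"
      proof (rule below_right(1))
        show "below (Suc n) (y \<circ> tr K ?N) (cox \<epsilon> n)" using Suc.prems(3) unfolding move(3) kK .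
        show "abs_len (Suc n) y + abs_len (Suc n) (tr K ?N) \<le> abs_len (Suc n) (y \<circ> tr K ?N)"
        proof -
          have "abs_len (Suc n) (y \<circ> tr K ?N) = Suc (abs_len M y)"
            using al[OF Suc.prems(1)] len unfolding move(3) kK by (simp only:)
          then show ?thesis using al[OF permutes_mono[OF move(1), of ?N]] abs_len_fix[OF move(1)] al[OF Kp] 
            abs_len_single[of K ?N ?N] K(1) by simp
        qed
      qed (use permutes_mono[OF move(1)] permutes_mono[OF Kp] Suc.prems(2) in simp_all)
      then show ?thesis using that[OF move(1) len] same_move_low[OF move(1,2)] move(3) kK by blast
    next
      assume xK: "x ?N = K"
      define y' where "y' = tr K ?N \<circ> x"
      have y'1: "y' permutes {1..?N}" unfolding y'_def by (intro permutes_compose Kp Suc.prems)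
      then have y': "y' permutes {1..M}" by (rule permutes_SucD) (simp add: y'_def xK)
      have xy': "x = tr K ?N \<circ> y'" unfolding y'_def by (simp only: o_assoc transpose_comp_involutory id_comp)
      have L: "abs_len ?N (tr K ?N \<circ> z) = Suc (abs_len M z)" if z: "z permutes {1..M}" for z
      proof -
        have "z permutes {1..?N}" using permutes_mono[OF z] by simp
        from abs_len_swap[OF Kp this] show ?thesis using abs_len_move[OF z K(1)] by simp
      qed
      have "below (Suc n) y' (cox \<epsilon> n)"
      proof (rule below_right(2))
        show "below (Suc n) (tr K ?N \<circ> y') (cox \<epsilon> n)" using Suc.prems(3) unfolding xy'[symmetric] .
        show "abs_len (Suc n) (tr K ?N) + abs_len (Suc n) y' \<le> abs_len (Suc n) (tr K ?N \<circ> y')"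
        proof -
          have "abs_len (Suc n) (tr K ?N \<circ> y') = Suc (abs_len M y')"
            using al[OF Suc.prems(1)] L[OF y'] unfolding xy'[symmetric] by (simp only:)
          then show ?thesis using al[OF permutes_mono[OF y', of ?N]] abs_len_fix[OF y'] al[OF Kp] 
            abs_len_single[of K ?N ?N] K(1) by simp
        qed
      qed (use permutes_mono[OF y'] permutes_mono[OF Kp] Suc.prems(2) in simp_all)
      moreover have "same ?N x a b = same M y' a b" if ab: "a \<in> {1..M}" "b \<in> {1..M}" for a b
      proof -
        have "y' \<circ> tr a b permutes {1..M}" using ab y' by (intro permutes_compose tr_permutes)
        then show ?thesis unfolding same_def xy' comp_assoc L[OF y'] by (simp only: L) simp
      qed
      ultimately show ?thesis using that[OF y'] L[OF y'] xy' by metis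
    qed
    from Suc.IH[OF y(1) _ y(3)] Suc.prems(2) obtain ws where
      ws: "\<forall>(k, l) \<in> set ws. edge M y k l" "distinct ws" "tprod ws = y" "length ws = abs_len M y" by auto
    have e: "\<forall>(k, l) \<in> set ws. edge ?N x k l" using ws(1) lift[OF _ s] by auto
    have new: "(K, ?N) \<notin> set ws" using ws(1) by (auto simp: edge_def)
    have "tprod (ws @ [(K, ?N)]) = y \<circ> tr K ?N" "tprod ((K, ?N) # ws) = tr K ?N \<circ> y"
      using ws(3) by (simp_all only: tprod_append tprod_simps comp_id)
    note P = this
    from or show ?thesis
    proof
      assume "x = y \<circ> tr K ?N"
      then have "tprod (ws @ [(K, ?N)]) = x" using P(1) by (simp only:)
      moreover have "length (ws @ [(K, ?N)]) = abs_len ?N x" "distinct (ws @ [(K, ?N)])"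
        "\<forall>(k, l) \<in> set (ws @ [(K, ?N)]). edge ?N x k l"
        using ws y(2) new e edgeK by auto
      ultimately show ?thesis by blast
    next
      assume "x = tr K ?N \<circ> y"
      then have "tprod ((K, ?N) # ws) = x" using P(2) by (simp only:)
      moreover have "length ((K, ?N) # ws) = abs_len ?N x" "distinct ((K, ?N) # ws)"
        "\<forall>(k, l) \<in> set ((K, ?N) # ws). edge ?N x k l"
        using ws y(2) new e edgeK by auto
      ultimately show ?thesis by blast
    qed
  qed
qed

text \<open>Chords of two different cycles split off one after the other, so their product has
  length two and divides the Coxeter element. In the picture: different polygons do not
  cross.\<close>

lemma same_pair_below:
  assumes x: "x permutes {1..Suc n}" "below (Suc n) x (cox \<epsilon> n)"
    and in': "a \<in> {1..Suc n}" "b \<in> {1..Suc n}" "d \<in> {1..Suc n}" "e \<in> {1..Suc n}" "a \<noteq> b" "d \<noteq> e"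
    and s: "same (Suc n) x a b" "same (Suc n) x d e" "\<not> same (Suc n) x a d"
  shows "pb \<epsilon> n d e a b"
proof -
  let ?M = "Suc n"
  define P where "P = tr d e \<circ> tr a b"
  define z where "z = x \<circ> tr a b \<circ> tr d e"
  have p1: "x \<circ> tr a b permutes {1..?M}" using x in' by (intro permutes_compose tr_permutes)
  have p: "tr d e permutes {1..?M}" "tr a b permutes {1..?M}" by (rule tr_permutes[OF in'(3,4)], rule tr_permutes[OF in'(1,2)])
  have zp: "z permutes {1..?M}" unfolding z_def by (intro permutes_compose p1 p)
  have Pp: "P permutes {1..?M}" unfolding P_def by (intro permutes_compose p)
  have "Suc (abs_len ?M (x \<circ> tr a b)) = abs_len ?M x"
    using same_eq_abs_len[OF x(1) in'(1,2,5)] s(1) by simp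
  moreover have "Suc (abs_len ?M z) = abs_len ?M (x \<circ> tr a b)"
    unfolding z_def using same_eq_abs_len[OF p1 in'(3,4,6)] same_disjoint[OF x(1) in'(1-4) s] by simp
  ultimately have lx: "abs_len ?M x = abs_len ?M z + 2" by simp
  have xz: "x = z \<circ> P" unfolding z_def P_def by (simp only: o_assoc tr_cancel)
  have "abs_len ?M P \<le> 2"
    using abs_len_comp[OF p] abs_len_single[OF in'(1,2,5)] abs_len_single[OF in'(3,4,6)] by (simp add: P_def)
  moreover have "abs_len ?M x \<le> abs_len ?M z + abs_len ?M P" unfolding xz by (rule abs_len_comp[OF zp Pp])
  ultimately have lP: "abs_len ?M P = 2" using lx by simp
  have "below ?M P (cox \<epsilon> n)"
    by (rule below_right(2)[OF _ zp Pp]) (use x(2) xz lx lP in \<open>simp_all del: comp_apply\<close>)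
  then show ?thesis using lP pair_below_of_below unfolding P_def by blast
qed

text \<open>Sweeping from left to right, a polygon is put in front of or behind all polygons met so far,
  according to the side of its first vertex. Noncrossing makes this a valid layering.\<close>

lemma layering:
  assumes x: "x permutes {1..Suc n}" "below (Suc n) x (cox \<epsilon> n)"
  shows "\<exists>w. pinj (Suc n) w \<and> (\<forall>k l. edge (Suc n) x k l \<longrightarrow>
    (\<exists>p. 1 \<le> p \<and> p \<le> n \<and> w p = k \<and> w (Suc p) = l \<and>
      (\<forall>i. 1 \<le> i \<and> i \<le> Suc n \<and> k < w i \<and> w i < l \<longrightarrow> (\<epsilon> (w i) \<longleftrightarrow> p < i))))"
proof -
  let ?M = "Suc n"
  let ?s = "same ?M x"
  \<comment> \<open>\<open>\<mu>\<close> is the first vertex of the polygon of a point and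
    \<open>key\<close> the level of that polygon. A polygon that starts later has a larger absolute
    level and so lies above or below all earlier ones. \<open>f\<close> encodes the lexicographic
    order by level and vertex, since the vertices are smaller than the factor.\<close>
  define \<mu> where "\<mu> m = Min {b \<in> {1..?M}. ?s b m}" for m
  define key where "key m = (if \<epsilon> (\<mu> m) then int (\<mu> m) else - int (\<mu> m))" for m
  define f where "f m = key m * int (Suc ?M) + int m" for m
  have \<mu>: "\<mu> m \<in> {1..?M}" "?s (\<mu> m) m" "\<mu> m \<le> m" if "m \<in> {1..?M}" for m
  proof -
    have "m \<in> {b \<in> {1..?M}. ?s b m}" using that by simp
    then have "\<mu> m \<in> {b \<in> {1..?M}. ?s b m}" unfolding \<mu>_def by (intro Min_in) auto
    then show "\<mu> m \<in> {1..?M}" "?s (\<mu> m) m" by auto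
    show "\<mu> m \<le> m" unfolding \<mu>_def using that by (intro Min_le) auto
  qed
  have tr: "?s a d" if "a \<in> {1..?M}" "b \<in> {1..?M}" "d \<in> {1..?M}" "?s a b" "?s b d" for a b d
    by (rule same_trans[OF x(1) that])
  have \<mu>_cong: "\<mu> a = \<mu> b" if "a \<in> {1..?M}" "b \<in> {1..?M}" "?s a b" for a b
  proof -
    have "{z \<in> {1..?M}. ?s z a} = {z \<in> {1..?M}. ?s z b}" using tr that same_sym by blast
    then show ?thesis by (simp add: \<mu>_def)
  qed
  have same_iff: "?s a b \<longleftrightarrow> \<mu> a = \<mu> b" if ab: "a \<in> {1..?M}" "b \<in> {1..?M}" for a b
  proof
    assume "\<mu> a = \<mu> b"
    then show "?s a b" using tr[of a "\<mu> a" b] \<mu>[OF ab(1)] \<mu>[OF ab(2)] ab same_sym by metis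
  qed (rule \<mu>_cong[OF ab])
  have key_iff: "key a = key b \<longleftrightarrow> ?s a b" if ab: "a \<in> {1..?M}" "b \<in> {1..?M}" for a b
    unfolding same_iff[OF ab] key_def using \<mu>(1)[OF ab(1)] \<mu>(1)[OF ab(2)] by (auto split: if_splits)
  have f_less: "f a < f b" if "key a < key b" "a \<in> {1..?M}" "b \<in> {1..?M}" for a b
  proof -
    have "f a < (key a + 1) * int (Suc ?M)" using that(2) by (simp add: f_def algebra_simps)
    also have "\<dots> \<le> key b * int (Suc ?M)" using that(1) by (intro mult_right_mono) auto
    also have "\<dots> < f b" using that(3) by (simp add: f_def)
    finally show ?thesis .
  qed
  have f_iff: "f a < f b \<longleftrightarrow> key a < key b \<or> (key a = key b \<and> a < b)" if ab: "a \<in> {1..?M}" "b \<in> {1..?M}" for a b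
    using f_less[OF _ ab] f_less[OF _ ab(2,1)] by (cases "key a" "key b" rule: linorder_cases) (auto simp: f_def)
  have f_inj: "a = b" if ab: "a \<in> {1..?M}" "b \<in> {1..?M}" "f a = f b" for a b
    using f_iff[OF ab(1,2)] f_iff[OF ab(2,1)] ab(3) by auto

  \<comment> \<open>The rank in the order given by \<open>f\<close>; the arrangement
    \<open>w\<close> is its inverse.\<close>
  define pos where "pos m = card {z \<in> {1..?M}. f z \<le> f m}" for m
  have pos_mono: "pos a < pos b" if "f a < f b" "b \<in> {1..?M}" for a b
    unfolding pos_def
  proof (rule psubset_card_mono)
    have "b \<in> {z \<in> {1..?M}. f z \<le> f b}" "b \<notin> {z \<in> {1..?M}. f z \<le> f a}" using that by auto
    moreover have "{z \<in> {1..?M}. f z \<le> f a} \<subseteq> {z \<in> {1..?M}. f z \<le> f b}" using that by auto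
    ultimately show "{z \<in> {1..?M}. f z \<le> f a} \<subset> {z \<in> {1..?M}. f z \<le> f b}" by blast
  qed simp
  have pos_iff: "pos a < pos b \<longleftrightarrow> f a < f b" if "a \<in> {1..?M}" "b \<in> {1..?M}" for a b
    using pos_mono[OF _ that(2), of a] pos_mono[OF _ that(1), of b] f_inj[OF that]
    by (cases "f a" "f b" rule: linorder_cases) auto
  have pos_in: "pos m \<in> {1..?M}" if "m \<in> {1..?M}" for m
  proof -
    have "{m} \<subseteq> {z \<in> {1..?M}. f z \<le> f m}" using that by auto
    then have "card {m} \<le> pos m" unfolding pos_def by (intro card_mono) auto
    moreover have "pos m \<le> card {1..?M}" unfolding pos_def by (intro card_mono) auto
    ultimately show ?thesis by simp
  qed
  have pos_inj: "inj_on pos {1..?M}"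
    by (rule inj_onI) (metis pos_iff f_inj linorder_neq_iff)
  have pos_bij: "pos ` {1..?M} = {1..?M}"
    by (rule endo_inj_surj[OF finite_atLeastAtMost _ pos_inj]) (use pos_in in blast)
  define w where "w = inv_into {1..?M} pos"
  have w_pos: "w (pos m) = m" if "m \<in> {1..?M}" for m
    unfolding w_def by (rule inv_into_f_f[OF pos_inj that])
  have pos_w: "pos (w i) = i" if "i \<in> {1..?M}" for i
    unfolding w_def by (rule f_inv_into_f) (use pos_bij that in blast)
  have w_in: "w i \<in> {1..?M}" if "i \<in> {1..?M}" for i
    unfolding w_def by (rule inv_into_into) (use pos_bij that in blast)
  have "pinj ?M w"
    unfolding pinj_def using w_in pos_w by (intro conjI inj_on_inverseI[of _ pos]) blast+
  moreover have "\<exists>p. 1 \<le> p \<and> p \<le> n \<and> w p = k \<and> w (Suc p) = l \<and>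
      (\<forall>i. 1 \<le> i \<and> i \<le> ?M \<and> k < w i \<and> w i < l \<longrightarrow> (\<epsilon> (w i) \<longleftrightarrow> p < i))" if e: "edge ?M x k l" for k l
  proof -
    have kl: "k \<in> {1..?M}" "l \<in> {1..?M}" "k < l" "?s k l" and gap: "\<And>m. k < m \<Longrightarrow> m < l \<Longrightarrow> \<not> ?s k m"
      using e by (auto simp: edge_def)
    have keq: "key k = key l" using key_iff[OF kl(1,2)] kl(4) by simp
    \<comment> \<open>Nothing lies between \<open>k\<close> and \<open>l\<close> in the order
      \<open>f\<close>, so their ranks are consecutive.\<close>
    have "{z \<in> {1..?M}. f z \<le> f l} = insert l {z \<in> {1..?M}. f z \<le> f k}"
    proof (intro equalityI subsetI)
      fix z assume z: "z \<in> {z \<in> {1..?M}. f z \<le> f l}"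
      show "z \<in> insert l {z \<in> {1..?M}. f z \<le> f k}"
      proof (rule ccontr)
        assume "z \<notin> insert l {z \<in> {1..?M}. f z \<le> f k}"
        then have zz: "z \<in> {1..?M}" "z \<noteq> l" "f k < f z" "f z \<le> f l" using z by auto
        then have "f z < f l" using f_inj[OF zz(1) kl(2)] by linarith
        then have "key k = key z \<and> k < z \<and> z < l"
          using zz(3) f_iff[OF kl(1) zz(1)] f_iff[OF zz(1) kl(2)] keq by auto
        then show False using gap[of z] key_iff[OF kl(1) zz(1)] by simp
      qed
    next
      have "f k < f l" using f_iff[OF kl(1,2)] keq kl(3) by simp
      then show "z \<in> {z \<in> {1..?M}. f z \<le> f l}" if "z \<in> insert l {z \<in> {1..?M}. f z \<le> f k}" for z
        using that kl by auto
    qed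
    moreover have "f k < f l" using f_iff[OF kl(1,2)] keq kl(3) by simp
    ultimately have suc: "pos l = Suc (pos k)" unfolding pos_def by simp
    have layer: "\<epsilon> m \<longleftrightarrow> f k < f m" if m: "k < m" "m < l" for m
    proof -
      have mM: "m \<in> {1..?M}" using m kl by auto
      let ?p = "\<mu> k" and ?q = "\<mu> m"
      have km: "\<not> ?s k m" by (rule gap[OF m])
      have pq: "?p \<noteq> ?q" using km same_iff[OF kl(1) mM] by simp
      have p: "?p \<in> {1..?M}" "?p \<le> k" "?s ?p l" using \<mu>[OF kl(1)] tr[OF _ kl(1,2) _ kl(4)] by auto
      have q: "?q \<in> {1..?M}" "?q \<le> m" "?s ?q m" using \<mu>[OF mM] by auto
      have npq: "\<not> ?s ?p ?q"
      proof
        assume "?s ?p ?q"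
        then have "\<mu> ?p = \<mu> ?q" using same_iff p q by blast
        moreover have "\<mu> ?p = \<mu> k" "\<mu> ?q = \<mu> m" using \<mu>_cong[OF p(1) kl(1)] \<mu>_cong[OF q(1) mM] \<mu>[OF kl(1)] \<mu>[OF mM] by auto
        ultimately show False using pq by simp
      qed
      \<comment> \<open>The chords from \<open>m\<close> and from \<open>l\<close> to the first
        vertices of their polygons do not cross. \<open>pb_crossing\<close> therefore relates the
        sign of \<open>m\<close> to that of the later of the two first vertices, and this vertex
        decides which polygon is on top.\<close>
      have pb: "pb \<epsilon> n ?q m ?p l" "pb \<epsilon> n ?p l ?q m" if "?q \<noteq> m"
        using same_pair_below[OF x p(1) kl(2) q(1) mM _ that p(3) q(3) npq]
          same_pair_below[OF x q(1) mM p(1) kl(2) that _ q(3) p(3)] npq same_sym m p by auto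
      have "key k < key m \<longleftrightarrow> \<epsilon> m"
      proof -
        consider "?q = m" | "?q < ?p" "?q \<noteq> m" | "?p < ?q" "?q \<noteq> m" using pq by linarith
        then show ?thesis
        proof cases
          case 1
          then show ?thesis using p m unfolding key_def by auto
        next
          case 2
          have "\<epsilon> ?p \<noteq> \<epsilon> m"
            by (rule pb_crossing(1)[of ?q ?p m l n \<epsilon>]) (use 2 p q m kl pb in auto)
          then show ?thesis using 2 p m unfolding key_def by auto
        next
          case 3
          have "\<epsilon> ?q = \<epsilon> m"
            by (rule pb_crossing(2)[of ?p ?q m l n \<epsilon>]) (use 3 p q m kl pb in auto)
          then show ?thesis using 3 p m unfolding key_def by auto
        qed
      qed
      then show ?thesis using f_iff[OF kl(1) mM] key_iff[OF kl(1) mM] km by auto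
    qed
    show ?thesis
    proof (intro exI[of _ "pos k"] conjI allI impI)
      show "1 \<le> pos k" using pos_in[OF kl(1)] by simp
      show "pos k \<le> n" using pos_in[OF kl(2)] suc by simp
      show "w (pos k) = k" "w (Suc (pos k)) = l" using w_pos kl suc by metis+
      fix i assume i: "1 \<le> i \<and> i \<le> ?M \<and> k < w i \<and> w i < l"
      then have "i \<in> {1..?M}" by simp
      then show "\<epsilon> (w i) \<longleftrightarrow> pos k < i"
        using layer[of "w i"] i pos_iff[OF kl(1) w_in] pos_w by simp
    qed
  qed
  ultimately show ?thesis by blast
qed

section \<open>Simple dual braids as Mikado braids\<close>

context braid_rep
begin

text \<open>In the arrangement from \<open>layering\<close> every edge of \<open>x\<close> occupies
  two neighbouring positions. \<open>Sig_conj\<close> carries the atoms of \<open>edge_word\<close>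
  past the lift of \<open>w\<close> one by one; they become distinct simple generators, because a
  position determines its edge, and \<open>Sig_mult_distinct\<close> turns the product into one
  lift.\<close>

theorem dual_elt_mikado:
  assumes "below (Suc n) x (cox \<epsilon> n)"
  shows "\<exists>u w. pinj (Suc n) u \<and> pinj (Suc n) w \<and> dual_elt \<epsilon> x = Sig n u - Sig n w"
proof -
  have x: "x permutes {1..Suc n}" by (rule below_permutes[OF assms])
  obtain ws where ws: "\<forall>(k, l) \<in> set ws. edge (Suc n) x k l" "distinct ws" "tprod ws = x" "length ws = abs_len (Suc n) x"
    using edge_word[OF x order.refl assms] by blast
  have tp: "set ws \<subseteq> tpairs (Suc n)" using ws(1) by (auto simp: edge_def tpairs_def)
  have ev: "dual_elt \<epsilon> x = ev \<epsilon> ws"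
    using dual_elt_eq[OF tp, of \<epsilon>] ws assms by (simp add: treduced_def)
  obtain w pos where w: "pinj (Suc n) w" and pos: "\<And>k l. edge (Suc n) x k l \<Longrightarrow>
    1 \<le> pos k l \<and> pos k l \<le> n \<and> w (pos k l) = k \<and> w (Suc (pos k l)) = l \<and>
      (\<forall>i. 1 \<le> i \<and> i \<le> Suc n \<and> k < w i \<and> w i < l \<longrightarrow> (\<epsilon> (w i) \<longleftrightarrow> pos k l < i))"
    using layering[OF x assms] by metis
  define qs where "qs = map (\<lambda>(k, l). pos k l) ws"
  have "ev \<epsilon> ws + Sig n w = Sig n w + sum_list (map s qs)"
    using ws(1) unfolding qs_def
  proof (induction ws)
    case (Cons e ws)
    obtain k l where e: "e = (k, l)" by force
    then have ed: "edge (Suc n) x k l" using Cons.prems by simp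
    have kl: "k < l" using ed by (simp add: edge_def)
    have "Sig n w + s (pos k l) = A \<epsilon> (w (pos k l)) (w (Suc (pos k l))) + Sig n w"
      by (rule Sig_conj[OF w]) (use pos[OF ed] kl in auto)
    then have 1: "Sig n w + s (pos k l) = A2 \<epsilon> k l + Sig n w" using pos[OF ed] kl by (simp add: A2_less)
    have "ev \<epsilon> (e # ws) + Sig n w = A2 \<epsilon> k l + (ev \<epsilon> ws + Sig n w)" by (simp add: e add.assoc)
    also have "\<dots> = (A2 \<epsilon> k l + Sig n w) + sum_list (map s (map (\<lambda>(k, l). pos k l) ws))"
      using Cons by (simp add: add.assoc)
    also have "\<dots> = Sig n w + sum_list (map s (map (\<lambda>(k, l). pos k l) (e # ws)))"
      unfolding 1[symmetric] by (simp add: e add.assoc)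
    finally show ?case .
  qed simp
  moreover have "\<exists>u. pinj (Suc n) u \<and> Sig n w + sum_list (map s qs) = Sig n u"
  proof (rule Sig_mult_distinct[OF w])
    show "distinct qs" unfolding qs_def distinct_map
    proof (intro conjI ws(2) inj_onI)
      fix e e' assume "e \<in> set ws" "e' \<in> set ws" and eq: "(case e of (k, l) \<Rightarrow> pos k l) = (case e' of (k, l) \<Rightarrow> pos k l)"
      then have "edge (Suc n) x (fst e) (snd e)" "edge (Suc n) x (fst e') (snd e')" using ws(1) by auto
      note E = pos[OF this(1)] pos[OF this(2)]
      have "pos (fst e) (snd e) = pos (fst e') (snd e')" using eq by (simp only: case_prod_beta)
      then have "fst e = fst e'" "snd e = snd e'" using E by metis+
      then show "e = e'" by (rule prod_eqI)
    qed
    show "1 \<le> p \<and> p \<le> n \<and> w p < w (Suc p)" if "p \<in> set qs" for p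
    proof -
      from that obtain k l where "edge (Suc n) x k l" "p = pos k l" using ws(1) by (auto simp: qs_def)
      then show ?thesis using pos[of k l] by (auto simp: edge_def)
    qed
  qed
  ultimately show ?thesis using w ev by (metis add_diff_cancel)
qed

end

section \<open>Temperley-Lieb images of braids\<close>

text \<open>Here \<open>B i\<close> stands for \<open>- b\<^sub>i\<close> and \<open>v'\<close> for \<open>v\<^sup>-\<^sup>1\<close>. The sign of the theorem is thus absorbed, and
  the only negative coefficient left is that of a closed loop, \<open>- (v + v')\<close>.\<close>

locale TL_rep = braid_rep n s for n and s :: "nat \<Rightarrow> 'g::group_add" +
  fixes val :: "'g \<Rightarrow> 'r::ring_1" and B :: "nat \<Rightarrow> 'r" and v v' :: 'r
  assumes val_0 [simp]: "val 0 = 1" and val_add: "val (x + y) = val x * val y"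
    and val_s: "\<lbrakk>1 \<le> i; i \<le> n\<rbrakk> \<Longrightarrow> val (s i) = v' + B i"
    and central: "v * z = z * v" "v' * z = z * v'" and vv' [simp]: "v * v' = 1"
    and sq: "\<lbrakk>1 \<le> i; i \<le> n\<rbrakk> \<Longrightarrow> B i * B i = - (v + v') * B i"
    and up_down: "\<lbrakk>1 \<le> i; Suc i \<le> n\<rbrakk> \<Longrightarrow> B i * B (Suc i) * B i = B i"
    and down_up: "\<lbrakk>1 \<le> i; Suc i \<le> n\<rbrakk> \<Longrightarrow> B (Suc i) * B i * B (Suc i) = B (Suc i)"
    and comm: "\<lbrakk>1 \<le> i; Suc i < j; j \<le> n\<rbrakk> \<Longrightarrow> B i * B j = B j * B i"
begin

lemma v'v [simp]: "v' * v = 1"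
  using central(1)[of v'] by simp

lemma pull: "z * (v * y) = v * (z * y)" "z * (v' * y) = v' * (z * y)"
  by (metis central(1) mult.assoc) (metis central(2) mult.assoc)

lemma val_minus [simp]: "val (- x) * val x = 1" "val x * val (- x) = 1"
  by (simp_all flip: val_add)

text \<open>The square relation of \<open>B i\<close> makes \<open>v' + B i\<close> and
  \<open>v + B i\<close> inverse to each other. Hence crossings of both kinds expand with positive
  coefficients.\<close>

lemma val_minus_s:
  assumes "1 \<le> i" "i \<le> n" shows "val (- s i) = v + B i"
proof -
  have "(v' + B i) * (v + B i) = v' * v + B i * v + v' * B i + B i * B i"
    by (simp add: algebra_simps)
  also have "\<dots> = 1" unfolding sq[OF assms] central(1)[of "B i", symmetric] by (simp add: algebra_simps)
  finally have "val (s i) * (v + B i) = 1" by (simp add: val_s[OF assms])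
  then have "val (- s i) * (val (s i) * (v + B i)) = val (- s i)" by simp
  then show ?thesis by (simp add: mult.assoc[symmetric])
qed

lemma commute_inverse:
  assumes "val g * x = x * val g" shows "val (- g) * x = x * val (- g)"
proof -
  have "val (- g) * x = val (- g) * (x * val g) * val (- g)" by (simp add: mult.assoc)
  also have "\<dots> = x * val (- g)" unfolding assms[symmetric] by (simp add: mult.assoc[symmetric])
  finally show ?thesis .
qed

text \<open>Moves of a strand across a cap. In the first two it is pulled off both legs at the cost
  of a framing factor, and the loop term from the square cancels against two other terms. The third
  slides the cap along the strand.\<close>

lemma crossing_cap:
  assumes "1 \<le> k" "Suc k \<le> n"
  shows "val (s k) * val (s (Suc k)) * B k = v' * (B (Suc k) * B k)"
    and "B k * val (- s (Suc k)) * val (- s k) = v * (B k * B (Suc k))"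
    and "val (s (Suc k)) * B k * val (- s (Suc k)) = val (- s k) * B (Suc k) * val (s k)"
proof -
  let ?a = "B k" and ?b = "B (Suc k)"
  have k: "k \<le> n" "1 \<le> Suc k" using assms by auto
  note vals = val_s[OF assms(1) k(1)] val_s[OF k(2) assms(2)] val_minus_s[OF assms(1) k(1)] val_minus_s[OF k(2) assms(2)]
  have sq1: "?a * ?a = - (v + v') * ?a" by (rule sq[OF assms(1) k(1)])
  have a1: "?a * v' = v' * ?a" "?a * v = v * ?a" "?b * v' = v' * ?b" "?b * v = v * ?b" by (simp_all add: central)
  have "(v' + ?a) * (v' + ?b) * ?a = v' * v' * ?a + v' * (?b * ?a) + ?a * v' * ?a + ?a * ?b * ?a"
    by (simp add: algebra_simps)
  also have "?a * v' * ?a = v' * (- (v + v') * ?a)" by (metis a1(1) sq1 mult.assoc)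
  also have "?a * ?b * ?a = ?a" by (rule up_down[OF assms])
  also have "v' * v' * ?a + v' * (?b * ?a) + v' * (- (v + v') * ?a) + ?a = v' * (?b * ?a)"
    by (simp add: algebra_simps) (simp add: mult.assoc[symmetric])
  finally show "val (s k) * val (s (Suc k)) * B k = v' * (?b * ?a)" by (simp add: vals)
  have "?a * (v + ?b) * (v + ?a) = ?a * v * v + ?a * v * ?a + ?a * ?b * v + ?a * ?b * ?a"
    by (simp add: algebra_simps)
  also have "?a * v * v = v * (v * ?a)" by (metis a1(2) mult.assoc)
  also have "?a * v * ?a = v * (- (v + v') * ?a)" by (metis a1(2) sq1 mult.assoc)
  also have "?a * ?b * v = v * (?a * ?b)" by (metis central(1))
  also have "?a * ?b * ?a = ?a" by (rule up_down[OF assms])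
  also have "v * (v * ?a) + v * (- (v + v') * ?a) + v * (?a * ?b) + ?a = v * (?a * ?b)"
    by (simp add: algebra_simps) (simp add: mult.assoc[symmetric])
  finally show "B k * val (- s (Suc k)) * val (- s k) = v * (B k * B (Suc k))" by (simp add: vals)
  have "(v' + ?b) * ?a * (v + ?b) = v' * ?a * v + v' * ?a * ?b + ?b * ?a * v + ?b * ?a * ?b"
    by (simp add: algebra_simps)
  also have "v' * ?a * v = ?a" using a1(2) by (simp add: mult.assoc) (simp add: mult.assoc[symmetric])
  also have "?b * ?a * v = v * ?b * ?a" by (simp add: central mult.assoc)
  also have "?b * ?a * ?b = ?b" by (rule down_up[OF assms])
  finally have 1: "(v' + ?b) * ?a * (v + ?b) = ?a + v' * ?a * ?b + v * ?b * ?a + ?b" .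
  have "(v + ?a) * ?b * (v' + ?a) = v * ?b * v' + v * ?b * ?a + ?a * ?b * v' + ?a * ?b * ?a"
    by (simp add: algebra_simps)
  also have "v * ?b * v' = ?b" using a1(3) by (simp add: mult.assoc) (simp add: mult.assoc[symmetric])
  also have "?a * ?b * v' = v' * ?a * ?b" by (simp add: central mult.assoc)
  also have "?a * ?b * ?a = ?a" by (rule up_down[OF assms])
  finally have 2: "(v + ?a) * ?b * (v' + ?a) = ?b + v * ?b * ?a + v' * ?a * ?b + ?a" .
  show "val (s (Suc k)) * B k * val (- s (Suc k)) = val (- s k) * B (Suc k) * val (s k)"
    unfolding vals 1 2 by (simp add: algebra_simps)
qed

subsection \<open>Monomials\<close>

text \<open>The descending run B_m ... B_k, empty for k > m. \<open>U\<close> is the ascending run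
  B_k ... B_m.\<close>

primrec D :: "nat \<Rightarrow> nat \<Rightarrow> 'r" where
  "D 0 k = 1"
| "D (Suc m) k = (if k \<le> Suc m then B (Suc m) * D m k else 1)"

primrec U :: "nat \<Rightarrow> nat \<Rightarrow> 'r" where
  "U 0 k = 1"
| "U (Suc m) k = (if k \<le> Suc m then U m k * B (Suc m) else 1)"

lemma D_empty [simp]: "m < k \<Longrightarrow> D m k = 1"
  by (cases m) auto

lemma U_empty [simp]: "m < k \<Longrightarrow> U m k = 1"
  by (cases m) auto

declare D.simps(2) [simp del] U.simps(2) [simp del]

lemma D_Suc: "k \<le> Suc m \<Longrightarrow> D (Suc m) k = B (Suc m) * D m k"
  by (simp add: D.simps)

lemma U_Suc: "k \<le> Suc m \<Longrightarrow> U (Suc m) k = U m k * B (Suc m)"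
  by (simp add: U.simps)

lemma D_split: "k \<le> Suc l \<Longrightarrow> l \<le> m \<Longrightarrow> D m (Suc l) * D l k = D m k"
proof (induction m)
  case (Suc m)
  show ?case
  proof (cases "l = Suc m")
    case False
    then show ?thesis using Suc by (simp add: D_Suc mult.assoc)
  qed simp
qed simp

lemma commute_D:
  assumes "\<And>i. k \<le> i \<Longrightarrow> i \<le> m \<Longrightarrow> B i * x = x * B i" shows "D m k * x = x * D m k"
  using assms
proof (induction m)
  case (Suc m)
  show ?case
  proof (cases "k \<le> Suc m")
    case True
    have 1: "D m k * x = x * D m k" by (rule Suc.IH) (use Suc.prems in auto)
    have 2: "B (Suc m) * x = x * B (Suc m)" using Suc.prems True by simp
    have "D (Suc m) k * x = B (Suc m) * x * D m k" by (simp only: D_Suc[OF True] mult.assoc 1)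
    then show ?thesis by (simp only: D_Suc[OF True] 2 mult.assoc)
  qed simp
qed simp

text \<open>At each stage at most one descending run is appended, which gives one formal product per
  permutation. As elements of the algebra many coincide; \<open>J_normal\<close> brings them to
  normal form.\<close>

primrec J :: "nat \<Rightarrow> 'r set" where
  "J 0 = {1}"
| "J (Suc m) = J m \<union> {p * D (Suc m) k |p k. p \<in> J m \<and> 1 \<le> k \<and> k \<le> Suc m}"

lemma J_comm:
  assumes "x \<in> J m" "Suc m < i" "i \<le> n" shows "B i * x = x * B i"
  using assms
proof (induction m arbitrary: x)
  case (Suc m)
  from Suc.prems(1) consider "x \<in> J m" | p k where "p \<in> J m" "1 \<le> k" "k \<le> Suc m" "x = p * D (Suc m) k"
    by auto
  then show ?case
  proof cases
    case 1
    then show ?thesis using Suc by simp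
  next
    case 2
    have 1: "B i * p = p * B i" using Suc 2 by simp
    have 3: "D (Suc m) k * B i = B i * D (Suc m) k"
    proof (rule commute_D)
      fix t assume "k \<le> t" "t \<le> Suc m"
      then show "B t * B i = B i * B t" using comm[of t i] 2 Suc.prems by auto
    qed
    show ?thesis unfolding 2(4) mult.assoc 3 by (simp only: mult.assoc[symmetric] 1)
  qed
qed simp

lemma J_mono: "J m \<subseteq> J (Suc m)"
  by simp

lemma J_right: "x \<in> J m \<Longrightarrow> 1 \<le> k \<Longrightarrow> k \<le> Suc m \<Longrightarrow> x * D (Suc m) k \<in> J (Suc m)"
  by auto

text \<open>The last letter of the ascending run commutes with the lower part of \<open>x\<close>
  and becomes the first letter of a descending run.\<close>

lemma J_left: 
  assumes "x \<in> J m" "1 \<le> k" "k \<le> Suc m" "Suc m \<le> n" shows "U (Suc m) k * x \<in> J (Suc m)"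
  using assms
proof (induction m arbitrary: x k)
  case 0
  then have "x = 1" "k = 1" by auto
  then have "U (Suc 0) k * x = 1 * D (Suc 0) 1" by (simp add: U_Suc D_Suc)
  then show ?case by (auto intro!: exI[of _ 1])
next
  case (Suc m)
  let ?N = "Suc (Suc m)"
  have U: "U ?N k * y = U (Suc m) k * y * B ?N" if "y \<in> J m" for y
    using J_comm[OF that, of ?N] Suc.prems by (simp add: U_Suc mult.assoc)
  have IH: "U (Suc m) k * y \<in> J (Suc m)" if "y \<in> J m" for y
  proof (cases "k \<le> Suc m")
    case True
    then show ?thesis using Suc that by simp
  next
    case False
    then show ?thesis using that J_mono by auto
  qed
  from Suc.prems(1) consider "x \<in> J m" | p l where "p \<in> J m" "1 \<le> l" "l \<le> Suc m" "x = p * D (Suc m) l"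
    by auto
  then show ?case
  proof cases
    case 1
    have "U (Suc m) k * x * D ?N ?N \<in> J ?N" by (rule J_right[OF IH[OF 1]]) auto
    then show ?thesis using U[OF 1] by (simp add: D_Suc)
  next
    case 2
    have "U ?N k * x = U (Suc m) k * p * (B ?N * D (Suc m) l)"
      using U[OF 2(1)] by (simp add: 2(4) mult.assoc[symmetric])
    also have "\<dots> = U (Suc m) k * p * D ?N l" using 2 by (simp add: D_Suc)
    also have "\<dots> \<in> J ?N" by (rule J_right[OF IH[OF 2(1)]]) (use 2 in auto)
    finally show ?thesis .
  qed
qed

text \<open>The recursion of \<open>J\<close> seen from the other end. It serves the case of
  \<open>front_strand\<close> in which the strand meets the diagram from the left without crossings
  of its own there.\<close>

lemma J_left_cases:
  assumes "x \<in> J (Suc m)" "Suc m \<le> n"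
  obtains (low) "x \<in> J m" | (left) p k where "p \<in> J m" "1 \<le> k" "k \<le> Suc m" "x = U (Suc m) k * p"
proof -
  have "x \<in> J m \<or> (\<exists>p k. p \<in> J m \<and> 1 \<le> k \<and> k \<le> Suc m \<and> x = U (Suc m) k * p)"
    using assms
  proof (induction m arbitrary: x)
    case 0
    then show ?case by (force simp: D_Suc U_Suc)
  next
    case (Suc m)
    let ?N = "Suc (Suc m)"
    from Suc.prems(1) consider "x \<in> J (Suc m)" | q l where "q \<in> J (Suc m)" "1 \<le> l" "l \<le> ?N" "x = q * D ?N l"
      by (auto simp del: J.simps(2)) (auto simp: J.simps(2)[of "Suc m"] simp del: J.simps(2))
    then show ?case
    proof cases
      case 2
      have "q \<in> J m \<or> (\<exists>p k. p \<in> J m \<and> 1 \<le> k \<and> k \<le> Suc m \<and> q = U (Suc m) k * p)"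
        using Suc 2 by simp
      \<comment> \<open>The bound on \<open>k\<close> is relaxed to \<open>?N\<close>, so that an
        empty ascending run covers the elements of \<open>J m\<close>.\<close>
      then obtain p k where p: "p \<in> J m" "1 \<le> k" "k \<le> ?N" "q = U (Suc m) k * p"
        by (elim disjE exE conjE) (rule that[of _ ?N], auto intro: that)
      have comm: "B ?N * p = p * B ?N" by (rule J_comm[OF p(1)]) (use Suc.prems in auto)
      have pD: "p * D (Suc m) l \<in> J (Suc m)"
        using J_right[OF p(1) 2(2)] J_mono p(1) by (cases "l \<le> Suc m") (auto simp del: J.simps(2))
      have "x = U (Suc m) k * (p * B ?N) * D (Suc m) l" using 2 p by (simp add: D_Suc mult.assoc)
      also have "\<dots> = U ?N k * (p * D (Suc m) l)" unfolding comm[symmetric] using p by (simp add: U_Suc mult.assoc)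
      finally show ?thesis using pD p by blast
    qed simp
  qed
  then show ?thesis using that by blast
qed

subsection \<open>Positive cones\<close>

text \<open>The combinations of S with coefficients in N[v, v^-1]. Closure under multiplication by
  \<open>v\<close> and \<open>v'\<close> replaces explicit coefficients, as the ring carries no
  scalar structure.\<close>

inductive_set cone :: "'r set \<Rightarrow> 'r set" for S where
  zero: "0 \<in> cone S"
| base: "x \<in> S \<Longrightarrow> x \<in> cone S"
| add: "x \<in> cone S \<Longrightarrow> y \<in> cone S \<Longrightarrow> x + y \<in> cone S"
| v: "x \<in> cone S \<Longrightarrow> v * x \<in> cone S"
| v': "x \<in> cone S \<Longrightarrow> v' * x \<in> cone S"

lemma cone_mono: "S \<subseteq> T \<Longrightarrow> x \<in> cone S \<Longrightarrow> x \<in> cone T"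
  by (rotate_tac, induction rule: cone.induct) (auto intro: cone.intros)

lemma cone_map:
  assumes "\<And>x. x \<in> S \<Longrightarrow> a * x * b \<in> cone T" "x \<in> cone S"
  shows "a * x * b \<in> cone T"
  using assms(2)
proof induction
  case (v x)
  have "a * (v * x) * b = v * (a * x * b)" by (metis central(1) mult.assoc)
  then show ?case using v by (simp add: cone.v)
next
  case (v' x)
  have "a * (v' * x) * b = v' * (a * x * b)" by (metis central(2) mult.assoc)
  then show ?case using v' by (simp add: cone.v')
next
  case (base x)
  then show ?case by (rule assms(1))
qed (auto intro: cone.intros simp: distrib_left distrib_right)

lemma cone_J_Suc: "x \<in> cone (J m) \<Longrightarrow> x \<in> cone (J (Suc m))"
  by (rule cone_mono[OF J_mono])

lemma cone_right: "x \<in> cone (J m) \<Longrightarrow> 1 \<le> k \<Longrightarrow> k \<le> Suc m \<Longrightarrow> x * D (Suc m) k \<in> cone (J (Suc m))"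
  using cone_map[of "J m" 1 "D (Suc m) k" "J (Suc m)" x] J_right cone.base by (auto simp del: J.simps)

lemma cone_left: "x \<in> cone (J m) \<Longrightarrow> 1 \<le> k \<Longrightarrow> k \<le> Suc m \<Longrightarrow> Suc m \<le> n \<Longrightarrow> U (Suc m) k * x \<in> cone (J (Suc m))"
  using cone_map[of "J m" "U (Suc m) k" 1 "J (Suc m)" x] J_left cone.base by (auto simp del: J.simps)

text \<open>\<open>T\<close> and \<open>T'\<close> are the two halves of a strand laid in front of a
  diagram, with its ends at the positions \<open>j\<close> and \<open>i\<close>.\<close>

definition T :: "nat \<Rightarrow> nat \<Rightarrow> 'r" where "T m j = val (seg j (Suc m))"
definition T' :: "nat \<Rightarrow> nat \<Rightarrow> 'r" where "T' m j = val (- seg j (Suc m))"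

lemma T_empty [simp]: "m < j \<Longrightarrow> T m j = 1" "m < j \<Longrightarrow> T' m j = 1"
  by (simp_all add: T_def T'_def)

lemma T_Suc: "j \<le> Suc m \<Longrightarrow> T (Suc m) j = T m j * val (s (Suc m))"
  "j \<le> Suc m \<Longrightarrow> T' (Suc m) j = val (- s (Suc m)) * T' m j"
  by (simp_all add: T_def T'_def seg_Suc[of j "Suc m"] val_add minus_add del: minus_add_distrib add_uminus_conv_diff flip: diff_conv_add_uminus)
    (simp add: diff_conv_add_uminus minus_add val_add del: add_uminus_conv_diff)?

lemma T'_rec: "j \<le> m \<Longrightarrow> T' m j = T' m (Suc j) * val (- s j)"
  using seg_rec[of j "Suc m"] minus_add[of "s j" "seg (Suc j) (Suc m)"]
  by (simp add: T'_def flip: val_add)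

lemma B_T':
  assumes "1 \<le> i" "i \<le> k" "Suc k \<le> m" "m \<le> n"
  shows "B k * T' m i = T' m i * B (Suc k)"
proof -
  have "val (seg i (Suc m)) * val (s k) = val (s (Suc k)) * val (seg i (Suc m))"
    using seg_shift[of i k "Suc m"] assms by (simp flip: val_add)
  then have "T m i * B k = B (Suc k) * T m i"
    using assms by (simp add: val_s T_def algebra_simps central)
  then have "T' m i * (T m i * B k) * T' m i = T' m i * (B (Suc k) * T m i) * T' m i" by simp
  moreover have "T' m i * T m i = 1" "T m i * T' m i = 1" by (simp_all add: T_def T'_def)
  ultimately show ?thesis by (metis mult.assoc mult_1 mult_1_right)
qed

lemma D_T':
  assumes "1 \<le> i" "i \<le> l" "Suc k \<le> m" "m \<le> n"
  shows "D k l * T' m i = T' m i * D (Suc k) (Suc l)"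
  using assms(3)
proof (induction k)
  case 0
  then show ?case using assms by simp
next
  case (Suc k)
  show ?case
  proof (cases "l \<le> Suc k")
    case True
    have "D (Suc k) l * T' m i = B (Suc k) * (T' m i * D (Suc k) (Suc l))"
      using Suc True by (simp add: D_Suc mult.assoc)
    also have "\<dots> = T' m i * (B (Suc (Suc k)) * D (Suc k) (Suc l))"
      using B_T'[of i "Suc k" m] assms True Suc.prems by (simp add: mult.assoc[symmetric])
    finally show ?thesis using True by (simp add: D_Suc)
  qed simp
qed

text \<open>Pulling the front strand off the arcs of the cap at \<open>l\<close>: either it avoids the cap, at the
  cost of the framing factor \<open>v'\<close>, or it crosses it once and the crossing is resolved.\<close>

lemma cap_slide:
  assumes l: "1 \<le> l" "l < i" and k: "i \<le> Suc k" "k \<le> n"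
  shows "val (s k) * D (k - 1) l * T' k i = T' (k - 1) (i - 1) * D k i * (val (s (i - 1)) * D (i - 2) l)"
  using k
proof (induction k)
  case 0
  then show ?case using l by simp
next
  case (Suc k)
  show ?case
  proof (cases "i = Suc (Suc k)")
    case True
    then show ?thesis by simp
  next
    case False
    then have i: "i \<le> Suc k" using Suc.prems by simp
    obtain j where k: "k = Suc j" using i l by (cases k) auto
    have comm1: "val (- s (Suc k)) * D j l = D j l * val (- s (Suc k))"
    proof (rule commute_D[symmetric])
      fix t assume "l \<le> t" "t \<le> j"
      then have "B t * B (Suc k) = B (Suc k) * B t" using comm[of t "Suc k"] k l Suc.prems by simp
      then show "B t * val (- s (Suc k)) = val (- s (Suc k)) * B t"
        using val_minus_s[of "Suc k"] Suc.prems by (simp add: algebra_simps central)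
    qed
    have comm2: "B (Suc k) * T' j (i - 1) = T' j (i - 1) * B (Suc k)"
    proof -
      have "val (seg (i - 1) (Suc j)) * val (s (Suc k)) = val (s (Suc k)) * val (seg (i - 1) (Suc j))"
      proof -
        have "1 \<le> i - 1" using l by linarith
        then show ?thesis using seg_comm_s[of "Suc k" "i - 1" "Suc j"] k Suc.prems by (simp flip: val_add)
      qed
      then have "val (seg (i - 1) (Suc j)) * B (Suc k) = B (Suc k) * val (seg (i - 1) (Suc j))"
        using Suc.prems by (simp add: val_s algebra_simps central)
      then show ?thesis unfolding T'_def using commute_inverse by metis
    qed
    have "val (s (Suc k)) * D k l * T' (Suc k) i = (val (s (Suc k)) * B k * val (- s (Suc k))) * D j l * T' k i"
    proof -
      have "val (s (Suc k)) * D k l * T' (Suc k) i = val (s (Suc k)) * B k * (D j l * val (- s (Suc k))) * T' k i"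
        using l i k by (simp add: T_Suc D_Suc mult.assoc)
      then show ?thesis unfolding comm1[symmetric] by (simp only: mult.assoc)
    qed
    also have "val (s (Suc k)) * B k * val (- s (Suc k)) = val (- s k) * B (Suc k) * val (s k)"
      by (rule crossing_cap(3)) (use k Suc.prems in auto)
    also have "val (- s k) * B (Suc k) * val (s k) * D j l * T' k i = val (- s k) * B (Suc k) * (val (s k) * D (k - 1) l * T' k i)"
      using k by (simp add: mult.assoc)
    also have "val (s k) * D (k - 1) l * T' k i = T' (k - 1) (i - 1) * D k i * (val (s (i - 1)) * D (i - 2) l)"
      by (rule Suc.IH) (use i Suc.prems in auto)
    also have "val (- s k) * B (Suc k) * (T' (k - 1) (i - 1) * D k i * (val (s (i - 1)) * D (i - 2) l)) =
      val (- s k) * (B (Suc k) * T' j (i - 1)) * D k i * (val (s (i - 1)) * D (i - 2) l)"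
      using k by (simp add: mult.assoc)
    also have "\<dots> = (val (- s k) * T' j (i - 1)) * (B (Suc k) * D k i) * (val (s (i - 1)) * D (i - 2) l)"
      unfolding comm2 by (simp add: mult.assoc)
    also have "val (- s k) * T' j (i - 1) = T' k (i - 1)" using i k by (simp add: T_Suc)
    also have "B (Suc k) * D k i = D (Suc k) i" using i by (simp add: D_Suc)
    finally show ?thesis by simp
  qed
qed

text \<open>The strand ends between the legs of the cap, so one crossing survives and contributes
  two positive terms.\<close>

lemma cap_slide_adjacent:
  assumes "1 \<le> l" "l < k" "k \<le> n"
  shows "val (s k) * D (k - 1) l * T' k (Suc l) = T' (k - 1) l * (v' * D k (Suc l) + D k l)"
proof -
  have "val (s k) * D (k - 1) l * T' k (Suc l) = T' (k - 1) l * D k (Suc l) * (v' + B l)"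
    using cap_slide[of l "Suc l" k] assms by (simp add: val_s)
  also have "D k (Suc l) * B l = D k l"
    using D_split[of l l k] D_Suc[of l "l - 1"] assms by simp
  then have "T' (k - 1) l * D k (Suc l) * (v' + B l) = T' (k - 1) l * (v' * D k (Suc l) + D k l)"
    by (simp add: algebra_simps central mult.assoc)
  finally show ?thesis .
qed

text \<open>The strand crosses both legs and is pulled off the cap. It loses two crossings, hence
  the end \<open>i - 2\<close>, and leaves the framing factor \<open>v'\<close>.\<close>

lemma cap_slide_far:
  assumes "1 \<le> l" "Suc l < i" "i \<le> Suc k" "k \<le> n"
  shows "val (s k) * D (k - 1) l * T' k i = T' (k - 1) (i - 2) * (v' * D k l)"
proof -
  obtain j where i: "i = Suc (Suc j)" "1 \<le> j" "l \<le> j" using assms by (cases i; cases "i - 1") auto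
  obtain h where j: "j = Suc h" using i by (cases j) auto
  have comm: "D k i * val (- s j) = val (- s j) * D k i"
  proof (rule commute_D)
    fix t assume "i \<le> t" "t \<le> k"
    then have "B t * B j = B j * B t" using comm[of j t] i assms by simp
    then show "B t * val (- s j) = val (- s j) * B t"
      using val_minus_s[of j] i assms by (simp add: algebra_simps central)
  qed
  have "val (s j) * val (s (Suc j)) * B j = v' * (B (Suc j) * B j)"
    by (rule crossing_cap(1)) (use i assms in auto)
  then have "val (- s j) * (val (s j) * val (s (Suc j)) * B j) = val (- s j) * (v' * (B (Suc j) * B j))" by simp
  then have c: "val (s (Suc j)) * B j = v' * val (- s j) * B (Suc j) * B j"
  proof -
    have "val (- s j) * (val (s j) * val (s (Suc j)) * B j) = val (s (Suc j)) * B j"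
      by (simp add: mult.assoc[symmetric])
    moreover have "val (- s j) * (v' * (B (Suc j) * B j)) = v' * val (- s j) * B (Suc j) * B j"
      by (metis central(2) mult.assoc)
    ultimately show ?thesis
      using \<open>val (- s j) * (val (s j) * val (s (Suc j)) * B j) = val (- s j) * (v' * (B (Suc j) * B j))\<close> by simp
  qed
  have "val (s k) * D (k - 1) l * T' k i = T' (k - 1) (Suc j) * D k i * (val (s (Suc j)) * D j l)"
    using cap_slide[of l i k] assms i by simp
  also have "val (s (Suc j)) * D j l = v' * val (- s j) * D (Suc j) l"
    using c i j by (simp add: D_Suc mult.assoc[symmetric])
  also have "T' (k - 1) (Suc j) * D k i * (v' * val (- s j) * D (Suc j) l) = T' (k - 1) (Suc j) * (D k i * val (- s j)) * (v' * D (Suc j) l)"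
    by (simp add: mult.assoc pull(2)[of "val (- s j)"])
  also have "\<dots> = (T' (k - 1) (Suc j) * val (- s j)) * (v' * (D k i * D (Suc j) l))"
    unfolding comm by (simp add: mult.assoc pull(2)[of "D k i"])
  also have "D k i * D (Suc j) l = D k l" using D_split[of l "Suc j" k] i assms by simp
  also have "T' (k - 1) (Suc j) * val (- s j) = T' (k - 1) j" using T'_rec[of j "k - 1"] i assms by simp
  finally show ?thesis using i by simp
qed

text \<open>The key step: laying a strand in front of a planar diagram and resolving its crossings with
  the diagram produces no closed loop, hence no negative coefficient.\<close>

theorem front_strand:
  assumes "x \<in> J m" "Suc m \<le> n" "1 \<le> i" "i \<le> Suc (Suc m)" "1 \<le> j" "j \<le> Suc (Suc m)"
  shows "T (Suc m) j * x * T' (Suc m) i \<in> cone (J (Suc m))"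
  using assms
proof (induction m arbitrary: x i j)
  case 0
  have 1: "1 \<in> cone (J (Suc 0))" "B 1 \<in> cone (J (Suc 0))" 
    by (auto intro!: cone.base exI[of _ 1] simp: D_Suc)
  have "v' * 1 + B 1 \<in> cone (J (Suc 0))" "v * 1 + B 1 \<in> cone (J (Suc 0))"
    by (rule cone.add[OF cone.v'[OF 1(1)] 1(2)], rule cone.add[OF cone.v[OF 1(1)] 1(2)])
  moreover have "T (Suc 0) j = 1 \<or> T (Suc 0) j = val (s 1)" "T' (Suc 0) i = 1 \<or> T' (Suc 0) i = val (- s 1)"
    "T (Suc 0) j = 1 \<or> T' (Suc 0) i = 1 \<or> T (Suc 0) j * T' (Suc 0) i = 1"
    using 0 by (cases "i = 1"; cases "j = 1"; simp add: T_Suc)+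
  ultimately show ?case using 0 1 val_s[of 1] val_minus_s[of 1] by (auto simp del: J.simps(2))
next
  case (Suc m)
  let ?m = "Suc m" and ?N = "Suc (Suc m)"
  have sB: "val (s ?N) = v' + B ?N" "val (- s ?N) = v + B ?N"
    using val_s[of ?N] val_minus_s[of ?N] Suc.prems by auto
  have commJ: "val (s ?N) * y = y * val (s ?N)" "val (- s ?N) * y = y * val (- s ?N)" if "y \<in> J m" for y
    using J_comm[OF that, of ?N] Suc.prems by (auto simp: sB algebra_simps central)
  have IH: "T ?m j * y * T' ?m i \<in> cone (J ?m)" if "y \<in> J m" "1 \<le> i" "i \<le> ?N" "1 \<le> j" "j \<le> ?N" for y i j
    using Suc.IH[OF that(1) _ that(2-5)] Suc.prems by simp
  have crossR: "y * (v' + B ?N) \<in> cone (J ?N)" if y: "y \<in> cone (J ?m)" for y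
  proof -
    have "y * D ?N ?N \<in> cone (J ?N)" by (rule cone_right[OF y]) auto
    then have "v' * y + y * B ?N \<in> cone (J ?N)" using cone.v'[OF cone_J_Suc[OF y]] by (auto intro: cone.add simp: D_Suc)
    then show ?thesis by (simp add: algebra_simps central)
  qed
  have crossL: "(v + B ?N) * y \<in> cone (J ?N)" if y: "y \<in> cone (J ?m)" for y
  proof -
    have "U ?N ?N * y \<in> cone (J ?N)" by (rule cone_left[OF y]) (use Suc.prems in auto)
    then have "v * y + B ?N * y \<in> cone (J ?N)" using cone.v[OF cone_J_Suc[OF y]] by (auto intro: cone.add simp: U_Suc)
    then show ?thesis by (simp add: algebra_simps)
  qed
  \<comment> \<open>The diagram does not touch the last strand, so the crossings at position
    \<open>?N\<close> commute with it; they cancel or leave one crossing to expand.\<close>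
  have low: ?case if A: "x \<in> J m"
  proof -
    consider "i \<le> ?N" "j \<le> ?N" | "i = Suc ?N" "j \<le> ?N" | "i \<le> ?N" "j = Suc ?N" | "i = Suc ?N" "j = Suc ?N"
      using Suc.prems by linarith
    then show ?thesis
    proof cases
      case 1
      have "T ?N j * x * T' ?N i = T ?m j * (val (s ?N) * x) * val (- s ?N) * T' ?m i"
        using 1 by (simp add: T_Suc mult.assoc)
      also have "\<dots> = T ?m j * x * (val (s ?N) * val (- s ?N)) * T' ?m i"
        unfolding commJ[OF A] by (simp only: mult.assoc)
      also have "\<dots> = T ?m j * x * T' ?m i" by simp
      finally show ?thesis using cone_J_Suc[OF IH[OF A, of i j]] 1 Suc.prems by (simp del: J.simps)
    next
      case 2
      have "T ?N j * x * T' ?N i = T ?m j * (val (s ?N) * x)" using 2 by (simp add: T_Suc mult.assoc)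
      also have "\<dots> = T ?m j * x * T' ?m ?N * (v' + B ?N)" unfolding commJ[OF A] by (simp add: sB mult.assoc)
      finally show ?thesis using crossR[OF IH[OF A, of ?N j]] 2 Suc.prems by (simp del: J.simps)
    next
      case 3
      have "T ?N j * x * T' ?N i = (x * val (- s ?N)) * T' ?m i" using 3 by (simp add: T_Suc mult.assoc)
      also have "\<dots> = (v + B ?N) * (T ?m ?N * x * T' ?m i)" unfolding commJ[OF A, symmetric] by (simp add: sB mult.assoc)
      finally show ?thesis using crossL[OF IH[OF A, of i ?N]] 3 Suc.prems by (simp del: J.simps)
    next
      case 4
      then show ?thesis using A by (auto intro!: cone.base)
    qed
  qed
  show ?case
  \<comment> \<open>For \<open>j = Suc ?N\<close> there is no crossing on the left and the diagram
    is opened from that side. Otherwise the crossing at \<open>?N\<close> is moved up to the last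
    descending run, which faces the other half of the strand.\<close>
  proof (cases "j = Suc ?N")
    case j: True
    show ?thesis
    proof (cases "i = Suc ?N")
      case True
      then show ?thesis using j cone.base[of x "J ?N"] Suc.prems J_mono[of ?m] by (auto simp del: J.simps)
    next
      case False
      then have i: "i \<le> ?N" using Suc.prems by simp
      have "?m \<le> n" using Suc.prems by simp
      with Suc.prems(1) consider (low) "x \<in> J m" | (left) q l where "q \<in> J m" "1 \<le> l" "l \<le> ?m" "x = U ?m l * q"
        by (rule J_left_cases)
      then show ?thesis
      proof cases
        case left
        have "T ?N j * x * T' ?N i = U ?m l * (q * val (- s ?N)) * T' ?m i"
          using j i left by (simp add: T_Suc mult.assoc)
        also have "\<dots> = U ?m l * val (- s ?N) * (q * T' ?m i)" unfolding commJ[OF left(1), symmetric] by (simp only: mult.assoc)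
        also have "\<dots> = U m l * (B ?m * val (- s ?N) * val (- s ?m)) * (val (s ?m) * q * T' ?m i)"
          using left by (simp add: U_Suc mult.assoc) (simp add: mult.assoc[symmetric])
        also have "B ?m * val (- s ?N) * val (- s ?m) = v * (B ?m * B ?N)"
          by (rule crossing_cap(2)) (use Suc.prems in auto)
        also have "U m l * (v * (B ?m * B ?N)) * (val (s ?m) * q * T' ?m i) = v * (U ?N l * (T ?m ?m * q * T' ?m i))"
          using left by (simp add: U_Suc T_Suc mult.assoc pull(1)[of "U m l"])
        also have "\<dots> \<in> cone (J ?N)"
          by (intro cone.v cone_left IH) (use left i Suc.prems in auto)
        finally show ?thesis .
      qed (use Suc.prems low in auto)
    qed
  next
    case False
    then have j: "j \<le> ?N" using Suc.prems by simp
    from Suc.prems(1) consider "x \<in> J m" | q l where "q \<in> J m" "1 \<le> l" "l \<le> ?m" "x = q * D ?m l" by auto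
    then show ?thesis
    proof cases
      case 2
      note q = 2
      have X: "T ?N j * x * T' ?N i = T ?m j * q * (val (s ?N) * D ?m l * T' ?N i)"
      proof -
        have "T ?N j * x * T' ?N i = T ?m j * (val (s ?N) * q) * D ?m l * T' ?N i"
          using j q by (simp add: T_Suc mult.assoc)
        then show ?thesis unfolding commJ[OF q(1)] by (simp only: mult.assoc)
      qed
      \<comment> \<open>The positions of the end \<open>i\<close> relative to the cap at
        \<open>l\<close>: at the far end, before the cap, between its legs, and beyond it.\<close>
      consider "i = Suc ?N" | "i \<le> l" | "i = Suc l" | "Suc l < i" "i \<le> ?N" using Suc.prems by linarith
      then show ?thesis
      proof cases
        case 1
        have "T ?m j * q * (val (s ?N) * D ?m l) = T ?m j * q * val (- s ?m) * (val (s ?m) * val (s ?N) * B ?m) * D m l"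
          using q by (simp add: D_Suc mult.assoc) (simp add: mult.assoc[symmetric])
        also have "val (s ?m) * val (s ?N) * B ?m = v' * (B ?N * B ?m)"
          by (rule crossing_cap(1)) (use Suc.prems in auto)
        also have "T ?m j * q * val (- s ?m) * (v' * (B ?N * B ?m)) * D m l = v' * ((T ?m j * q * T' ?m ?m) * D ?N l)"
          using q by (simp add: D_Suc T_Suc mult.assoc pull(2)[of "val (- s ?m)"] pull(2)[of q] pull(2)[of "T ?m j"])
        also have "\<dots> \<in> cone (J ?N)"
          by (intro cone.v' cone_right IH) (use q j Suc.prems in auto)
        finally show ?thesis using X 1 by simp
      next
        case 2
        have "val (s ?N) * D ?m l * T' ?N i = val (s ?N) * (T' ?N i * D ?N (Suc l))"
          using D_T'[of i l ?m ?N] 2 Suc.prems by (simp add: mult.assoc)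
        also have "\<dots> = T' ?m i * D ?N (Suc l)" using 2 q by (simp add: T_Suc mult.assoc[symmetric])
        finally have "T ?N j * x * T' ?N i = (T ?m j * q * T' ?m i) * D ?N (Suc l)" using X by (simp add: mult.assoc)
        also have "\<dots> \<in> cone (J ?N)"
          by (intro cone_right IH) (use q 2 j Suc.prems in auto)
        finally show ?thesis .
      next
        case 3
        have "val (s ?N) * D ?m l * T' ?N i = T' ?m l * (v' * D ?N (Suc l) + D ?N l)"
          using cap_slide_adjacent[of l ?N] 3 q Suc.prems by simp
        then have "T ?N j * x * T' ?N i = v' * ((T ?m j * q * T' ?m l) * D ?N (Suc l)) + (T ?m j * q * T' ?m l) * D ?N l"
          unfolding X by (simp add: distrib_left mult.assoc pull(2)[of "T' ?m l"] pull(2)[of q] pull(2)[of "T ?m j"])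
        also have "\<dots> \<in> cone (J ?N)"
          by (intro cone.add cone.v' cone_right IH) (use q j Suc.prems in auto)
        finally show ?thesis .
      next
        case 4
        have "val (s ?N) * D ?m l * T' ?N i = T' ?m (i - 2) * (v' * D ?N l)"
          using cap_slide_far[of l i ?N] 4 q Suc.prems by simp
        then have "T ?N j * x * T' ?N i = v' * ((T ?m j * q * T' ?m (i - 2)) * D ?N l)"
          unfolding X by (simp add: mult.assoc pull(2)[of "T' ?m (i - 2)"] pull(2)[of q] pull(2)[of "T ?m j"])
        also have "\<dots> \<in> cone (J ?N)"
          by (intro cone.v' cone_right IH) (use q 4 j Suc.prems in auto)
        finally show ?thesis .
      qed
    qed (rule low)
  qed
qed

text \<open>The outermost runs of the two lifts are the halves of a single strand in front of all
  others. \<open>front_strand\<close> applies to each generator of the cone found for the remaining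
  strands.\<close>

theorem mikado_positive:
  assumes "pinj (Suc m) u" "pinj (Suc m) w" "m \<le> n"
  shows "val (Sig m u - Sig m w) \<in> cone (J m)"
  using assms
proof (induction m arbitrary: u w)
  case 0
  then show ?case by (auto intro!: cone.base)
next
  case (Suc m)
  let ?N = "Suc (Suc m)"
  let ?i = "w ?N" and ?j = "u ?N"
  have ij: "1 \<le> ?i" "?i \<le> ?N" "1 \<le> ?j" "?j \<le> ?N"
    using pinj_in[OF Suc.prems(1), of ?N] pinj_in[OF Suc.prems(2), of ?N] by auto
  have "Sig (Suc m) u - Sig (Suc m) w = seg ?j ?N + (Sig m (dl ?j u) - Sig m (dl ?i w)) + - seg ?i ?N"
    by (simp only: Sig.simps diff_conv_add_uminus minus_add add.assoc)
  then have "val (Sig (Suc m) u - Sig (Suc m) w) =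
    T (Suc m) ?j * val (Sig m (dl ?j u) - Sig m (dl ?i w)) * T' (Suc m) ?i"
    by (simp only: val_add T_def T'_def)
  also have "\<dots> \<in> cone (J (Suc m))"
  proof (rule cone_map)
    show "val (Sig m (dl ?j u) - Sig m (dl ?i w)) \<in> cone (J m)"
      using Suc.IH[OF pinj_dl[OF Suc.prems(1)] pinj_dl[OF Suc.prems(2)]] Suc.prems by simp
  qed (use front_strand Suc.prems ij in auto)
  finally show ?case .
qed

end

section \<open>Coxeter length and reduced words\<close>

text \<open>The Coxeter length is the canonical lift to the integers, where every generator is 1.\<close>

interpretation len: braid_rep n "\<lambda>_. 1 :: int" for n
  by standard auto

abbreviation ell :: "nat \<Rightarrow> (nat \<Rightarrow> nat) \<Rightarrow> int"
  where "ell \<equiv> braid_rep.Sig (\<lambda>_. 1)"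

definition sprod :: "nat list \<Rightarrow> nat \<Rightarrow> nat"
  where "sprod u = foldr (\<lambda>x y. s_perm x \<circ> y) u id"

lemma sprod_eq: "word_prod (Sym n) s_perm u = sprod u"
  by (simp only: word_prod_Sym sprod_def)

lemma pinj_permutes: "w permutes {1..M} \<Longrightarrow> pinj M w"
  unfolding pinj_def by (simp only: permutes_inj_on permutes_image order.refl simp_thms)

lemma len_seg: "j \<le> k \<Longrightarrow> len.seg j k = int (k - j)"
  by (induction k) (auto simp: len.seg_Suc le_Suc_eq)

lemma ell_nonneg: "pinj (Suc m) a \<Longrightarrow> 0 \<le> ell m a"
proof (induction m arbitrary: a)
  case (Suc m)
  have "0 \<le> ell m (dl (a (Suc (Suc m))) a)" by (rule Suc.IH[OF pinj_dl[OF Suc.prems]])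
  then show ?case using pinj_in[OF Suc.prems, of "Suc (Suc m)"] by (simp add: len_seg)
qed simp

lemma ell_fix:
  assumes "w permutes {1..Suc m}" shows "ell (Suc m) w = ell m w"
proof -
  have "w (Suc (Suc m)) = Suc (Suc m)" using assms by (simp add: permutes_not_in)
  moreover have "ell m (dl (Suc (Suc m)) w) = ell m w"
  proof (rule len.Sig_cong)
    fix i assume i: "1 \<le> i" "i \<le> Suc m"
    then show "dl (Suc (Suc m)) w i = w i"
      using pinj_in[OF pinj_permutes[OF assms], of i] by (simp add: dl_def)
  qed
  ultimately show ?thesis by simp
qed

lemma ell_id: "ell m id = 0"
proof (induction m)
  case (Suc m)
  then show ?case using ell_fix[OF permutes_id, of m] by (simp only:)
qed (simp only: len.Sig.simps)

lemma s_perm_permutes: "i \<in> {1..m} \<Longrightarrow> s_perm i permutes {1..Suc m}"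
  unfolding s_perm_eq by (rule tr_permutes) auto

lemma comp_s_permutes: "w permutes {1..Suc m} \<Longrightarrow> i \<in> {1..m} \<Longrightarrow> w \<circ> s_perm i permutes {1..Suc m}"
  by (rule permutes_compose[OF s_perm_permutes])

lemma s_cancel: "w \<circ> s_perm i \<circ> s_perm i = w"
  unfolding s_perm_eq by (rule tr_cancel)

lemma ell_up:
  assumes "w permutes {1..Suc m}" "i \<in> {1..m}" "w i < w (Suc i)"
  shows "ell m (w \<circ> s_perm i) = ell m w + 1"
  using len.Sig_lift[OF pinj_permutes[OF assms(1)] order.refl, of i] assms(2,3) by (simp add: s_perm_eq del: comp_apply)

lemma ell_down:
  assumes "w permutes {1..Suc m}" "i \<in> {1..m}" "w (Suc i) < w i"
  shows "ell m (w \<circ> s_perm i) = ell m w - 1"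
proof -
  have "(w \<circ> s_perm i) i < (w \<circ> s_perm i) (Suc i)" using assms(3) by (simp add: s_perm_eq)
  from ell_up[OF comp_s_permutes[OF assms(1,2)] assms(2) this] show ?thesis unfolding s_cancel by linarith
qed

lemma ell_step:
  assumes "w permutes {1..Suc m}" "i \<in> {1..m}"
  shows "(ell m (w \<circ> s_perm i) < ell m w \<longleftrightarrow> w (Suc i) < w i)" "ell m (w \<circ> s_perm i) \<le> ell m w + 1"
    "ell m w \<le> ell m (w \<circ> s_perm i) + 1"
proof -
  have "w i \<noteq> w (Suc i)" using inj_eq[OF permutes_inj[OF assms(1)]] by simp
  then show "(ell m (w \<circ> s_perm i) < ell m w \<longleftrightarrow> w (Suc i) < w i)" "ell m (w \<circ> s_perm i) \<le> ell m w + 1"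
    "ell m w \<le> ell m (w \<circ> s_perm i) + 1"
    using ell_up[OF assms] ell_down[OF assms] by linarith+
qed

lemma sprod_Nil: "sprod [] = id"
  by (simp add: sprod_def)

lemma sprod_snoc: "sprod (u @ [i]) = sprod u \<circ> s_perm i"
  using foldr_comp_append[of s_perm u "[i]"] by (simp add: sprod_def)

lemma sprod_append: "sprod (u @ v) = sprod u \<circ> sprod v"
  unfolding sprod_def by (rule foldr_comp_append)

lemma sprod_permutes: "set u \<subseteq> {1..m} \<Longrightarrow> sprod u permutes {1..Suc m}"
proof (induction u rule: rev_induct)
  case Nil
  show ?case unfolding sprod_Nil by (rule permutes_id)
next
  case (snoc i u)
  then show ?case unfolding sprod_snoc by (intro comp_s_permutes) auto
qed

lemma ell_le_length: "set u \<subseteq> {1..m} \<Longrightarrow> ell m (sprod u) \<le> int (length u)"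
proof (induction u rule: rev_induct)
  case Nil
  show ?case unfolding sprod_Nil ell_id by simp
next
  case (snoc i u)
  then have u: "set u \<subseteq> {1..m}" "i \<in> {1..m}" by auto
  show ?case using snoc.IH[OF u(1)] ell_step(2)[OF sprod_permutes[OF u(1)] u(2)] unfolding sprod_snoc length_append_singleton of_nat_Suc by linarith
qed

lemma increasing_id:
  assumes w: "w permutes {1..Suc m}" and inc: "\<And>i. i \<in> {1..m} \<Longrightarrow> w i < w (Suc i)"
  shows "w = id"
proof -
  note r = pinj_in[OF pinj_permutes[OF w]]
  have lo: "i \<le> w i" if "1 \<le> i" "i \<le> Suc m" for i
    using that
  proof (induction i)
    case (Suc i)
    then show ?case using inc[of i] r[of 1] by (cases "i = 0") fastforce+
  qed simp
  have hi: "w i \<le> i" if "1 \<le> i" "i \<le> Suc m" for i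
    using that(2,1)
  proof (induction i rule: inc_induct)
    case base
    then show ?case using r by simp
  next
    case (step i)
    then show ?case using inc[of i] by fastforce
  qed
  show ?thesis
  proof
    fix i show "w i = id i"
      using lo[of i] hi[of i] permutes_not_in[OF w, of i] by (cases "i \<in> {1..Suc m}") auto
  qed
qed

text \<open>Undoing a descent lowers the length by one, and only the identity has no
  descent.\<close>

lemma ex_sword: "w permutes {1..Suc m} \<Longrightarrow> \<exists>u. set u \<subseteq> {1..m} \<and> sprod u = w \<and> int (length u) = ell m w"
proof (induction "nat (ell m w)" arbitrary: w rule: less_induct)
  case less
  show ?case
  proof (cases "\<exists>i \<in> {1..m}. w (Suc i) < w i")
    case True
    then obtain i where i: "i \<in> {1..m}" "w (Suc i) < w i" by blast
    have d: "ell m (w \<circ> s_perm i) = ell m w - 1" by (rule ell_down[OF less.prems i])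
    have p: "w \<circ> s_perm i permutes {1..Suc m}" by (rule comp_s_permutes[OF less.prems i(1)])
    have "nat (ell m (w \<circ> s_perm i)) < nat (ell m w)"
      using d ell_nonneg[OF pinj_permutes[OF p]] by simp
    from less.hyps[OF this p] obtain u where u: "set u \<subseteq> {1..m}" "sprod u = w \<circ> s_perm i" "int (length u) = ell m (w \<circ> s_perm i)"
      by blast
    have "sprod (u @ [i]) = w" unfolding sprod_snoc u(2) by (rule s_cancel)
    moreover have "int (length (u @ [i])) = ell m w" using u(3) d by simp
    moreover have "set (u @ [i]) \<subseteq> {1..m}" using u(1) i(1) by simp
    ultimately show ?thesis by blast
  next
    case False
    have "w = id"
    proof (rule increasing_id[OF less.prems])
      fix i assume "i \<in> {1..m}"
      then have "\<not> w (Suc i) < w i" using False by blast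
      moreover have "w i \<noteq> w (Suc i)" using inj_eq[OF permutes_inj[OF less.prems], of i "Suc i"] by simp
      ultimately show "w i < w (Suc i)" by linarith
    qed
    show ?thesis unfolding \<open>w = id\<close>
    proof (intro exI[of _ "[]"] conjI)
      show "sprod [] = id" by (rule sprod_Nil)
      show "int (length []) = ell m id" unfolding ell_id by simp
    qed simp
  qed
qed

lemma length_S_eq:
  assumes w: "w permutes {1..n + 1}" shows "int (length_S n w) = ell n w"
proof -
  have w': "w permutes {1..Suc n}" using w by simp
  have map: "word_prod (Sym n) (\<lambda>x. x) (map s_perm u) = sprod u" for u
  proof (induction u)
    case Nil
    show ?case by (simp only: word_prod_Sym list.map foldr.simps sprod_Nil id_apply)
  next
    case (Cons i u)
    have "word_prod (Sym n) (\<lambda>x. x) (map s_perm (i # u)) = s_perm i \<circ> word_prod (Sym n) (\<lambda>x. x) (map s_perm u)"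
      unfolding word_prod_Sym list.map(2) foldr_Cons ..
    then show ?case by (simp only: Cons.IH sprod_def foldr_Cons)
  qed
  have "length_S n w = nat (ell n w)" unfolding length_S_def word_length_def
  proof (rule Least_equality)
    from ex_sword[OF w'] obtain u where u: "set u \<subseteq> {1..n}" "sprod u = w" "int (length u) = ell n w" by blast
    show "\<exists>u. set u \<subseteq> simple_refls n \<and> length u = nat (ell n w) \<and> word_prod (Sym n) (\<lambda>x. x) u = w"
      using u map[of u] by (intro exI[of _ "map s_perm u"]) (auto simp: simple_refls_def)
  next
    fix k assume "\<exists>u. set u \<subseteq> simple_refls n \<and> length u = k \<and> word_prod (Sym n) (\<lambda>x. x) u = w"
    then obtain u where u: "set u \<subseteq> simple_refls n" "length u = k" "word_prod (Sym n) (\<lambda>x. x) u = w" by blast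
    then have "u \<in> lists (s_perm ` {1..n})" by (auto simp: simple_refls_def)
    then obtain v where v: "v \<in> lists {1..n}" "u = map s_perm v" unfolding lists_image by blast
    then have "ell n (sprod v) \<le> int (length v)" by (intro ell_le_length) auto
    then show "nat (ell n w) \<le> k" using u v map[of v] by simp
  qed
  then show ?thesis using ell_nonneg[OF pinj_permutes[OF w']] by simp
qed

lemma reduced_exprs_eq:
  assumes w: "w permutes {1..Suc n}"
  shows "u \<in> reduced_exprs n w \<longleftrightarrow> set u \<subseteq> {1..n} \<and> sprod u = w \<and> int (length u) = ell n w"
  unfolding reduced_exprs_def sprod_eq using length_S_eq[of w n] w by auto

subsection \<open>Permutations avoiding 321\<close>

definition av321 :: "nat \<Rightarrow> (nat \<Rightarrow> nat) \<Rightarrow> bool"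
  where "av321 M w \<longleftrightarrow> (\<forall>a b c. 1 \<le> a \<and> a < b \<and> b < c \<and> c \<le> M \<longrightarrow> \<not> (w c < w b \<and> w b < w a))"

text \<open>Undoing a descent turns no other pair of values around, so a decreasing triple
  afterwards comes from a decreasing triple before.\<close>

lemma av321_descent:
  assumes av: "av321 (Suc m) w" and i: "i \<in> {1..m}" "w (Suc i) < w i" shows "av321 (Suc m) (w \<circ> s_perm i)"
  unfolding av321_def
proof (intro allI impI notI)
  fix a b c assume abc: "1 \<le> a \<and> a < b \<and> b < c \<and> c \<le> Suc m" 
    and dec: "(w \<circ> s_perm i) c < (w \<circ> s_perm i) b \<and> (w \<circ> s_perm i) b < (w \<circ> s_perm i) a"
  let ?s = "s_perm i"
  have s: "?s x = (if x = i then Suc i else if x = Suc i then i else x)" for x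
    by (simp add: s_perm_eq Transposition.transpose_def)
  have mono: "?s x < ?s y" if "x < y" "w (?s y) < w (?s x)" for x y
    using that i(2) unfolding s by (auto split: if_splits)
  have "?s a < ?s b" "?s b < ?s c" using mono abc dec by auto
  moreover have "1 \<le> ?s a" "?s c \<le> Suc m" using abc i(1) unfolding s by auto
  ultimately show False using av dec unfolding av321_def comp_apply by blast
qed

lemma commutation_snoc:
  assumes "(u, v) \<in> commutation_steps\<^sup>*" shows "(u @ q, v @ q) \<in> commutation_steps\<^sup>*"
  using assms
proof induction
  case (step y z)
  then obtain p i j r where "y = p @ [i, j] @ r" "z = p @ [j, i] @ r" "far i j" by (auto simp: commutation_steps_def)
  then have "y @ q = p @ [i, j] @ (r @ q)" "z @ q = p @ [j, i] @ (r @ q)" by auto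
  then have "(y @ q, z @ q) \<in> commutation_steps" using \<open>far i j\<close> unfolding commutation_steps_def by blast
  then show ?case using step by (meson rtrancl.rtrancl_into_rtrancl)
qed simp

lemma far_cases:
  assumes "\<not> far i j" "i \<noteq> j" shows "j = Suc i \<or> i = Suc j"
  using assms by (auto simp: far_def)

text \<open>The usual induction for Matsumoto's theorem; a braid move would need the pattern 321.\<close>

lemma av321_commutation:
  assumes "w permutes {1..Suc n}" "av321 (Suc n) w" "u \<in> reduced_exprs n w" "u' \<in> reduced_exprs n w"
  shows "(u, u') \<in> commutation_steps\<^sup>*"
  using assms
proof (induction "length u" arbitrary: u u' w)
  case 0
  have "int (length u') = int (length u)"
    using 0 reduced_exprs_eq[OF 0(2)] by metis
  then have "u' = u" using 0(1) by simp
  then show ?case by simp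
next
  case (Suc k)
  have "int (length u') = int (length u)"
    using Suc.prems(3,4) reduced_exprs_eq[OF Suc.prems(1)] by metis
  then have len: "length u' = length u" by simp
  obtain u1 i where u: "u = u1 @ [i]" using Suc.hyps(2) by (cases u rule: rev_cases) auto
  obtain u1' j where u': "u' = u1' @ [j]" using Suc.hyps(2) len by (cases u' rule: rev_cases) auto
  have last: "i \<in> {1..n} \<and> w (Suc i) < w i \<and> u1 \<in> reduced_exprs n (w \<circ> s_perm i) \<and>
     w \<circ> s_perm i permutes {1..Suc n} \<and> av321 (Suc n) (w \<circ> s_perm i)"
    if "u1 @ [i] \<in> reduced_exprs n w" for u1 i
  proof -
    have r: "set u1 \<subseteq> {1..n}" "i \<in> {1..n}" "sprod u1 \<circ> s_perm i = w" "int (length u1) + 1 = ell n w"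
      using that unfolding reduced_exprs_eq[OF Suc.prems(1)] sprod_snoc by simp_all
    have u1: "w \<circ> s_perm i = sprod u1" unfolding r(3)[symmetric] by (rule s_cancel)
    have p: "w \<circ> s_perm i permutes {1..Suc n}" by (rule comp_s_permutes[OF Suc.prems(1) r(2)])
    have "ell n (w \<circ> s_perm i) \<le> int (length u1)" unfolding u1 by (rule ell_le_length[OF r(1)])
    moreover note st = ell_step[OF Suc.prems(1) r(2)]
    ultimately have lt: "w (Suc i) < w i" and e: "int (length u1) = ell n (w \<circ> s_perm i)" using r(4) by linarith+
    then show ?thesis using reduced_exprs_eq[OF p] r(1,2) u1 p av321_descent[OF Suc.prems(2) r(2) lt] by auto
  qed
  note I = last[OF Suc.prems(3)[unfolded u]] and I' = last[OF Suc.prems(4)[unfolded u']]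
  have k: "k = length u1" "k = length u1'" using Suc.hyps(2) u u' len by auto
  show ?case
  proof (cases "i = j")
    case True
    have "(u1, u1') \<in> commutation_steps\<^sup>*"
      by (rule Suc.hyps(1)[OF k(1), of "w \<circ> s_perm i"]) (use I I' True in auto)
    then show ?thesis unfolding u u' True by (rule commutation_snoc)
  next
    case ne: False
    \<comment> \<open>Descents at two neighbouring positions would form the pattern 321.\<close>
    have far: "far i j"
    proof (rule ccontr)
      assume "\<not> far i j"
      from far_cases[OF this ne] show False
        using Suc.prems(2) I I' unfolding av321_def
        by (elim disjE) (metis atLeastAtMost_iff lessI Suc_le_mono)+
    qed
    then have gap: "s_perm i j = j" "s_perm i (Suc j) = Suc j" 
      by (auto simp: far_def s_perm_eq Transposition.transpose_def)
    have pi: "w \<circ> s_perm i permutes {1..Suc n}" using I by blast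
    have desc: "(w \<circ> s_perm i) (Suc j) < (w \<circ> s_perm i) j" using I' gap by simp
    have pij: "w \<circ> s_perm i \<circ> s_perm j permutes {1..Suc n}" using I' by (intro comp_s_permutes pi) blast
    have eij: "ell n (w \<circ> s_perm i \<circ> s_perm j) = ell n w - 2"
    proof -
      have "ell n (w \<circ> s_perm i \<circ> s_perm j) = ell n (w \<circ> s_perm i) - 1"
        by (rule ell_down[OF pi _ desc]) (use I' in blast)
      moreover have "ell n (w \<circ> s_perm i) = ell n w - 1"
        by (rule ell_down[OF Suc.prems(1)]) (use I in blast)+
      ultimately show ?thesis by linarith
    qed
    have comm: "w \<circ> s_perm i \<circ> s_perm j = w \<circ> s_perm j \<circ> s_perm i"
    proof -
      have "s_perm i \<circ> s_perm j = s_perm j \<circ> s_perm i"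
        using gap unfolding s_perm_eq by (subst tr_tr) simp
      then show ?thesis by (simp only: comp_assoc)
    qed
    \<comment> \<open>A reduced word of what is left after both descents links the two given words
      through r j i and r i j.\<close>
    obtain r where r: "set r \<subseteq> {1..n}" "sprod r = w \<circ> s_perm i \<circ> s_perm j" "int (length r) = ell n (w \<circ> s_perm i \<circ> s_perm j)"
      using ex_sword[OF pij] by blast
    have rj: "r @ [j] \<in> reduced_exprs n (w \<circ> s_perm i)"
      unfolding reduced_exprs_eq[OF pi] sprod_snoc r(2) s_cancel
      using r eij I I' ell_down[OF Suc.prems(1), of i] by auto
    have pj: "w \<circ> s_perm j permutes {1..Suc n}" using I' by blast
    have "sprod (r @ [i]) = w \<circ> s_perm j" unfolding sprod_snoc r(2) comm by (rule s_cancel)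
    moreover have "int (length (r @ [i])) = ell n (w \<circ> s_perm j)"
    proof -
      have "ell n (w \<circ> s_perm j) = ell n w - 1"
        by (rule ell_down[OF Suc.prems(1)]) (use I' in blast)+
      then show ?thesis using r(3) eij by simp
    qed
    moreover have "set (r @ [i]) \<subseteq> {1..n}" using r(1) I by simp
    ultimately have ri: "r @ [i] \<in> reduced_exprs n (w \<circ> s_perm j)"
      unfolding reduced_exprs_eq[OF pj] by blast
    have "(u1, r @ [j]) \<in> commutation_steps\<^sup>*"
      by (rule Suc.hyps(1)[OF k(1), of "w \<circ> s_perm i"]) (use I rj in auto)
    then have 1: "(u, r @ [j, i]) \<in> commutation_steps\<^sup>*" using commutation_snoc[of u1 "r @ [j]" "[i]"] u by simp
    have "length (r @ [i]) = k"
    proof -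
      have "length (r @ [i]) = length u1'"
        using ri I' reduced_exprs_eq[of "w \<circ> s_perm j" n] by (metis of_nat_eq_iff)
      then show ?thesis using k by simp
    qed
    then have "(r @ [i], u1') \<in> commutation_steps\<^sup>*"
      using Suc.hyps(1)[of "r @ [i]" "w \<circ> s_perm j" u1'] I' ri by auto
    then have 3: "(r @ [i, j], u') \<in> commutation_steps\<^sup>*" using commutation_snoc[of "r @ [i]" u1' "[j]"] u' by simp
    have "far j i" using far by (simp add: far_def abs_minus_commute)
    then have "(r @ [j, i] @ [], r @ [i, j] @ []) \<in> commutation_steps" unfolding commutation_steps_def by blast
    then have "(r @ [j, i], r @ [i, j]) \<in> commutation_steps" by simp
    with 1 3 show ?thesis by (meson rtrancl.rtrancl_into_rtrancl rtrancl_trans)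
  qed
qed

subsection \<open>Normal words\<close>

text \<open>Jones's normal form: \<open>l\<close> is the last letter, or 0 for the empty word.\<close>

inductive normal_word :: "nat \<Rightarrow> nat \<Rightarrow> nat list \<Rightarrow> bool" where
  nil: "normal_word 0 0 []"
| lift: "normal_word m l u \<Longrightarrow> normal_word (Suc m) l u"
| run: "normal_word m l' u \<Longrightarrow> l' < l \<Longrightarrow> l \<le> Suc m \<Longrightarrow> normal_word (Suc m) l (u @ rev [l..<Suc (Suc m)])"

lemma normal_word_set: "normal_word m l u \<Longrightarrow> set u \<subseteq> {1..m}"
proof (induction rule: normal_word.induct)
  case (run m l' u l)
  then have "set u \<subseteq> {1..Suc m}" "set (rev [l..<Suc (Suc m)]) \<subseteq> {1..Suc m}" by auto
  then show ?case by (simp only: set_append) blast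
qed auto

lemma normal_word_lift: "normal_word m l u \<Longrightarrow> m \<le> n \<Longrightarrow> normal_word n l u"
  by (induction n) (auto simp: le_Suc_eq intro: normal_word.lift)

lemma normal_word_last_run:
  "normal_word m l u \<Longrightarrow> 1 \<le> l \<Longrightarrow> \<exists>q l' u'. q < m \<and> normal_word q l' u' \<and> l' < l \<and> l \<le> Suc q \<and> u = u' @ rev [l..<Suc (Suc q)]"
proof (induction rule: normal_word.induct)
  case (lift m l u)
  then show ?case by (meson less_SucI)
next
  case (run m l' u l)
  then show ?case by blast
qed simp

text \<open>The descending run carries the top value down to position \<open>l\<close> and shifts
  the values behind it by one place. Every letter creates one inversion.\<close>

lemma run_product:
  assumes y: "y permutes {1..Suc m}" and l: "1 \<le> l" "l \<le> Suc (Suc m)"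
  defines "w \<equiv> \<lambda>l. y \<circ> sprod (rev [l..<Suc (Suc m)])"
  shows "w l permutes {1..Suc (Suc m)} \<and> w l l = Suc (Suc m) \<and> (\<forall>i<l. w l i = y i) \<and>
    (\<forall>i. l < i \<and> i \<le> Suc (Suc m) \<longrightarrow> w l i = y (i - 1)) \<and> ell (Suc m) (w l) = ell (Suc m) y + int (Suc (Suc m) - l)"
  using l(2,1)
proof (induction l rule: inc_induct)
  case base
  have "[Suc (Suc m)..<Suc (Suc m)] = []" by simp
  then have "w (Suc (Suc m)) = y" unfolding w_def by (simp only: rev.simps sprod_Nil comp_id)
  then show ?case using permutes_mono[OF y, of "Suc (Suc m)"] y by (simp add: permutes_not_in)
next
  case (step l)
  have IH: "w (Suc l) permutes {1..Suc (Suc m)}" "w (Suc l) (Suc l) = Suc (Suc m)" "\<And>i. i < Suc l \<Longrightarrow> w (Suc l) i = y i"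
    "\<And>i. Suc l < i \<Longrightarrow> i \<le> Suc (Suc m) \<Longrightarrow> w (Suc l) i = y (i - 1)" 
    "ell (Suc m) (w (Suc l)) = ell (Suc m) y + int (Suc (Suc m) - Suc l)"
    using step.IH by auto
  have wl: "w l = w (Suc l) \<circ> s_perm l"
  proof -
    have "rev [l..<Suc (Suc m)] = rev [Suc l..<Suc (Suc m)] @ [l]" using step.hyps by (simp add: upt_rec[of l])
    then show ?thesis unfolding w_def by (simp only: sprod_snoc o_assoc)
  qed
  have li: "l \<in> {1..Suc m}" using step by auto
  have yl: "y l \<le> Suc m" using pinj_in[OF pinj_permutes[OF y], of l] li by auto
  have lt: "w (Suc l) l < w (Suc l) (Suc l)" using IH(2) IH(3)[of l] yl by simp
  show ?case
  proof (intro conjI allI impI)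
    show "w l permutes {1..Suc (Suc m)}" unfolding wl by (rule comp_s_permutes[OF IH(1) li])
    show "w l l = Suc (Suc m)" unfolding wl using IH(2) by (simp add: s_perm_eq)
    show "w l i = y i" if "i < l" for i unfolding wl using that IH(3)[of i] by (simp add: s_perm_eq)
    show "w l i = y (i - 1)" if i: "l < i \<and> i \<le> Suc (Suc m)" for i
    proof (cases "i = Suc l")
      case True
      then show ?thesis unfolding wl using IH(3)[of l] by (simp add: s_perm_eq)
    next
      case False
      then show ?thesis unfolding wl using i IH(4)[of i] by (simp add: s_perm_eq)
    qed
    show "ell (Suc m) (w l) = ell (Suc m) y + int (Suc (Suc m) - l)"
      unfolding wl using ell_up[OF IH(1) li lt] IH(5) step.hyps by simp
  qed
qed

text \<open>The invariant behind the induction is that the values increase beyond position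
  \<open>l\<close>. A new run inserts the top value further to the right than the previous last
  letter, so what follows it is increasing and it starts no decreasing triple.\<close>

lemma normal_word_avoids:
  assumes "normal_word m l u"
  shows "av321 (Suc m) (sprod u) \<and> (\<forall>i j. l < i \<and> i < j \<and> j \<le> Suc m \<longrightarrow> sprod u i < sprod u j) \<and>
    ell m (sprod u) = int (length u)"
  using assms
proof (induction rule: normal_word.induct)
  case nil
  show ?case
  proof (intro conjI)
    show "av321 (Suc 0) (sprod [])" unfolding av321_def by auto
    show "ell 0 (sprod []) = int (length [])" by (simp only: len.Sig.simps list.size)
  qed auto
next
  case (lift m l u)
  have p: "sprod u permutes {1..Suc m}" by (rule sprod_permutes[OF normal_word_set[OF lift.hyps]])
  have top: "sprod u (Suc (Suc m)) = Suc (Suc m)" using p by (simp add: permutes_not_in)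
  have low: "sprod u i \<le> Suc m" if "i \<le> Suc m" "1 \<le> i" for i
    using pinj_in[OF pinj_permutes[OF p]] that by simp
  have "av321 (Suc (Suc m)) (sprod u)"
    unfolding av321_def
  proof (intro allI impI notI)
    fix a b c assume abc: "1 \<le> a \<and> a < b \<and> b < c \<and> c \<le> Suc (Suc m)" and d: "sprod u c < sprod u b \<and> sprod u b < sprod u a"
    have "c \<noteq> Suc (Suc m)" using d abc top low[of b] by auto
    then show False using lift.IH abc d unfolding av321_def by (metis le_SucE)
  qed
  moreover have "sprod u i < sprod u j" if "l < i \<and> i < j \<and> j \<le> Suc (Suc m)" for i j
    using that lift.IH top low[of i] by (cases "j = Suc (Suc m)") auto
  moreover have "ell (Suc m) (sprod u) = int (length u)" using ell_fix[OF p] lift.IH by (simp only:)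
  ultimately show ?case by blast
next
  case (run m l' u l)
  have y: "sprod u permutes {1..Suc m}" by (rule sprod_permutes[OF normal_word_set[OF run.hyps(1)]])
  let ?y = "sprod u" and ?w = "sprod (u @ rev [l..<Suc (Suc m)])"
  have P: "?w permutes {1..Suc (Suc m)}" "?w l = Suc (Suc m)" "\<And>i. i < l \<Longrightarrow> ?w i = ?y i"
    "\<And>i. l < i \<Longrightarrow> i \<le> Suc (Suc m) \<Longrightarrow> ?w i = ?y (i - 1)" "ell (Suc m) ?w = ell (Suc m) ?y + int (Suc (Suc m) - l)"
    using run_product[OF y, of l] run.hyps unfolding sprod_append by auto
  have low: "?w i \<le> Suc (Suc m)" if "1 \<le> i" "i \<le> Suc (Suc m)" for i
    using pinj_in[OF pinj_permutes[OF P(1)]] that by simp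
  \<comment> \<open>The position in the shorter word's permutation that corresponds to
    \<open>i\<close> once the place \<open>l\<close> of the new top value is removed.\<close>
  define d where "d i = (if i < l then i else i - 1)" for i
  have wd: "?w i = ?y (d i)" if "i \<noteq> l" "i \<le> Suc (Suc m)" for i
    using P(3,4) that by (auto simp: d_def)
  have inc: "?y i < ?y j" if "l' < i" "i < j" "j \<le> Suc m" for i j using run.IH that by blast
  have "av321 (Suc (Suc m)) ?w"
    unfolding av321_def
  proof (intro allI impI notI)
    fix a b c assume abc: "1 \<le> a \<and> a < b \<and> b < c \<and> c \<le> Suc (Suc m)" and dec: "?w c < ?w b \<and> ?w b < ?w a"
    have bc: "b \<noteq> l" "c \<noteq> l" using dec P(2) low[of a] low[of b] abc by auto
    show False
    proof (cases "a = l")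
      case True
      have "?y (d b) < ?y (d c)" by (rule inc) (use True abc run.hyps in \<open>auto simp: d_def\<close>)
      then show False using dec wd[OF bc(1)] wd[OF bc(2)] abc by simp
    next
      case False
      have "1 \<le> d a \<and> d a < d b \<and> d b < d c \<and> d c \<le> Suc m"
        using abc bc False run.hyps by (auto simp: d_def)
      then show False using run.IH dec wd[OF bc(1)] wd[OF bc(2)] wd[OF False] abc unfolding av321_def by auto
    qed
  qed
  moreover have "?w i < ?w j" if "l < i \<and> i < j \<and> j \<le> Suc (Suc m)" for i j
    using inc[of "i - 1" "j - 1"] P(4)[of i] P(4)[of j] that run.hyps by auto
  moreover have "ell (Suc m) ?w = int (length (u @ rev [l..<Suc (Suc m)]))"
  proof -
    have "int (length (u @ rev [l..<Suc (Suc m)])) = int (length u) + int (Suc (Suc m) - l)"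
      by (simp only: length_append length_rev length_upt of_nat_add)
    then show ?thesis using P(5) ell_fix[OF y] run.IH by linarith
  qed
  ultimately show ?case by blast
qed

theorem normal_word_W_f:
  assumes "normal_word n l u" shows "sprod u \<in> W_f n" "u \<in> reduced_exprs n (sprod u)"
proof -
  have p: "sprod u permutes {1..Suc n}" by (rule sprod_permutes[OF normal_word_set[OF assms]])
  show "u \<in> reduced_exprs n (sprod u)"
    using reduced_exprs_eq[OF p] normal_word_set[OF assms] normal_word_avoids[OF assms] by simp
  show "sprod u \<in> W_f n"
    unfolding W_f_def fully_commutative_def sym_group_carrier
    using p av321_commutation[OF p] normal_word_avoids[OF assms] by simp
qed

section \<open>Rewriting products of runs into normal words\<close>

context TL_rep
begin

definition monomial :: "nat list \<Rightarrow> 'r" where "monomial u = prod_list (map B u)"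

lemma ew_append: "monomial (u @ w) = monomial u * monomial w" by (simp add: monomial_def)

lemma ew_run: "1 \<le> l \<Longrightarrow> monomial (rev [l..<Suc m]) = D m l"
proof (induction m)
  case 0
  then show ?case by (auto simp: monomial_def)
next
  case (Suc m)
  then show ?case by (cases "l \<le> Suc m") (auto simp: monomial_def D_Suc)
qed

text \<open>The base case is B_l B_(l+1) B_l = B_l; the further letters of the two runs commute with
  everything they have to pass.\<close>

lemma D_D_adjacent:
  assumes "1 \<le> k" "k \<le> l" "l \<le> q" "Suc q \<le> n"
  shows "D q l * D (Suc q) k = D q k * D (Suc q) (Suc (Suc l))"
  using assms(3,4)
proof (induction q rule: dec_induct)
  case base
  then obtain l' where l: "l = Suc l'" using assms by (cases l) auto
  have "D l l * D (Suc l) k = B l * B (Suc l) * B l * D l' k"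
    using assms l by (simp add: D_Suc mult.assoc)
  also have "B l * B (Suc l) * B l = B l" by (rule up_down) (use assms base in auto)
  finally show ?case using assms l by (simp add: D_Suc)
next
  case (step q)
  have 1: "D q l * B (Suc (Suc q)) = B (Suc (Suc q)) * D q l"
  proof (rule commute_D)
    fix i assume "l \<le> i" "i \<le> q"
    then show "B i * B (Suc (Suc q)) = B (Suc (Suc q)) * B i" using comm[of i "Suc (Suc q)"] step.prems assms by simp
  qed
  have 2: "D q k * B (Suc (Suc q)) = B (Suc (Suc q)) * D q k"
  proof (rule commute_D)
    fix i assume "k \<le> i" "i \<le> q"
    then show "B i * B (Suc (Suc q)) = B (Suc (Suc q)) * B i" using comm[of i "Suc (Suc q)"] step.prems assms by simp
  qed
  have "D (Suc q) l * D (Suc (Suc q)) k = B (Suc q) * (D q l * B (Suc (Suc q))) * D (Suc q) k"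
    using assms step.hyps by (simp add: D_Suc[of l q] D_Suc[of k "Suc q"] mult.assoc)
  also have "\<dots> = B (Suc q) * B (Suc (Suc q)) * (D q l * D (Suc q) k)" unfolding 1 by (simp only: mult.assoc)
  also have "D q l * D (Suc q) k = D q k * D (Suc q) (Suc (Suc l))" using step by simp
  also have "B (Suc q) * B (Suc (Suc q)) * (D q k * D (Suc q) (Suc (Suc l))) =
    B (Suc q) * (B (Suc (Suc q)) * D q k) * D (Suc q) (Suc (Suc l))" by (simp only: mult.assoc)
  also have "\<dots> = D (Suc q) k * D (Suc (Suc q)) (Suc (Suc l))"
    unfolding 2[symmetric] using assms step.hyps by (simp add: D_Suc[of k q] D_Suc[of "Suc (Suc l)" "Suc q"] mult.assoc)
  finally show ?case .
qed

text \<open>The rewriting rule for two runs whose last letters fail to increase: the smaller end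
  moves to the earlier run and the later run is cut back to \<open>l + 2\<close>. Two letters
  disappear, and no scalar arises.\<close>

lemma D_D:
  assumes "1 \<le> k" "k \<le> l" "l \<le> q" "q \<le> m" "Suc m \<le> n"
  shows "D q l * D (Suc m) k = D q k * D (Suc m) (Suc (Suc l))"
proof -
  have 1: "D q j * D (Suc m) (Suc (Suc q)) = D (Suc m) (Suc (Suc q)) * D q j" if "1 \<le> j" for j
  proof (rule commute_D)
    fix i assume i: "j \<le> i" "i \<le> q"
    show "B i * D (Suc m) (Suc (Suc q)) = D (Suc m) (Suc (Suc q)) * B i"
      
    proof (rule commute_D[symmetric])
      fix t assume "Suc (Suc q) \<le> t" "t \<le> Suc m"
      then show "B t * B i = B i * B t" using comm[of i t] i that assms by simp
    qed
  qed
  have "D q l * D (Suc m) k = (D q l * D (Suc m) (Suc (Suc q))) * D (Suc q) k"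
    using D_split[of k "Suc q" "Suc m"] assms by (simp add: mult.assoc)
  also have "\<dots> = D (Suc m) (Suc (Suc q)) * (D q l * D (Suc q) k)" using 1[of l] assms by (simp add: mult.assoc)
  also have "D q l * D (Suc q) k = D q k * D (Suc q) (Suc (Suc l))" by (rule D_D_adjacent) (use assms in auto)
  also have "D (Suc m) (Suc (Suc q)) * (D q k * D (Suc q) (Suc (Suc l))) = D q k * (D (Suc m) (Suc (Suc q)) * D (Suc q) (Suc (Suc l)))"
    using 1[of k] assms by (simp add: mult.assoc[symmetric])
  also have "D (Suc m) (Suc (Suc q)) * D (Suc q) (Suc (Suc l)) = D (Suc m) (Suc (Suc l))"
    by (rule D_split) (use assms in auto)
  finally show ?thesis .
qed

text \<open>The bound on the new last letter drives the recursion. It keeps the result for the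
  earlier runs at most \<open>Suc l'\<close>, so the shortened run ending in \<open>l' + 2\<close>
  may follow it.\<close>

lemma normal_word_times_run:
  assumes "normal_word m l' u" "1 \<le> k" "k \<le> Suc m" "Suc m \<le> n"
  shows "\<exists>u' l. normal_word (Suc m) l u' \<and> l \<le> max k (l' + 2) \<and> monomial u * D (Suc m) k = monomial u'"
  using assms
proof (induction m arbitrary: l' u k rule: less_induct)
  case (less m)
  show ?case
  proof (cases "l' < k")
    case True
    have "monomial u * D (Suc m) k = monomial (u @ rev [k..<Suc (Suc m)])"
      by (simp only: ew_append ew_run[OF less.prems(2)])
    then show ?thesis using normal_word.run[OF less.prems(1) True less.prems(3)] by (meson max.cobounded1)
  next
    case False
    then obtain q l2 u1 where q: "q < m" "normal_word q l2 u1" "l2 < l'" "l' \<le> Suc q" "u = u1 @ rev [l'..<Suc (Suc q)]"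
      using normal_word_last_run[OF less.prems(1)] less.prems(2) by auto
    obtain u2 l3 where u2: "normal_word (Suc q) l3 u2" "l3 \<le> max k (l2 + 2)" "monomial u1 * D (Suc q) k = monomial u2"
      using less.IH[OF q(1,2), of k] less.prems q False by auto
    have "monomial u * D (Suc m) k = monomial u1 * (D (Suc q) l' * D (Suc m) k)"
    proof -
      have "1 \<le> l'" using q(3) by simp
      then show ?thesis unfolding q(5) by (simp only: ew_append ew_run mult.assoc)
    qed
    also have "D (Suc q) l' * D (Suc m) k = D (Suc q) k * D (Suc m) (Suc (Suc l'))"
      by (rule D_D) (use less.prems q False in auto)
    finally have eq: "monomial u * D (Suc m) k = monomial u2 * D (Suc m) (Suc (Suc l'))"
      using u2(3) by (simp add: mult.assoc[symmetric])
    have n2: "normal_word m l3 u2" using normal_word_lift[OF u2(1)] q by simp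
    have l3: "l3 \<le> Suc l'" using u2(2) q False by auto
    show ?thesis
    proof (cases "Suc (Suc l') \<le> Suc m")
      case True
      have "monomial u * D (Suc m) k = monomial (u2 @ rev [Suc (Suc l')..<Suc (Suc m)])" 
      proof -
        have "1 \<le> Suc (Suc l')" by simp
        then show ?thesis unfolding eq by (simp only: ew_append ew_run)
      qed
      moreover have "normal_word (Suc m) (Suc (Suc l')) (u2 @ rev [Suc (Suc l')..<Suc (Suc m)])"
        by (rule normal_word.run[OF n2 _ True]) (use l3 in simp)
      ultimately show ?thesis by (metis add_2_eq_Suc' max.cobounded2)
    next
      case False
      then have "monomial u * D (Suc m) k = monomial u2" using eq by simp
      moreover have "l3 \<le> max k (l' + 2)" using l3 by simp
      ultimately show ?thesis using normal_word.lift[OF n2] by blast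
    qed
  qed
qed

text \<open>Each product is a single monomial with coefficient one, since the rewriting uses only
  commutations and the relations B_i B_(i+1) B_i = B_i, never a square.\<close>

theorem J_normal:
  assumes "x \<in> J m" "m \<le> n" shows "\<exists>u l. normal_word m l u \<and> x = monomial u"
  using assms
proof (induction m arbitrary: x)
  case 0
  then show ?case using normal_word.nil by (auto simp: monomial_def)
next
  case (Suc m)
  from Suc.prems(1) consider "x \<in> J m" | q k where "q \<in> J m" "1 \<le> k" "k \<le> Suc m" "x = q * D (Suc m) k" by auto
  then show ?case
  proof cases
    case 1
    then show ?thesis using Suc normal_word.lift by (meson Suc_leD)
  next
    case 2
    then obtain u l where "normal_word m l u" "q = monomial u" using Suc by (meson Suc_leD)
    then show ?thesis using normal_word_times_run[of m l u k] 2 Suc.prems by metis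
  qed
qed

end

subsection \<open>Presented monoids and groups\<close>

lemma pres_cong_lists: "(u, v) \<in> pres_cong X R \<Longrightarrow> u \<in> lists X \<and> v \<in> lists X"
  by (induction rule: pres_cong.induct) auto

lemma pres_cong_context:
  "(u, v) \<in> pres_cong X R \<Longrightarrow> p \<in> lists X \<Longrightarrow> q \<in> lists X \<Longrightarrow> (p @ u @ q, p @ v @ q) \<in> pres_cong X R"
proof (induction rule: pres_cong.induct)
  case (refl u)
  then show ?case by (intro pres_cong.refl) auto
next
  case (rel u v p' q')
  then show ?case using pres_cong.rel[of u v R X "p @ p'" "q' @ q"] by simp
next
  case (sym u v)
  then show ?case by (blast intro: pres_cong.sym)
next
  case (trans u v w)
  then show ?case by (blast intro: pres_cong.trans)
qed

lemma pres_cong_append: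
  assumes "(u, u') \<in> pres_cong X R" "(v, v') \<in> pres_cong X R" shows "(u @ v, u' @ v') \<in> pres_cong X R"
proof -
  have "(u @ v, u' @ v) \<in> pres_cong X R"
    using pres_cong_context[OF assms(1), of "[]" v] pres_cong_lists[OF assms(2)] by simp
  moreover have "(u' @ v, u' @ v') \<in> pres_cong X R"
    using pres_cong_context[OF assms(2), of u' "[]"] pres_cong_lists[OF assms(1)] by simp
  ultimately show ?thesis by (rule pres_cong.trans)
qed

lemma equiv_pres_cong: "equiv (lists X) (pres_cong X R)"
proof (rule equivI)
  show "pres_cong X R \<subseteq> lists X \<times> lists X" by (auto dest: pres_cong_lists simp del: in_lists_conv_set)
  show "refl_on (lists X) (pres_cong X R)" by (intro refl_onI pres_cong.refl)
  show "sym (pres_cong X R)" by (rule symI) (rule pres_cong.sym)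
  show "trans (pres_cong X R)" by (rule transI) (rule pres_cong.trans)
qed

definition pcls :: "'a set \<Rightarrow> ('a list \<times> 'a list) set \<Rightarrow> 'a list \<Rightarrow> 'a list set"
  where "pcls X R u = pres_cong X R `` {u}"

lemma pcls_eqI: "(u, v) \<in> pres_cong X R \<Longrightarrow> pcls X R u = pcls X R v"
  unfolding pcls_def using equiv_pres_cong by (rule equiv_class_eq)

lemma pcls_rel: "(u, v) \<in> R \<Longrightarrow> u \<in> lists X \<Longrightarrow> v \<in> lists X \<Longrightarrow> pcls X R u = pcls X R v"
  using pres_cong.rel[of u v R X "[]" "[]"] by (intro pcls_eqI) simp

lemma in_pcls: "v \<in> pcls X R u \<longleftrightarrow> (u, v) \<in> pres_cong X R"
  by (simp add: pcls_def)

lemma carrier_presented: "carrier (presented_monoid X R) = pcls X R ` lists X"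
  by (auto simp: presented_monoid_def quotient_def pcls_def)

lemma mult_presented:
  assumes "u \<in> lists X" "v \<in> lists X"
  shows "pcls X R u \<otimes>\<^bsub>presented_monoid X R\<^esub> pcls X R v = pcls X R (u @ v)"
proof -
  have "pres_cong X R `` {u' @ v' |u' v'. u' \<in> pcls X R u \<and> v' \<in> pcls X R v} = pcls X R (u @ v)"
  proof (intro equalityI subsetI)
    fix w assume "w \<in> pres_cong X R `` {u' @ v' |u' v'. u' \<in> pcls X R u \<and> v' \<in> pcls X R v}"
    then obtain u' v' where "(u, u') \<in> pres_cong X R" "(v, v') \<in> pres_cong X R" "(u' @ v', w) \<in> pres_cong X R"
      by (auto simp: in_pcls)
    then show "w \<in> pcls X R (u @ v)" unfolding in_pcls by (blast intro: pres_cong.trans pres_cong_append)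
  next
    fix w assume "w \<in> pcls X R (u @ v)"
    moreover have "u \<in> pcls X R u" "v \<in> pcls X R v" using assms by (auto simp: in_pcls intro: pres_cong.refl)
    ultimately show "w \<in> pres_cong X R `` {u' @ v' |u' v'. u' \<in> pcls X R u \<and> v' \<in> pcls X R v}"
      unfolding in_pcls[of w] by blast
  qed
  then show ?thesis by (simp add: presented_monoid_def)
qed

lemma one_presented: "\<one>\<^bsub>presented_monoid X R\<^esub> = pcls X R []"
  by (simp add: presented_monoid_def pcls_def)

lemma monoid_presented: "monoid (presented_monoid X R)"
proof (rule monoidI)
  fix a b c
  assume "a \<in> carrier (presented_monoid X R)" "b \<in> carrier (presented_monoid X R)" "c \<in> carrier (presented_monoid X R)"
  then obtain u v w where *: "a = pcls X R u" "b = pcls X R v" "c = pcls X R w" "u \<in> lists X" "v \<in> lists X" "w \<in> lists X"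
    by (auto simp: carrier_presented)
  then have l: "u @ v \<in> lists X" "v @ w \<in> lists X" by auto
  show "a \<otimes>\<^bsub>presented_monoid X R\<^esub> b \<otimes>\<^bsub>presented_monoid X R\<^esub> c = a \<otimes>\<^bsub>presented_monoid X R\<^esub> (b \<otimes>\<^bsub>presented_monoid X R\<^esub> c)"
    by (simp only: * mult_presented l append_assoc)
next
  fix a b
  assume "a \<in> carrier (presented_monoid X R)" "b \<in> carrier (presented_monoid X R)"
  then obtain u v where "a = pcls X R u" "b = pcls X R v" "u \<in> lists X" "v \<in> lists X"
    by (auto simp: carrier_presented)
  then show "a \<otimes>\<^bsub>presented_monoid X R\<^esub> b \<in> carrier (presented_monoid X R)"
    using mult_presented[of u X v R] by (auto simp: carrier_presented)
next
  show "\<one>\<^bsub>presented_monoid X R\<^esub> \<in> carrier (presented_monoid X R)"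
    unfolding one_presented carrier_presented by (rule imageI) simp
next
  fix a assume "a \<in> carrier (presented_monoid X R)"
  then obtain u where u: "a = pcls X R u" "u \<in> lists X" by (auto simp: carrier_presented)
  show "\<one>\<^bsub>presented_monoid X R\<^esub> \<otimes>\<^bsub>presented_monoid X R\<^esub> a = a"
    "a \<otimes>\<^bsub>presented_monoid X R\<^esub> \<one>\<^bsub>presented_monoid X R\<^esub> = a"
    unfolding one_presented u(1) using mult_presented[of "[]" X u R] mult_presented[of u X "[]" R] u(2) by simp_all
qed

lemma inverse_word:
  assumes "w \<in> lists (X \<times> (UNIV :: bool set))"
  shows "pcls (X \<times> UNIV) (group_rels X R) (w @ rev (map (\<lambda>(x, e). (x, \<not> e)) w)) = pcls (X \<times> UNIV) (group_rels X R) []"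
proof (rule pcls_eqI)
  show "(w @ rev (map (\<lambda>(x, e). (x, \<not> e)) w), []) \<in> pres_cong (X \<times> UNIV) (group_rels X R)"
    using assms
  proof (induction w rule: list.induct)
    case Nil
    show ?case using pres_cong.refl[of "[]"] by simp
  next
    case (Cons p w)
    obtain x e where p: "p = (x, e)" by force
    let ?P = "pres_cong (X \<times> UNIV) (group_rels X R)" and ?w = "rev (map (\<lambda>(x, e). (x, \<not> e)) w)"
    have x: "x \<in> X" "w \<in> lists (X \<times> UNIV)" using Cons.prems unfolding p by auto
    have "([(x, e)] @ (w @ ?w) @ [(x, \<not> e)], [(x, e)] @ [] @ [(x, \<not> e)]) \<in> ?P"
      by (rule pres_cong_context[OF Cons.IH[OF x(2)]]) (use x in auto)
    moreover have "([(x, e), (x, \<not> e)], []) \<in> group_rels X R" using x by (auto simp: group_rels_def)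
    then have "([(x, e), (x, \<not> e)], []) \<in> ?P"
      using pres_cong.rel[of "[(x, e), (x, \<not> e)]" "[]" "group_rels X R" "X \<times> UNIV" "[]" "[]"] x by simp
    ultimately show ?case unfolding p by (simp) (rule pres_cong.trans)
  qed
qed

lemma group_presented: "group (presented_group X R)"
proof -
  let ?M = "presented_monoid (X \<times> UNIV) (group_rels X R)"
  interpret monoid ?M by (rule monoid_presented)
  show ?thesis unfolding presented_group_def
  proof (rule group.intro[OF monoid_presented], unfold_locales, unfold Units_def, safe)
    fix a assume "a \<in> carrier ?M"
    then obtain w where w: "a = pcls (X \<times> UNIV) (group_rels X R) w" "w \<in> lists (X \<times> UNIV)"
      by (auto simp: carrier_presented)
    let ?f = "\<lambda>(x, e). (x, \<not> e)"
    let ?w = "rev (map ?f w)"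
    have ww: "?w \<in> lists (X \<times> UNIV)" using w(2) by auto
    have "rev (map ?f ?w) = w" by (induction w) auto
    then have "pcls (X \<times> UNIV) (group_rels X R) ?w \<otimes>\<^bsub>?M\<^esub> a = \<one>\<^bsub>?M\<^esub>"
      using inverse_word[OF ww, of R] by (simp add: w(1) mult_presented[OF ww w(2)] one_presented)
    moreover have "a \<otimes>\<^bsub>?M\<^esub> pcls (X \<times> UNIV) (group_rels X R) ?w = \<one>\<^bsub>?M\<^esub>"
      using inverse_word[OF w(2), of R] by (simp add: w(1) mult_presented[OF w(2) ww] one_presented)
    ultimately show "\<exists>y \<in> carrier ?M. y \<otimes>\<^bsub>?M\<^esub> a = \<one>\<^bsub>?M\<^esub> \<and> a \<otimes>\<^bsub>?M\<^esub> y = \<one>\<^bsub>?M\<^esub>"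
      using ww unfolding carrier_presented by blast
  qed
qed

context monoid
begin

lemma word_prod_Nil: "word_prod G f [] = \<one>"
  by (simp add: word_prod_def)

lemma word_prod_Cons: "word_prod G f (x # u) = f x \<otimes> word_prod G f u"
  by (simp add: word_prod_def)

lemma word_prod_closed: "f \<in> X \<rightarrow> carrier G \<Longrightarrow> u \<in> lists X \<Longrightarrow> word_prod G f u \<in> carrier G"
  by (induction u) (auto simp: word_prod_Nil word_prod_Cons)

lemma word_prod_append:
  "f \<in> X \<rightarrow> carrier G \<Longrightarrow> u \<in> lists X \<Longrightarrow> v \<in> lists X \<Longrightarrow> word_prod G f (u @ v) = word_prod G f u \<otimes> word_prod G f v"
proof (induction u)
  case Nil
  then show ?case using word_prod_closed[of f X v] by (simp add: word_prod_Nil)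
next
  case (Cons x u)
  then have "f x \<in> carrier G" "word_prod G f u \<in> carrier G" "word_prod G f v \<in> carrier G"
    using word_prod_closed by auto
  then show ?case using Cons by (simp add: word_prod_Cons m_assoc)
qed

lemma word_prod_pres_cong:
  assumes f: "f \<in> X \<rightarrow> carrier G"
    and R: "\<And>u v. (u, v) \<in> R \<Longrightarrow> u \<in> lists X \<Longrightarrow> v \<in> lists X \<Longrightarrow> word_prod G f u = word_prod G f v"
    and "(u, v) \<in> pres_cong X R"
  shows "word_prod G f u = word_prod G f v"
  using assms(3)
proof (induction rule: pres_cong.induct)
  case (rel u v p q)
  then have "word_prod G f (p @ (u @ q)) = word_prod G f (p @ (v @ q))"
    using R[OF rel(1-3)] word_prod_append[OF f] by simp
  then show ?case .
qed auto

text \<open>All words of a class have the same value in a group or monoid where the relations hold,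
  so \<open>the_elem\<close> returns it. This is the universal property in the form used by
  \<open>group_lift\<close>.\<close>

lemma the_elem_word_prod:
  assumes f: "f \<in> X \<rightarrow> carrier G"
    and R: "\<And>u v. (u, v) \<in> R \<Longrightarrow> u \<in> lists X \<Longrightarrow> v \<in> lists X \<Longrightarrow> word_prod G f u = word_prod G f v"
    and w: "w \<in> lists X"
  shows "the_elem (word_prod G f ` pcls X R w) = word_prod G f w"
proof -
  have "w \<in> pcls X R w" using w by (auto simp: in_pcls intro: pres_cong.refl)
  moreover have "word_prod G f v = word_prod G f w" if "v \<in> pcls X R w" for v
    using that word_prod_pres_cong[of f X R, OF f R, of w v] by (simp add: in_pcls)
  then have "word_prod G f ` pcls X R w = (\<lambda>_. word_prod G f w) ` pcls X R w" by (rule image_cong[OF HOL.refl])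
  ultimately show ?thesis by (auto simp: image_constant_conv)
qed

end

definition signed :: "('b, 'm) monoid_scheme \<Rightarrow> ('a \<Rightarrow> 'b) \<Rightarrow> 'a \<times> bool \<Rightarrow> 'b"
  where "signed H f = (\<lambda>(x, e). if e then f x else inv\<^bsub>H\<^esub> (f x))"

context group
begin

lemma signed_closed: "f \<in> X \<rightarrow> carrier G \<Longrightarrow> signed G f \<in> X \<times> UNIV \<rightarrow> carrier G"
  by (auto simp: signed_def Pi_iff)

lemma word_prod_signed_pos: "word_prod G (signed G f) (map (\<lambda>x. (x, True)) u) = word_prod G f u"
  by (induction u) (auto simp: word_prod_Nil word_prod_Cons signed_def)

lemma signed_group_rels:
  assumes f: "f \<in> X \<rightarrow> carrier G"
    and R: "\<And>u v. (u, v) \<in> R \<Longrightarrow> u \<in> lists X \<Longrightarrow> v \<in> lists X \<Longrightarrow> word_prod G f u = word_prod G f v"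
    and uv: "(u, v) \<in> group_rels X R" "u \<in> lists (X \<times> UNIV)" "v \<in> lists (X \<times> UNIV)"
  shows "word_prod G (signed G f) u = word_prod G (signed G f) v"
proof -
  from uv(1) consider u' v' where "u = map (\<lambda>x. (x, True)) u'" "v = map (\<lambda>x. (x, True)) v'" "(u', v') \<in> R"
    | x e where "x \<in> X" "u = [(x, e), (x, \<not> e)]" "v = []"
    by (auto simp: group_rels_def)
  then show ?thesis
  proof cases
    case 1
    then have "u' \<in> lists X" "v' \<in> lists X" using uv by auto
    then show ?thesis using R[OF 1(3)] 1 by (simp only: word_prod_signed_pos)
  next
    case 2
    then have "f x \<in> carrier G" using f by auto
    then show ?thesis using 2 by (simp add: word_prod_Nil word_prod_Cons signed_def)
  qed
qed

lemma group_lift_word: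
  assumes f: "f \<in> X \<rightarrow> carrier G"
    and R: "\<And>u v. (u, v) \<in> R \<Longrightarrow> u \<in> lists X \<Longrightarrow> v \<in> lists X \<Longrightarrow> word_prod G f u = word_prod G f v"
    and w: "w \<in> lists (X \<times> UNIV)"
  shows "group_lift G f (pcls (X \<times> UNIV) (group_rels X R) w) = word_prod G (signed G f) w"
proof -
  have "group_lift G f A = the_elem (word_prod G (signed G f) ` A)" for A
    by (simp only: group_lift_def signed_def)
  moreover have gr: "word_prod G (signed G f) u = word_prod G (signed G f) v"
    if "(u, v) \<in> group_rels X R" "u \<in> lists (X \<times> UNIV)" "v \<in> lists (X \<times> UNIV)" for u v
    by (rule signed_group_rels[OF f _ that]) (rule R)
  have "the_elem (word_prod G (signed G f) ` pcls (X \<times> UNIV) (group_rels X R) w) = word_prod G (signed G f) w"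
    by (rule the_elem_word_prod[OF signed_closed[OF f] _ w]) (rule gr)
  ultimately show ?thesis by simp
qed

lemma word_prod_signed_inverse:
  assumes f: "f \<in> X \<rightarrow> carrier G" and w: "w \<in> lists (X \<times> UNIV)"
  shows "word_prod G (signed G f) (rev (map (\<lambda>(x, e). (x, \<not> e)) w)) = inv (word_prod G (signed G f) w)"
  using w
proof (induction w rule: list.induct)
  case Nil
  then show ?case by (simp add: word_prod_Nil)
next
  case (Cons p w)
  obtain x e where p: "p = (x, e)" by force
  then have x: "x \<in> X" "w \<in> lists (X \<times> UNIV)" using Cons.prems unfolding p by auto
  then have fx: "f x \<in> carrier G" using f by auto
  let ?r = "rev (map (\<lambda>(x, e). (x, \<not> e)) w)"
  have wc: "word_prod G (signed G f) w \<in> carrier G" by (rule word_prod_closed[OF signed_closed[OF f] x(2)])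
  have "word_prod G (signed G f) (?r @ [(x, \<not> e)]) = word_prod G (signed G f) ?r \<otimes> word_prod G (signed G f) [(x, \<not> e)]"
    by (rule word_prod_append[OF signed_closed[OF f]]) (use x in auto)
  also have "word_prod G (signed G f) [(x, \<not> e)] = inv (signed G f (x, e))"
    using fx by (simp add: word_prod_Nil word_prod_Cons signed_def)
  also have "word_prod G (signed G f) ?r \<otimes> inv (signed G f (x, e)) = inv (word_prod G (signed G f) (p # w))"
    using Cons.IH[OF x(2)] wc fx by (simp add: p word_prod_Cons signed_def inv_mult_group)
  finally show ?case by (simp add: p)
qed

end

lemma carrier_presented_group: "carrier (presented_group X R) = pcls (X \<times> UNIV) (group_rels X R) ` lists (X \<times> UNIV)"
  by (simp add: presented_group_def carrier_presented)

lemma group_gen_eq: "group_gen X R x = pcls (X \<times> UNIV) (group_rels X R) [(x, True)]"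
  by (simp add: group_gen_def pcls_def)

lemma monoid_gen_eq: "monoid_gen X R x = pcls X R [x]"
  by (simp add: monoid_gen_def pcls_def)

subsection \<open>The group of fractions of the dual braid monoid\<close>

lemma below_cox_Suc:
  assumes "below (Suc m) x (cox \<epsilon> m)" shows "below (Suc (Suc m)) x (cox \<epsilon> (Suc m))"
proof -
  let ?s = "tr (Suc m) (Suc (Suc m))"
  have x: "x permutes {1..Suc m}" by (rule below_permutes[OF assms])
  obtain v where v: "v permutes {1..Suc m}" "cox \<epsilon> m = x \<circ> v" "abs_len (Suc m) (cox \<epsilon> m) = abs_len (Suc m) x + abs_len (Suc m) v"
    using assms by (auto simp: below_def)
  have up: "x permutes {1..Suc (Suc m)}" "v permutes {1..Suc (Suc m)}" using x v permutes_mono by auto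
  have len: "abs_len (Suc m) x + abs_len (Suc m) v = m" using v(3) abs_len_cox by simp
  have s: "abs_len (Suc (Suc m)) ?s = 1" by (rule abs_len_single) auto
  show ?thesis
  proof (cases "\<epsilon> (Suc m)")
    case True
    show ?thesis
    proof (rule below_mid[OF top_tr_permutes up])
      show "cox \<epsilon> (Suc m) = ?s \<circ> x \<circ> v" using True v(2) by (simp only: cox.simps if_True comp_assoc)
      show "abs_len (Suc (Suc m)) ?s + abs_len (Suc (Suc m)) x + abs_len (Suc (Suc m)) v \<le> abs_len (Suc (Suc m)) (cox \<epsilon> (Suc m))"
        using len s abs_len_fix[OF x] abs_len_fix[OF v(1)] abs_len_cox[of "Suc m" \<epsilon>] by simp
    qed
  next
    case False
    show ?thesis
    proof (rule below_mid[OF permutes_id up(1) permutes_compose[OF top_tr_permutes up(2)]])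
      show "cox \<epsilon> (Suc m) = id \<circ> x \<circ> (v \<circ> ?s)" using False v(2) by (simp only: cox.simps if_False comp_assoc id_comp)
      show "abs_len (Suc (Suc m)) id + abs_len (Suc (Suc m)) x + abs_len (Suc (Suc m)) (v \<circ> ?s) \<le> abs_len (Suc (Suc m)) (cox \<epsilon> (Suc m))"
        using len abs_len_top[OF v(1)] abs_len_fix[OF x] abs_len_cox[of "Suc m" \<epsilon>] abs_len_id[of "Suc (Suc m)"] by linarith
    qed
  qed
qed

lemma below_cox_mono: "m \<le> n \<Longrightarrow> below (Suc m) x (cox \<epsilon> m) \<Longrightarrow> below (Suc n) x (cox \<epsilon> n)"
proof (induction n)
  case (Suc n)
  then show ?case using below_cox_Suc by (cases "m = Suc n") auto
qed simp

lemma below_tr': "(a, b) \<in> tpairs (Suc m) \<Longrightarrow> below (Suc m) (tr a b) (cox \<epsilon> m)"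
proof -
  interpret b: braid_rep m "\<lambda>_. 0 :: int" by standard auto
  show "(a, b) \<in> tpairs (Suc m) \<Longrightarrow> below (Suc m) (tr a b) (cox \<epsilon> m)" by (rule b.below_tr)
qed

text \<open>The Coxeter element on one more point is the old one times the new simple reflection, on
  the side given by the sign. A reflection of the old points can be moved next to it inside this
  product.\<close>

lemma below_top_pair:
  assumes ab: "(a, b) \<in> tpairs (Suc m)" and mn: "Suc m \<le> n"
  defines "s \<equiv> tr (Suc m) (Suc (Suc m))"
  shows "\<not> \<epsilon> (Suc m) \<Longrightarrow> below (Suc n) (tr a b \<circ> s) (cox \<epsilon> n)" "\<epsilon> (Suc m) \<Longrightarrow> below (Suc n) (s \<circ> tr a b) (cox \<epsilon> n)"
    "abs_len (Suc n) (tr a b \<circ> s) = 2" "abs_len (Suc n) (s \<circ> tr a b) = 2"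
proof -
  let ?N = "Suc (Suc m)"
  have sp: "s permutes {1..?N}" unfolding s_def by (rule top_tr_permutes)
  have tp: "tr a b permutes {1..Suc m}" using ab by (intro tr_permutes) (auto simp: tpairs_def)
  have tp2: "tr a b permutes {1..?N}" using permutes_mono[OF tp] by simp
  have l1: "abs_len (Suc m) (tr a b) = 1" using ab by (intro abs_len_single) (auto simp: tpairs_def)
  have l2: "abs_len ?N (tr a b \<circ> s) = 2" using abs_len_top[OF tp] l1 by (simp add: s_def)
  have l3: "abs_len ?N (s \<circ> tr a b) = 2" using abs_len_swap[OF sp tp2] l2 by simp
  show "abs_len (Suc n) (tr a b \<circ> s) = 2" "abs_len (Suc n) (s \<circ> tr a b) = 2"
    using abs_len_mono[OF permutes_compose[OF sp tp2], of "Suc n"] abs_len_mono[OF permutes_compose[OF tp2 sp], of "Suc n"]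
      l2 l3 mn by simp_all
  obtain v where v: "v permutes {1..Suc m}" "cox \<epsilon> m = tr a b \<circ> v" "abs_len (Suc m) (cox \<epsilon> m) = 1 + abs_len (Suc m) v"
    using below_tr'[OF ab, of \<epsilon>] l1 by (auto simp: below_def)
  have v2: "v permutes {1..?N}" using permutes_mono[OF v(1)] by simp
  have lv: "abs_len ?N v + 1 = m" using v(3) abs_len_cox[of m \<epsilon>] abs_len_fix[OF v(1)] by simp
  {
    assume e: "\<not> \<epsilon> (Suc m)"
    have "below ?N (tr a b \<circ> s) (cox \<epsilon> (Suc m))"
    proof (rule below_mid[OF permutes_id permutes_compose[OF sp tp2]])
      show "s \<circ> v \<circ> inv' s permutes {1..?N}" by (intro permutes_compose permutes_inv sp v2)
      have ss: "tr (Suc m) (Suc (Suc m)) \<circ> (tr (Suc m) (Suc (Suc m)) \<circ> f) = f" for f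
        by (simp only: o_assoc transpose_comp_involutory id_comp)
      show "cox \<epsilon> (Suc m) = id \<circ> (tr a b \<circ> s) \<circ> (s \<circ> v \<circ> inv' s)"
        using e v(2) unfolding s_def by (simp only: cox.simps if_False comp_assoc id_comp inv_transpose_eq ss)
      show "abs_len ?N id + abs_len ?N (tr a b \<circ> s) + abs_len ?N (s \<circ> v \<circ> inv' s) \<le> abs_len ?N (cox \<epsilon> (Suc m))"
        using abs_len_conj[OF v2 sp] l2 lv abs_len_cox[of "Suc m" \<epsilon>] abs_len_id[of ?N] by linarith
    qed
    then show "below (Suc n) (tr a b \<circ> s) (cox \<epsilon> n)" by (rule below_cox_mono[OF mn])
  next
    assume e: "\<epsilon> (Suc m)"
    have "below ?N (s \<circ> tr a b) (cox \<epsilon> (Suc m))"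
    proof (rule below_mid[OF permutes_id permutes_compose[OF tp2 sp] v2])
      show "cox \<epsilon> (Suc m) = id \<circ> (s \<circ> tr a b) \<circ> v"
        using e v(2) unfolding s_def by (simp only: cox.simps if_True comp_assoc id_comp)
      show "abs_len ?N id + abs_len ?N (s \<circ> tr a b) + abs_len ?N v \<le> abs_len ?N (cox \<epsilon> (Suc m))"
        using l3 lv abs_len_cox[of "Suc m" \<epsilon>] abs_len_id[of ?N] by linarith
    qed
    then show "below (Suc n) (s \<circ> tr a b) (cox \<epsilon> n)" by (rule below_cox_mono[OF mn])
  }
qed

text \<open>The properties of the simple elements through which the group of fractions enters: they
  are multiplicative along length-additive factorizations of divisors.\<close>

locale dual_rep = group F for F :: "('f, 'k) monoid_scheme" (structure) +
  fixes n :: nat and \<epsilon> :: "nat \<Rightarrow> bool" and d :: "(nat \<Rightarrow> nat) \<Rightarrow> 'f"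
  assumes d_closed: "below (Suc n) x (cox \<epsilon> n) \<Longrightarrow> d x \<in> carrier F"
    and d_id: "d id = \<one>"
    and d_mult: "x permutes {1..Suc n} \<Longrightarrow> y permutes {1..Suc n} \<Longrightarrow> below (Suc n) (x \<circ> y) (cox \<epsilon> n) \<Longrightarrow>
      abs_len (Suc n) (x \<circ> y) = abs_len (Suc n) x + abs_len (Suc n) y \<Longrightarrow> d x \<otimes> d y = d (x \<circ> y)"
begin

lemma d_tr: "(a, b) \<in> tpairs (Suc n) \<Longrightarrow> d (tr a b) \<in> carrier F"
  by (intro d_closed below_tr')

lemma d_pair:
  assumes "(a, b) \<in> tpairs (Suc n)" "(a', b') \<in> tpairs (Suc n)" "x = tr a b \<circ> tr a' b'"
    "below (Suc n) x (cox \<epsilon> n)" "abs_len (Suc n) x = 2"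
  shows "d (tr a b) \<otimes> d (tr a' b') = d x"
  unfolding assms(3)
proof (rule d_mult)
  show "tr a b permutes {1..Suc n}" "tr a' b' permutes {1..Suc n}"
    using assms(1,2) by (auto intro!: tr_permutes simp: tpairs_def simp del: One_nat_def)
  show "below (Suc n) (tr a b \<circ> tr a' b') (cox \<epsilon> n)" using assms(3,4) by (simp only:)
  have "abs_len (Suc n) (tr a b) = 1" "abs_len (Suc n) (tr a' b') = 1"
    using assms(1,2) by (auto intro!: abs_len_single simp: tpairs_def simp del: One_nat_def)
  then show "abs_len (Suc n) (tr a b \<circ> tr a' b') = abs_len (Suc n) (tr a b) + abs_len (Suc n) (tr a' b')"
    using assms(3,5) by (simp only:)
qed

text \<open>A single divisor of length two, supported on three points, has three factorizations into
  reflections. Comparing their images gives the relations of the triangle.\<close>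

lemma d_slide:
  assumes "a \<in> {1..m}" "Suc m \<le> n"
  defines "t \<equiv> tr a (Suc m)" and "t' \<equiv> tr a (Suc (Suc m))" and "s \<equiv> tr (Suc m) (Suc (Suc m))"
  shows "\<not> \<epsilon> (Suc m) \<Longrightarrow> d t \<otimes> d s = d s \<otimes> d t' \<and> d t \<otimes> d s = d t' \<otimes> d t"
    "\<epsilon> (Suc m) \<Longrightarrow> d s \<otimes> d t = d t \<otimes> d t' \<and> d s \<otimes> d t = d t' \<otimes> d s"
proof -
  have p: "(a, Suc m) \<in> tpairs (Suc n)" "(a, Suc (Suc m)) \<in> tpairs (Suc n)" "(Suc m, Suc (Suc m)) \<in> tpairs (Suc n)"
    and p': "(a, Suc m) \<in> tpairs (Suc m)"
    using assms(1,2) by (auto simp: tpairs_def)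
  have ne: "a \<noteq> Suc m" "a \<noteq> Suc (Suc m)" "Suc m \<noteq> Suc (Suc m)" using assms(1) by auto
  have e: "t \<circ> s = s \<circ> t'" "t \<circ> s = t' \<circ> t" "s \<circ> t = t \<circ> t'" "s \<circ> t = t' \<circ> s"
    unfolding t_def t'_def s_def using ne by (simp_all add: fun_eq_iff transpose_def)
  note b = below_top_pair(1,2)[OF p' assms(2), of \<epsilon>, folded t_def s_def] below_top_pair(3,4)[OF p' assms(2), folded t_def s_def]
  note f = d_pair[OF p(1,3), folded t_def s_def] d_pair[OF p(3,2), folded t'_def s_def] d_pair[OF p(2,1), folded t_def t'_def]
    d_pair[OF p(3,1), folded t_def s_def] d_pair[OF p(1,2), folded t_def t'_def] d_pair[OF p(2,3), folded t'_def s_def]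
  show "d t \<otimes> d s = d s \<otimes> d t' \<and> d t \<otimes> d s = d t' \<otimes> d t" if "\<not> \<epsilon> (Suc m)"
    using f(1)[OF HOL.refl b(1)[OF that] b(3)] f(2)[OF e(1) b(1)[OF that] b(3)] f(3)[OF e(2) b(1)[OF that] b(3)] by simp
  show "d s \<otimes> d t = d t \<otimes> d t' \<and> d s \<otimes> d t = d t' \<otimes> d s" if "\<epsilon> (Suc m)"
    using f(4)[OF HOL.refl b(2)[OF that] b(4)] f(5)[OF e(3) b(2)[OF that] b(4)] f(6)[OF e(4) b(2)[OF that] b(4)] by simp
qed

lemma d_s_closed: "i \<in> {1..n} \<Longrightarrow> d (s_perm i) \<in> carrier F"
  unfolding s_perm_eq by (rule d_tr) (auto simp: tpairs_def)

text \<open>Both sides of the braid relation are compared through the third reflection of the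
  triangle i, i+1, i+2.\<close>

lemma d_braid:
  assumes "i \<in> {1..n}" "Suc i \<in> {1..n}"
  shows "d (s_perm i) \<otimes> d (s_perm (Suc i)) \<otimes> d (s_perm i) = d (s_perm (Suc i)) \<otimes> d (s_perm i) \<otimes> d (s_perm (Suc i))"
proof -
  let ?s = "d (s_perm i)" and ?s' = "d (s_perm (Suc i))" and ?t = "d (tr i (Suc (Suc i)))"
  have c: "?s \<in> carrier F" "?s' \<in> carrier F" using d_s_closed assms by auto
  have t: "?t \<in> carrier F" using assms by (intro d_tr) (auto simp: tpairs_def)
  have i: "i \<in> {1..i}" "Suc i \<le> n" using assms by auto
  show ?thesis
  proof (cases "\<epsilon> (Suc i)")
    case True
    then have e: "?s' \<otimes> ?s = ?s \<otimes> ?t" "?s' \<otimes> ?s = ?t \<otimes> ?s'"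
      unfolding s_perm_eq using d_slide(2)[OF i] by auto
    show ?thesis using e(1) e(2)[symmetric] c t by (simp add: m_assoc)
  next
    case False
    then have e: "?s \<otimes> ?s' = ?s' \<otimes> ?t" "?s \<otimes> ?s' = ?t \<otimes> ?s"
      unfolding s_perm_eq using d_slide(1)[OF i] by auto
    have "?s \<otimes> ?s' \<otimes> ?s = ?s' \<otimes> (?t \<otimes> ?s)" using e(1) c t by (simp add: m_assoc)
    also have "\<dots> = ?s' \<otimes> ?s \<otimes> ?s'" using e(2)[symmetric] c t by (simp add: m_assoc)
    finally show ?thesis .
  qed
qed

lemma d_far:
  assumes "i \<in> {1..n}" "j \<in> {1..n}" "Suc i < j"
  shows "d (s_perm i) \<otimes> d (s_perm j) = d (s_perm j) \<otimes> d (s_perm i)"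
proof -
  obtain m where m: "j = Suc m" using assms(3) by (cases j) auto
  have p: "(i, Suc i) \<in> tpairs (Suc m)" "Suc m \<le> n" using assms m by (auto simp: tpairs_def)
  have q: "(i, Suc i) \<in> tpairs (Suc n)" "(j, Suc j) \<in> tpairs (Suc n)" using assms by (auto simp: tpairs_def)
  let ?x = "tr i (Suc i) \<circ> tr j (Suc j)"
  have c: "?x = tr j (Suc j) \<circ> tr i (Suc i)" using assms(3) by (auto simp: fun_eq_iff transpose_def)
  have b: "below (Suc n) ?x (cox \<epsilon> n)" "abs_len (Suc n) ?x = 2"
    using below_top_pair(1,2)[OF p, of \<epsilon>] below_top_pair(3)[OF p] c unfolding m by metis+
  show ?thesis unfolding s_perm_eq using d_pair[OF q HOL.refl b] d_pair[OF q(2,1) c b] by simp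
qed

lemma braid_word_prod:
  assumes "(u, v) \<in> braid_rels n"
  shows "word_prod F (\<lambda>i. d (s_perm i)) u = word_prod F (\<lambda>i. d (s_perm i)) v"
proof -
  have far: "d (s_perm i) \<otimes> d (s_perm j) = d (s_perm j) \<otimes> d (s_perm i)" if "i \<in> {1..n}" "j \<in> {1..n}" "far i j" for i j
  proof -
    have "Suc i < j \<or> Suc j < i" using that(3) by (auto simp: far_def)
    then show ?thesis using d_far[OF that(1,2)] d_far[OF that(2,1)] by auto
  qed
  have adj: "d (s_perm i) \<otimes> d (s_perm j) \<otimes> d (s_perm i) = d (s_perm j) \<otimes> d (s_perm i) \<otimes> d (s_perm j)"
    if "i \<in> {1..n}" "j \<in> {1..n}" "adjacent i j" for i j
  proof -
    have "j = Suc i \<or> i = Suc j" using that(3) by (auto simp: adjacent_def)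
    then show ?thesis using d_braid[of i] d_braid[of j] that(1,2) by metis
  qed
  from assms consider i j where "u = [i, j, i]" "v = [j, i, j]" "i \<in> {1..n}" "j \<in> {1..n}" "adjacent i j"
    | i j where "u = [i, j]" "v = [j, i]" "i \<in> {1..n}" "j \<in> {1..n}" "far i j"
    unfolding braid_rels_def by blast
  then show ?thesis
  proof cases
    case 1
    show ?thesis using adj[OF 1(3-5)] 1(1,2) d_s_closed[OF 1(3)] d_s_closed[OF 1(4)]
      by (simp add: word_prod_Nil word_prod_Cons m_assoc)
  next
    case 2
    show ?thesis using far[OF 2(3-5)] 2(1,2) d_s_closed[OF 2(3)] d_s_closed[OF 2(4)]
      by (simp add: word_prod_Nil word_prod_Cons)
  qed
qed

text \<open>Bessis' morphism evaluated on signed words; \<open>artin_image\<close> is its image, a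
  subgroup.\<close>

definition artin :: "(nat \<times> bool) list \<Rightarrow> 'f"
  where "artin = word_prod F (signed F (\<lambda>i. d (s_perm i)))"

definition artin_image :: "'f set"
  where "artin_image = artin ` lists ({1..n} \<times> UNIV)"

lemma s_perm_funcset: "(\<lambda>i. d (s_perm i)) \<in> {1..n} \<rightarrow> carrier F"
  by (intro Pi_I d_s_closed)

lemma artin_image_closed: "x \<in> artin_image \<Longrightarrow> x \<in> carrier F"
  unfolding artin_image_def artin_def using word_prod_closed[OF signed_closed[OF s_perm_funcset]] by blast

lemma artin_image_one: "\<one> \<in> artin_image"
  unfolding artin_image_def artin_def by (rule image_eqI[of _ _ "[]"]) (simp_all add: word_prod_Nil)

lemma artin_image_mult:
  assumes "x \<in> artin_image" "y \<in> artin_image" shows "x \<otimes> y \<in> artin_image"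
proof -
  obtain u v where uv: "u \<in> lists ({1..n} \<times> UNIV)" "x = artin u" "v \<in> lists ({1..n} \<times> UNIV)" "y = artin v"
    using assms unfolding artin_image_def by blast
  then have "x \<otimes> y = artin (u @ v)"
    unfolding artin_def using word_prod_append[OF signed_closed[OF s_perm_funcset]] by simp
  moreover have "u @ v \<in> lists ({1..n} \<times> UNIV)" using uv by simp
  ultimately show ?thesis unfolding artin_image_def by blast
qed

lemma artin_image_inv:
  assumes "x \<in> artin_image" shows "inv x \<in> artin_image"
proof -
  obtain u where u: "u \<in> lists ({1..n} \<times> UNIV)" "x = artin u"
    using assms unfolding artin_image_def by blast
  have "inv x = artin (rev (map (\<lambda>(x, e). (x, \<not> e)) u))"
    unfolding u(2) artin_def by (rule word_prod_signed_inverse[OF s_perm_funcset u(1), symmetric])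
  moreover have "rev (map (\<lambda>(x, e). (x, \<not> e)) u) \<in> lists ({1..n} \<times> UNIV)" using u(1) by fastforce
  ultimately show ?thesis unfolding artin_image_def by blast
qed

lemma artin_image_gen:
  assumes "i \<in> {1..n}" shows "d (s_perm i) \<in> artin_image"
proof -
  have "d (s_perm i) = artin [(i, True)]"
    unfolding artin_def using d_s_closed[OF assms] by (simp add: word_prod_Nil word_prod_Cons signed_def)
  moreover have "[(i, True)] \<in> lists ({1..n} \<times> UNIV)" using assms by simp
  ultimately show ?thesis unfolding artin_image_def by blast
qed

text \<open>By \<open>d_slide\<close> a longer atom is the conjugate of a shorter one by a simple
  generator or its inverse.\<close>

lemma artin_image_tr: "m \<le> n \<Longrightarrow> a \<in> {1..m} \<Longrightarrow> d (tr a (Suc m)) \<in> artin_image"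
proof (induction m)
  case (Suc m)
  let ?t = "d (tr a (Suc m))" and ?t' = "d (tr a (Suc (Suc m)))" and ?s = "d (tr (Suc m) (Suc (Suc m)))"
  have s: "?s \<in> artin_image" using artin_image_gen[of "Suc m"] Suc.prems(1) by (simp add: s_perm_eq)
  show ?case
  proof (cases "a = Suc m")
    case True
    then show ?thesis using s by (simp only:)
  next
    case False
    then have a: "a \<in> {1..m}" using Suc.prems by auto
    have t: "?t \<in> artin_image" using Suc a by simp
    have c: "?s \<in> carrier F" "?t \<in> carrier F" using s t artin_image_closed by auto
    have c': "?t' \<in> carrier F" by (rule d_tr) (use Suc.prems in \<open>auto simp: tpairs_def\<close>)
    show ?thesis
    proof (cases "\<epsilon> (Suc m)")
      case True
      then have "?s \<otimes> ?t = ?t' \<otimes> ?s" using d_slide(2)[OF a Suc.prems(1)] by blast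
      then have "?t' = ?s \<otimes> ?t \<otimes> inv ?s" using c c' by (metis inv_solve_right m_closed)
      then show ?thesis using s t artin_image_mult artin_image_inv by simp
    next
      case False
      then have "?t \<otimes> ?s = ?s \<otimes> ?t'" using d_slide(1)[OF a Suc.prems(1)] by blast
      then have "?t' = inv ?s \<otimes> (?t \<otimes> ?s)" using c c' by (metis inv_solve_left m_closed)
      then show ?thesis using s t artin_image_mult artin_image_inv by simp
    qed
  qed
qed simp

lemma artin_image_pair:
  assumes "(a, b) \<in> tpairs (Suc n)" shows "d (tr a b) \<in> artin_image"
proof -
  have "d (tr k l) \<in> artin_image" if "1 \<le> k" "k < l" "l \<le> Suc n" for k l
    using artin_image_tr[of "l - 1" k] that by simp
  from this[of a b] this[of b a] show ?thesis
    using assms by (cases "a < b") (auto simp: tpairs_def transpose_commute[of b a])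
qed

text \<open>A divisor is the product of the atoms along a reduced word, and the atoms lie in the
  image. Hence the preimage that the definition of a simple dual braid asks for exists.\<close>

lemma artin_image_dual:
  assumes "below (Suc n) x (cox \<epsilon> n)" shows "d x \<in> artin_image"
proof -
  interpret b: braid_rep n "\<lambda>_. 0 :: int" by standard auto
  have "d (tprod ws) \<in> artin_image"
    if "set ws \<subseteq> tpairs (Suc n)" "b.treduced ws" "below (Suc n) (tprod ws) (cox \<epsilon> n)" for ws
    using that
  proof (induction ws)
    case Nil
    have "tprod [] = id" by (simp add: tprod_def)
    then show ?case using artin_image_one by (simp only: d_id)
  next
    case (Cons p ws)
    obtain a b where p: "p = (a, b)" by force
    have ab: "(a, b) \<in> tpairs (Suc n)" "set ws \<subseteq> tpairs (Suc n)" using Cons.prems(1) p by auto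
    have r: "b.treduced ws" using b.treduced_append[of "[p]" ws] Cons.prems by simp
    have "below (Suc n) (tprod ws) (cox \<epsilon> n)"
      using b.below_infix[of "[p]" ws "[]"] Cons.prems by simp
    then have IH: "d (tprod ws) \<in> artin_image" using Cons.IH ab r by blast
    have e: "tprod (p # ws) = tr a b \<circ> tprod ws" by (simp add: tprod_def p)
    have "d (tr a b) \<otimes> d (tprod ws) = d (tr a b \<circ> tprod ws)"
    proof (rule d_mult)
      show "tr a b permutes {1..Suc n}" using ab by (auto intro!: tr_permutes simp: tpairs_def simp del: One_nat_def)
      show "tprod ws permutes {1..Suc n}" by (rule tprod_permutes[OF ab(2)])
      show "below (Suc n) (tr a b \<circ> tprod ws) (cox \<epsilon> n)" using Cons.prems(3) unfolding e .
      have "abs_len (Suc n) (tr a b) = 1" using ab by (auto intro!: abs_len_single simp: tpairs_def simp del: One_nat_def)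
      then show "abs_len (Suc n) (tr a b \<circ> tprod ws) = abs_len (Suc n) (tr a b) + abs_len (Suc n) (tprod ws)"
        using r Cons.prems(2) unfolding b.treduced_def e by simp
    qed
    then show ?case unfolding e using artin_image_mult[OF artin_image_pair[OF ab(1)] IH] by (simp only:)
  qed
  moreover obtain ws where "set ws \<subseteq> tpairs (Suc n)" "tprod ws = x" "b.treduced ws"
    by (rule b.ex_treduced[OF below_permutes[OF assms]])
  ultimately show ?thesis using assms by blast
qed

end

text \<open>The relations between divisors pass to the group of fractions as \<open>d_mult\<close>;
  the one that identifies the generator of the identity with the unit gives
  \<open>d_id\<close>.\<close>

lemma dual_rep_frac:
  fixes n \<epsilon> defines "c \<equiv> cox \<epsilon> n"
  shows "dual_rep (fraction_group (dual_braid_monoid n c)) n \<epsilon> (dual_braid_in_frac n c)"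
proof -
  define D R where "D = Div n c" and "R = dual_braid_rels n c"
  define M where "M = dual_braid_monoid n c"
  have M: "M = presented_monoid D R" by (simp add: M_def D_def R_def dual_braid_monoid_def)
  define F where "F = fraction_group M"
  interpret M: monoid M unfolding M by (rule monoid_presented)
  interpret F: group F unfolding F_def fraction_group_def by (rule group_presented)
  have cp: "c permutes {1..n + 1}" unfolding c_def using cox_permutes by simp
  have D: "x \<in> D \<longleftrightarrow> below (Suc n) x c" for x unfolding D_def Div_eq[OF cp] by simp
  define g where "g = dual_braid_gen n c"
  have g: "g x = pcls D R [x]" for x by (simp add: g_def D_def R_def dual_braid_gen_def monoid_gen_eq)
  define P where "P = pcls (carrier M \<times> (UNIV :: bool set)) (group_rels (carrier M) (mult_rels M))"
  have d: "dual_braid_in_frac n c x = P [(g x, True)]" for x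
    by (simp add: dual_braid_in_frac_def frac_incl_def group_gen_eq P_def M_def g_def)
  have gc: "g x \<in> carrier M" if "x \<in> D" for x
    unfolding M carrier_presented g by (rule imageI) (use that in simp)
  have mult: "P u \<otimes>\<^bsub>F\<^esub> P v = P (u @ v)"
    if "u \<in> lists (carrier M \<times> UNIV)" "v \<in> lists (carrier M \<times> UNIV)" for u v
    using that unfolding F_def fraction_group_def presented_group_def P_def by (rule mult_presented)
  have one: "\<one>\<^bsub>F\<^esub> = P []"
    unfolding F_def fraction_group_def presented_group_def P_def by (rule one_presented)
  have rel: "P (map (\<lambda>x. (x, True)) u) = P (map (\<lambda>x. (x, True)) v)"
    if "(u, v) \<in> mult_rels M" "u \<in> lists (carrier M)" "v \<in> lists (carrier M)" for u v
    unfolding P_def by (rule pcls_rel) (use that in \<open>auto simp: group_rels_def\<close>)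
  have gmult: "g x \<otimes>\<^bsub>M\<^esub> g y = g (x \<circ> y)"
    if "x \<in> D" "y \<in> D" "x \<circ> y \<in> D" "abs_len (Suc n) (x \<circ> y) = abs_len (Suc n) x + abs_len (Suc n) y" for x y
  proof -
    have "length_T n z = abs_len (Suc n) z" if "z \<in> D" for z
      using below_permutes[of "Suc n" z c] that D length_T_eq[of z n] by simp
    then have "([x, y], [x \<circ> y]) \<in> R"
      using that unfolding R_def dual_braid_rels_def D_def by (auto simp: sym_group_def)
    then have "pcls D R [x, y] = pcls D R [x \<circ> y]" by (rule pcls_rel) (use that in auto)
    moreover have "g x \<otimes>\<^bsub>M\<^esub> g y = pcls D R ([x] @ [y])"
      unfolding M g by (rule mult_presented) (use that in auto)
    ultimately show ?thesis unfolding g by simp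
  qed
  have idD: "id \<in> D" unfolding D below_def c_def
    using cox_permutes[of \<epsilon> n] abs_len_id[of "Suc n"] permutes_id by auto
  have gid: "g id = \<one>\<^bsub>M\<^esub>"
    unfolding M one_presented g
    by (rule pcls_rel) (use idD in \<open>auto simp: R_def dual_braid_rels_def sym_group_def\<close>)
  have "dual_rep F n \<epsilon> (\<lambda>x. P [(g x, True)])"
  proof (unfold_locales)
    fix x assume "below (Suc n) x (cox \<epsilon> n)"
    then have "x \<in> D" unfolding D c_def .
    then show "P [(g x, True)] \<in> carrier F"
      unfolding F_def fraction_group_def carrier_presented_group P_def by (intro imageI) (simp add: gc)
  next
    have "P (map (\<lambda>x. (x, True)) [\<one>\<^bsub>M\<^esub>]) = P (map (\<lambda>x. (x, True)) [])"
      by (rule rel) (auto simp: mult_rels_def)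
    then show "P [(g id, True)] = \<one>\<^bsub>F\<^esub>" unfolding one gid by simp
  next
    fix x y
    assume xy: "x permutes {1..Suc n}" "y permutes {1..Suc n}" "below (Suc n) (x \<circ> y) (cox \<epsilon> n)"
      "abs_len (Suc n) (x \<circ> y) = abs_len (Suc n) x + abs_len (Suc n) y"
    have xD: "x \<in> D" unfolding D c_def
      by (rule below_trans_mid[OF xy(3) permutes_id xy(1,2)]) (use xy(4) abs_len_id in auto)
    have yD: "y \<in> D" unfolding D c_def
      by (rule below_trans_mid[OF xy(3) xy(1,2) permutes_id]) (use xy(4) abs_len_id in auto)
    have xyD: "x \<circ> y \<in> D" unfolding D c_def by (rule xy(3))
    have "P [(g x, True)] \<otimes>\<^bsub>F\<^esub> P [(g y, True)] = P (map (\<lambda>x. (x, True)) [g x, g y])"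
      using mult[of "[(g x, True)]" "[(g y, True)]"] gc xD yD by simp
    also have "\<dots> = P (map (\<lambda>x. (x, True)) [g x \<otimes>\<^bsub>M\<^esub> g y])"
      by (rule rel) (use gc xD yD in \<open>auto simp: mult_rels_def\<close>)
    also have "\<dots> = P [(g (x \<circ> y), True)]" using gmult[OF xD yD xyD xy(4)] by simp
    finally show "P [(g x, True)] \<otimes>\<^bsub>F\<^esub> P [(g y, True)] = P [(g (x \<circ> y), True)]" .
  qed
  then show ?thesis unfolding F_def M_def using d by presburger
qed

subsection \<open>The Temperley--Lieb algebra as a ring\<close>

lemma ring_free_algebra: "ring (free_algebra X :: ('a list \<Rightarrow>\<^sub>0 'r::comm_ring_1) ring)"
proof -
  let ?R = "free_algebra X :: ('a list \<Rightarrow>\<^sub>0 'r) ring"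
  have c: "p \<in> carrier ?R \<longleftrightarrow> Poly_Mapping.keys p \<subseteq> lists X" for p by (simp add: free_algebra_def)
  have add: "p + q \<in> carrier ?R" if "p \<in> carrier ?R" "q \<in> carrier ?R" for p q
    using that Poly_Mapping.keys_add[of p q] unfolding c by blast
  have neg: "- p \<in> carrier ?R" if "p \<in> carrier ?R" for p using that unfolding c by simp
  have mult: "p * q \<in> carrier ?R" if "p \<in> carrier ?R" "q \<in> carrier ?R" for p q
  proof -
    have "Poly_Mapping.keys (p * q) \<subseteq> {a + b | a b. a \<in> Poly_Mapping.keys p \<and> b \<in> Poly_Mapping.keys q}" by (rule keys_mult)
    also have "\<dots> \<subseteq> lists X" using that unfolding c by (fastforce simp: plus_list_def)
    finally show ?thesis unfolding c .
  qed
  have zero: "0 \<in> carrier ?R" and one: "1 \<in> carrier ?R"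
    unfolding c by (simp_all add: zero_list_def)
  have ops: "p \<oplus>\<^bsub>?R\<^esub> q = p + q" "p \<otimes>\<^bsub>?R\<^esub> q = p * q" "\<zero>\<^bsub>?R\<^esub> = 0" "\<one>\<^bsub>?R\<^esub> = 1" for p q
    by (simp_all add: free_algebra_def)
  show ?thesis
  proof (rule ringI)
    show "abelian_group ?R"
      by (rule abelian_groupI) (use add zero neg in \<open>auto simp: ops algebra_simps intro: bexI[of _ "- p" for p]\<close>)
    show "monoid ?R"
      by (rule monoidI) (use mult one in \<open>auto simp: ops mult.assoc\<close>)
  qed (auto simp: ops algebra_simps)
qed

lemma TL_free_ops:
  "p \<oplus>\<^bsub>TL_free n\<^esub> q = p + q" "p \<otimes>\<^bsub>TL_free n\<^esub> q = p * q" "\<zero>\<^bsub>TL_free n\<^esub> = 0" "\<one>\<^bsub>TL_free n\<^esub> = 1"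
  "p \<in> carrier (TL_free n) \<longleftrightarrow> Poly_Mapping.keys p \<subseteq> lists {1..n}"
  by (simp_all add: TL_free_def free_algebra_def)

lemma ring_TL_free: "ring (TL_free n)"
  unfolding TL_free_def by (rule ring_free_algebra)

lemma indet_closed: "i \<in> {1..n} \<Longrightarrow> indet i \<in> carrier (TL_free n)"
  by (simp add: TL_free_ops(5) indet_def)

lemma scalar_closed: "scalar_poly r \<in> carrier (TL_free n)"
  by (simp add: TL_free_ops(5) scalar_poly_def)

lemma scalar_poly_add: "scalar_poly (r + s) = scalar_poly r + scalar_poly s"
  by (simp add: scalar_poly_def single_add)

lemma scalar_poly_mult: "scalar_poly (r * s) = scalar_poly r * scalar_poly s"
  by (simp add: scalar_poly_def mult_single plus_list_def)

lemma scalar_poly_one: "scalar_poly 1 = 1"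
  by (simp add: scalar_poly_def flip: single_one zero_list_def)

lemma scalar_poly_commute: "scalar_poly r * p = p * scalar_poly r"
proof (induction p rule: update_induct)
  case const
  show ?case by simp
next
  case (update p k x)
  have "Poly_Mapping.update k x p = p + Poly_Mapping.single k x"
    using update(1) by (intro poly_mapping_eqI) (auto simp: lookup_update lookup_add lookup_single in_keys_iff when_def)
  moreover have "scalar_poly r * Poly_Mapping.single k x = Poly_Mapping.single k x * scalar_poly r"
    by (simp add: scalar_poly_def mult_single plus_list_def mult.commute)
  ultimately show ?case using update(3) by (simp add: distrib_left distrib_right)
qed

lemma TL_free_minus_closed:
  assumes "p \<in> carrier (TL_free n)" "q \<in> carrier (TL_free n)" shows "p - q \<in> carrier (TL_free n)"
  using assms Poly_Mapping.keys_diff[of p q] unfolding TL_free_ops by blast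

lemma TL_rels_closed: "TL_rels n \<subseteq> carrier (TL_free n)"
proof -
  interpret ring "TL_free n" by (rule ring_TL_free)
  note m = m_closed[unfolded TL_free_ops(2)]
  show ?thesis unfolding TL_rels_def
    by (auto intro!: TL_free_minus_closed m indet_closed scalar_closed)
qed

lemma TL_ideal: "ideal (TL_ideal n) (TL_free n)"
  unfolding TL_ideal_def by (rule ring.genideal_ideal[OF ring_TL_free TL_rels_closed])

lemma ring_TL: "ring (TL n)"
  unfolding TL_def by (rule ideal.quotient_is_ring[OF TL_ideal])

lemma TL_class_hom: "TL_class n \<in> ring_hom (TL_free n) (TL n)"
proof -
  have "TL_class n = (+>\<^bsub>TL_free n\<^esub>) (TL_ideal n)" by (simp add: fun_eq_iff TL_class_def)
  then show ?thesis unfolding TL_def using ideal.rcos_ring_hom[OF TL_ideal] by simp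
qed

lemma TL_class_closed: "p \<in> carrier (TL_free n) \<Longrightarrow> TL_class n p \<in> carrier (TL n)"
  by (rule ring_hom_closed[OF TL_class_hom])

lemma TL_class_ops:
  assumes "p \<in> carrier (TL_free n)" "q \<in> carrier (TL_free n)"
  shows "TL_class n (p + q) = TL_class n p \<oplus>\<^bsub>TL n\<^esub> TL_class n q" "TL_class n (p * q) = TL_class n p \<otimes>\<^bsub>TL n\<^esub> TL_class n q"
  using ring_hom_add[OF TL_class_hom assms] ring_hom_mult[OF TL_class_hom assms] by (simp_all add: TL_free_ops)

lemma TL_class_one: "TL_class n 1 = \<one>\<^bsub>TL n\<^esub>"
  using ring_hom_one[OF TL_class_hom] by (simp add: TL_free_ops)

lemma TL_carrier: "carrier (TL n) = TL_class n ` carrier (TL_free n)"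
  by (auto simp: TL_def FactRing_def A_RCOSETS_def' TL_class_def)

lemma TL_class_ideal: "p \<in> TL_ideal n \<Longrightarrow> TL_class n p = \<zero>\<^bsub>TL n\<^esub>"
  using ring.a_rcos_zero[OF ring_TL_free TL_ideal] by (simp add: TL_class_def TL_def FactRing_def)

lemma TL_class_rel:
  assumes "p - q \<in> TL_rels n" "q \<in> carrier (TL_free n)" shows "TL_class n p = TL_class n q"
proof -
  interpret ring "TL n" by (rule ring_TL)
  have c: "p - q \<in> carrier (TL_free n)" using assms(1) TL_rels_closed by blast
  have "p - q \<in> TL_ideal n" unfolding TL_ideal_def
    using assms(1) ring.genideal_self[OF ring_TL_free TL_rels_closed] by blast
  then have "TL_class n ((p - q) + q) = TL_class n q"
    using TL_class_ops(1)[OF c assms(2)] TL_class_ideal TL_class_closed[OF assms(2)] by simp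
  then show ?thesis by simp
qed

lemma b_gen_closed: "i \<in> {1..n} \<Longrightarrow> b_gen n i \<in> carrier (TL n)"
  unfolding b_gen_def by (intro TL_class_closed indet_closed)

lemma TL_scalar_closed: "TL_scalar n r \<in> carrier (TL n)"
  unfolding TL_scalar_def by (intro TL_class_closed scalar_closed)

lemma TL_scalar_add: "TL_scalar n (r + s) = TL_scalar n r \<oplus>\<^bsub>TL n\<^esub> TL_scalar n s"
  unfolding TL_scalar_def scalar_poly_add by (intro TL_class_ops scalar_closed)

lemma TL_scalar_mult: "TL_scalar n (r * s) = TL_scalar n r \<otimes>\<^bsub>TL n\<^esub> TL_scalar n s"
  unfolding TL_scalar_def scalar_poly_mult by (intro TL_class_ops scalar_closed)

lemma TL_scalar_one: "TL_scalar n 1 = \<one>\<^bsub>TL n\<^esub>"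
  unfolding TL_scalar_def scalar_poly_one by (rule TL_class_one)

lemma TL_scalar_zero: "TL_scalar n 0 = \<zero>\<^bsub>TL n\<^esub>"
proof -
  interpret ring "TL n" by (rule ring_TL)
  show ?thesis using TL_scalar_add[of n 0 0] TL_scalar_closed[of n 0] by (metis add.l_cancel_one add_0)
qed

lemma TL_scalar_uminus: "TL_scalar n (- r) = \<ominus>\<^bsub>TL n\<^esub> TL_scalar n r"
proof -
  interpret ring "TL n" by (rule ring_TL)
  have "TL_scalar n (- r) \<oplus>\<^bsub>TL n\<^esub> TL_scalar n r = \<zero>\<^bsub>TL n\<^esub>"
    using TL_scalar_add[of n "- r" r] TL_scalar_zero by simp
  then show ?thesis using minus_equality[OF _ TL_scalar_closed TL_scalar_closed] by metis
qed

lemma TL_scalar_central: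
  assumes "a \<in> carrier (TL n)" shows "TL_scalar n r \<otimes>\<^bsub>TL n\<^esub> a = a \<otimes>\<^bsub>TL n\<^esub> TL_scalar n r"
proof -
  obtain p where p: "p \<in> carrier (TL_free n)" "a = TL_class n p" using assms unfolding TL_carrier by blast
  show ?thesis unfolding p(2) TL_scalar_def
    using TL_class_ops(2)[OF p(1) scalar_closed] TL_class_ops(2)[OF scalar_closed p(1)] scalar_poly_commute[of r p] by metis
qed

lemma v_v_inv: "v_laurent * v_inv_laurent = 1" "v_inv_laurent * v_laurent = 1"
  by (simp_all add: v_laurent_def v_inv_laurent_def mult_single)

lemma TL_class_triple:
  assumes "i \<in> {1..n}" "j \<in> {1..n}"
  shows "TL_class n (indet i * indet j) = b_gen n i \<otimes>\<^bsub>TL n\<^esub> b_gen n j"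
    "TL_class n (indet i * indet j * indet i) = b_gen n i \<otimes>\<^bsub>TL n\<^esub> b_gen n j \<otimes>\<^bsub>TL n\<^esub> b_gen n i"
    "indet i * indet j \<in> carrier (TL_free n)"
proof -
  interpret R: ring "TL_free n" by (rule ring_TL_free)
  note c = indet_closed[OF assms(1)] indet_closed[OF assms(2)]
  show m: "indet i * indet j \<in> carrier (TL_free n)" using R.m_closed[OF c] by (simp add: TL_free_ops(2))
  show "TL_class n (indet i * indet j) = b_gen n i \<otimes>\<^bsub>TL n\<^esub> b_gen n j"
    unfolding b_gen_def using TL_class_ops(2)[OF c] .
  then show "TL_class n (indet i * indet j * indet i) = b_gen n i \<otimes>\<^bsub>TL n\<^esub> b_gen n j \<otimes>\<^bsub>TL n\<^esub> b_gen n i"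
    using TL_class_ops(2)[OF m c(1)] by (simp add: b_gen_def)
qed

lemma b_gen_adjacent:
  assumes "i \<in> {1..n}" "j \<in> {1..n}" "adjacent i j"
  shows "b_gen n i \<otimes>\<^bsub>TL n\<^esub> b_gen n j \<otimes>\<^bsub>TL n\<^esub> b_gen n i = b_gen n i"
proof -
  have "TL_class n (indet i * indet j * indet i) = TL_class n (indet i)"
    by (rule TL_class_rel[OF _ indet_closed[OF assms(1)]]) (use assms in \<open>auto simp: TL_rels_def\<close>)
  then show ?thesis using TL_class_triple(2)[OF assms(1,2)] by (simp add: b_gen_def)
qed

lemma b_gen_far:
  assumes "i \<in> {1..n}" "j \<in> {1..n}" "far i j"
  shows "b_gen n i \<otimes>\<^bsub>TL n\<^esub> b_gen n j = b_gen n j \<otimes>\<^bsub>TL n\<^esub> b_gen n i"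
proof -
  have "TL_class n (indet i * indet j) = TL_class n (indet j * indet i)"
    by (rule TL_class_rel[OF _ TL_class_triple(3)[OF assms(2,1)]]) (use assms in \<open>auto simp: TL_rels_def\<close>)
  then show ?thesis using TL_class_triple(1)[OF assms(1,2)] TL_class_triple(1)[OF assms(2,1)] by simp
qed

lemma b_gen_square:
  assumes "i \<in> {1..n}"
  shows "b_gen n i \<otimes>\<^bsub>TL n\<^esub> b_gen n i = TL_scalar n (v_laurent + v_inv_laurent) \<otimes>\<^bsub>TL n\<^esub> b_gen n i"
proof -
  interpret R: ring "TL_free n" by (rule ring_TL_free)
  let ?c = "scalar_poly (v_laurent + v_inv_laurent)"
  have "?c * indet i \<in> carrier (TL_free n)"
    using R.m_closed[OF scalar_closed indet_closed[OF assms]] by (simp add: TL_free_ops(2))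
  then have "TL_class n (indet i * indet i) = TL_class n (?c * indet i)"
    by (rule TL_class_rel[rotated]) (use assms in \<open>auto simp: TL_rels_def\<close>)
  then show ?thesis using TL_class_triple(1)[OF assms assms] TL_class_ops(2)[OF scalar_closed indet_closed[OF assms]]
    by (simp add: b_gen_def TL_scalar_def)
qed

text \<open>One non-trivial component suffices for 0 and 1 to differ in the product of all the
  algebras. For n = 0 there are no relations and the ideal is zero.\<close>

lemma TL_0_nontrivial: "\<zero>\<^bsub>TL 0\<^esub> \<noteq> \<one>\<^bsub>TL 0\<^esub>"
proof
  interpret R: ring "TL_free 0" by (rule ring_TL_free)
  interpret I: ideal "TL_ideal 0" "TL_free 0" by (rule TL_ideal)
  have "TL_rels 0 = {}" by (simp add: TL_rels_def)
  then have I: "TL_ideal 0 \<subseteq> {0}"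
    using R.genideal_minimal[OF R.zeroideal, of "{}"] by (simp add: TL_ideal_def TL_free_ops)
  assume "\<zero>\<^bsub>TL 0\<^esub> = \<one>\<^bsub>TL 0\<^esub>"
  then have "TL_ideal 0 +>\<^bsub>TL_free 0\<^esub> \<one>\<^bsub>TL_free 0\<^esub> = TL_ideal 0"
    by (simp add: TL_def FactRing_def)
  then have "\<one>\<^bsub>TL_free 0\<^esub> \<in> TL_ideal 0" by (intro I.rcos_const_imp_mem) auto
  then show False using I by (auto simp: TL_free_ops)
qed

subsection \<open>Families of elements of the Temperley--Lieb algebras\<close>

text \<open>The algebra \<open>TL n\<close> is a record depending on the number \<open>n\<close>, whereas the positivity
  argument is carried out in a type of class \<open>ring_1\<close>. The product of all these algebras is such
  a type, in which \<open>TL n\<close> is found as the \<open>n\<close>-th component.\<close>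

typedef tl_family = "{f. \<forall>n. f n \<in> carrier (TL n)}"
  by (rule exI[of _ "\<lambda>n. \<zero>\<^bsub>TL n\<^esub>"]) (simp add: ring.ring_simprules(2)[OF ring_TL])

definition component :: "nat \<Rightarrow> tl_family \<Rightarrow> (nat list \<Rightarrow>\<^sub>0 laurent) set"
  where "component n f = Rep_tl_family f n"

lemma component_closed: "component n f \<in> carrier (TL n)"
  using Rep_tl_family[of f] by (simp add: component_def)

lemma component_Abs: "(\<And>n. f n \<in> carrier (TL n)) \<Longrightarrow> component n (Abs_tl_family f) = f n"
  by (simp add: component_def Abs_tl_family_inverse)

lemma tl_family_eqI: "(\<And>n. component n f = component n g) \<Longrightarrow> f = g"
  unfolding component_def by (metis Rep_tl_family_inject ext)

instantiation tl_family :: ring_1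
begin

definition zero_tl_family :: tl_family where "zero_tl_family = Abs_tl_family (\<lambda>n. \<zero>\<^bsub>TL n\<^esub>)"
definition one_tl_family :: tl_family where "one_tl_family = Abs_tl_family (\<lambda>n. \<one>\<^bsub>TL n\<^esub>)"
definition plus_tl_family :: "tl_family \<Rightarrow> tl_family \<Rightarrow> tl_family"
  where "plus_tl_family f g = Abs_tl_family (\<lambda>n. component n f \<oplus>\<^bsub>TL n\<^esub> component n g)"
definition times_tl_family :: "tl_family \<Rightarrow> tl_family \<Rightarrow> tl_family"
  where "times_tl_family f g = Abs_tl_family (\<lambda>n. component n f \<otimes>\<^bsub>TL n\<^esub> component n g)"
definition uminus_tl_family :: "tl_family \<Rightarrow> tl_family"
  where "uminus_tl_family f = Abs_tl_family (\<lambda>n. \<ominus>\<^bsub>TL n\<^esub> component n f)"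
definition minus_tl_family :: "tl_family \<Rightarrow> tl_family \<Rightarrow> tl_family"
  where "minus_tl_family f g = Abs_tl_family (\<lambda>n. component n f \<ominus>\<^bsub>TL n\<^esub> component n g)"

lemma component_ops:
  "component n 0 = \<zero>\<^bsub>TL n\<^esub>" "component n 1 = \<one>\<^bsub>TL n\<^esub>" "component n (f + g) = component n f \<oplus>\<^bsub>TL n\<^esub> component n g"
  "component n (f * g) = component n f \<otimes>\<^bsub>TL n\<^esub> component n g" "component n (- f) = \<ominus>\<^bsub>TL n\<^esub> component n f" "component n (f - g) = component n f \<ominus>\<^bsub>TL n\<^esub> component n g"
  unfolding zero_tl_family_def one_tl_family_def plus_tl_family_def times_tl_family_def uminus_tl_family_def minus_tl_family_def
  by (rule component_Abs; intro ring.ring_simprules[OF ring_TL] component_closed)+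

instance
proof
  fix f g h :: tl_family
  show "f + g + h = f + (g + h)" "f + g = g + f" "0 + f = f" "- f + f = 0" "f - g = f + - g"
    "f * g * h = f * (g * h)" "1 * f = f" "f * 1 = f" "(f + g) * h = f * h + g * h" "f * (g + h) = f * g + f * h"
    by (rule tl_family_eqI;
        simp only: component_ops ring.ring_simprules[OF ring_TL] component_closed a_minus_def monoid.r_one[OF ring.is_monoid[OF ring_TL]])+
  show "(0 :: tl_family) \<noteq> 1"
    using TL_0_nontrivial component_ops(1,2)[of 0] by metis
qed

end

text \<open>Zero outside component n and for indices out of range, so that the relations need
  checking only where a generator exists. The minus sign is the one that \<open>TL_rep\<close>
  builds into its generators.\<close>

definition b_family :: "nat \<Rightarrow> nat \<Rightarrow> tl_family"
  where "b_family n i = Abs_tl_family (\<lambda>m. if m = n \<and> i \<in> {1..n} then \<ominus>\<^bsub>TL n\<^esub> b_gen n i else \<zero>\<^bsub>TL m\<^esub>)"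

definition scalar_family :: "laurent \<Rightarrow> tl_family"
  where "scalar_family r = Abs_tl_family (\<lambda>m. TL_scalar m r)"

lemma component_scalar: "component m (scalar_family r) = TL_scalar m r"
  unfolding scalar_family_def by (rule component_Abs) (rule TL_scalar_closed)

lemma component_b: "component m (b_family n i) = (if m = n \<and> i \<in> {1..n} then \<ominus>\<^bsub>TL n\<^esub> b_gen n i else \<zero>\<^bsub>TL m\<^esub>)"
proof -
  have "(if k = n \<and> i \<in> {1..n} then \<ominus>\<^bsub>TL n\<^esub> b_gen n i else \<zero>\<^bsub>TL k\<^esub>) \<in> carrier (TL k)" for k
  proof -
    interpret ring "TL k" by (rule ring_TL)
    show ?thesis
    proof (cases "n = k")
      case True
      show ?thesis unfolding True using b_gen_closed[of i k] by simp
    qed simp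
  qed
  then show ?thesis unfolding b_family_def by (rule component_Abs)
qed

lemma scalar_family_central: "scalar_family r * f = f * scalar_family r"
  by (rule tl_family_eqI) (simp add: component_ops component_scalar TL_scalar_central component_closed)

lemma scalar_family_inverse: "scalar_family v_laurent * scalar_family v_inv_laurent = 1"
  by (rule tl_family_eqI) (simp add: component_ops component_scalar v_v_inv TL_scalar_one flip: TL_scalar_mult)

lemma b_family_other: "m \<noteq> n \<or> i \<notin> {1..n} \<Longrightarrow> component m (b_family n i) = \<zero>\<^bsub>TL m\<^esub>"
  by (auto simp: component_b)

lemma b_family_self: "i \<in> {1..n} \<Longrightarrow> component n (b_family n i) = \<ominus>\<^bsub>TL n\<^esub> b_gen n i"
  by (simp add: component_b)

lemma b_family_square:
  "b_family n i * b_family n i = - (scalar_family v_laurent + scalar_family v_inv_laurent) * b_family n i"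
proof (rule tl_family_eqI)
  fix m
  interpret ring "TL m" by (rule ring_TL)
  have sc: "component m (- (scalar_family v_laurent + scalar_family v_inv_laurent)) = \<ominus>\<^bsub>TL m\<^esub> TL_scalar m (v_laurent + v_inv_laurent)"
    by (simp only: component_ops component_scalar TL_scalar_add)
  show "component m (b_family n i * b_family n i) = component m (- (scalar_family v_laurent + scalar_family v_inv_laurent) * b_family n i)"
  proof (cases "m = n \<and> i \<in> {1..n}")
    case True
    then have i: "i \<in> {1..m}" and m: "n = m" by simp_all
    show ?thesis using b_gen_square[OF i] b_gen_closed[OF i] TL_scalar_closed[of m "v_laurent + v_inv_laurent"]
      by (simp only: component_ops(4) sc m b_family_self[OF i] l_minus r_minus a_inv_closed m_closed)
  next
    case False
    then have "component m (b_family n i) = \<zero>\<^bsub>TL m\<^esub>" by (intro b_family_other) auto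
    then show ?thesis using TL_scalar_closed[of m "v_laurent + v_inv_laurent"]
      by (simp only: component_ops(4) sc r_null a_inv_closed zero_closed)
  qed
qed

lemma b_family_adjacent:
  assumes "i \<in> {1..n}" "j \<in> {1..n}" "adjacent i j"
  shows "b_family n i * b_family n j * b_family n i = b_family n i"
proof (rule tl_family_eqI)
  fix m
  interpret ring "TL m" by (rule ring_TL)
  show "component m (b_family n i * b_family n j * b_family n i) = component m (b_family n i)"
  proof (cases "n = m")
    case True
    note ij = assms[unfolded True]
    show ?thesis unfolding True using b_gen_adjacent[OF ij] b_gen_closed[OF ij(1)] b_gen_closed[OF ij(2)]
      by (simp only: component_ops(4) b_family_self[OF ij(1)] b_family_self[OF ij(2)] l_minus r_minus a_inv_closed m_closed minus_minus)
  qed (simp add: component_ops(4) b_family_other)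
qed

lemma b_family_far:
  assumes "i \<in> {1..n}" "j \<in> {1..n}" "far i j"
  shows "b_family n i * b_family n j = b_family n j * b_family n i"
proof (rule tl_family_eqI)
  fix m
  interpret ring "TL m" by (rule ring_TL)
  show "component m (b_family n i * b_family n j) = component m (b_family n j * b_family n i)"
  proof (cases "n = m")
    case True
    note ij = assms[unfolded True]
    show ?thesis unfolding True using b_gen_far[OF ij] b_gen_closed[OF ij(1)] b_gen_closed[OF ij(2)]
      by (simp only: component_ops(4) b_family_self[OF ij(1)] b_family_self[OF ij(2)] l_minus r_minus a_inv_closed m_closed)
  qed (simp add: component_ops(4) b_family_other)
qed

subsection \<open>The group of units of a ring as a type\<close>

text \<open>Carrying the inverse along makes negation an operation of the type, as
  \<open>group_add\<close> requires. This is the group to which \<open>braid_rep\<close> is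
  applied.\<close>

typedef (overloaded) 'a unit_pair = "{(a, b :: 'a::ring_1). a * b = 1 \<and> b * a = 1}"
  by (rule exI[of _ "(1, 1)"]) simp

definition unit_val :: "'a::ring_1 unit_pair \<Rightarrow> 'a" where "unit_val u = fst (Rep_unit_pair u)"
definition unit_inv :: "'a::ring_1 unit_pair \<Rightarrow> 'a" where "unit_inv u = snd (Rep_unit_pair u)"

lemma unit_val_inv: "unit_val u * unit_inv u = 1" "unit_inv u * unit_val u = 1"
  using Rep_unit_pair[of u] by (auto simp: unit_val_def unit_inv_def)

lemma unit_val_Abs:
  "a * b = 1 \<Longrightarrow> b * a = 1 \<Longrightarrow> unit_val (Abs_unit_pair (a, b)) = a"
  "a * b = 1 \<Longrightarrow> b * a = 1 \<Longrightarrow> unit_inv (Abs_unit_pair (a, b)) = b"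
  by (simp_all add: unit_val_def unit_inv_def Abs_unit_pair_inverse)

lemma unit_pair_eqI: "unit_val x = unit_val y \<Longrightarrow> x = y"
proof -
  assume e: "unit_val x = unit_val y"
  have "unit_inv x = unit_inv x * (unit_val y * unit_inv y)" by (simp add: unit_val_inv)
  also have "\<dots> = unit_inv y" by (simp add: unit_val_inv flip: mult.assoc e)
  finally show "x = y" using e unfolding unit_val_def unit_inv_def
    by (metis Rep_unit_pair_inject prod.expand)
qed

instantiation unit_pair :: (ring_1) group_add
begin

definition zero_unit_pair :: "'a unit_pair" where "zero_unit_pair = Abs_unit_pair (1, 1)"
definition plus_unit_pair :: "'a unit_pair \<Rightarrow> 'a unit_pair \<Rightarrow> 'a unit_pair"
  where "plus_unit_pair x y = Abs_unit_pair (unit_val x * unit_val y, unit_inv y * unit_inv x)"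
definition uminus_unit_pair :: "'a unit_pair \<Rightarrow> 'a unit_pair"
  where "uminus_unit_pair x = Abs_unit_pair (unit_inv x, unit_val x)"
definition minus_unit_pair :: "'a unit_pair \<Rightarrow> 'a unit_pair \<Rightarrow> 'a unit_pair"
  where "minus_unit_pair x y = x + - y"

lemma unit_val_zero: "unit_val 0 = 1"
  unfolding zero_unit_pair_def by (rule unit_val_Abs) simp_all

lemma unit_val_add: "unit_val (x + y) = unit_val x * unit_val y"
  unfolding plus_unit_pair_def
proof (rule unit_val_Abs)
  have "unit_val x * unit_val y * (unit_inv y * unit_inv x) = unit_val x * (unit_val y * unit_inv y) * unit_inv x"
    by (simp only: mult.assoc)
  then show "unit_val x * unit_val y * (unit_inv y * unit_inv x) = 1" by (simp add: unit_val_inv)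
  have "unit_inv y * unit_inv x * (unit_val x * unit_val y) = unit_inv y * (unit_inv x * unit_val x) * unit_val y"
    by (simp only: mult.assoc)
  then show "unit_inv y * unit_inv x * (unit_val x * unit_val y) = 1" by (simp add: unit_val_inv)
qed

lemma unit_val_uminus: "unit_val (- x) = unit_inv x"
  unfolding uminus_unit_pair_def by (rule unit_val_Abs) (simp_all add: unit_val_inv)

instance
proof
  fix x y z :: "'a unit_pair"
  show "x + y + z = x + (y + z)" "0 + x = x" "x + 0 = x" "- x + x = 0"
    by (rule unit_pair_eqI; simp add: unit_val_add unit_val_zero unit_val_uminus unit_val_inv mult.assoc)+
qed (simp add: minus_unit_pair_def)

end

text \<open>For \<open>i\<close> in range, component n is v^-1 - b_i, the value of
  \<open>omega\<close> at the generator, stored together with its inverse v - b_i.\<close>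

definition sigma_unit :: "nat \<Rightarrow> nat \<Rightarrow> tl_family unit_pair"
  where "sigma_unit n i =
    Abs_unit_pair (scalar_family v_inv_laurent + b_family n i, scalar_family v_laurent + b_family n i)"

lemma sigma_unit_val: "unit_val (sigma_unit n i) = scalar_family v_inv_laurent + b_family n i"
  unfolding sigma_unit_def
proof (rule unit_val_Abs)
  let ?V = "scalar_family v_laurent" and ?V' = "scalar_family v_inv_laurent" and ?B = "b_family n i"
  have vv: "?V * ?V' = 1" "?V' * ?V = 1" using scalar_family_inverse scalar_family_central[of v_laurent ?V'] by simp_all
  have "(?V' + ?B) * (?V + ?B) = ?V' * ?V + ?V' * ?B + ?B * ?V + ?B * ?B" by (simp add: algebra_simps)
  also have "\<dots> = 1" by (simp add: b_family_square vv scalar_family_central[of v_laurent ?B, symmetric] algebra_simps)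
  finally show "(?V' + ?B) * (?V + ?B) = 1" .
  have "(?V + ?B) * (?V' + ?B) = ?V * ?V' + ?V * ?B + ?B * ?V' + ?B * ?B" by (simp add: algebra_simps)
  also have "\<dots> = 1" by (simp add: b_family_square vv scalar_family_central[of v_inv_laurent ?B, symmetric] algebra_simps)
  finally show "(?V + ?B) * (?V' + ?B) = 1" .
qed

text \<open>The expansion is symmetric in x and y, and this symmetry is the braid relation.\<close>

lemma braid_of_TL:
  fixes x y w v :: "'a::ring_1"
  assumes w: "\<And>z. w * z = z * w" and v: "v * w = 1" "\<And>z. v * z = z * v"
    and x: "x * x = - (v + w) * x" "x * y * x = x"
  shows "(w + x) * (w + y) * (w + x) = w * w * w + w * w * (x + y) + w * (x * y + y * x)"
proof -
  have pull: "x * w = w * x" "y * w = w * y" "x * (w * z) = w * (x * z)" "y * (w * z) = w * (y * z)" for z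
    using w[of x] w[of y] by (simp_all flip: mult.assoc)
  have 1: "w * (x * x) = - x - w * w * x"
    unfolding x(1) using v(1) v(2)[of w] by (simp add: algebra_simps flip: mult.assoc)
  have "(w + x) * (w + y) * (w + x) =
      w * w * w + w * w * (x + x + y) + w * (x * x) + w * (x * y + y * x) + x * y * x"
    by (simp add: algebra_simps pull)
  then show ?thesis unfolding 1 x(2) by (simp add: algebra_simps)
qed

lemma TL_rep_family:
  "TL_rep n (sigma_unit n) unit_val (b_family n) (scalar_family v_laurent) (scalar_family v_inv_laurent)"
proof -
  let ?V = "scalar_family v_laurent" and ?V' = "scalar_family v_inv_laurent" and ?B = "b_family n"
  have adj: "?B i * ?B (Suc i) * ?B i = ?B i" "?B (Suc i) * ?B i * ?B (Suc i) = ?B (Suc i)" if "1 \<le> i" "Suc i \<le> n" for i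
    using b_family_adjacent[of i n "Suc i"] b_family_adjacent[of "Suc i" n i] that by (auto simp: adjacent_def)
  have far: "?B i * ?B j = ?B j * ?B i" if "1 \<le> i" "Suc i < j" "j \<le> n" for i j
    using b_family_far[of i n j] that by (auto simp: far_def)
  show ?thesis
  proof (unfold_locales)
    fix i assume i: "1 \<le> i" "Suc i \<le> n"
    show "sigma_unit n i + sigma_unit n (Suc i) + sigma_unit n i = sigma_unit n (Suc i) + sigma_unit n i + sigma_unit n (Suc i)"
    proof (rule unit_pair_eqI)
      note c = scalar_family_central[of v_inv_laurent] scalar_family_inverse scalar_family_central[of v_laurent] b_family_square
      show "unit_val (sigma_unit n i + sigma_unit n (Suc i) + sigma_unit n i) =
          unit_val (sigma_unit n (Suc i) + sigma_unit n i + sigma_unit n (Suc i))"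
        using braid_of_TL[OF c adj(1)[OF i]] braid_of_TL[OF c adj(2)[OF i]]
        by (simp add: unit_val_add sigma_unit_val add.commute)
    qed
  next
    fix i j assume i: "1 \<le> i" "Suc i < j" "j \<le> n"
    show "sigma_unit n i + sigma_unit n j = sigma_unit n j + sigma_unit n i"
      using far[OF i] scalar_family_central[of v_inv_laurent "?B i"] scalar_family_central[of v_inv_laurent "?B j"]
      by (intro unit_pair_eqI) (simp add: unit_val_add sigma_unit_val distrib_left distrib_right add_ac)
  qed (rule unit_val_zero unit_val_add sigma_unit_val scalar_family_central scalar_family_inverse b_family_square adj far | assumption)+
qed

subsection \<open>Non-negative combinations of the monomial basis\<close>

lemma nonneg_laurent_add: "p \<in> nonneg_laurent \<Longrightarrow> q \<in> nonneg_laurent \<Longrightarrow> p + q \<in> nonneg_laurent"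
  by (simp add: nonneg_laurent_def lookup_add)

lemma nonneg_laurent_mult:
  assumes "p \<in> nonneg_laurent" "q \<in> nonneg_laurent" shows "p * q \<in> nonneg_laurent"
proof -
  have "0 \<le> Sum_any f" if "\<And>x. 0 \<le> f x" for f :: "int \<Rightarrow> int"
    unfolding Sum_any.expand_set using that by (intro sum_nonneg)
  then show ?thesis using assms unfolding nonneg_laurent_def by (auto simp: lookup_mult when_def intro!: mult_nonneg_nonneg)
qed

lemma nonneg_laurent_v: "v_laurent \<in> nonneg_laurent" "v_inv_laurent \<in> nonneg_laurent"
  by (auto simp: nonneg_laurent_def v_laurent_def v_inv_laurent_def lookup_single when_def)

lemma finite_W_f: "finite (W_f n)"
  by (rule finite_subset[of _ "{w. w permutes {1..n + 1}}"]) (auto simp: W_f_def sym_group_def intro!: finite_permutations)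

lemma TL_word_closed: "u \<in> lists {1..n} \<Longrightarrow> word_prod (TL n) (b_gen n) u \<in> carrier (TL n)"
  by (rule monoid.word_prod_closed[OF ring.is_monoid[OF ring_TL]]) (auto intro: b_gen_closed)

lemma commutation_word_prod:
  assumes "(u, u') \<in> commutation_steps\<^sup>*" "u \<in> lists {1..n}"
  shows "u' \<in> lists {1..n} \<and> word_prod (TL n) (b_gen n) u' = word_prod (TL n) (b_gen n) u"
  using assms(1)
proof (induction rule: rtrancl_induct)
  case base
  show ?case using assms(2) by simp
next
  case (step y z)
  interpret ring "TL n" by (rule ring_TL)
  from step.hyps(2) obtain p q i j where y: "y = p @ [i, j] @ q" "z = p @ [j, i] @ q" "far i j"
    by (auto simp: commutation_steps_def)
  then have l: "p \<in> lists {1..n}" "q \<in> lists {1..n}" "i \<in> {1..n}" "j \<in> {1..n}" using step.IH by auto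
  have b: "b_gen n \<in> {1..n} \<rightarrow> carrier (TL n)" by (intro Pi_I b_gen_closed)
  have "word_prod (TL n) (b_gen n) (i # j # q) = word_prod (TL n) (b_gen n) (j # i # q)"
    using b_gen_far[OF l(3,4) y(3)] b_gen_closed[OF l(3)] b_gen_closed[OF l(4)] TL_word_closed[OF l(2)]
    by (simp add: word_prod_Cons flip: m_assoc)
  then have "word_prod (TL n) (b_gen n) z = word_prod (TL n) (b_gen n) y"
    unfolding y using word_prod_append[OF b l(1), of "i # j # q"] word_prod_append[OF b l(1), of "j # i # q"] l by simp
  moreover have "z \<in> lists {1..n}" unfolding y using l by simp
  ultimately show ?case using step.IH by simp
qed

text \<open>Commutations link any two reduced expressions of a fully commutative element, and the
  product of the b_i is invariant under them.\<close>

lemma b_elt_eq: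
  assumes "w \<in> W_f n" "u \<in> reduced_exprs n w"
  shows "b_elt n w = word_prod (TL n) (b_gen n) u"
proof -
  have "(SOME u. u \<in> reduced_exprs n w) \<in> reduced_exprs n w" using assms(2) by (rule someI)
  then have "(u, SOME u. u \<in> reduced_exprs n w) \<in> commutation_steps\<^sup>*"
    using assms unfolding W_f_def fully_commutative_def by blast
  moreover have "u \<in> lists {1..n}" using assms(2) by (simp add: reduced_exprs_def)
  ultimately show ?thesis unfolding b_elt_def by (intro conjunct2[OF commutation_word_prod])
qed

lemma b_elt_closed:
  assumes "w \<in> W_f n" shows "b_elt n w \<in> carrier (TL n)"
proof -
  have w: "w permutes {1..Suc n}" using assms by (simp add: W_f_def sym_group_def)
  obtain u where "u \<in> reduced_exprs n w" using ex_sword[OF w] reduced_exprs_eq[OF w] by blast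
  then show ?thesis using b_elt_eq[OF assms] TL_word_closed by (simp add: reduced_exprs_def)
qed

text \<open>The right-hand side of the theorem as a function of its coefficients, in which it is
  linear.\<close>

definition combination :: "nat \<Rightarrow> ((nat \<Rightarrow> nat) \<Rightarrow> laurent) \<Rightarrow> (nat list \<Rightarrow>\<^sub>0 laurent) set"
  where "combination n p = (\<Oplus>\<^bsub>TL n\<^esub>w \<in> W_f n. TL_smult n (p w * (- 1) ^ length_S n w) (b_elt n w))"

lemma TL_smult_closed: "a \<in> carrier (TL n) \<Longrightarrow> TL_smult n r a \<in> carrier (TL n)"
  unfolding TL_smult_def using ring.ring_simprules(5)[OF ring_TL TL_scalar_closed] .

lemma combination_funcset: "(\<lambda>w. TL_smult n (p w * (- 1) ^ length_S n w) (b_elt n w)) \<in> W_f n \<rightarrow> carrier (TL n)"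
  by (intro Pi_I TL_smult_closed b_elt_closed)

lemma combination_zero: "combination n (\<lambda>_. 0) = \<zero>\<^bsub>TL n\<^esub>"
proof -
  interpret ring "TL n" by (rule ring_TL)
  have "combination n (\<lambda>_. 0) = (\<Oplus>\<^bsub>TL n\<^esub>w \<in> W_f n. \<zero>\<^bsub>TL n\<^esub>)"
    unfolding combination_def
    by (rule finsum_cong') (auto simp: TL_smult_def TL_scalar_zero b_elt_closed)
  then show ?thesis by simp
qed

lemma combination_add: "combination n (\<lambda>w. p w + q w) = combination n p \<oplus>\<^bsub>TL n\<^esub> combination n q"
proof -
  interpret ring "TL n" by (rule ring_TL)
  have "combination n (\<lambda>w. p w + q w) =
      (\<Oplus>\<^bsub>TL n\<^esub>w \<in> W_f n. TL_smult n (p w * (- 1) ^ length_S n w) (b_elt n w) \<oplus>\<^bsub>TL n\<^esub> TL_smult n (q w * (- 1) ^ length_S n w) (b_elt n w))"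
    unfolding combination_def
    by (rule finsum_cong') (auto simp: TL_smult_def distrib_right TL_scalar_add l_distr TL_scalar_closed b_elt_closed)
  then show ?thesis unfolding combination_def using finsum_addf[OF combination_funcset combination_funcset] by simp
qed

lemma combination_smult: "combination n (\<lambda>w. r * p w) = TL_scalar n r \<otimes>\<^bsub>TL n\<^esub> combination n p"
proof -
  interpret ring "TL n" by (rule ring_TL)
  have "combination n (\<lambda>w. r * p w) = (\<Oplus>\<^bsub>TL n\<^esub>w \<in> W_f n. TL_scalar n r \<otimes>\<^bsub>TL n\<^esub> TL_smult n (p w * (- 1) ^ length_S n w) (b_elt n w))"
    unfolding combination_def
    by (rule finsum_cong') (auto simp: TL_smult_def mult.assoc TL_scalar_mult[of n r] m_assoc TL_scalar_closed b_elt_closed)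
  then show ?thesis unfolding combination_def
    using finsum_rdistr[OF finite_W_f TL_scalar_closed combination_funcset] by simp
qed

lemma combination_single:
  assumes "w \<in> W_f n"
  shows "combination n (\<lambda>w'. if w = w' then 1 else 0) = TL_smult n ((- 1) ^ length_S n w) (b_elt n w)"
proof -
  interpret ring "TL n" by (rule ring_TL)
  let ?f = "\<lambda>w. TL_smult n ((- 1) ^ length_S n w) (b_elt n w)"
  have f: "?f \<in> W_f n \<rightarrow> carrier (TL n)" by (intro Pi_I TL_smult_closed b_elt_closed)
  have "combination n (\<lambda>w'. if w = w' then 1 else 0) = (\<Oplus>\<^bsub>TL n\<^esub>w' \<in> W_f n. if w = w' then ?f w' else \<zero>\<^bsub>TL n\<^esub>)"
    unfolding combination_def
    by (rule finsum_cong') (use f in \<open>auto simp: TL_smult_def TL_scalar_zero b_elt_closed\<close>)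
  then show ?thesis using finsum_singleton[OF assms finite_W_f f] by simp
qed

text \<open>The signs absorbed into the generators come back here, one for each letter.\<close>

lemma component_word:
  "u \<in> lists {1..n} \<Longrightarrow>
    component n (prod_list (map (b_family n) u)) = TL_smult n ((- 1) ^ length u) (word_prod (TL n) (b_gen n) u)"
proof (induction u rule: list.induct)
  case Nil
  interpret ring "TL n" by (rule ring_TL)
  show ?case by (simp add: component_ops TL_smult_def TL_scalar_one word_prod_Nil)
next
  case (Cons i u)
  interpret ring "TL n" by (rule ring_TL)
  let ?c = "TL_scalar n ((- 1) ^ length u)" and ?b = "b_gen n i" and ?w = "word_prod (TL n) (b_gen n) u"
  have i: "i \<in> {1..n}" "u \<in> lists {1..n}" using Cons.prems by auto
  note cl = b_gen_closed[OF i(1)] TL_word_closed[OF i(2)] TL_scalar_closed[of n "(- 1) ^ length u"]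
  have "component n (prod_list (map (b_family n) (i # u))) = (\<ominus>\<^bsub>TL n\<^esub> ?b) \<otimes>\<^bsub>TL n\<^esub> (?c \<otimes>\<^bsub>TL n\<^esub> ?w)"
    using Cons.IH[OF i(2)] by (simp add: component_ops b_family_self[OF i(1)] TL_smult_def del: One_nat_def)
  also have "\<dots> = (\<ominus>\<^bsub>TL n\<^esub> ?c) \<otimes>\<^bsub>TL n\<^esub> (?b \<otimes>\<^bsub>TL n\<^esub> ?w)"
    using cl TL_scalar_central[OF cl(1), of "(- 1) ^ length u"] by (simp add: l_minus m_assoc[symmetric])
  also have "\<ominus>\<^bsub>TL n\<^esub> ?c = TL_scalar n ((- 1) ^ length (i # u))" by (simp flip: TL_scalar_uminus)
  finally show ?case by (simp add: TL_smult_def word_prod_Cons)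
qed

text \<open>The closure rules of the cone are those of combinations with coefficients in N[v, v^-1],
  and its generators are monomials along normal words, each of them a signed basis element.\<close>

lemma cone_combination:
  assumes "x \<in> TL_rep.cone (scalar_family v_laurent) (scalar_family v_inv_laurent) (TL_rep.J (b_family n) n)"
  shows "\<exists>p. (\<forall>w. p w \<in> nonneg_laurent) \<and> component n x = combination n p"
proof -
  interpret TL: TL_rep n "sigma_unit n" unit_val "b_family n" "scalar_family v_laurent" "scalar_family v_inv_laurent"
    by (rule TL_rep_family)
  from assms show ?thesis
  proof (induction rule: TL.cone.induct)
    case zero
    show ?case by (intro exI[of _ "\<lambda>_. 0"]) (simp add: nonneg_laurent_def component_ops combination_zero)
  next
    case (base x)
    then obtain u l where u: "normal_word n l u" "x = TL.monomial u" using TL.J_normal[of x n] by blast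
    let ?w = "sprod u"
    have w: "?w \<in> W_f n" "u \<in> reduced_exprs n ?w" using normal_word_W_f[OF u(1)] by auto
    then have r: "u \<in> lists {1..n}" "length u = length_S n ?w" by (simp_all add: reduced_exprs_def)
    \<comment> \<open>As \<open>u\<close> is reduced, its sign (-1)^length is the sign attached to
      \<open>?w\<close>.\<close>
    have "component n x = combination n (\<lambda>w'. if ?w = w' then 1 else 0)"
      unfolding u(2) TL.monomial_def component_word[OF r(1)] combination_single[OF w(1)] r(2) b_elt_eq[OF w] ..
    then show ?case
      by (intro exI[of _ "\<lambda>w'. if ?w = w' then 1 else 0"])
        (auto simp: nonneg_laurent_def lookup_one when_def)
  next
    case (add x y)
    then obtain p q where "\<forall>w. p w \<in> nonneg_laurent" "component n x = combination n p"
      "\<forall>w. q w \<in> nonneg_laurent" "component n y = combination n q" by blast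
    then show ?case
      by (intro exI[of _ "\<lambda>w. p w + q w"]) (simp add: component_ops combination_add nonneg_laurent_add)
  next
    case (v x)
    then obtain p where "\<forall>w. p w \<in> nonneg_laurent" "component n x = combination n p" by blast
    then show ?case
      by (intro exI[of _ "\<lambda>w. v_laurent * p w"])
        (simp add: component_ops component_scalar combination_smult nonneg_laurent_mult nonneg_laurent_v)
  next
    case (v' x)
    then obtain p where "\<forall>w. p w \<in> nonneg_laurent" "component n x = combination n p" by blast
    then show ?case
      by (intro exI[of _ "\<lambda>w. v_inv_laurent * p w"])
        (simp add: component_ops component_scalar combination_smult nonneg_laurent_mult nonneg_laurent_v)
  qed
qed

subsection \<open>The image of a simple dual braid\<close>

lemma word_prod_cong: "(\<And>x. x \<in> set u \<Longrightarrow> f x = g x) \<Longrightarrow> word_prod G f u = word_prod G g u"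
  unfolding word_prod_def by (rule foldr_cong) auto

lemma hom_word_prod_signed:
  assumes "group F" "group U" and h: "h \<in> hom F U" and g: "g \<in> X \<rightarrow> carrier F" and w: "w \<in> lists (X \<times> UNIV)"
  shows "h (word_prod F (signed F g) w) = word_prod U (signed U (\<lambda>i. h (g i))) w"
proof -
  interpret F: group F by (rule assms(1))
  interpret U: group U by (rule assms(2))
  interpret h: group_hom F U h by (unfold_locales) (rule h)
  show ?thesis using w
  proof (induction w rule: list.induct)
    case Nil
    show ?case by (simp add: F.word_prod_Nil U.word_prod_Nil)
  next
    case (Cons p w)
    obtain x e where p: "p = (x, e)" by force
    then have x: "x \<in> X" "w \<in> lists (X \<times> UNIV)" using Cons.prems unfolding p by auto
    have "g x \<in> carrier F" using g x(1) by auto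
    moreover have "word_prod F (signed F g) w \<in> carrier F"
      by (rule F.word_prod_closed[OF F.signed_closed[OF g] x(2)])
    ultimately show ?case using Cons.IH[OF x(2)]
      by (simp add: p F.word_prod_Cons U.word_prod_Cons signed_def)
  qed
qed

lemma (in group) group_lift_hom:
  assumes f: "f \<in> X \<rightarrow> carrier G"
    and R: "\<And>u v. (u, v) \<in> R \<Longrightarrow> u \<in> lists X \<Longrightarrow> v \<in> lists X \<Longrightarrow> word_prod G f u = word_prod G f v"
  shows "group_lift G f \<in> hom (presented_group X R) G"
proof (rule homI)
  note lift = group_lift_word[of f X R, OF f R]
  note closed = word_prod_closed[OF signed_closed[OF f]]
  fix a assume "a \<in> carrier (presented_group X R)"
  then obtain u where u: "u \<in> lists (X \<times> UNIV)" "a = pcls (X \<times> UNIV) (group_rels X R) u"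
    unfolding carrier_presented_group by blast
  then show "group_lift G f a \<in> carrier G" using lift[OF _ _ _ u(1)] closed[OF u(1)] by simp
  fix b assume "b \<in> carrier (presented_group X R)"
  then obtain v where v: "v \<in> lists (X \<times> UNIV)" "b = pcls (X \<times> UNIV) (group_rels X R) v"
    unfolding carrier_presented_group by blast
  have uv: "u @ v \<in> lists (X \<times> UNIV)" using u v by simp
  have "a \<otimes>\<^bsub>presented_group X R\<^esub> b = pcls (X \<times> UNIV) (group_rels X R) (u @ v)"
    unfolding presented_group_def u(2) v(2) by (rule mult_presented[OF u(1) v(1)])
  then show "group_lift G f (a \<otimes>\<^bsub>presented_group X R\<^esub> b) = group_lift G f a \<otimes> group_lift G f b"
    using lift[OF _ _ _ u(1)] lift[OF _ _ _ v(1)] lift[OF _ _ _ uv] word_prod_append[OF signed_closed[OF f] u(1) v(1)] u(2) v(2) by simp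
qed

definition TL_unit :: "nat \<Rightarrow> tl_family unit_pair \<Rightarrow> (nat list \<Rightarrow>\<^sub>0 laurent) set"
  where "TL_unit n x = component n (unit_val x)"

lemma group_TL_units: "group (units_of (TL n))"
  by (rule monoid.units_group[OF ring.is_monoid[OF ring_TL]])

lemma TL_unit_closed: "TL_unit n x \<in> carrier (units_of (TL n))"
proof -
  have "component n (unit_val x) \<otimes>\<^bsub>TL n\<^esub> component n (unit_inv x) = \<one>\<^bsub>TL n\<^esub>"
    "component n (unit_inv x) \<otimes>\<^bsub>TL n\<^esub> component n (unit_val x) = \<one>\<^bsub>TL n\<^esub>"
    by (simp_all only: unit_val_inv component_ops(2) flip: component_ops(4))
  then show ?thesis unfolding TL_unit_def units_of_carrier Units_def using component_closed by blast
qed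

lemma TL_unit_zero: "TL_unit n 0 = \<one>\<^bsub>units_of (TL n)\<^esub>"
  by (simp add: TL_unit_def unit_val_zero component_ops units_of_one)

lemma TL_unit_add: "TL_unit n (x + y) = TL_unit n x \<otimes>\<^bsub>units_of (TL n)\<^esub> TL_unit n y"
  by (simp add: TL_unit_def unit_val_add component_ops units_of_mult)

lemma word_prod_TL_unit: "word_prod (units_of (TL n)) (\<lambda>x. TL_unit n (f x)) u = TL_unit n (sum_list (map f u))"
  by (induction u) (simp_all add: word_prod_def TL_unit_zero TL_unit_add)

lemma TL_unit_sigma:
  "i \<in> {1..n} \<Longrightarrow> TL_unit n (sigma_unit n i) = TL_scalar n v_inv_laurent \<ominus>\<^bsub>TL n\<^esub> b_gen n i"
  unfolding TL_unit_def sigma_unit_val component_ops component_scalar a_minus_def by (simp only: b_family_self)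

text \<open>The braid is only known as some preimage of \<open>d x\<close> under Bessis' morphism. A
  morphism \<open>\<psi>\<close> from the group of fractions whose composite with Bessis' morphism
  has the same values on generators as \<open>omega\<close> determines the image of any such
  preimage.\<close>

lemma Z_elt_dual_elt:
  assumes c: "c = cox \<epsilon> n" and x: "x \<in> Div n c"
  shows "Z_elt n c x = TL_unit n (braid_rep.dual_elt n (sigma_unit n) \<epsilon> x)"
proof -
  interpret TL: TL_rep n "sigma_unit n" unit_val "b_family n" "scalar_family v_laurent" "scalar_family v_inv_laurent"
    by (rule TL_rep_family)
  let ?U = "units_of (TL n)"
  interpret U: group ?U by (rule group_TL_units)
  define M F where "M = dual_braid_monoid n c" and "F = fraction_group M"
  define d where "d = dual_braid_in_frac n c"
  interpret D: dual_rep F n \<epsilon> d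
    using dual_rep_frac[of n \<epsilon>] by (simp add: F_def M_def d_def c)
  define L where "L = lists ({1..n} \<times> (UNIV :: bool set))"
  define cls where "cls = pcls ({1..n} \<times> (UNIV :: bool set)) (group_rels {1..n} (braid_rels n))"
  define \<sigma> where "\<sigma> = (\<lambda>i. TL_scalar n v_inv_laurent \<ominus>\<^bsub>TL n\<^esub> b_gen n i)"
  define Zt where "Zt = (\<lambda>x. TL_unit n (TL.dual_elt \<epsilon> x))"
  have cp: "c permutes {1..n + 1}" unfolding c using cox_permutes by simp
  have Div: "y \<in> Div n c \<longleftrightarrow> below (Suc n) y (cox \<epsilon> n)" for y
    unfolding Div_eq[OF cp] by (simp add: c)
  have carrier_B: "carrier (braid_group n) = cls ` L"
    unfolding braid_group_def carrier_presented_group cls_def L_def ..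
  have \<sigma>: "\<sigma> i = TL_unit n (sigma_unit n i)" if "i \<in> {1..n}" for i
    unfolding \<sigma>_def TL_unit_sigma[OF that] ..
  have omega: "omega n (cls w) = word_prod ?U (signed ?U \<sigma>) w" if "w \<in> L" for w
    unfolding omega_def \<sigma>_def[symmetric] cls_def
  proof (rule U.group_lift_word)
    show "\<sigma> \<in> {1..n} \<rightarrow> carrier ?U" by (intro Pi_I) (simp only: \<sigma> TL_unit_closed)
    show "w \<in> lists ({1..n} \<times> UNIV)" using that unfolding L_def .
    fix u v assume uv: "(u, v) \<in> braid_rels n" "u \<in> lists {1..n}" "v \<in> lists {1..n}"
    have far: "sigma_unit n i + sigma_unit n j = sigma_unit n j + sigma_unit n i" if "i \<in> {1..n}" "j \<in> {1..n}" "far i j" for i j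
    proof -
      have "Suc i < j \<or> Suc j < i" using that(3) by (auto simp: far_def)
      then show ?thesis using TL.far_comm[of i j] TL.far_comm[of j i] that(1,2) by auto
    qed
    have adj: "sigma_unit n i + sigma_unit n j + sigma_unit n i = sigma_unit n j + sigma_unit n i + sigma_unit n j"
      if "i \<in> {1..n}" "j \<in> {1..n}" "adjacent i j" for i j
    proof -
      have "j = Suc i \<or> i = Suc j" using that(3) by (auto simp: adjacent_def)
      then show ?thesis using TL.braid[of i] TL.braid[of j] that(1,2) by auto
    qed
    from uv(1) consider i j where "u = [i, j, i]" "v = [j, i, j]" "i \<in> {1..n}" "j \<in> {1..n}" "adjacent i j"
      | i j where "u = [i, j]" "v = [j, i]" "i \<in> {1..n}" "j \<in> {1..n}" "far i j"
      unfolding braid_rels_def by blast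
    then have "sum_list (map (sigma_unit n) u) = sum_list (map (sigma_unit n) v)"
    proof cases
      case 1
      then show ?thesis using adj[OF 1(3-5)] by (simp add: add.assoc)
    next
      case 2
      then show ?thesis using far[OF 2(3-5)] by simp
    qed
    moreover have "word_prod ?U \<sigma> w = TL_unit n (sum_list (map (sigma_unit n) w))" if "w \<in> lists {1..n}" for w
    proof -
      have "word_prod ?U \<sigma> w = word_prod ?U (\<lambda>i. TL_unit n (sigma_unit n i)) w"
        by (rule word_prod_cong) (use that \<sigma> in auto)
      then show ?thesis by (simp only: word_prod_TL_unit)
    qed
    ultimately show "word_prod ?U \<sigma> u = word_prod ?U \<sigma> v" using uv(2,3) by simp
  qed
  have bessis: "bessis_iso n c (cls w) = D.artin w" if "w \<in> L" for w
    unfolding bessis_iso_def cls_def D.artin_def F_def[unfolded M_def, symmetric] d_def[symmetric]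
    by (rule D.group_lift_word[OF D.s_perm_funcset], erule D.braid_word_prod) (use that in \<open>simp only: L_def\<close>)
  \<comment> \<open>Since \<open>d x\<close> lies in the image, \<open>inv_into\<close> does return
    a preimage; a signed word \<open>w\<close> for it is fixed.\<close>
  have "d x \<in> D.artin_image" using x unfolding Div by (rule D.artin_image_dual)
  then have "d x \<in> bessis_iso n c ` carrier (braid_group n)"
    unfolding D.artin_image_def carrier_B image_image L_def[symmetric] using bessis by auto
  then have "simple_dual_braid n c x \<in> carrier (braid_group n)" "bessis_iso n c (simple_dual_braid n c x) = d x"
    unfolding simple_dual_braid_def d_def[symmetric] by (rule inv_into_into, rule f_inv_into_f)
  then obtain w where w: "w \<in> L" "simple_dual_braid n c x = cls w" "D.artin w = d x"
    using bessis unfolding carrier_B by auto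
  \<comment> \<open>The elements \<open>Zt y\<close> satisfy the relations of the dual braid monoid,
    so they induce \<open>h\<close> on its classes; \<open>\<psi>\<close> extends \<open>h\<close>
    to the group of fractions.\<close>
  define h where "h A = the_elem (word_prod ?U Zt ` A)" for A
  have Zt: "Zt \<in> Div n c \<rightarrow> carrier ?U" unfolding Zt_def by (intro Pi_I TL_unit_closed)
  have h: "h (pcls (Div n c) (dual_braid_rels n c) u) = word_prod ?U Zt u" if "u \<in> lists (Div n c)" for u
    unfolding h_def
  proof (rule U.the_elem_word_prod[OF Zt _ that])
    fix u v assume "(u, v) \<in> dual_braid_rels n c"
    then consider y z where "u = [y, z]" "v = [y \<circ> z]" "y \<in> Div n c" "z \<in> Div n c" "y \<circ> z \<in> Div n c"
        "length_T n (y \<circ> z) = length_T n y + length_T n z"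
      | "u = [id]" "v = []"
      unfolding dual_braid_rels_def by (auto simp: sym_group_def)
    then have "sum_list (map (TL.dual_elt \<epsilon>) u) = sum_list (map (TL.dual_elt \<epsilon>) v)"
    proof cases
      case 1
      have len: "length_T n a = abs_len (Suc n) a" "a permutes {1..Suc n}" if "a \<in> Div n c" for a
        using below_permutes[of "Suc n" a] that Div length_T_eq[of a n] by simp_all
      have "TL.dual_elt \<epsilon> (y \<circ> z) = TL.dual_elt \<epsilon> y + TL.dual_elt \<epsilon> z"
        by (rule TL.dual_elt_mult) (use 1(3-6) len Div in \<open>simp_all del: comp_apply\<close>)
      then show ?thesis using 1(1,2) by simp
    next
      case 2
      then show ?thesis using TL.dual_elt_id[of \<epsilon>] by simp
    qed
    then show "word_prod ?U Zt u = word_prod ?U Zt v" unfolding Zt_def word_prod_TL_unit by simp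
  qed
  have M: "M = presented_monoid (Div n c) (dual_braid_rels n c)" by (simp add: M_def dual_braid_monoid_def)
  have h_closed: "h \<in> carrier M \<rightarrow> carrier ?U"
  proof (rule Pi_I)
    fix a assume "a \<in> carrier M"
    then obtain u where "u \<in> lists (Div n c)" "a = pcls (Div n c) (dual_braid_rels n c) u"
      unfolding M carrier_presented by blast
    then show "h a \<in> carrier ?U" using h[of u] U.word_prod_closed[OF Zt, of u] by simp
  qed
  have h_mult: "h (a \<otimes>\<^bsub>M\<^esub> b) = h a \<otimes>\<^bsub>?U\<^esub> h b" if ab: "a \<in> carrier M" "b \<in> carrier M" for a b
  proof -
    obtain u v where "u \<in> lists (Div n c)" "v \<in> lists (Div n c)"
      "a = pcls (Div n c) (dual_braid_rels n c) u" "b = pcls (Div n c) (dual_braid_rels n c) v"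
      using ab unfolding M carrier_presented by blast
    then show ?thesis unfolding M using h[of u] h[of v] h[of "u @ v"] U.word_prod_append[OF Zt, of u v]
      by (simp only: mult_presented append_in_lists_conv simp_thms)
  qed
  have h_one: "h \<one>\<^bsub>M\<^esub> = \<one>\<^bsub>?U\<^esub>"
    unfolding M one_presented using h[of "[]"] by (simp add: U.word_prod_Nil)
  have mult_rels: "word_prod ?U h u = word_prod ?U h v"
    if "(u, v) \<in> mult_rels M" "u \<in> lists (carrier M)" "v \<in> lists (carrier M)" for u v
  proof -
    from that(1) consider a b where "u = [a, b]" "v = [a \<otimes>\<^bsub>M\<^esub> b]" "a \<in> carrier M" "b \<in> carrier M"
      | "u = [\<one>\<^bsub>M\<^esub>]" "v = []" unfolding mult_rels_def by blast
    then show ?thesis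
    proof cases
      case 1
      have "h a \<in> carrier ?U" "h b \<in> carrier ?U" using h_closed 1(3,4) by auto
      then show ?thesis using h_mult[OF 1(3,4)] by (simp add: 1 U.word_prod_Cons U.word_prod_Nil)
    next
      case 2
      then show ?thesis by (simp add: U.word_prod_Cons U.word_prod_Nil h_one)
    qed
  qed
  define \<psi> where "\<psi> = group_lift ?U h"
  have \<psi>: "\<psi> \<in> hom F ?U"
    unfolding \<psi>_def F_def fraction_group_def by (rule U.group_lift_hom[OF h_closed mult_rels])
  have \<psi>d: "\<psi> (d y) = Zt y" if "y \<in> Div n c" for y
  proof -
    let ?g = "dual_braid_gen n c y"
    have g: "?g = pcls (Div n c) (dual_braid_rels n c) [y]" by (simp add: dual_braid_gen_def monoid_gen_eq)
    have gM: "?g \<in> carrier M" unfolding M carrier_presented g using that by (intro imageI) simp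
    have Zy: "Zt y \<in> carrier ?U" using Zt that by (rule funcset_mem)
    have hg: "h ?g = Zt y" unfolding g using h[of "[y]"] that Zy by (simp add: U.word_prod_Cons U.word_prod_Nil)
    have "d y = pcls (carrier M \<times> UNIV) (group_rels (carrier M) (mult_rels M)) [(?g, True)]"
      by (simp add: d_def dual_braid_in_frac_def frac_incl_def group_gen_eq M_def)
    then have "\<psi> (d y) = word_prod ?U (signed ?U h) [(?g, True)]"
      unfolding \<psi>_def by (simp only:) (rule U.group_lift_word[OF h_closed mult_rels]; use gM in simp)
    then show ?thesis using hg Zy by (simp add: U.word_prod_Cons U.word_prod_Nil signed_def)
  qed
  \<comment> \<open>On generators \<open>\<psi>\<close> after Bessis' morphism agrees with
    \<open>omega\<close>, because the atom of a simple reflection is the generator itself.\<close>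
  have gen: "\<psi> (d (s_perm i)) = \<sigma> i" if i: "i \<in> {1..n}" for i
  proof -
    have t: "(i, Suc i) \<in> tpairs (Suc n)" using i by (auto simp: tpairs_def)
    have "TL.dual_elt \<epsilon> (s_perm i) = sigma_unit n i"
      unfolding s_perm_eq TL.dual_elt_tr[OF t] by (rule TL.A2_top)
    moreover have "s_perm i \<in> Div n c" unfolding Div s_perm_eq by (rule below_tr'[OF t])
    ultimately show ?thesis using \<psi>d[of "s_perm i"] \<sigma>[OF i] by (simp add: Zt_def)
  qed
  have "Zt x = \<psi> (D.artin w)" using \<psi>d[OF x] w(3) by simp
  also have "\<dots> = word_prod ?U (signed ?U (\<lambda>i. \<psi> (d (s_perm i)))) w"
    unfolding D.artin_def
    by (rule hom_word_prod_signed[OF D.group_axioms U.group_axioms \<psi> D.s_perm_funcset]) (use w(1) in \<open>simp only: L_def\<close>)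
  also have "\<dots> = word_prod ?U (signed ?U \<sigma>) w"
  proof (rule word_prod_cong)
    fix p assume p: "p \<in> set w"
    obtain i e where ie: "p = (i, e)" by force
    have "i \<in> {1..n}" using p w(1) unfolding ie L_def by auto
    then show "signed ?U (\<lambda>i. \<psi> (d (s_perm i))) p = signed ?U \<sigma> p" by (simp only: ie signed_def prod.case gen)
  qed
  also have "\<dots> = Z_elt n c x" unfolding Z_elt_def w(2) by (rule omega[OF w(1), symmetric])
  finally show ?thesis by (simp add: Zt_def)
qed

theorem theorem8p16:
  fixes n :: nat and c x :: "nat \<Rightarrow> nat"
  assumes "n \<ge> 1"
    and "standard_coxeter_element n c"
    and "x \<in> Div n c"
  shows "\<exists>p :: (nat \<Rightarrow> nat) \<Rightarrow> laurent.
    (\<forall>w \<in> W_f n. p w \<in> nonneg_laurent) \<and>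
    Z_elt n c x = (\<Oplus>\<^bsub>TL n\<^esub>w \<in> W_f n. TL_smult n (p w * (- 1) ^ length_S n w) (b_elt n w))"
proof -
  obtain u where u: "distinct u" "set u = {1..n}" "c = word_prod (Sym n) s_perm u"
    using assms(2) unfolding standard_coxeter_element_def by blast
  obtain \<epsilon> where c: "c = cox \<epsilon> n"
    using coxeter_signs[OF u(1,2)] unfolding u(3) word_prod_Sym by blast
  have cp: "c permutes {1..n + 1}" unfolding c using cox_permutes by simp
  have x: "below (Suc n) x (cox \<epsilon> n)" using assms(3) unfolding Div_eq[OF cp] by (simp add: c)
  interpret TL: TL_rep n "sigma_unit n" unit_val "b_family n" "scalar_family v_laurent" "scalar_family v_inv_laurent"
    by (rule TL_rep_family)
  obtain u w where "pinj (Suc n) u" "pinj (Suc n) w" "TL.dual_elt \<epsilon> x = TL.Sig n u - TL.Sig n w"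
    using TL.dual_elt_mikado[OF x] by blast
  then have "unit_val (TL.dual_elt \<epsilon> x) \<in> TL.cone (TL.J n)" using TL.mikado_positive[of n u w] by simp
  then obtain p where "\<forall>w. p w \<in> nonneg_laurent" "component n (unit_val (TL.dual_elt \<epsilon> x)) = combination n p"
    using cone_combination by blast
  then show ?thesis
    using Z_elt_dual_elt[OF c assms(3)] by (intro exI[of _ p]) (simp add: TL_unit_def combination_def)
qed

end
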